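(* Let $L,T,\lambda,\overline U_0>0$ be constants with $\overline U_0<\lambda^{-1}$, and let $f,g$ on $(0,L)\times(0,T)$ and $u_0,\psi_0$ on $(0,L)$ be given functions independent of $\varepsilon$. Assume that for each small $\varepsilon>0$ the pair $(u^\varepsilon,\psi^\varepsilon)\in\mathcal K$ is a solution of the viscous problem $(P_\varepsilon)$, and that $(u^0,\psi^0)\in\mathcal K^0$ is a solution of the limit problem $(P_0)$ with the same data $f,g,u_0,\psi_0$ (all defined in the context). Then: (1) for any nonnegative function $\delta(\varepsilon)$ satisfying $\delta(\varepsilon)\to0$ and $\delta(\varepsilon)/\varepsilon\to+\infty$ as $\varepsilon\to0^+$, $$\lim_{\varepsilon\to0^+}\|(u^\varepsilon-u^0,\psi^\varepsilon-\psi^0)\|_{L^\infty(0,T;L^\infty(\delta(\varepsilon),L))}=0;$$ (2) for any nonnegative function $\delta(\varepsilon)$ satisfying $\delta(\varepsilon)\to0$ and $\delta(\varepsilon)/\varepsilon\to c$ as $\varepsilon\to0^+$ for some nonnegative constant $c$, $$\liminf_{\varepsilon\to0^+}\|(u^\varepsilon-u^0,\psi^\varepsilon-\psi^0)\|_{L^\infty(0,T;L^\infty(0,\delta(\varepsilon)))}>0$$ whenever $(u^0(0,t),\psi^0(0,t))\not\equiv(0,0)$ in $(0,T)$. This implies that the thickness of the boundary layer (at $x=0$) is of the order $O(\varepsilon)$.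
   Context: Subscripts $x,t$ denote partial derivatives; equations hold almost everywhere in $(0,L)\times(0,T)$; the norm of a tuple is the sum of the norms of its components. The boundary layer is the region near $x=0$ in which $(u^\varepsilon,\psi^\varepsilon)$ fails to converge uniformly to $(u^0,\psi^0)$ as $\varepsilon\to0^+$; its thickness is understood in the sense of (1) and (2). Problem $(P_\varepsilon)$, in $(0,L)\times(0,T)$: $$u^\varepsilon_t+\overline U_0u^\varepsilon_x+\psi^\varepsilon_x-2\varepsilon u^\varepsilon_{xx}=f,\qquad \psi^\varepsilon_t+\overline U_0\psi^\varepsilon_x+\lambda^{-2}u^\varepsilon_x=g,$$ with $u^\varepsilon(0,t)=u^\varepsilon(L,t)=0$, $\psi^\varepsilon(0,t)=0$ for $0<t<T$, and $u^\varepsilon(x,0)=u_0(x)$, $\psi^\varepsilon(x,0)=\psi_0(x)$ for $0<x<L$. Problem $(P_0)$, in $(0,L)\times(0,T)$: $$u^0_t+\overline U_0u^0_x+\psi^0_x=f,\qquad \psi^0_t+\overline U_0\psi^0_x+\lambda^{-2}u^0_x=g,$$ with $u^0(0,t)+\overline U_0\lambda^2\psi^0(0,t)=0$, $u^0(L,t)=0$ for $0<t<T$, and $u^0(x,0)=u_0(x)$, $\psi^0(x,0)=\psi_0(x)$ for $0<x<L$. Function spaces. $H=L^2(0,L)\times L^2(0,L)$; $D(A)=\{(u,\psi)\in H : u_x,\psi_x,u_{xx}\in L^2(0,L),\ u(0)=\psi(0)=u(L)=0\}$; $D(A^0)=\{(u,\psi)\in H : u_x,\psi_x\in L^2(0,L),\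 u(0)+\overline U_0\lambda^2\psi(0)=0,\ u(L)=0\}$; $\mathcal F=C([0,T];H)\cap L^\infty(0,T;D(A))$; $\mathcal F^0=C([0,T];H)\cap L^\infty(0,T;D(A^0))$; $\mathcal K=\{(u,\psi)\in\mathcal F : \psi_{xt},\psi_{xx}\in L^\infty(0,T;L^2(0,L)),\ (u_t,\psi_t)\in C([0,T];H)\}$; $\mathcal K^0=\{(u,\psi)\in\mathcal F^0 : \psi_{xt},u_{xx},\psi_{xx}\in L^\infty(0,T;L^2(0,L)),\ (u_t,\psi_t)\in C([0,T];H)\}$.
   Formalization: In (2) the liminf is taken only along those ε>0 with δ(ε)>0; where δ(ε)=0 the interval (0,δ(ε)) is empty and its norm is 0 or undefined, so the claim as stated fails, e.g. for δ≡0, c=0. *)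

theory Defs
  imports "HOL-Analysis.Analysis" "HOL-Probability.Essential_Supremum"
begin

text \<open>
  Functions on space-time are functions of the pair (x, t).  Elements of the Lebesgue and Bochner
  spaces below are given by Borel representatives (every class has one); no notion below changes
  under modification of a representative on a null set, except that an element of C([0,T];H) is
  represented so that its slice at every t in [0,T], not only at almost every t, is the L^2 class
  of its value at t.
\<close>

section \<open>Weak derivatives\<close>

primrec Ck :: "nat \<Rightarrow> ('a::euclidean_space \<Rightarrow> real) \<Rightarrow> bool" where
  "Ck 0 \<phi> \<longleftrightarrow> continuous_on UNIV \<phi>"
| "Ck (Suc n) \<phi> \<longleftrightarrow> (\<forall>x. \<phi> differentiable at x) \<and>
     (\<forall>b\<in>Basis. Ck n (\<lambda>x. frechet_derivative \<phi> (at x) b))"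

definition test_function :: "'a::euclidean_space set \<Rightarrow> ('a \<Rightarrow> real) \<Rightarrow> bool" where
  "test_function S \<phi> \<longleftrightarrow>
     (\<forall>n. Ck n \<phi>) \<and> (\<exists>K. compact K \<and> K \<subseteq> S \<and> (\<forall>x. x \<notin> K \<longrightarrow> \<phi> x = 0))"

definition locally_integrable :: "'a::euclidean_space set \<Rightarrow> ('a \<Rightarrow> real) \<Rightarrow> bool" where
  "locally_integrable S u \<longleftrightarrow> (\<forall>K. compact K \<and> K \<subseteq> S \<longrightarrow> set_integrable lborel K u)"

text \<open>The function v is the weak derivative of u in direction b on the open set S.\<close>

definition weak_deriv ::
  "'a::euclidean_space set \<Rightarrow> 'a \<Rightarrow> ('a \<Rightarrow> real) \<Rightarrow> ('a \<Rightarrow> real) \<Rightarrow> bool" where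
  "weak_deriv S b u v \<longleftrightarrow> locally_integrable S u \<and> locally_integrable S v \<and>
     (\<forall>\<phi>. test_function S \<phi> \<longrightarrow>
        (LINT x:S|lborel. u x * frechet_derivative \<phi> (at x) b) = - (LINT x:S|lborel. v x * \<phi> x))"

abbreviation spacetime :: "real \<Rightarrow> real \<Rightarrow> (real \<times> real) set" where
  "spacetime L T \<equiv> {0<..<L} \<times> {0<..<T}"

abbreviation weak_dx ::
  "real \<Rightarrow> real \<Rightarrow> (real \<times> real \<Rightarrow> real) \<Rightarrow> (real \<times> real \<Rightarrow> real) \<Rightarrow> bool" where
  "weak_dx L T \<equiv> weak_deriv (spacetime L T) (1, 0)"

abbreviation weak_dt ::
  "real \<Rightarrow> real \<Rightarrow> (real \<times> real \<Rightarrow> real) \<Rightarrow> (real \<times> real \<Rightarrow> real) \<Rightarrow> bool" where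
  "weak_dt L T \<equiv> weak_deriv (spacetime L T) (0, 1)"

section \<open>Function spaces\<close>

definition L2 :: "'a::euclidean_space set \<Rightarrow> ('a \<Rightarrow> real) \<Rightarrow> bool" where
  "L2 S v \<longleftrightarrow> set_borel_measurable lborel S v \<and> set_integrable lborel S (\<lambda>x. (v x)\<^sup>2)"

definition L2_norm_on :: "'a::euclidean_space set \<Rightarrow> ('a \<Rightarrow> real) \<Rightarrow> real" where
  "L2_norm_on S v = sqrt (LINT x:S|lborel. (v x)\<^sup>2)"

text \<open>The value at the end point y is that of the continuous representative on the closed interval,
  which for functions with v and v_x in L^2(0,L) exists and is the trace.\<close>

definition boundary_value :: "real \<Rightarrow> (real \<Rightarrow> real) \<Rightarrow> real \<Rightarrow> real \<Rightarrow> bool" where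
  "boundary_value L v y a \<longleftrightarrow>
     (\<exists>w. continuous_on {0..L} w \<and> (AE x in lborel. x \<in> {0<..<L} \<longrightarrow> v x = w x) \<and> w y = a)"

definition dom_A :: "real \<Rightarrow> ((real \<Rightarrow> real) \<times> (real \<Rightarrow> real)) set" where
  "dom_A L = {(u, \<psi>). L2 {0<..<L} u \<and> L2 {0<..<L} \<psi> \<and>
     (\<exists>ux \<psi>x uxx. weak_deriv {0<..<L} 1 u ux \<and> weak_deriv {0<..<L} 1 \<psi> \<psi>x \<and>
        weak_deriv {0<..<L} 1 ux uxx \<and> L2 {0<..<L} ux \<and> L2 {0<..<L} \<psi>x \<and> L2 {0<..<L} uxx) \<and>
     boundary_value L u 0 0 \<and> boundary_value L \<psi> 0 0 \<and> boundary_value L u L 0}"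

definition dom_A0 :: "real \<Rightarrow> real \<Rightarrow> real \<Rightarrow> ((real \<Rightarrow> real) \<times> (real \<Rightarrow> real)) set" where
  "dom_A0 lam U0 L = {(u, \<psi>). L2 {0<..<L} u \<and> L2 {0<..<L} \<psi> \<and>
     (\<exists>ux \<psi>x. weak_deriv {0<..<L} 1 u ux \<and> weak_deriv {0<..<L} 1 \<psi> \<psi>x \<and>
        L2 {0<..<L} ux \<and> L2 {0<..<L} \<psi>x) \<and>
     (\<exists>a b. boundary_value L u 0 a \<and> boundary_value L \<psi> 0 b \<and> a + U0 * lam\<^sup>2 * b = 0) \<and>
     boundary_value L u L 0}"

text \<open>C([0,T]; L^2(0,L))\<close>

definition C_L2 :: "real \<Rightarrow> real \<Rightarrow> (real \<times> real \<Rightarrow> real) \<Rightarrow> bool" where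
  "C_L2 L T v \<longleftrightarrow> set_borel_measurable lborel ({0<..<L} \<times> {0..T}) v \<and>
     (\<forall>t\<in>{0..T}. L2 {0<..<L} (\<lambda>x. v (x, t))) \<and>
     (\<forall>t\<in>{0..T}. ((\<lambda>s. L2_norm_on {0<..<L} (\<lambda>x. v (x, s) - v (x, t))) \<longlongrightarrow> 0)
        (at t within {0..T}))"

text \<open>L^\<infinity>(0,T; L^2(0,L))\<close>

definition Linf_L2 :: "real \<Rightarrow> real \<Rightarrow> (real \<times> real \<Rightarrow> real) \<Rightarrow> bool" where
  "Linf_L2 L T v \<longleftrightarrow> set_borel_measurable lborel (spacetime L T) v \<and>
     (\<exists>C. AE t in lborel. t \<in> {0<..<T} \<longrightarrow>
        L2 {0<..<L} (\<lambda>x. v (x, t)) \<and> L2_norm_on {0<..<L} (\<lambda>x. v (x, t)) \<le> C)"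

text \<open>L^\<infinity>(0,T; D(A)) and L^\<infinity>(0,T; D(A^0)): almost every slice is in the domain, and the sum of the
  L^2 norms of u, \<psi> and of the x-derivatives occurring in the domain, a norm on D(A) resp. D(A^0)
  equivalent to the graph norm, is essentially bounded in t.\<close>

definition Linf_dom_A ::
  "real \<Rightarrow> real \<Rightarrow> (real \<times> real \<Rightarrow> real) \<Rightarrow> (real \<times> real \<Rightarrow> real) \<Rightarrow> bool" where
  "Linf_dom_A L T u \<psi> \<longleftrightarrow>
     (AE t in lborel. t \<in> {0<..<T} \<longrightarrow> ((\<lambda>x. u (x, t)), (\<lambda>x. \<psi> (x, t))) \<in> dom_A L) \<and>
     Linf_L2 L T u \<and> Linf_L2 L T \<psi> \<and>
     (\<exists>ux \<psi>x uxx. weak_dx L T u ux \<and> weak_dx L T \<psi> \<psi>x \<and> weak_dx L T ux uxx \<and>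
        Linf_L2 L T ux \<and> Linf_L2 L T \<psi>x \<and> Linf_L2 L T uxx)"

definition Linf_dom_A0 ::
  "real \<Rightarrow> real \<Rightarrow> real \<Rightarrow> real \<Rightarrow> (real \<times> real \<Rightarrow> real) \<Rightarrow> (real \<times> real \<Rightarrow> real) \<Rightarrow> bool" where
  "Linf_dom_A0 lam U0 L T u \<psi> \<longleftrightarrow>
     (AE t in lborel. t \<in> {0<..<T} \<longrightarrow>
        ((\<lambda>x. u (x, t)), (\<lambda>x. \<psi> (x, t))) \<in> dom_A0 lam U0 L) \<and>
     Linf_L2 L T u \<and> Linf_L2 L T \<psi> \<and>
     (\<exists>ux \<psi>x. weak_dx L T u ux \<and> weak_dx L T \<psi> \<psi>x \<and> Linf_L2 L T ux \<and> Linf_L2 L T \<psi>x)"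

definition space_F :: "real \<Rightarrow> real \<Rightarrow> ((real \<times> real \<Rightarrow> real) \<times> (real \<times> real \<Rightarrow> real)) set" where
  "space_F L T = {(u, \<psi>). C_L2 L T u \<and> C_L2 L T \<psi> \<and> Linf_dom_A L T u \<psi>}"

definition space_F0 ::
  "real \<Rightarrow> real \<Rightarrow> real \<Rightarrow> real \<Rightarrow> ((real \<times> real \<Rightarrow> real) \<times> (real \<times> real \<Rightarrow> real)) set" where
  "space_F0 lam U0 L T = {(u, \<psi>). C_L2 L T u \<and> C_L2 L T \<psi> \<and> Linf_dom_A0 lam U0 L T u \<psi>}"

definition space_K :: "real \<Rightarrow> real \<Rightarrow> ((real \<times> real \<Rightarrow> real) \<times> (real \<times> real \<Rightarrow> real)) set" where
  "space_K L T = {(u, \<psi>). (u, \<psi>) \<in> space_F L T \<and>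
     (\<exists>\<psi>x \<psi>xt \<psi>xx. weak_dx L T \<psi> \<psi>x \<and> weak_dt L T \<psi>x \<psi>xt \<and> weak_dx L T \<psi>x \<psi>xx \<and>
        Linf_L2 L T \<psi>xt \<and> Linf_L2 L T \<psi>xx) \<and>
     (\<exists>ut \<psi>t. weak_dt L T u ut \<and> weak_dt L T \<psi> \<psi>t \<and> C_L2 L T ut \<and> C_L2 L T \<psi>t)}"

definition space_K0 ::
  "real \<Rightarrow> real \<Rightarrow> real \<Rightarrow> real \<Rightarrow> ((real \<times> real \<Rightarrow> real) \<times> (real \<times> real \<Rightarrow> real)) set" where
  "space_K0 lam U0 L T = {(u, \<psi>). (u, \<psi>) \<in> space_F0 lam U0 L T \<and>
     (\<exists>ux uxx \<psi>x \<psi>xt \<psi>xx. weak_dx L T u ux \<and> weak_dx L T ux uxx \<and>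
        weak_dx L T \<psi> \<psi>x \<and> weak_dt L T \<psi>x \<psi>xt \<and> weak_dx L T \<psi>x \<psi>xx \<and>
        Linf_L2 L T \<psi>xt \<and> Linf_L2 L T uxx \<and> Linf_L2 L T \<psi>xx) \<and>
     (\<exists>ut \<psi>t. weak_dt L T u ut \<and> weak_dt L T \<psi> \<psi>t \<and> C_L2 L T ut \<and> C_L2 L T \<psi>t)}"

section \<open>The viscous and the limit problem\<close>

definition viscous_solution where
  "viscous_solution lam U0 L T (\<epsilon>::real) f g u_init \<psi>_init u \<psi> \<longleftrightarrow>
     (\<exists>ut ux uxx \<psi>t \<psi>x. weak_dt L T u ut \<and> weak_dx L T u ux \<and> weak_dx L T ux uxx \<and>
        weak_dt L T \<psi> \<psi>t \<and> weak_dx L T \<psi> \<psi>x \<and>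
        (AE p in lborel. p \<in> spacetime L T \<longrightarrow>
           ut p + U0 * ux p + \<psi>x p - 2 * \<epsilon> * uxx p = f p \<and>
           \<psi>t p + U0 * \<psi>x p + ux p / lam\<^sup>2 = g p)) \<and>
     (AE t in lborel. t \<in> {0<..<T} \<longrightarrow>
        boundary_value L (\<lambda>x. u (x, t)) 0 0 \<and> boundary_value L (\<lambda>x. u (x, t)) L 0 \<and>
        boundary_value L (\<lambda>x. \<psi> (x, t)) 0 0) \<and>
     (AE x in lborel. x \<in> {0<..<L} \<longrightarrow> u (x, 0) = u_init x \<and> \<psi> (x, 0) = \<psi>_init x)"

definition limit_solution where
  "limit_solution lam U0 L T f g u_init \<psi>_init u \<psi> \<longleftrightarrow>
     (\<exists>ut ux \<psi>t \<psi>x. weak_dt L T u ut \<and> weak_dx L T u ux \<and>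
        weak_dt L T \<psi> \<psi>t \<and> weak_dx L T \<psi> \<psi>x \<and>
        (AE p in lborel. p \<in> spacetime L T \<longrightarrow>
           ut p + U0 * ux p + \<psi>x p = f p \<and>
           \<psi>t p + U0 * \<psi>x p + ux p / lam\<^sup>2 = g p)) \<and>
     (AE t in lborel. t \<in> {0<..<T} \<longrightarrow>
        (\<exists>a b. boundary_value L (\<lambda>x. u (x, t)) 0 a \<and> boundary_value L (\<lambda>x. \<psi> (x, t)) 0 b \<and>
           a + U0 * lam\<^sup>2 * b = 0) \<and>
        boundary_value L (\<lambda>x. u (x, t)) L 0) \<and>
     (AE x in lborel. x \<in> {0<..<L} \<longrightarrow> u (x, 0) = u_init x \<and> \<psi> (x, 0) = \<psi>_init x)"

section \<open>Norms of the error\<close>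

text \<open>The norm of L^\<infinity>(0,T; L^\<infinity>(a,b)), with values in [0,\<infinity>]; it is 0 if the interval (a,b) is empty.\<close>

definition Linf_Linf :: "real \<Rightarrow> real \<Rightarrow> real \<Rightarrow> (real \<times> real \<Rightarrow> real) \<Rightarrow> ennreal" where
  "Linf_Linf T a b v = esssup (restrict_space lborel {0<..<T})
     (\<lambda>t. esssup (restrict_space lborel {a<..<b}) (\<lambda>x. ennreal \<bar>v (x, t)\<bar>))"

definition Linf_Linf_pair ::
  "real \<Rightarrow> real \<Rightarrow> real \<Rightarrow> (real \<times> real \<Rightarrow> real) \<Rightarrow> (real \<times> real \<Rightarrow> real) \<Rightarrow> ennreal" where
  "Linf_Linf_pair T a b v w = Linf_Linf T a b v + Linf_Linf T a b w"

end

theory Submission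
  imports Defs
begin

text \<open>
  With \<open>\<nu> = 2\<epsilon>\<close>, \<open>c = 1/\<lambda>\<close> and \<open>p = \<lambda>\<psi>\<close>, the boundary layer is captured by an exact solution of the
  steady equation \<open>\<nu> E'' = - m E'\<close>, \<open>m = c\<^sup>2/U - U > 0\<close>, with \<open>E(0) = 1\<close> and \<open>E(L) = 0\<close>: since
  \<open>u\<^sup>0 + U \<lambda>\<^sup>2 \<psi>\<^sup>0 = 0\<close> at \<open>x = 0\<close>, adding \<open>a(t) E(x)\<close> and \<open>- (c/U) a(t) E(x)\<close>, \<open>a = - u\<^sup>0(0,\<cdot>)\<close>, to
  \<open>(u\<^sup>0, p\<^sup>0)\<close> restores all boundary conditions of the viscous problem.
  The remainder \<open>(w, p)\<close> starts from \<open>0\<close> and is driven by \<open>\<nu> u\<^sup>0\<^sub>x\<^sub>x\<close> and \<open>a'(t) E\<close>. Three energies are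
  combined: that of \<open>(w, p)\<close>, that of the effective velocity \<open>v = w + (\<nu>/c) p\<^sub>x\<close> together with \<open>p\<close>, which
  yields the missing dissipation \<open>\<nu> \<parallel>p\<^sub>x\<parallel>\<^sup>2\<close>, and \<open>\<nu>\<^sup>2 \<parallel>w\<^sub>x\<parallel>\<^sup>2\<close>. Then \<open>w\<^sup>2 \<le> 2 \<parallel>w\<parallel> \<parallel>w\<^sub>x\<parallel>\<close> and the same
  for \<open>p\<close> give the uniform bound \<open>O(\<nu>\<^sup>1\<^sup>/\<^sup>2)\<close> for the remainder. The time derivatives needed for this are
  obtained by Steklov averaging.
  So the error is at most \<open>O(\<epsilon>\<^sup>1\<^sup>/\<^sup>2) + A exp (- m x / \<nu>)\<close>, which gives (1); and (2) holds because \<open>u\<^sup>\<epsilon>\<close> and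
  \<open>\<psi>\<^sup>\<epsilon>\<close> vanish at \<open>x = 0\<close> while a boundary value of \<open>u\<^sup>0\<close> or \<open>\<psi>\<^sup>0\<close> does not.
\<close>

section \<open>Square-integrable functions on an interval\<close>

text \<open>The forcing a'(t) E has L^2 norm of order \<nu>^(1/2), so a plain energy estimate bounds
  squared norms by order \<nu>, short of the order \<nu>^2 on which the uniform bound rests. But E
  lives within distance \<nu> of x = 0, where w and p vanish: integration by parts bounds the
  integral of exp (- m x / \<nu>) |w| by \<nu> / m times that of exp (- m x / \<nu>) |w_x|. The
  forcing then costs order \<nu>^2, plus multiples of \<nu> ||w_x||^2 and \<nu> ||p_x||^2. Viscosity
  pays the first; nothing in the equation of p pays the second, hence the effective velocity. Its
  energy leaves an inflow trace \<nu>^2 w_x(0)^2, paid by the dissipation \<nu>^3 ||w_xx||^2 of the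
  third energy. The direction (1, - c / U) is the one in which the second steady equation holds; the
  limit condition at x = 0 says that the boundary values lie along it, and U < c makes the profile
  decay away from x = 0. That a has a square-integrable derivative and a(0) = 0 is not assumed but
  drawn from \<psi>_xt and the common initial data.\<close>

definition Iv :: "real \<Rightarrow> real measure" where
  "Iv a = density lborel (indicator {0<..<a})"

text \<open>\<open>Iv a\<close> is Lebesgue measure on (0, a), written as a density and not as a
  restricted space: the sigma-algebra stays \<open>borel\<close> on the whole line, so one notion of
  measurability serves all intervals and their products.\<close>

lemma sets_Iv [simp, measurable_cong]: "sets (Iv a) = sets borel"
  by (simp add: Iv_def)

lemma space_Iv [simp]: "space (Iv a) = UNIV"
  by (simp add: Iv_def)

lemma AE_Iv: "(AE x in Iv a. P x) \<longleftrightarrow> (AE x in lborel. x \<in> {0<..<a} \<longrightarrow> P x)"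
  unfolding Iv_def by (subst AE_density) (auto simp: indicator_def)

lemma AE_Iv_in: "AE x in Iv a. 0 < x \<and> x < a"
  by (simp add: AE_Iv)

lemma emeasure_Iv: "A \<in> sets borel \<Longrightarrow> emeasure (Iv a) A = emeasure lborel (A \<inter> {0<..<a})"
  unfolding Iv_def
  by (subst emeasure_density)
     (auto simp: mult.commute simp flip: indicator_inter_arith intro!: nn_integral_indicator)

lemma finite_measure_Iv: "finite_measure (Iv a)"
  by (rule finite_measureI) (cases "0 \<le> a"; simp add: emeasure_Iv)

interpretation Iv: finite_measure "Iv a" for a
  by (rule finite_measure_Iv)

interpretation Iv2: pair_sigma_finite "Iv a" "Iv b" for a b
  by unfold_locales

interpretation Iv2f: finite_measure "Iv a \<Otimes>\<^sub>M Iv b" for a b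
  by (intro finite_measure_pair_measure finite_measure_Iv)

lemma emeasure_Iv_singleton: "emeasure (Iv a) {x} = 0"
  using emeasure_mono[of "{x} \<inter> {0<..<a}" "{x}" lborel] by (simp add: emeasure_Iv)

lemma AE_Iv_neq: "AE x in Iv a. x \<noteq> y"
  by (rule AE_I[of _ _ "{y}"]) (auto simp: emeasure_Iv_singleton)

lemma measure_Iv: "0 \<le> a \<Longrightarrow> measure (Iv a) UNIV = a"
  by (simp add: measure_def emeasure_Iv)

lemma integral_Iv:
  fixes f :: "real \<Rightarrow> real"
  assumes "f \<in> borel_measurable borel"
  shows "integral\<^sup>L (Iv a) f = (LINT x:{0<..<a}|lborel. f x)"
proof -
  have "Iv a = density lborel (\<lambda>x. ennreal (indicator {0<..<a} x))"
    unfolding Iv_def by (rule arg_cong[where f="density lborel"]) (auto simp: indicator_def)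
  then show ?thesis using assms
    by (simp add: integral_real_density set_lebesgue_integral_def)
qed

lemma integrable_Iv:
  fixes f :: "real \<Rightarrow> real"
  assumes "f \<in> borel_measurable borel"
  shows "integrable (Iv a) f \<longleftrightarrow> set_integrable lborel {0<..<a} f"
proof -
  have "Iv a = density lborel (\<lambda>x. ennreal (indicator {0<..<a} x))"
    unfolding Iv_def by (rule arg_cong[where f="density lborel"]) (auto simp: indicator_def)
  then show ?thesis using assms
    by (simp add: integrable_real_density set_integrable_def)
qed

definition sqint :: "'a measure \<Rightarrow> ('a \<Rightarrow> real) \<Rightarrow> bool" where
  "sqint M f \<longleftrightarrow> f \<in> borel_measurable M \<and> integrable M (\<lambda>x. (f x)\<^sup>2)"

lemma sqint_measurable [measurable_dest]: "sqint M f \<Longrightarrow> f \<in> borel_measurable M"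
  by (simp add: sqint_def)

lemma sqint_integrable_sq: "sqint M f \<Longrightarrow> integrable M (\<lambda>x. (f x)\<^sup>2)"
  by (simp add: sqint_def)

lemma sqint_integrable_mult:
  assumes "sqint M f" "sqint M g"
  shows "integrable M (\<lambda>x. f x * g x)"
proof (rule Bochner_Integration.integrable_bound)
  show "integrable M (\<lambda>x. (f x)\<^sup>2 + (g x)\<^sup>2)"
    using assms by (simp add: sqint_def)
  show "(\<lambda>x. f x * g x) \<in> borel_measurable M"
    using assms by measurable
  show "AE x in M. norm (f x * g x) \<le> norm ((f x)\<^sup>2 + (g x)\<^sup>2)"
  proof (rule AE_I2)
    fix x
    have "2 * \<bar>f x * g x\<bar> \<le> (f x)\<^sup>2 + (g x)\<^sup>2"
      using sum_squares_bound[of "\<bar>f x\<bar>" "\<bar>g x\<bar>"] by (simp add: abs_mult)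
    then show "norm (f x * g x) \<le> norm ((f x)\<^sup>2 + (g x)\<^sup>2)" by simp
  qed
qed

lemma sqint_cmult:
  assumes [measurable]: "sqint M f"
  shows "sqint M (\<lambda>x. k * f x)"
  using sqint_integrable_sq[OF assms] by (simp add: sqint_def power_mult_distrib)

lemma sqint_mult_right: "sqint M f \<Longrightarrow> sqint M (\<lambda>x. f x * k)"
  using sqint_cmult[of M f k] by (simp add: mult.commute)

lemma sqint_divide: "sqint M f \<Longrightarrow> sqint M (\<lambda>x. f x / k)"
  using sqint_mult_right[of M f "1 / k"] by simp

lemma sqint_add:
  assumes [measurable]: "sqint M f" "sqint M g"
  shows "sqint M (\<lambda>x. f x + g x)"
proof -
  have "integrable M (\<lambda>x. (f x)\<^sup>2 + (g x)\<^sup>2 + 2 * (f x * g x))"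
    using sqint_integrable_mult[OF assms] assms by (simp add: sqint_integrable_sq)
  then show ?thesis by (simp add: sqint_def power2_sum mult.assoc)
qed

lemma sqint_uminus: "sqint M f \<Longrightarrow> sqint M (\<lambda>x. - f x)"
  using sqint_cmult[of M f "-1"] by simp

lemma sqint_diff: "sqint M f \<Longrightarrow> sqint M g \<Longrightarrow> sqint M (\<lambda>x. f x - g x)"
  using sqint_add[OF _ sqint_uminus, of M f g] by simp

lemma sqint_abs:
  assumes [measurable]: "sqint M f"
  shows "sqint M (\<lambda>x. \<bar>f x\<bar>)"
  using sqint_integrable_sq[OF assms] by (simp add: sqint_def)

lemma sqint_bound:
  assumes "sqint M f" "g \<in> borel_measurable M" "AE x in M. \<bar>g x\<bar> \<le> \<bar>f x\<bar>"
  shows "sqint M g"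
  unfolding sqint_def
proof (intro conjI)
  show "integrable M (\<lambda>x. (g x)\<^sup>2)"
    using assms(1,2) unfolding sqint_def
    by (intro Bochner_Integration.integrable_bound[of M "\<lambda>x. (f x)\<^sup>2" "\<lambda>x. (g x)\<^sup>2"])
       (auto intro: eventually_mono[OF assms(3)] simp: abs_le_square_iff)
qed fact

lemma sqint_cong_AE:
  assumes "sqint M f" "g \<in> borel_measurable M" "AE x in M. g x = f x"
  shows "sqint M g"
  by (rule sqint_bound[OF assms(1,2)]) (rule eventually_mono[OF assms(3)], simp)

lemma (in finite_measure) sqint_const: "sqint M (\<lambda>x. k)"
  by (simp add: sqint_def)

lemma (in finite_measure) sqint_bounded:
  assumes "g \<in> borel_measurable M" "\<And>x. \<bar>g x\<bar> \<le> k"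
  shows "sqint M g"
  by (rule sqint_bound[OF sqint_const[of k] assms(1)])
     (use assms(2) in \<open>auto intro!: AE_I2 order_trans[OF _ abs_ge_self]\<close>)

lemma (in finite_measure) sqint_integrable: "sqint M f \<Longrightarrow> integrable M f"
  using sqint_integrable_mult[OF _ sqint_const[of 1]] by simp

lemma sqint_mult_bounded:
  assumes "sqint M f" "g \<in> borel_measurable M" "\<And>x. \<bar>g x\<bar> \<le> k"
  shows "sqint M (\<lambda>x. g x * f x)"
proof (rule sqint_bound[OF sqint_cmult[OF assms(1), of k]])
  have "0 \<le> k" using assms(3) abs_ge_zero order_trans by blast
  then show "AE x in M. \<bar>g x * f x\<bar> \<le> \<bar>k * f x\<bar>"
    using assms(3) by (auto simp: abs_mult intro!: mult_right_mono)
qed (use assms in measurable)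

text \<open>Cauchy-Schwarz against the constant 1, from the nonnegative integral of (f - A)^2 where
  A is the mean of f; a null measure admits no mean and is treated apart.\<close>

lemma (in finite_measure) square_integral_le:
  assumes "sqint M f"
  shows "(\<integral>x. f x \<partial>M)\<^sup>2 \<le> measure M (space M) * (\<integral>x. (f x)\<^sup>2 \<partial>M)"
proof (cases "measure M (space M) = 0")
  case True
  then have "emeasure M (space M) = 0" by (simp add: emeasure_eq_measure)
  then have "AE x in M. f x = 0" by (auto intro: AE_I)
  then have "(\<integral>x. f x \<partial>M) = 0" by (rule integral_eq_zero_AE)
  then show ?thesis by (simp add: True)
next
  case False
  define A where "A = (\<integral>x. f x \<partial>M) / measure M (space M)"
  have pos: "measure M (space M) > 0" using False by (simp add: less_le)
  have "0 \<le> (\<integral>x. (f x - A)\<^sup>2 \<partial>M)" by simp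
  also have "\<dots> = (\<integral>x. (f x)\<^sup>2 - 2 * A * f x + A\<^sup>2 \<partial>M)"
    by (intro Bochner_Integration.integral_cong) (auto simp: power2_diff)
  also have "\<dots> = (\<integral>x. (f x)\<^sup>2 \<partial>M) - 2 * A * (\<integral>x. f x \<partial>M) + A\<^sup>2 * measure M (space M)"
    using assms sqint_integrable[OF assms] by (simp add: sqint_def mult.commute)
  also have "\<dots> = (\<integral>x. (f x)\<^sup>2 \<partial>M) - (\<integral>x. f x \<partial>M)\<^sup>2 / measure M (space M)"
    using pos by (simp add: A_def power2_eq_square field_simps)
  finally show ?thesis using pos by (simp add: field_simps)
qed

section \<open>Primitives\<close>

text \<open>The primitive that starts from 0 at the left end. With \<open>Iv a\<close> it is total:
  constantly 0 to the left of 0 and constantly the full integral to the right of a. Absolutely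
  continuous functions appear throughout as a boundary value plus \<open>prim\<close> of the
  derivative, so that Sobolev functions need no pointwise derivatives.\<close>

definition prim :: "real measure \<Rightarrow> (real \<Rightarrow> real) \<Rightarrow> real \<Rightarrow> real" where
  "prim M f x = (\<integral>y. indicator {..<x} y * f y \<partial>M)"

lemma integrable_indicator_mult [simp]:
  fixes f :: "'a \<Rightarrow> real"
  assumes "integrable M f" "A \<in> sets M"
  shows "integrable M (\<lambda>x. indicator A x * f x)"
  using integrable_mult_indicator[OF assms(2,1)] by simp

lemma measurable_prim [measurable]:
  assumes [measurable]: "(\<lambda>(x, y). f x y) \<in> borel_measurable (N \<Otimes>\<^sub>M borel)" "h \<in> borel_measurable N"
  shows "(\<lambda>x. prim (Iv a) (f x) (h x)) \<in> borel_measurable N"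
proof -
  have [measurable]: "(\<lambda>(x, y). f x y) \<in> borel_measurable (N \<Otimes>\<^sub>M Iv a)"
    using assms(1) by (simp cong: measurable_cong_sets sets_pair_measure_cong)
  have [measurable]: "Measurable.pred (N \<Otimes>\<^sub>M Iv a) (\<lambda>x. snd x \<in> {..<h (fst x)})"
    unfolding lessThan_iff by measurable
  show ?thesis unfolding prim_def by measurable
qed

lemma prim_cong_AE:
  assumes "AE y in Iv a. f y = g y" "f \<in> borel_measurable borel" "g \<in> borel_measurable borel"
  shows "prim (Iv a) f x = prim (Iv a) g x"
  unfolding prim_def using assms by (intro integral_cong_AE) auto

lemma prim_add:
  assumes "integrable (Iv a) f" "integrable (Iv a) g"
  shows "prim (Iv a) (\<lambda>y. f y + g y) x = prim (Iv a) f x + prim (Iv a) g x"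
  unfolding prim_def using assms by (simp add: distrib_left)

lemma prim_diff:
  assumes "integrable (Iv a) f" "integrable (Iv a) g"
  shows "prim (Iv a) (\<lambda>y. f y - g y) x = prim (Iv a) f x - prim (Iv a) g x"
  unfolding prim_def using assms by (simp add: right_diff_distrib)

lemma prim_cmult: "prim (Iv a) (\<lambda>y. k * f y) x = k * prim (Iv a) f x"
  unfolding prim_def by (simp add: mult.left_commute)

lemma prim_nonpos: "x \<le> 0 \<Longrightarrow> prim (Iv a) f x = 0"
  unfolding prim_def
  by (rule integral_eq_zero_AE) (use AE_Iv_in in eventually_elim, auto)

lemma prim_total:
  assumes "a \<le> x" "f \<in> borel_measurable borel"
  shows "prim (Iv a) f x = integral\<^sup>L (Iv a) f"
  unfolding prim_def
  by (rule integral_cong_AE) (use assms in measurable, use AE_Iv_in in eventually_elim, use assms in auto)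

lemma abs_prim_le:
  assumes "integrable (Iv a) f"
  shows "\<bar>prim (Iv a) f x\<bar> \<le> (\<integral>y. \<bar>f y\<bar> \<partial>Iv a)"
proof -
  have "\<bar>prim (Iv a) f x\<bar> \<le> (\<integral>y. \<bar>indicator {..<x} y * f y\<bar> \<partial>Iv a)"
    unfolding prim_def by (rule integral_abs_bound)
  also have "\<dots> \<le> (\<integral>y. \<bar>f y\<bar> \<partial>Iv a)"
    using assms by (intro integral_mono integrable_abs integrable_indicator_mult) (auto simp: indicator_def)
  finally show ?thesis .
qed

lemma integrable_pair_mult:
  fixes f g :: "real \<Rightarrow> real"
  assumes [measurable]: "integrable (Iv a) f" "integrable (Iv b) g"
  shows "integrable (Iv a \<Otimes>\<^sub>M Iv b) (\<lambda>p. f (fst p) * g (snd p))"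
proof (rule Iv2.Fubini_integrable)
  show "(\<lambda>p. f (fst p) * g (snd p)) \<in> borel_measurable (Iv a \<Otimes>\<^sub>M Iv b)"
    by measurable
  show "integrable (Iv a) (\<lambda>x. \<integral>y. norm (f (fst (x, y)) * g (snd (x, y))) \<partial>Iv b)"
    using assms by (auto simp: abs_mult)
  show "AE x in Iv a. integrable (Iv b) (\<lambda>y. f (fst (x, y)) * g (snd (x, y)))"
    using assms by auto
qed

text \<open>Fubini: the diagonal cuts the square into two open triangles, over which f(x) g(y)
  integrates to the two terms on the left; the diagonal itself is a null set.\<close>

lemma prim_integral_by_parts:
  assumes f: "integrable (Iv a) f" and g: "integrable (Iv a) g"
  shows "(\<integral>x. f x * prim (Iv a) g x \<partial>Iv a) + (\<integral>x. prim (Iv a) f x * g x \<partial>Iv a)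
    = (\<integral>x. f x \<partial>Iv a) * (\<integral>x. g x \<partial>Iv a)"
proof -
  have [measurable]: "f \<in> borel_measurable borel" "g \<in> borel_measurable borel"
    using borel_measurable_integrable[OF f] borel_measurable_integrable[OF g] by simp_all
  let ?P = "Iv a \<Otimes>\<^sub>M Iv a"
  define F where "F p = f (fst p) * g (snd p)" for p
  have F: "integrable ?P F"
    unfolding F_def by (rule integrable_pair_mult[OF f g])
  have [measurable]: "F \<in> borel_measurable ?P" using F by simp
  define A where "A = {p :: real \<times> real. snd p < fst p}"
  define B where "B = {p :: real \<times> real. fst p < snd p}"
  have A[measurable]: "A \<in> sets ?P" and B[measurable]: "B \<in> sets ?P"
  proof -
    have "{p \<in> space ?P. snd p < fst p} \<in> sets ?P" by measurable
    then show "A \<in> sets ?P" by (simp add: A_def space_pair_measure)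
    have "{p \<in> space ?P. fst p < snd p} \<in> sets ?P" by measurable
    then show "B \<in> sets ?P" by (simp add: B_def space_pair_measure)
  qed
  have "AE p in ?P. fst p \<noteq> snd p"
  proof (rule Iv2.AE_pair_measure)
    have "{p \<in> space ?P. fst p \<noteq> snd p} = A \<union> B"
      by (auto simp: A_def B_def space_pair_measure)
    then show "{p \<in> space ?P. fst p \<noteq> snd p} \<in> sets ?P"
      using A B by simp
    show "AE x in Iv a. AE y in Iv a. fst (x, y) \<noteq> snd (x, y)"
      using AE_Iv_neq[of _ a] by (auto simp: eq_commute)
  qed
  then have "(\<integral>p. F p \<partial>?P) = (\<integral>p. indicator A p * F p + indicator B p * F p \<partial>?P)"
    by (intro integral_cong_AE) (measurable, auto simp: A_def B_def indicator_def elim!: eventually_mono)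
  also have "\<dots> = (\<integral>p. indicator A p * F p \<partial>?P) + (\<integral>p. indicator B p * F p \<partial>?P)"
    using F A B by (intro Bochner_Integration.integral_add integrable_indicator_mult)
  also have "(\<integral>p. indicator A p * F p \<partial>?P) = (\<integral>x. \<integral>y. indicator A (x, y) * F (x, y) \<partial>Iv a \<partial>Iv a)"
    using Iv2.integral_fst'[OF integrable_indicator_mult[OF F A]] by simp
  also have "\<dots> = (\<integral>x. f x * prim (Iv a) g x \<partial>Iv a)"
    unfolding prim_def F_def A_def
    by (intro Bochner_Integration.integral_cong refl)
       (auto simp: indicator_def mult.left_commute simp flip: Bochner_Integration.integral_mult_right_zero
             intro!: Bochner_Integration.integral_cong)
  also have "(\<integral>p. indicator B p * F p \<partial>?P) = (\<integral>y. \<integral>x. indicator B (x, y) * F (x, y) \<partial>Iv a \<partial>Iv a)"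
    using Iv2.integral_snd[of a a "\<lambda>x y. indicator B (x, y) * F (x, y)"] integrable_indicator_mult[OF F B]
    by (simp add: split_beta')
  also have "\<dots> = (\<integral>x. prim (Iv a) f x * g x \<partial>Iv a)"
    unfolding prim_def F_def B_def
    by (intro Bochner_Integration.integral_cong refl)
       (auto simp: indicator_def mult.assoc simp flip: Bochner_Integration.integral_mult_left_zero
             intro!: Bochner_Integration.integral_cong)
  also have "(\<integral>p. F p \<partial>?P) = (\<integral>x. f x \<partial>Iv a) * (\<integral>x. g x \<partial>Iv a)"
    using F by (subst Iv2.integral_fst'[symmetric]) (auto simp: F_def)
  finally show ?thesis by simp
qed

lemma integrable_mult_bounded:
  fixes f g :: "'a \<Rightarrow> real"
  assumes "integrable M f" "g \<in> borel_measurable M" "\<And>x. \<bar>g x\<bar> \<le> k"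
  shows "integrable M (\<lambda>x. f x * g x)" "integrable M (\<lambda>x. g x * f x)"
proof -
  have "integrable M (\<lambda>x. k * f x)" using assms(1) by simp
  then show "integrable M (\<lambda>x. f x * g x)"
  proof (rule Bochner_Integration.integrable_bound)
    have "0 \<le> k" using assms(3) abs_ge_zero order_trans by blast
    then show "AE x in M. norm (f x * g x) \<le> norm (k * f x)"
      using assms(3) by (auto simp: abs_mult mult.commute[of k] intro!: mult_left_mono AE_I2)
  qed (use assms in measurable)
  then show "integrable M (\<lambda>x. g x * f x)" by (simp add: mult.commute)
qed

lemma integrable_mult_prim:
  assumes "integrable (Iv a) f" "integrable (Iv a) g"
  shows "integrable (Iv a) (\<lambda>x. f x * (k + prim (Iv a) g x))"
proof (rule integrable_mult_bounded(1)[OF assms(1)])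
  show "(\<lambda>x. k + prim (Iv a) g x) \<in> borel_measurable (Iv a)"
    using borel_measurable_integrable[OF assms(2)] by simp
  show "\<bar>k + prim (Iv a) g x\<bar> \<le> \<bar>k\<bar> + (\<integral>y. \<bar>g y\<bar> \<partial>Iv a)" for x
    using abs_prim_le[OF assms(2), of x] by linarith
qed

text \<open>Here \<open>f0 + integral\<^sup>L (Iv a) f'\<close> is the value of f at the right end
  point, so the right-hand side is the boundary term of f g.\<close>

lemma integral_by_parts_Iv:
  assumes f: "integrable (Iv a) f'" and g: "integrable (Iv a) g'"
    and F: "\<And>x. f x = f0 + prim (Iv a) f' x" and G: "\<And>x. g x = g0 + prim (Iv a) g' x"
  shows "(\<integral>x. f' x * g x \<partial>Iv a) + (\<integral>x. f x * g' x \<partial>Iv a)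
    = (f0 + integral\<^sup>L (Iv a) f') * (g0 + integral\<^sup>L (Iv a) g') - f0 * g0"
proof -
  have "(\<integral>x. f' x * g x \<partial>Iv a) = g0 * integral\<^sup>L (Iv a) f' + (\<integral>x. f' x * prim (Iv a) g' x \<partial>Iv a)"
    using f integrable_mult_prim[OF f g, of 0] by (simp add: G distrib_left mult.commute)
  moreover have "(\<integral>x. f x * g' x \<partial>Iv a) = f0 * integral\<^sup>L (Iv a) g' + (\<integral>x. prim (Iv a) f' x * g' x \<partial>Iv a)"
    using g integrable_mult_prim[OF g f, of 0] by (simp add: F distrib_left mult.commute[of _ "g' _"])
  ultimately show ?thesis
    using prim_integral_by_parts[OF f g] by (simp add: algebra_simps)
qed

text \<open>Dynkin's argument: boxes form an intersection-stable generator of the Borel sets, and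
  exhausting the space by boxes gives total integral 0, as closure under complements requires. The
  sets where r > 0 and where r < 0 then show that |r| has integral 0.\<close>

lemma AE_eq_0_if_box_integrals_eq_0:
  fixes r :: "'a::euclidean_space \<Rightarrow> real"
  assumes int: "integrable lborel r"
    and box: "\<And>a b. (\<integral>x. indicator (box a b) x * r x \<partial>lborel) = 0"
  shows "AE x in lborel. r x = 0"
proof -
  have [measurable]: "r \<in> borel_measurable borel" using int by simp
  have UNIV: "(\<integral>x. r x \<partial>lborel) = 0"
  proof -
    have "(\<lambda>n. \<integral>x. indicator (box (- real n *\<^sub>R One) (real n *\<^sub>R One)) x * r x \<partial>lborel)
        \<longlonglongrightarrow> (\<integral>x. r x \<partial>lborel)"
    proof (rule integral_dominated_convergence[where w="\<lambda>x. \<bar>r x\<bar>"])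
      show "AE x in lborel. (\<lambda>n. indicator (box (- real n *\<^sub>R One) (real n *\<^sub>R One)) x * r x) \<longlonglongrightarrow> r x"
      proof (rule AE_I2)
        fix x :: 'a
        obtain N :: nat where N: "\<And>b. b \<in> Basis \<Longrightarrow> \<bar>x \<bullet> b\<bar> < real N"
          by (metis Basis_le_norm le_less_trans reals_Archimedean2)
        have "eventually (\<lambda>n. indicator (box (- real n *\<^sub>R One) (real n *\<^sub>R One)) x * r x = r x) sequentially"
          using eventually_ge_at_top[of N]
        proof eventually_elim
          case (elim n)
          have "x \<in> box (- real n *\<^sub>R One) (real n *\<^sub>R One)"
            unfolding mem_box
          proof
            fix b :: 'a assume b: "b \<in> Basis"
            have "\<bar>x \<bullet> b\<bar> < real n" using N[OF b] elim by linarith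
            then show "- real n *\<^sub>R One \<bullet> b < x \<bullet> b \<and> x \<bullet> b < real n *\<^sub>R One \<bullet> b"
              using b by (auto simp: inner_sum_left_Basis)
          qed
          then show ?case by simp
        qed
        then show "(\<lambda>n. indicator (box (- real n *\<^sub>R One) (real n *\<^sub>R One)) x * r x) \<longlonglongrightarrow> r x"
          by (rule tendsto_eventually)
      qed
    qed (use int in \<open>auto simp: indicator_def\<close>)
    then show ?thesis by (simp add: box LIMSEQ_const_iff)
  qed
  define G :: "'a set set" where "G = range (\<lambda>(a, b). box a b)"
  have borel_G: "sets (borel :: 'a measure) = sigma_sets UNIV G"
    unfolding G_def by (subst borel_eq_box) simp
  have A: "(\<integral>x. indicator A x * r x \<partial>lborel) = 0" if "A \<in> sets borel" for A
  proof -
    have mem: "A \<in> sigma_sets UNIV G" using that borel_G by simp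
    have "Int_stable G"
      unfolding G_def Int_stable_def by (auto simp: box_Int_box intro!: rev_image_eqI)
    moreover have "G \<subseteq> Pow UNIV" by simp
    ultimately show ?thesis
      using mem
    proof (induction rule: sigma_sets_induct_disjoint)
      case (basic A)
      then show ?case using box by (auto simp: G_def)
    next
      case (compl A)
      then have "A \<in> sets lborel" using borel_G by simp
      then have I: "integrable lborel (\<lambda>x. indicator A x * r x)"
        using int by simp
      have "(\<integral>x. indicator (UNIV - A) x * r x \<partial>lborel) = (\<integral>x. r x - indicator A x * r x \<partial>lborel)"
        by (intro Bochner_Integration.integral_cong) (auto simp: indicator_def)
      also have "\<dots> = 0" using int I UNIV compl by simp
      finally show ?case .
    next
      case (union A)
      then have meas: "A i \<in> sets lborel" for i using borel_G by auto
      have "set_integrable lborel (\<Union> (range A)) r"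
        unfolding set_integrable_def using int meas by (intro integrable_mult_indicator) auto
      then have "(LINT x:(\<Union>i. A i)|lborel. r x) = (\<Sum>i. (LINT x:A i|lborel. r x))"
        using meas union by (intro lebesgue_integral_countable_add) (auto simp: disjoint_family_on_def)
      then show ?case
        using union by (simp add: set_lebesgue_integral_def)
    qed simp
  qed
  have "(\<integral>x. \<bar>r x\<bar> \<partial>lborel)
      = (\<integral>x. indicator {x. 0 < r x} x * r x - indicator {x. r x < 0} x * r x \<partial>lborel)"
    by (intro Bochner_Integration.integral_cong) (auto simp: indicator_def)
  also have "\<dots> = 0" using int A by simp
  finally have "(\<integral>x. \<bar>r x\<bar> \<partial>lborel) = 0" .
  then show ?thesis
    using int by (subst (asm) integral_nonneg_eq_0_iff_AE) auto
qed

text \<open>Dominated convergence: away from the null point y = x the indicators are eventually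
  constant along any sequence tending to x.\<close>

lemma isCont_prim:
  assumes "integrable (Iv a) f"
  shows "isCont (prim (Iv a) f) x"
  unfolding continuous_at_sequentially comp_def
proof safe
  fix X assume X: "X \<longlonglongrightarrow> x"
  have [measurable]: "f \<in> borel_measurable borel" using borel_measurable_integrable[OF assms] by simp
  show "(\<lambda>n. prim (Iv a) f (X n)) \<longlonglongrightarrow> prim (Iv a) f x"
    unfolding prim_def
  proof (rule integral_dominated_convergence[where w="\<lambda>y. \<bar>f y\<bar>"])
    show "AE y in Iv a. (\<lambda>n. indicator {..<X n} y * f y) \<longlonglongrightarrow> indicator {..<x} y * f y"
      using AE_Iv_neq[of x]
    proof eventually_elim
      case (elim y)
      have "eventually (\<lambda>n. indicator {..<X n} y * f y = indicator {..<x} y * f y) sequentially"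
      proof (cases "y < x")
        case True
        show ?thesis
          using order_tendstoD(1)[OF X True] True by (auto elim!: eventually_mono simp: indicator_def)
      next
        case False
        with elim have xy: "x < y" by simp
        show ?thesis
          by (rule eventually_mono[OF order_tendstoD(2)[OF X xy]]) (use xy in auto)
      qed
      then show ?case by (rule tendsto_eventually)
    qed
  qed (use assms in \<open>auto simp: indicator_def\<close>)
qed

text \<open>A continuous function that differs from k at x does so on a relatively open piece of
  [0, a], which has positive measure even when x is an end point.\<close>

lemma continuous_AE_eq_const:
  fixes F :: "real \<Rightarrow> real"
  assumes F: "continuous_on {0..a} F" and AE: "AE x in Iv a. F x = k" and x: "x \<in> {0..a}" and a: "0 < a"
  shows "F x = k"
proof (rule ccontr)
  assume neq: "F x \<noteq> k"
  have "(F \<longlongrightarrow> F x) (at x within {0..a})"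
    using F x by (auto simp: continuous_on_def)
  then have "eventually (\<lambda>y. F y \<noteq> k) (at x within {0..a})"
    using neq by (rule tendsto_imp_eventually_ne)
  then obtain d where d: "d > 0" "\<And>y. y \<in> {0..a} \<Longrightarrow> y \<noteq> x \<Longrightarrow> dist y x < d \<Longrightarrow> F y \<noteq> k"
    unfolding eventually_at by auto
  define l where "l = max 0 (x - d)"
  define u where "u = min a (x + d)"
  have lu: "l < u" using x a d(1) by (auto simp: l_def u_def)
  have "AE y in lborel. \<not> (l < y \<and> y < u)"
  proof -
    have "AE y in lborel. y \<in> {0<..<a} \<longrightarrow> F y = k" using AE by (simp add: AE_Iv)
    then have "AE y in lborel. y \<noteq> x \<longrightarrow> \<not> (l < y \<and> y < u)"
      
    proof eventually_elim
      case (elim y)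
      show ?case using elim d(2)[of y] by (auto simp: l_def u_def dist_real_def abs_less_iff)
    qed
    with AE_lborel_singleton[of x] show ?thesis
      by eventually_elim auto
  qed
  then have "AE y in lborel. y \<notin> {l<..<u}" by simp
  then have "emeasure lborel {l<..<u} = 0"
    by (subst (asm) AE_iff_measurable[where N="{l<..<u}"]) auto
  then show False using lu by simp
qed

text \<open>This takes the place of differentiation: evaluating the continuous difference at 0
  isolates the constant, and then the integrals of f - g over all intervals vanish as differences of
  primitives.\<close>

lemma AE_eq_if_prim_eq:
  assumes a: "0 < a" and f: "integrable (Iv a) f" and g: "integrable (Iv a) g"
    and AE: "AE x in Iv a. prim (Iv a) f x = k + prim (Iv a) g x"
  shows "k = 0" "AE x in Iv a. f x = g x"
proof -
  define h where "h y = f y - g y" for y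
  have h: "integrable (Iv a) h" unfolding h_def using f g by simp
  have [measurable]: "h \<in> borel_measurable borel" using borel_measurable_integrable[OF h] by simp
  have "AE x in Iv a. prim (Iv a) h x = k"
    using AE by eventually_elim (simp add: h_def[abs_def] prim_diff[OF f g])
  moreover have "continuous_on {0..a} (prim (Iv a) h)"
    using isCont_prim[OF h] by (simp add: continuous_at_imp_continuous_on)
  ultimately have P: "prim (Iv a) h x = k" if "x \<in> {0..a}" for x
    using continuous_AE_eq_const that a by blast
  from P[of 0] a show k: "k = 0" by (simp add: prim_nonpos)
  have P0: "prim (Iv a) h x = 0" for x
  proof -
    consider "x \<le> 0" | "x \<in> {0..a}" | "a \<le> x" by fastforce
    then show ?thesis
    proof cases
      case 3
      then show ?thesis using P[of a] a k by (simp add: prim_total)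
    qed (use P k in \<open>auto simp: prim_nonpos\<close>)
  qed
  define r where "r y = indicator {0<..<a} y * h y" for y
  have "AE y in lborel. r y = 0"
  proof (rule AE_eq_0_if_box_integrals_eq_0)
    show r: "integrable lborel r"
      using h by (simp add: r_def[abs_def] integrable_Iv set_integrable_def)
    fix u v :: real
    show "(\<integral>x. indicator (box u v) x * r x \<partial>lborel) = 0"
    proof (cases "u < v")
      case True
      have "(\<integral>x. indicator (box u v) x * r x \<partial>lborel) = (\<integral>x. indicator (box u v) x * h x \<partial>Iv a)"
        by (simp add: integral_Iv r_def set_lebesgue_integral_def mult.left_commute)
      also have "\<dots> = (\<integral>x. indicator {..<v} x * h x - indicator {..<u} x * h x \<partial>Iv a)"
      proof (rule integral_cong_AE)
        show "AE x in Iv a. indicator (box u v) x * h x = indicator {..<v} x * h x - indicator {..<u} x * h x"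
          using AE_Iv_neq[of u a] by eventually_elim (use True in \<open>auto simp: indicator_def box_real\<close>)
      qed measurable
      also have "\<dots> = prim (Iv a) h v - prim (Iv a) h u"
        unfolding prim_def using h by simp
      finally show ?thesis by (simp add: P0)
    qed (simp add: box_real)
  qed
  then show "AE x in Iv a. f x = g x"
    unfolding AE_Iv by eventually_elim (auto simp: r_def h_def)
qed

lemma prim_FTC:
  assumes F: "\<And>y. 0 \<le> y \<Longrightarrow> y \<le> a \<Longrightarrow> (F has_real_derivative f y) (at y)"
    and f: "continuous_on UNIV f" and x: "0 \<le> x" "x \<le> a"
  shows "prim (Iv a) f x = F x - F 0"
proof -
  have [measurable]: "f \<in> borel_measurable borel"
    using f by (simp add: borel_measurable_continuous_onI)
  have "prim (Iv a) f x = (\<integral>y. indicator {0..x} y *\<^sub>R f y \<partial>lborel)"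
    unfolding prim_def integral_Iv set_lebesgue_integral_def
  proof (subst integral_Iv, measurable, unfold set_lebesgue_integral_def, rule integral_cong_AE)
    show "AE y in lborel. indicator {0<..<a} y *\<^sub>R (indicator {..<x} y * f y) = indicator {0..x} y *\<^sub>R f y"
      using AE_lborel_singleton[of x] AE_lborel_singleton[of 0]
      by eventually_elim (use x in \<open>auto simp: indicator_def\<close>)
  qed measurable
  also have "\<dots> = F x - F 0"
  proof (rule integral_FTC_Icc)
    show "(F has_vector_derivative f y) (at y within {0..x})" if "0 \<le> y" "y \<le> x" for y
      using F[of y] that x
      by (auto simp: has_real_derivative_iff_has_vector_derivative intro: has_vector_derivative_at_within)
    show "continuous_on {0..x} f" using f continuous_on_subset by blast
  qed (use x in auto)
  finally show ?thesis .
qed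

section \<open>Exponential weights and Young's inequality\<close>

lemma integral_exp_sq_le:
  assumes "0 < \<nu>" "0 < m" "0 \<le> L"
  shows "(\<integral>x. (exp (- m * x / \<nu>))\<^sup>2 \<partial>Iv L) \<le> \<nu> / (2 * m)"
proof -
  have "(\<integral>x. (exp (- m * x / \<nu>))\<^sup>2 \<partial>Iv L) = prim (Iv L) (\<lambda>x. (exp (- m * x / \<nu>))\<^sup>2) L"
    using assms by (simp add: prim_total)
  also have "\<dots> = - \<nu> / (2 * m) * (exp (- m * L / \<nu>))\<^sup>2 - (- \<nu> / (2 * m) * (exp (- m * 0 / \<nu>))\<^sup>2)"
    by (rule prim_FTC)
       (use assms in \<open>auto intro!: derivative_eq_intros continuous_intros simp: power2_eq_square field_simps\<close>)
  also have "\<dots> \<le> \<nu> / (2 * m)"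
    using assms by simp
  finally show ?thesis .
qed

text \<open>A Hardy-type gain: a function vanishing at x = 0 is small where the weight is
  concentrated. Integration by parts moves the primitive from |f| to the weight, whose primitive is
  \<nu> / m times 1 - e; the term at x = L has a favourable sign and is dropped.\<close>

lemma integral_exp_prim_le:
  assumes \<nu>: "0 < \<nu>" and m: "0 < m" and L: "0 \<le> L" and f: "integrable (Iv L) f"
  shows "(\<integral>x. exp (- m * x / \<nu>) * \<bar>prim (Iv L) f x\<bar> \<partial>Iv L)
    \<le> \<nu> / m * (\<integral>x. exp (- m * x / \<nu>) * \<bar>f x\<bar> \<partial>Iv L)"
proof -
  have [measurable]: "f \<in> borel_measurable borel" using borel_measurable_integrable[OF f] by simp
  define e where "e x = exp (- m * x / \<nu>)" for x
  \<comment> \<open>The exponential is unbounded for x < 0, and boundedness is asked on the whole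
    line; the cut changes nothing almost everywhere on (0, L).\<close>
  define e' where "e' x = indicator {0..L} x * e x" for x
  have [measurable]: "e \<in> borel_measurable borel" "e' \<in> borel_measurable borel"
    unfolding e_def e'_def by measurable
  have e'_bound: "\<bar>e' x\<bar> \<le> 1" for x
    using \<nu> m by (auto simp: e'_def e_def indicator_def)
  have ee': "AE x in Iv L. e' x = e x"
    using AE_Iv_in by eventually_elim (auto simp: e'_def)
  have e': "integrable (Iv L) e'"
    by (rule Iv.sqint_integrable, rule Iv.sqint_bounded[OF _ e'_bound]) simp
  have pe: "prim (Iv L) e' x = \<nu> / m * (1 - e x)" if "0 \<le> x" "x \<le> L" for x
  proof -
    have "prim (Iv L) e' x = prim (Iv L) e x"
      by (rule prim_cong_AE[OF ee']) auto
    also have "\<dots> = - \<nu> / m * exp (- m * x / \<nu>) - (- \<nu> / m * exp (- m * 0 / \<nu>))"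
      unfolding e_def
      by (rule prim_FTC)
         (use \<nu> m that in \<open>auto intro!: derivative_eq_intros continuous_intros simp: field_simps\<close>)
    finally show ?thesis by (simp add: e_def right_diff_distrib)
  qed
  have af: "integrable (Iv L) (\<lambda>x. \<bar>f x\<bar>)" using f by simp
  have ie: "integrable (Iv L) (\<lambda>x. e' x * \<bar>prim (Iv L) f x\<bar>)"
    by (rule integrable_mult_bounded(1)[OF e', where k="\<integral>x. \<bar>f x\<bar> \<partial>Iv L"])
       (use abs_prim_le[OF f] in auto)
  have "(\<integral>x. e x * \<bar>prim (Iv L) f x\<bar> \<partial>Iv L) = (\<integral>x. e' x * \<bar>prim (Iv L) f x\<bar> \<partial>Iv L)"
    by (rule integral_cong_AE) (measurable, use ee' in eventually_elim, simp)
  also have "\<dots> \<le> (\<integral>x. prim (Iv L) (\<lambda>x. \<bar>f x\<bar>) x * e' x \<partial>Iv L)"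
  proof (rule integral_mono[OF ie])
    show "integrable (Iv L) (\<lambda>x. prim (Iv L) (\<lambda>x. \<bar>f x\<bar>) x * e' x)"
      using integrable_mult_prim[OF e' af, of 0] by (simp add: mult.commute)
    fix x
    have "\<bar>prim (Iv L) f x\<bar> \<le> prim (Iv L) (\<lambda>x. \<bar>f x\<bar>) x"
      unfolding prim_def
      using integral_abs_bound[of "Iv L" "\<lambda>y. indicator {..<x} y * f y"] by (simp add: abs_mult)
    moreover have "0 \<le> e' x" by (simp add: e'_def e_def)
    ultimately show "e' x * \<bar>prim (Iv L) f x\<bar> \<le> prim (Iv L) (\<lambda>x. \<bar>f x\<bar>) x * e' x"
      by (simp add: mult.commute mult_left_mono)
  qed
  also have "\<dots> = (\<integral>x. \<bar>f x\<bar> \<partial>Iv L) * (\<integral>x. e' x \<partial>Iv L) - (\<integral>x. \<bar>f x\<bar> * prim (Iv L) e' x \<partial>Iv L)"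
    using prim_integral_by_parts[OF af e'] by simp
  also have "(\<integral>x. e' x \<partial>Iv L) = \<nu> / m * (1 - e L)"
    using pe[of L] L by (simp add: prim_total)
  also have "(\<integral>x. \<bar>f x\<bar> * prim (Iv L) e' x \<partial>Iv L) = (\<integral>x. \<nu> / m * \<bar>f x\<bar> - \<nu> / m * (e' x * \<bar>f x\<bar>) \<partial>Iv L)"
    by (rule integral_cong_AE) (measurable, use AE_Iv_in in eventually_elim,
        auto simp: pe e'_def algebra_simps)
  also have "\<dots> = \<nu> / m * (\<integral>x. \<bar>f x\<bar> \<partial>Iv L) - \<nu> / m * (\<integral>x. e' x * \<bar>f x\<bar> \<partial>Iv L)"
    using af integrable_mult_bounded(2)[OF af _ e'_bound] by simp
  also have "(\<integral>x. e' x * \<bar>f x\<bar> \<partial>Iv L) = (\<integral>x. e x * \<bar>f x\<bar> \<partial>Iv L)"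
    by (rule integral_cong_AE) (measurable, use ee' in eventually_elim, simp)
  also have "(\<integral>x. \<bar>f x\<bar> \<partial>Iv L) * (\<nu> / m * (1 - e L))
      - (\<nu> / m * (\<integral>x. \<bar>f x\<bar> \<partial>Iv L) - \<nu> / m * (\<integral>x. e x * \<bar>f x\<bar> \<partial>Iv L))
    = \<nu> / m * (\<integral>x. e x * \<bar>f x\<bar> \<partial>Iv L) - \<nu> / m * e L * (\<integral>x. \<bar>f x\<bar> \<partial>Iv L)"
    by (simp add: algebra_simps)
  also have "\<dots> \<le> \<nu> / m * (\<integral>x. e x * \<bar>f x\<bar> \<partial>Iv L)"
    using \<nu> m by (simp add: e_def)
  finally show ?thesis by (simp add: e_def)
qed

lemma young_mult_le:
  fixes a b \<theta> :: real
  assumes "0 < \<theta>"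
  shows "a * b \<le> \<theta> * a\<^sup>2 + b\<^sup>2 / (4 * \<theta>)"
proof -
  have "0 \<le> (2 * \<theta> * a - b)\<^sup>2 / (4 * \<theta>)" using assms by simp
  also have "\<dots> = \<theta> * a\<^sup>2 + b\<^sup>2 / (4 * \<theta>) - a * b"
    using assms by (simp add: power2_eq_square field_simps)
  finally show ?thesis by simp
qed

lemma integral_young:
  fixes f g :: "'a \<Rightarrow> real"
  assumes "sqint M f" "sqint M g" "0 < \<theta>"
  shows "(\<integral>x. f x * g x \<partial>M) \<le> \<theta> * (\<integral>x. (f x)\<^sup>2 \<partial>M) + (\<integral>x. (g x)\<^sup>2 \<partial>M) / (4 * \<theta>)"
proof -
  have "(\<integral>x. f x * g x \<partial>M) \<le> (\<integral>x. \<theta> * (f x)\<^sup>2 + (g x)\<^sup>2 / (4 * \<theta>) \<partial>M)"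
    using assms by (intro integral_mono sqint_integrable_mult young_mult_le)
      (auto intro!: Bochner_Integration.integrable_add simp: sqint_integrable_sq)
  also have "\<dots> = \<theta> * (\<integral>x. (f x)\<^sup>2 \<partial>M) + (\<integral>x. (g x)\<^sup>2 \<partial>M) / (4 * \<theta>)"
    using assms by (simp add: sqint_integrable_sq)
  finally show ?thesis .
qed

text \<open>The constant 8 is the 4 of Young's inequality times the 2 in the squared norm \<nu> / (2
  m) of the exponential.\<close>

lemma integral_young_exp:
  assumes \<nu>: "0 < \<nu>" and m: "0 < m" and L: "0 \<le> L" and f: "sqint (Iv L) f" and \<theta>: "0 < \<theta>"
  shows "\<bar>b\<bar> * (\<integral>x. exp (- m * x / \<nu>) * \<bar>f x\<bar> \<partial>Iv L)
    \<le> \<theta> * (\<integral>x. (f x)\<^sup>2 \<partial>Iv L) + b\<^sup>2 * \<nu> / (8 * \<theta> * m)"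
proof -
  let ?e = "\<lambda>x. indicator {0..} x * exp (- m * x / \<nu>)"
  have eb: "\<bar>?e x\<bar> \<le> 1" for x
    using \<nu> m by (auto simp: indicator_def)
  have se: "sqint (Iv L) ?e"
    by (rule Iv.sqint_bounded[OF _ eb]) simp
  have [measurable]: "f \<in> borel_measurable borel" using sqint_measurable[OF f] by simp
  have "\<bar>b\<bar> * (\<integral>x. exp (- m * x / \<nu>) * \<bar>f x\<bar> \<partial>Iv L) = (\<integral>x. \<bar>f x\<bar> * (\<bar>b\<bar> * ?e x) \<partial>Iv L)"
    by (subst Bochner_Integration.integral_mult_right_zero[symmetric], rule integral_cong_AE)
       (measurable, use AE_Iv_in in eventually_elim, auto)
  also have "\<dots> \<le> \<theta> * (\<integral>x. \<bar>f x\<bar>\<^sup>2 \<partial>Iv L) + (\<integral>x. (\<bar>b\<bar> * ?e x)\<^sup>2 \<partial>Iv L) / (4 * \<theta>)"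
    by (rule integral_young) (use f se \<theta> in \<open>auto intro!: sqint_abs sqint_cmult\<close>)
  also have "(\<integral>x. (\<bar>b\<bar> * ?e x)\<^sup>2 \<partial>Iv L) = b\<^sup>2 * (\<integral>x. (exp (- m * x / \<nu>))\<^sup>2 \<partial>Iv L)"
    by (subst Bochner_Integration.integral_mult_right_zero[symmetric], rule integral_cong_AE)
       (measurable, use AE_Iv_in in eventually_elim, auto simp: power_mult_distrib)
  also have "\<dots> / (4 * \<theta>) \<le> b\<^sup>2 * (\<nu> / (2 * m)) / (4 * \<theta>)"
    using \<theta> integral_exp_sq_le[OF \<nu> m L] by (intro divide_right_mono mult_left_mono) auto
  finally show ?thesis by (simp add: mult_ac)
qed

lemma sqint_prim:
  assumes "integrable (Iv a) f"
  shows "sqint (Iv a) (prim (Iv a) f)"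
  by (rule Iv.sqint_bounded[OF _ abs_prim_le[OF assms]])
     (use borel_measurable_integrable[OF assms] in simp)

lemma sqint_Iv_integrable: "sqint (Iv a) f \<Longrightarrow> integrable (Iv a) f"
  by (rule Iv.sqint_integrable)

text \<open>The chain rule for a square, as integration by parts of a function with itself, where
  its derivative z is cut off at x: the value at the right end point is then the value at x.\<close>

lemma square_prim:
  assumes z: "sqint (Iv a) z"
  shows "(d + prim (Iv a) z x)\<^sup>2 = d\<^sup>2 + 2 * prim (Iv a) (\<lambda>y. z y * (d + prim (Iv a) z y)) x"
proof -
  define k where "k y = indicator {..<x} y * z y" for y
  have k: "sqint (Iv a) k"
    unfolding k_def by (rule sqint_mult_bounded[OF z, where k=1]) (auto simp: indicator_def)
  note ik = sqint_Iv_integrable[OF k]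
  define f where "f y = d + prim (Iv a) k y" for y
  have fk: "(\<integral>y. k y * f y \<partial>Iv a) + (\<integral>y. f y * k y \<partial>Iv a) = (d + integral\<^sup>L (Iv a) k)\<^sup>2 - d\<^sup>2"
    using integral_by_parts_Iv[OF ik ik f_def f_def] by (simp add: power2_eq_square)
  have Ik: "integral\<^sup>L (Iv a) k = prim (Iv a) z x" by (simp add: prim_def k_def[abs_def])
  have fw: "k y * f y = indicator {..<x} y * (z y * (d + prim (Iv a) z y))" for y
  proof (cases "y < x")
    case True
    have "prim (Iv a) k y = prim (Iv a) z y"
      unfolding prim_def k_def using True
      by (intro Bochner_Integration.integral_cong) (auto simp: indicator_def)
    then show ?thesis using True by (simp add: k_def f_def)
  qed (simp add: k_def)
  show ?thesis
    using fk unfolding Ik by (simp add: mult.commute[of "f _"] fw prim_def)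
qed

section \<open>Energy estimates for a time slice of the remainder\<close>

definition layer :: "real \<Rightarrow> real \<Rightarrow> real \<Rightarrow> real \<Rightarrow> real" where
  "layer L m \<nu> x = (exp (- m * x / \<nu>) - exp (- m * L / \<nu>)) / (1 - exp (- m * L / \<nu>))"

definition layer' :: "real \<Rightarrow> real \<Rightarrow> real \<Rightarrow> real \<Rightarrow> real" where
  "layer' L m \<nu> x = - (m / \<nu>) * exp (- m * x / \<nu>) / (1 - exp (- m * L / \<nu>))"

lemma layer_measurable [measurable]:
  "layer L m \<nu> \<in> borel_measurable borel" "layer' L m \<nu> \<in> borel_measurable borel"
  unfolding layer_def[abs_def] layer'_def[abs_def] by measurable

context
  fixes L m \<nu> :: real
  assumes L: "0 < L" and m: "0 < m" and \<nu>: "0 < \<nu>"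
begin

lemma layer_denom_pos: "0 < 1 - exp (- m * L / \<nu>)"
proof -
  have "- m * L < 0" using mult_pos_pos[OF m L] by simp
  then have "- m * L / \<nu> < 0" using \<nu> by (rule divide_neg_pos)
  then show ?thesis by (metis diff_gt_0_iff_gt exp_less_one_iff)
qed

lemma has_derivative_exp_layer:
  "((\<lambda>x. exp (- m * x / \<nu>)) has_real_derivative - (m / \<nu>) * exp (- m * x / \<nu>)) (at x)"
  using \<nu> by (auto intro!: derivative_eq_intros)

lemma layer_0: "layer L m \<nu> 0 = 1"
proof -
  have "1 - exp (- m * L / \<nu>) \<noteq> 0" using layer_denom_pos by linarith
  then show ?thesis
    by (simp only: layer_def mult_zero_right div_0 exp_zero, intro divide_self)
qed

lemma layer_L: "layer L m \<nu> L = 0"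
  by (simp add: layer_def)

lemma layer_bounds:
  assumes "0 \<le> x" "x \<le> L"
  shows "0 \<le> layer L m \<nu> x" "layer L m \<nu> x \<le> exp (- m * x / \<nu>)"
proof -
  let ?e = "exp (- m * x / \<nu>)" and ?q = "exp (- m * L / \<nu>)"
  have "?q \<le> ?e" using assms m \<nu> by (simp add: divide_right_mono)
  then show "0 \<le> layer L m \<nu> x" using layer_denom_pos by (simp add: layer_def)
  have "?e \<le> 1" using assms m \<nu> by simp
  then have "?e * ?q \<le> ?q" by simp
  then have "?e - ?q \<le> ?e * (1 - ?q)" by (simp add: right_diff_distrib)
  then show "layer L m \<nu> x \<le> ?e"
    using layer_denom_pos by (simp add: layer_def divide_le_eq)
qed

lemma has_derivative_layer: "(layer L m \<nu> has_real_derivative layer' L m \<nu> x) (at x)"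
  unfolding layer_def[abs_def] layer'_def
  using DERIV_cdivide[OF DERIV_diff[OF has_derivative_exp_layer DERIV_const]] by simp

lemma has_derivative_layer': "(layer' L m \<nu> has_real_derivative - (m / \<nu>) * layer' L m \<nu> x) (at x)"
  unfolding layer'_def[abs_def]
  using DERIV_cdivide[OF DERIV_cmult[OF has_derivative_exp_layer, of "- (m / \<nu>)"],
    of "1 - exp (- m * L / \<nu>)"] by (simp add: mult.assoc)

lemma continuous_layer': "continuous_on UNIV (layer' L m \<nu>)"
  using has_derivative_layer' by (auto intro!: continuous_at_imp_continuous_on DERIV_isCont)

text \<open>By the steady equation \<open>- (m / \<nu>) * layer' L m \<nu> x\<close> is the second
  derivative. The identities stop at [0, L], since a primitive over (0, L) is constant
  beyond.\<close>

lemma layer_eq_prim: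
  assumes "0 \<le> x" "x \<le> L"
  shows "layer L m \<nu> x = 1 + prim (Iv L) (layer' L m \<nu>) x"
    "layer' L m \<nu> x = layer' L m \<nu> 0 + prim (Iv L) (\<lambda>x. - (m / \<nu>) * layer' L m \<nu> x) x"
proof -
  show "layer L m \<nu> x = 1 + prim (Iv L) (layer' L m \<nu>) x"
    by (subst prim_FTC[OF has_derivative_layer continuous_layer' assms]) (simp add: layer_0)
  show "layer' L m \<nu> x = layer' L m \<nu> 0 + prim (Iv L) (\<lambda>x. - (m / \<nu>) * layer' L m \<nu> x) x"
    by (subst prim_FTC[OF has_derivative_layer' _ assms])
       (use \<nu> in \<open>auto intro!: continuous_intros continuous_layer'\<close>)
qed

text \<open>For \<nu> \<le> 1 the denominator is at least its value at \<nu> = 1, which makes the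
  constant independent of \<nu>.\<close>

lemma abs_layer'_le:
  assumes "\<nu> \<le> 1"
  shows "\<nu> * \<bar>layer' L m \<nu> x\<bar> \<le> m / (1 - exp (- m * L)) * exp (- m * x / \<nu>)"
proof -
  have "m * L \<le> m * L / \<nu>" using L m \<nu> assms by (simp add: field_simps)
  then have "exp (- m * L / \<nu>) \<le> exp (- m * L)" by simp
  moreover have "exp (- m * L) < 1" using L m by simp
  ultimately have "1 / (1 - exp (- m * L / \<nu>)) \<le> 1 / (1 - exp (- m * L))"
    using layer_denom_pos by (intro divide_left_mono) auto
  then have "m * exp (- m * x / \<nu>) * (1 / (1 - exp (- m * L / \<nu>)))
      \<le> m * exp (- m * x / \<nu>) * (1 / (1 - exp (- m * L)))"
    using m by (intro mult_left_mono) auto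
  moreover have "\<nu> * \<bar>layer' L m \<nu> x\<bar> = m * exp (- m * x / \<nu>) * (1 / (1 - exp (- m * L / \<nu>)))"
    using \<nu> m layer_denom_pos by (simp add: layer'_def abs_mult)
  ultimately show ?thesis by simp
qed

lemma sqint_exp_layer: "sqint (Iv L) (\<lambda>x. exp (- m * x / \<nu>))"
proof -
  let ?e = "\<lambda>x. indicator {0..} x * exp (- m * x / \<nu>)"
  have eb: "\<bar>?e x\<bar> \<le> 1" for x
    using \<nu> m by (auto simp: indicator_def)
  have "sqint (Iv L) ?e"
    by (rule Iv.sqint_bounded[OF _ eb]) simp
  then show ?thesis
    by (rule sqint_cong_AE) (measurable, use AE_Iv_in in eventually_elim, auto)
qed

lemma sqint_layer: "sqint (Iv L) (layer L m \<nu>)" "sqint (Iv L) (layer' L m \<nu>)"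
proof -
  show "sqint (Iv L) (layer L m \<nu>)" "sqint (Iv L) (layer' L m \<nu>)"
    unfolding layer_def[abs_def] layer'_def[abs_def]
    by (intro sqint_divide sqint_diff sqint_exp_layer Iv.sqint_const sqint_cmult)+
qed

end

text \<open>A time slice of the equations for the remainder, with \<open>p = \<lambda>\<psi>\<close> and \<open>c = 1/\<lambda>\<close>; \<open>wt\<close>, \<open>pt\<close> are
  the time derivatives, \<open>z\<close>, \<open>y\<close> the second space derivatives of \<open>w\<close>, \<open>p\<close>, and \<open>d\<close>, \<open>e\<close> the values of
  \<open>w\<^sub>x\<close>, \<open>p\<^sub>x\<close> at \<open>x = 0\<close>.\<close>

locale remainder_slice =
  fixes L U c m \<nu> b d e :: real and z y r w1t p1t w1 w p1 p wt pt :: "real \<Rightarrow> real"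
  assumes L: "0 < L" and U: "0 < U" and c: "0 < c" and m: "0 < m" and \<nu>: "0 < \<nu>" "\<nu> \<le> 1"
    and sq: "sqint (Iv L) z" "sqint (Iv L) y" "sqint (Iv L) r" "sqint (Iv L) w1t" "sqint (Iv L) p1t"
    and w1: "\<And>x. w1 x = d + prim (Iv L) z x" and w: "\<And>x. w x = prim (Iv L) w1 x"
    and p1: "\<And>x. p1 x = e + prim (Iv L) y x" and p: "\<And>x. p x = prim (Iv L) p1 x"
    and wt: "\<And>x. wt x = prim (Iv L) w1t x" and pt: "\<And>x. pt x = prim (Iv L) p1t x"
    and w_L: "integral\<^sup>L (Iv L) w1 = 0" and wt_L: "integral\<^sup>L (Iv L) w1t = 0"
    and PDE1: "AE x in Iv L. wt x = \<nu> * z x - U * w1 x - c * p1 x + \<nu> * r x - b * layer L m \<nu> x"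
    and PDE2: "AE x in Iv L. pt x = - U * p1 x - c * w1 x + c / U * b * layer L m \<nu> x"
begin

abbreviation I :: "(real \<Rightarrow> real) \<Rightarrow> real" where "I f \<equiv> integral\<^sup>L (Iv L) f"
abbreviation E :: "real \<Rightarrow> real" where "E \<equiv> layer L m \<nu>"
abbreviation E1 :: "real \<Rightarrow> real" where "E1 \<equiv> layer' L m \<nu>"

definition v :: "real \<Rightarrow> real" where "v x = w x + \<nu> / c * p1 x"
definition v1 :: "real \<Rightarrow> real" where "v1 x = w1 x + \<nu> / c * y x"
definition vt :: "real \<Rightarrow> real" where "vt x = wt x + \<nu> / c * p1t x"

lemma sqE: "sqint (Iv L) E" "sqint (Iv L) E1"
  using sqint_layer[OF L m \<nu>(1)] .

lemma sq': "sqint (Iv L) w1" "sqint (Iv L) w" "sqint (Iv L) p1" "sqint (Iv L) p"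
    "sqint (Iv L) wt" "sqint (Iv L) pt" "sqint (Iv L) v" "sqint (Iv L) v1" "sqint (Iv L) vt"
proof -
  have eq: "w1 = (\<lambda>x. d + prim (Iv L) z x)" "w = prim (Iv L) w1" "p1 = (\<lambda>x. e + prim (Iv L) y x)"
    "p = prim (Iv L) p1" "wt = prim (Iv L) w1t" "pt = prim (Iv L) p1t"
    using w1 w p1 p wt pt by auto
  show 1: "sqint (Iv L) w1" "sqint (Iv L) p1"
    unfolding eq(1,3) by (intro sqint_add Iv.sqint_const sqint_prim sqint_Iv_integrable sq)+
  show 2: "sqint (Iv L) w" "sqint (Iv L) p" "sqint (Iv L) wt" "sqint (Iv L) pt"
    unfolding eq(2,4,5,6) by (intro sqint_prim sqint_Iv_integrable sq 1)+
  show "sqint (Iv L) v" "sqint (Iv L) v1" "sqint (Iv L) vt"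
    unfolding v_def[abs_def] v1_def[abs_def] vt_def[abs_def]
    by (intro sqint_add sqint_cmult sq 1 2)+
qed

lemmas sqs = sq sq' sqE

lemma int_mult:
  "sqint (Iv L) f \<Longrightarrow> sqint (Iv L) g \<Longrightarrow> integrable (Iv L) (\<lambda>x. f x * g x)"
  by (rule sqint_integrable_mult)

lemma meas [measurable]:
  "w1 \<in> borel_measurable borel" "w \<in> borel_measurable borel" "p1 \<in> borel_measurable borel"
  "p \<in> borel_measurable borel" "wt \<in> borel_measurable borel" "pt \<in> borel_measurable borel"
  "v \<in> borel_measurable borel" "v1 \<in> borel_measurable borel" "vt \<in> borel_measurable borel"
  "z \<in> borel_measurable borel" "y \<in> borel_measurable borel" "r \<in> borel_measurable borel"
  "w1t \<in> borel_measurable borel" "p1t \<in> borel_measurable borel"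
  using sqs[THEN sqint_measurable] by simp_all

text \<open>Only one boundary term survives: w and wt vanish at both ends, but p only at x = 0, and
  \<open>I p1\<close> is its value at the outflow end x = L.\<close>

lemma by_parts:
  "I (\<lambda>x. w x * z x) = - I (\<lambda>x. w1 x * w1 x)"
  "I (\<lambda>x. w x * w1 x) = 0"
  "I (\<lambda>x. w x * p1 x) + I (\<lambda>x. p x * w1 x) = 0"
  "I (\<lambda>x. p x * p1 x) = (I p1)\<^sup>2 / 2"
  "I (\<lambda>x. wt x * z x) = - I (\<lambda>x. w1 x * w1t x)"
proof -
  note i = sqs[THEN sqint_Iv_integrable]
  have w0: "w x = 0 + prim (Iv L) w1 x" "p x = 0 + prim (Iv L) p1 x" "wt x = 0 + prim (Iv L) w1t x" for x
    using w p wt by auto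
  show "I (\<lambda>x. w x * z x) = - I (\<lambda>x. w1 x * w1 x)"
    using integral_by_parts_Iv[OF i(6) i(1) w0(1) w1] w_L by simp
  show "I (\<lambda>x. w x * w1 x) = 0"
    using integral_by_parts_Iv[OF i(6) i(6) w0(1) w0(1)] w_L by (simp add: mult.commute)
  show "I (\<lambda>x. w x * p1 x) + I (\<lambda>x. p x * w1 x) = 0"
    using integral_by_parts_Iv[OF i(6) i(8) w0(1) w0(2)] w_L by (simp add: mult.commute)
  show "I (\<lambda>x. p x * p1 x) = (I p1)\<^sup>2 / 2"
    using integral_by_parts_Iv[OF i(8) i(8) w0(2) w0(2)]
    by (simp add: mult.commute power2_eq_square)
  show "I (\<lambda>x. wt x * z x) = - I (\<lambda>x. w1 x * w1t x)"
    using integral_by_parts_Iv[OF i(4) i(1) w0(3) w1] wt_L by (simp add: mult.commute)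
qed

text \<open>The square of v at the outflow end is dropped. At the inflow end w vanishes, so v
  reduces there to \<open>\<nu> / c * e\<close>; this trace has to be absorbed later.\<close>

lemma v_by_parts: "I (\<lambda>x. v x * v1 x) \<ge> - (\<nu> / c * e)\<^sup>2 / 2"
proof -
  note i = sqs[THEN sqint_Iv_integrable]
  have v: "v x = \<nu> / c * e + prim (Iv L) v1 x" for x
    unfolding v_def v1_def
    by (subst prim_add[OF i(6)], simp add: i, subst prim_cmult, simp add: w[symmetric] p1 distrib_left)
  have "I (\<lambda>x. v x * v1 x) = ((\<nu> / c * e + I v1)\<^sup>2 - (\<nu> / c * e)\<^sup>2) / 2"
    using integral_by_parts_Iv[OF i(13) i(13) v v] by (simp add: mult.commute power2_eq_square)
  then show ?thesis
    using zero_le_power2[of "\<nu> / c * e + I v1"] by (simp add: diff_divide_distrib)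
qed

text \<open>Both sides of the second equation are primitives up to a constant. Equality of the
  integrands is the equation differentiated in x; equality of the constants is the equation at x =
  0, where pt = 0 and the profile is 1. The latter ties the traces d and e together.\<close>

lemma diff_PDE2:
  "U * e + c * d = c / U * b"
  "AE x in Iv L. p1t x = - U * y x - c * z x + c / U * b * E1 x"
proof -
  note i = sqs[THEN sqint_Iv_integrable]
  let ?g = "\<lambda>x. - U * y x - c * z x + c / U * b * E1 x"
  have g: "integrable (Iv L) ?g" using i by simp
  have pg: "prim (Iv L) ?g x = - U * prim (Iv L) y x - c * prim (Iv L) z x + c / U * b * prim (Iv L) E1 x" for x
    by (subst prim_add prim_diff, simp add: i, simp add: i)+ (simp only: prim_cmult)
  have "AE x in Iv L. prim (Iv L) p1t x = (c / U * b - U * e - c * d) + prim (Iv L) ?g x"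
    using PDE2 AE_Iv_in
  proof eventually_elim
    case (elim x)
    show ?case
      using elim unfolding pg by (simp add: pt[symmetric] p1 w1 layer_eq_prim(1)[OF L m \<nu>(1)] algebra_simps)
  qed
  from AE_eq_if_prim_eq[OF L i(5) g this]
  show "U * e + c * d = c / U * b" "AE x in Iv L. p1t x = ?g x" by auto
qed

text \<open>Adding \<nu> / c times the differentiated second equation to the first removes \<nu> z,
  and the two forcing terms merge.\<close>

lemma vt_eq: "AE x in Iv L. vt x = - U * v1 x - c * p1 x + \<nu> * r x + b * (\<nu> / U * E1 x - E x)"
  using PDE1 diff_PDE2(2)
proof eventually_elim
  case (elim x)
  show ?case unfolding vt_def v1_def elim using c U by (simp add: field_simps)
qed

text \<open>Testing the two equations with w and p. Since w vanishes at both ends, the coupling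
  terms cancel in the sum; the part for p alone is kept because it recurs in the energy of
  v.\<close>

lemma energy1:
  "I (\<lambda>x. w x * wt x) + I (\<lambda>x. p x * pt x)
    = - \<nu> * I (\<lambda>x. w1 x * w1 x) - U / 2 * (I p1)\<^sup>2 + \<nu> * I (\<lambda>x. w x * r x)
      - b * I (\<lambda>x. w x * E x) + c / U * b * I (\<lambda>x. p x * E x)"
  (is ?A)
  "I (\<lambda>x. p x * pt x) = - U / 2 * (I p1)\<^sup>2 - c * I (\<lambda>x. p x * w1 x) + c / U * b * I (\<lambda>x. p x * E x)"
  (is ?B)
proof -
  have "I (\<lambda>x. w x * wt x) = I (\<lambda>x. \<nu> * (w x * z x) - U * (w x * w1 x) - c * (w x * p1 x)
      + \<nu> * (w x * r x) - b * (w x * E x))"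
    by (rule integral_cong_AE) (measurable, use PDE1 in eventually_elim, simp only:, simp add: algebra_simps)
  also have "\<dots> = \<nu> * I (\<lambda>x. w x * z x) - U * I (\<lambda>x. w x * w1 x) - c * I (\<lambda>x. w x * p1 x)
      + \<nu> * I (\<lambda>x. w x * r x) - b * I (\<lambda>x. w x * E x)"
    using int_mult[OF sqs(7)] sqs by simp
  finally have 1: "I (\<lambda>x. w x * wt x) = \<dots>" .
  have "I (\<lambda>x. p x * pt x) = I (\<lambda>x. - U * (p x * p1 x) - c * (p x * w1 x) + c / U * b * (p x * E x))"
    by (rule integral_cong_AE) (measurable, use PDE2 in eventually_elim, simp only:, simp add: algebra_simps)
  also have "\<dots> = - U * I (\<lambda>x. p x * p1 x) - c * I (\<lambda>x. p x * w1 x) + c / U * b * I (\<lambda>x. p x * E x)"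
    using int_mult[OF sqs(9)] sqs by simp
  finally show ?B by (simp add: by_parts)
  have "c * I (\<lambda>x. w x * p1 x) + c * I (\<lambda>x. p x * w1 x) = 0"
    using by_parts(3) by (simp flip: distrib_left)
  then show ?A unfolding 1 \<open>?B\<close> by (simp add: by_parts(1,2))
qed

text \<open>Testing the first equation with z = w_xx: as wt vanishes at both ends, the left-hand
  side becomes the energy of w_x, and the viscous term gives the dissipation of w_xx.\<close>

lemma energy2:
  "I (\<lambda>x. w1 x * w1t x) = - \<nu> * I (\<lambda>x. z x * z x) + U * I (\<lambda>x. z x * w1 x) + c * I (\<lambda>x. z x * p1 x)
    - \<nu> * I (\<lambda>x. z x * r x) + b * I (\<lambda>x. z x * E x)"
proof -
  have "I (\<lambda>x. wt x * z x) = I (\<lambda>x. \<nu> * (z x * z x) - U * (z x * w1 x) - c * (z x * p1 x)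
      + \<nu> * (z x * r x) - b * (z x * E x))"
    by (rule integral_cong_AE) (measurable, use PDE1 in eventually_elim, simp only:, simp add: algebra_simps)
  also have "\<dots> = \<nu> * I (\<lambda>x. z x * z x) - U * I (\<lambda>x. z x * w1 x) - c * I (\<lambda>x. z x * p1 x)
      + \<nu> * I (\<lambda>x. z x * r x) - b * I (\<lambda>x. z x * E x)"
    using int_mult[OF sqs(1)] sqs by simp
  finally show ?thesis using by_parts(5) by simp
qed

text \<open>Differentiating the second equation in \<open>x\<close> turns \<open>\<nu> w\<^sub>x\<^sub>x\<close> into \<open>- (\<nu>/c) (p\<^sub>x\<^sub>t + U p\<^sub>x\<^sub>x)\<close> up to the layer term,
  so \<open>v\<close> is transported without diffusion while \<open>- c v p\<^sub>x\<close> supplies the dissipation of \<open>p\<^sub>x\<close>.\<close>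

lemma energy3:
  "I (\<lambda>x. v x * vt x) + I (\<lambda>x. p x * pt x)
    \<le> U / 2 * (\<nu> / c * e)\<^sup>2 - \<nu> * I (\<lambda>x. p1 x * p1 x) - U / 2 * (I p1)\<^sup>2 + \<nu> * I (\<lambda>x. v x * r x)
      + b * I (\<lambda>x. v x * (\<nu> / U * E1 x - E x)) + c / U * b * I (\<lambda>x. p x * E x)"
proof -
  let ?F = "\<lambda>x. \<nu> / U * E1 x - E x"
  have F: "sqint (Iv L) ?F" by (intro sqint_diff sqint_cmult sqs)
  have "I (\<lambda>x. v x * vt x) = I (\<lambda>x. - U * (v x * v1 x) - c * (v x * p1 x) + \<nu> * (v x * r x) + b * (v x * ?F x))"
    by (rule integral_cong_AE) (measurable, use vt_eq in eventually_elim, simp only:, simp add: algebra_simps)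
  also have "\<dots> = - U * I (\<lambda>x. v x * v1 x) - c * I (\<lambda>x. v x * p1 x) + \<nu> * I (\<lambda>x. v x * r x)
      + b * I (\<lambda>x. v x * ?F x)"
    using int_mult[OF sqs(12)] sqs F by simp
  also have "I (\<lambda>x. v x * p1 x) = I (\<lambda>x. w x * p1 x + \<nu> / c * (p1 x * p1 x))"
    by (rule Bochner_Integration.integral_cong) (auto simp: v_def algebra_simps)
  also have "\<dots> = I (\<lambda>x. w x * p1 x) + \<nu> / c * I (\<lambda>x. p1 x * p1 x)"
    using int_mult sqs by simp
  finally have 1: "I (\<lambda>x. v x * vt x) = - U * I (\<lambda>x. v x * v1 x) - c * I (\<lambda>x. w x * p1 x)
      - \<nu> * I (\<lambda>x. p1 x * p1 x) + \<nu> * I (\<lambda>x. v x * r x) + b * I (\<lambda>x. v x * ?F x)"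
    using c by (simp add: algebra_simps)
  have "c * I (\<lambda>x. w x * p1 x) + c * I (\<lambda>x. p x * w1 x) = 0"
    using by_parts(3) by (simp flip: distrib_left)
  moreover have "- U * I (\<lambda>x. v x * v1 x) \<le> U / 2 * (\<nu> / c * e)\<^sup>2"
    using mult_left_mono[OF v_by_parts, of U] U by simp
  ultimately show ?thesis unfolding 1 energy1(2) by simp
qed

abbreviation exl :: "real \<Rightarrow> real" where "exl \<equiv> \<lambda>x. exp (- m * x / \<nu>)"

lemma abs_integral_exl_le:
  assumes f: "sqint (Iv L) f" and k: "k \<in> borel_measurable borel"
    and le: "\<And>x. 0 < x \<Longrightarrow> x < L \<Longrightarrow> \<bar>k x\<bar> \<le> g * exl x"
  shows "\<bar>I (\<lambda>x. f x * k x)\<bar> \<le> g * I (\<lambda>x. exl x * \<bar>f x\<bar>)"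
proof -
  have [measurable]: "f \<in> borel_measurable borel" using sqint_measurable[OF f] by simp
  note e = sqint_exp_layer[OF L m \<nu>(1)]
  have ie: "integrable (Iv L) (\<lambda>x. g * (exl x * \<bar>f x\<bar>))"
    using int_mult[OF e sqint_abs[OF f]] by simp
  have AE: "AE x in Iv L. \<bar>f x * k x\<bar> \<le> g * (exl x * \<bar>f x\<bar>)"
    using AE_Iv_in
  proof eventually_elim
    case (elim x)
    then show ?case using mult_left_mono[OF le[of x], of "\<bar>f x\<bar>"] by (simp add: abs_mult mult_ac)
  qed
  have "integrable (Iv L) (\<lambda>x. \<bar>f x * k x\<bar>)"
    by (rule Bochner_Integration.integrable_bound[OF ie])
       (use k in measurable, use AE in eventually_elim, auto)
  then have "I (\<lambda>x. \<bar>f x * k x\<bar>) \<le> I (\<lambda>x. g * (exl x * \<bar>f x\<bar>))"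
    by (rule integral_mono_AE[OF _ ie AE])
  then have "I (\<lambda>x. \<bar>f x * k x\<bar>) \<le> g * I (\<lambda>x. exl x * \<bar>f x\<bar>)" by simp
  then show ?thesis
    using integral_abs_bound[of "Iv L" "\<lambda>x. f x * k x"] by linarith
qed

text \<open>The Hardy-type gain contributes the factor \<nu> / m, and Young's inequality is used
  with parameter \<theta> m, so that the first term is a multiple of the dissipation \<nu> ||f||^2
  and the second is of order \<nu>^2.\<close>

lemma young_exl_prim:
  assumes f: "sqint (Iv L) f" and "\<And>x. F x = prim (Iv L) f x" and \<theta>: "0 < \<theta>"
  shows "\<bar>b\<bar> * I (\<lambda>x. exl x * \<bar>F x\<bar>) \<le> \<theta> * (\<nu> * I (\<lambda>x. (f x)\<^sup>2)) + b\<^sup>2 * \<nu>\<^sup>2 / (8 * \<theta> * m ^ 3)"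
proof -
  have "\<bar>b\<bar> * I (\<lambda>x. exl x * \<bar>F x\<bar>) \<le> \<bar>b\<bar> * (\<nu> / m * I (\<lambda>x. exl x * \<bar>f x\<bar>))"
    unfolding assms(2)
    using integral_exp_prim_le[OF \<nu>(1) m less_imp_le[OF L] sqint_Iv_integrable[OF f]]
    by (intro mult_left_mono) auto
  also have "\<dots> = \<nu> / m * (\<bar>b\<bar> * I (\<lambda>x. exl x * \<bar>f x\<bar>))" by simp
  also have "\<dots> \<le> \<nu> / m * (\<theta> * m * I (\<lambda>x. (f x)\<^sup>2) + b\<^sup>2 * \<nu> / (8 * (\<theta> * m) * m))"
    using \<nu> m \<theta> by (intro mult_left_mono integral_young_exp f) (auto simp: L less_imp_le)
  also have "\<dots> = \<theta> * (\<nu> * I (\<lambda>x. (f x)\<^sup>2)) + b\<^sup>2 * \<nu>\<^sup>2 / (8 * \<theta> * m ^ 3)"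
    using m \<theta> by (simp add: field_simps power2_eq_square power3_eq_cube)
  finally show ?thesis .
qed

text \<open>Between 0 and x the square of w1 changes by at most twice the integral of |z w1|;
  averaging over x in (0, L) yields the trace.\<close>

lemma trace_w1: "L * d\<^sup>2 \<le> I (\<lambda>x. (w1 x)\<^sup>2) + 2 * L * I (\<lambda>x. \<bar>z x * w1 x\<bar>)"
proof -
  have zw: "integrable (Iv L) (\<lambda>x. z x * w1 x)" using int_mult sqs by blast
  have "d\<^sup>2 \<le> (w1 x)\<^sup>2 + 2 * I (\<lambda>x. \<bar>z x * w1 x\<bar>)" for x
    using square_prim[OF sq(1), of d x] abs_prim_le[OF zw, of x] by (simp flip: w1)
  then have "I (\<lambda>x. d\<^sup>2) \<le> I (\<lambda>x. (w1 x)\<^sup>2 + 2 * I (\<lambda>x. \<bar>z x * w1 x\<bar>))"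
    by (intro integral_mono Bochner_Integration.integrable_add sqint_integrable_sq sqs Iv.sqint_const) auto
  then show ?thesis
    using L sqint_integrable_sq[OF sqs(6)] by (simp add: measure_Iv mult_ac)
qed

text \<open>With X, Y, Z the squared norms of w_x, p_x, w_xx, the dissipations at hand are K \<nu>
  X, \<nu> Y and \<eta> \<nu>^3 Z. The constants distribute them: g bounds the forcing of v by the
  exponential; \<eta> and \<theta> make two of the claims on \<nu> Y equal to 1/8 each; K is twice
  the sum of the other claims on \<nu> X, because half of K \<nu> X is spent on the forcing of w.
  The parameter \<sigma> stays free for the estimate in time.\<close>

theorem slice_estimate:
  fixes g \<eta> K \<theta> \<sigma> :: real
  assumes \<sigma>: "0 < \<sigma>"
    and g: "g = 1 + m / (U * (1 - exp (- m * L)))"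
    and \<eta>: "\<eta> = 1 / (16 * c\<^sup>2)"
    and K: "K = 2 * (g + 1 / (U * L) + 4 / (\<eta> * U\<^sup>2) + 2 * U\<^sup>2 * \<eta>)"
    and \<theta>: "\<theta> = 1 / (8 * ((K + 1) * (c / U)))"
  shows "K * (I (\<lambda>x. w x * wt x) + I (\<lambda>x. p x * pt x)) + (I (\<lambda>x. v x * vt x) + I (\<lambda>x. p x * pt x))
      + \<eta> * \<nu>\<^sup>2 * I (\<lambda>x. w1 x * w1t x)
    \<le> (K / (4 * m ^ 3) + (K + 1) * (c / U) / (8 * \<theta> * m ^ 3) + g / (8 * m ^ 3) + g\<^sup>2 / (c\<^sup>2 * m) + 1 / U ^ 3 + \<eta> / m)
          * (\<nu>\<^sup>2 * b\<^sup>2)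
      + ((K + 1) / (4 * \<sigma>) + 2 * \<eta>) * (\<nu>\<^sup>2 * I (\<lambda>x. (r x)\<^sup>2))
      + \<sigma> * (K * I (\<lambda>x. (w x)\<^sup>2) + I (\<lambda>x. (v x)\<^sup>2))"
proof -
  define X where "X = I (\<lambda>x. (w1 x)\<^sup>2)"
  define Y where "Y = I (\<lambda>x. (p1 x)\<^sup>2)"
  define Z where "Z = I (\<lambda>x. (z x)\<^sup>2)"
  define R where "R = I (\<lambda>x. (r x)\<^sup>2)"
  define J where "J = I (\<lambda>x. exl x * \<bar>w x\<bar>)"
  have nonneg: "0 \<le> X" "0 \<le> Y" "0 \<le> Z" "0 \<le> R"
    by (auto simp: X_def Y_def Z_def R_def)
  have q: "0 < 1 - exp (- m * L)" using layer_denom_pos[OF L m, of 1] by simp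
  have g_pos: "1 \<le> g" using m U q by (simp add: g)
  have \<eta>_pos: "0 < \<eta>" using c by (simp add: \<eta>)
  have K_pos: "0 < K" using g_pos U L \<eta>_pos by (simp add: K add_pos_nonneg)
  have \<theta>_pos: "0 < \<theta>" using K_pos U c by (simp add: \<theta>)
  have bE: "\<bar>E x\<bar> \<le> 1 * exl x" if "0 < x" "x < L" for x
    using layer_bounds[OF L m \<nu>(1), of x] that by simp
  have bF: "\<bar>\<nu> / U * E1 x - E x\<bar> \<le> g * exl x" if "0 < x" "x < L" for x
  proof -
    have "\<bar>\<nu> / U * E1 x\<bar> = \<nu> * \<bar>E1 x\<bar> / U" using \<nu> U by (simp add: abs_mult)
    also have "\<dots> \<le> m / (1 - exp (- m * L)) * exl x / U"
      using abs_layer'_le[OF L m \<nu>, of x] U by (intro divide_right_mono) auto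
    finally have "\<bar>\<nu> / U * E1 x\<bar> \<le> m / (U * (1 - exp (- m * L))) * exl x"
      by (simp add: mult.commute)
    then show ?thesis
      using bE[OF that] abs_triangle_ineq4[of "\<nu> / U * E1 x" "E x"] unfolding g distrib_right by linarith
  qed
  have J_nonneg: "0 \<le> J" by (simp add: J_def)
  have bw: "- (b * I (\<lambda>x. w x * E x)) \<le> \<nu> * X / 2 + \<nu>\<^sup>2 * b\<^sup>2 / (4 * m ^ 3)"
  proof -
    have "- (b * I (\<lambda>x. w x * E x)) \<le> \<bar>b\<bar> * \<bar>I (\<lambda>x. w x * E x)\<bar>"
      by (metis abs_ge_self abs_minus_cancel abs_mult)
    also have "\<dots> \<le> \<bar>b\<bar> * J"
      using abs_integral_exl_le[OF sqs(7) _ bE] by (auto simp: J_def intro!: mult_left_mono)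
    also have "\<dots> \<le> 1/2 * (\<nu> * X) + b\<^sup>2 * \<nu>\<^sup>2 / (8 * (1/2) * m ^ 3)"
      unfolding J_def X_def by (rule young_exl_prim[OF sqs(6) w]) simp
    finally show ?thesis by (simp add: mult.commute)
  qed
  have bp: "b * I (\<lambda>x. p x * E x) \<le> \<theta> * (\<nu> * Y) + \<nu>\<^sup>2 * b\<^sup>2 / (8 * \<theta> * m ^ 3)"
  proof -
    have "b * I (\<lambda>x. p x * E x) \<le> \<bar>b\<bar> * \<bar>I (\<lambda>x. p x * E x)\<bar>"
      by (metis abs_ge_self abs_mult)
    also have "\<dots> \<le> \<bar>b\<bar> * I (\<lambda>x. exl x * \<bar>p x\<bar>)"
      using abs_integral_exl_le[OF sqs(9) _ bE] by (auto intro!: mult_left_mono)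
    also have "\<dots> \<le> \<theta> * (\<nu> * Y) + b\<^sup>2 * \<nu>\<^sup>2 / (8 * \<theta> * m ^ 3)"
      unfolding Y_def by (rule young_exl_prim[OF sqs(8) p \<theta>_pos])
    finally show ?thesis by (simp add: mult.commute)
  qed
  \<comment> \<open>v splits into w and (\<nu> / c) p_x. The part w vanishes at x = 0 and takes the
    Hardy-type gain; p_x does not, but it carries a factor \<nu> of its own, so plain Young with
    parameter c / (8 g) suffices and claims \<nu> Y / 8.\<close>
  have bv: "b * I (\<lambda>x. v x * (\<nu> / U * E1 x - E x))
      \<le> g * (\<nu> * X) + g * (\<nu>\<^sup>2 * b\<^sup>2) / (8 * m ^ 3) + \<nu> * Y / 8 + g\<^sup>2 / (c\<^sup>2 * m) * (\<nu>\<^sup>2 * b\<^sup>2)"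
  proof -
    let ?J' = "I (\<lambda>x. exl x * \<bar>p1 x\<bar>)"
    note e = sqint_exp_layer[OF L m \<nu>(1)]
    have "b * I (\<lambda>x. v x * (\<nu> / U * E1 x - E x)) \<le> \<bar>b\<bar> * \<bar>I (\<lambda>x. v x * (\<nu> / U * E1 x - E x))\<bar>"
      by (metis abs_ge_self abs_mult)
    also have "\<dots> \<le> \<bar>b\<bar> * (g * I (\<lambda>x. exl x * \<bar>v x\<bar>))"
      using abs_integral_exl_le[OF sqs(12) _ bF] by (auto intro!: mult_left_mono)
    also have "\<dots> \<le> \<bar>b\<bar> * (g * I (\<lambda>x. exl x * \<bar>w x\<bar> + \<nu> / c * (exl x * \<bar>p1 x\<bar>)))"
    proof (intro mult_left_mono integral_mono)
      show "integrable (Iv L) (\<lambda>x. exl x * \<bar>v x\<bar>)"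
        by (intro int_mult e sqint_abs sqs)
      show "integrable (Iv L) (\<lambda>x. exl x * \<bar>w x\<bar> + \<nu> / c * (exl x * \<bar>p1 x\<bar>))"
        by (intro Bochner_Integration.integrable_add integrable_mult_right int_mult e sqint_abs sqs)
      show "exl x * \<bar>v x\<bar> \<le> exl x * \<bar>w x\<bar> + \<nu> / c * (exl x * \<bar>p1 x\<bar>)" for x
      proof -
        have "\<bar>v x\<bar> \<le> \<bar>w x\<bar> + \<nu> / c * \<bar>p1 x\<bar>"
          using abs_triangle_ineq[of "w x" "\<nu> / c * p1 x"] \<nu> c by (simp add: v_def abs_mult)
        then have "exl x * \<bar>v x\<bar> \<le> exl x * (\<bar>w x\<bar> + \<nu> / c * \<bar>p1 x\<bar>)"
          by (intro mult_left_mono) auto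
        also have "\<dots> = exl x * \<bar>w x\<bar> + \<nu> / c * (exl x * \<bar>p1 x\<bar>)"
          by (simp add: distrib_left)
        finally show ?thesis .
      qed
    qed (use g_pos in auto)
    also have "I (\<lambda>x. exl x * \<bar>w x\<bar> + \<nu> / c * (exl x * \<bar>p1 x\<bar>)) = J + \<nu> / c * ?J'"
      using int_mult[OF e sqint_abs] sqs by (simp add: J_def)
    also have "\<bar>b\<bar> * (g * (J + \<nu> / c * ?J')) = g * (\<bar>b\<bar> * J) + g * (\<nu> / c) * (\<bar>b\<bar> * ?J')"
      by (simp add: algebra_simps)
    also have "\<dots> \<le> g * (1 * (\<nu> * X) + b\<^sup>2 * \<nu>\<^sup>2 / (8 * 1 * m ^ 3))
        + g * (\<nu> / c) * (c / (8 * g) * Y + b\<^sup>2 * \<nu> / (8 * (c / (8 * g)) * m))"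
    proof (intro add_mono mult_left_mono)
      show "\<bar>b\<bar> * J \<le> 1 * (\<nu> * X) + b\<^sup>2 * \<nu>\<^sup>2 / (8 * 1 * m ^ 3)"
        unfolding J_def X_def by (rule young_exl_prim[OF sqs(6) w]) simp
      show "\<bar>b\<bar> * ?J' \<le> c / (8 * g) * Y + b\<^sup>2 * \<nu> / (8 * (c / (8 * g)) * m)"
        unfolding Y_def by (rule integral_young_exp[OF \<nu>(1) m less_imp_le[OF L] sqs(8)])
          (use c g_pos in auto)
    qed (use g_pos \<nu> c in auto)
    also have "\<dots> = g * (\<nu> * X) + g * (\<nu>\<^sup>2 * b\<^sup>2) / (8 * m ^ 3) + \<nu> * Y / 8 + g\<^sup>2 / (c\<^sup>2 * m) * (\<nu>\<^sup>2 * b\<^sup>2)"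
      using g_pos c m by (simp add: field_simps power2_eq_square)
    finally show ?thesis .
  qed
  \<comment> \<open>The trace e of p_x is eliminated in favour of b and d by the equation at x =
    0.\<close>
  have e2: "U / 2 * (\<nu> / c * e)\<^sup>2 \<le> \<nu>\<^sup>2 / U * (b\<^sup>2 / U\<^sup>2 + d\<^sup>2)"
  proof -
    have e: "e / c = (b / U - d) / U"
      using diff_PDE2(1) U c by (simp add: field_simps)
    have "(b / U - d)\<^sup>2 \<le> 2 * ((b / U)\<^sup>2 + d\<^sup>2)"
      using zero_le_power2[of "b / U + d"] by (simp add: power2_sum power2_diff)
    then have "U / 2 * \<nu>\<^sup>2 / U\<^sup>2 * (b / U - d)\<^sup>2 \<le> U / 2 * \<nu>\<^sup>2 / U\<^sup>2 * (2 * ((b / U)\<^sup>2 + d\<^sup>2))"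
      using U by (intro mult_left_mono) auto
    moreover have "U / 2 * (\<nu> / c * e)\<^sup>2 = U / 2 * \<nu>\<^sup>2 / U\<^sup>2 * (b / U - d)\<^sup>2"
    proof -
      have "\<nu> / c * e = \<nu> * ((b / U - d) / U)" unfolding e[symmetric] by simp
      then show ?thesis by (simp add: power_mult_distrib power_divide)
    qed
    moreover have "U / 2 * \<nu>\<^sup>2 / U\<^sup>2 * (2 * ((b / U)\<^sup>2 + d\<^sup>2)) = \<nu>\<^sup>2 / U * (b\<^sup>2 / U\<^sup>2 + d\<^sup>2)"
      using U by (simp add: field_simps power2_eq_square)
    ultimately show ?thesis by simp
  qed
  \<comment> \<open>The Young parameter \<open>\<eta> * \<nu> * U / 8\<close> turns the term with z
    into a quarter of the dissipation \<eta> \<nu>^3 Z. In the term without z, \<nu>^2 is weakened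
    to \<nu> by \<nu> \<le> 1.\<close>
  have d2: "\<nu>\<^sup>2 / U * d\<^sup>2 \<le> 1 / (U * L) * (\<nu> * X) + 4 / (\<eta> * U\<^sup>2) * (\<nu> * X) + \<eta> / 4 * (\<nu> ^ 3 * Z)"
  proof -
    have "I (\<lambda>x. \<bar>z x\<bar> * \<bar>w1 x\<bar>) \<le> \<eta> * \<nu> * U / 8 * I (\<lambda>x. \<bar>z x\<bar>\<^sup>2) + I (\<lambda>x. \<bar>w1 x\<bar>\<^sup>2) / (4 * (\<eta> * \<nu> * U / 8))"
      by (rule integral_young) (use sqint_abs sqs \<eta>_pos \<nu> U in auto)
    then have "I (\<lambda>x. \<bar>z x * w1 x\<bar>) \<le> \<eta> * \<nu> * U / 8 * Z + 2 * X / (\<eta> * \<nu> * U)"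
      by (simp add: abs_mult X_def Z_def mult_ac)
    then have "\<nu>\<^sup>2 / U * (2 * I (\<lambda>x. \<bar>z x * w1 x\<bar>)) \<le> \<nu>\<^sup>2 / U * (2 * (\<eta> * \<nu> * U / 8 * Z + 2 * X / (\<eta> * \<nu> * U)))"
      using U by (intro mult_left_mono) auto
    also have "\<dots> = \<eta> / 4 * (\<nu> ^ 3 * Z) + 4 / (\<eta> * U\<^sup>2) * (\<nu> * X)"
      using U \<nu> \<eta>_pos by (simp add: field_simps power2_eq_square power3_eq_cube)
    finally have 1: "\<nu>\<^sup>2 / U * (2 * I (\<lambda>x. \<bar>z x * w1 x\<bar>)) \<le> \<dots>" .
    have "d\<^sup>2 \<le> X / L + 2 * I (\<lambda>x. \<bar>z x * w1 x\<bar>)"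
      using trace_w1 L by (simp add: X_def field_simps)
    then have "\<nu>\<^sup>2 / U * d\<^sup>2 \<le> \<nu>\<^sup>2 / U * (X / L + 2 * I (\<lambda>x. \<bar>z x * w1 x\<bar>))"
      using U by (intro mult_left_mono) auto
    moreover have "\<nu>\<^sup>2 / U * (X / L) \<le> 1 / (U * L) * (\<nu> * X)"
    proof -
      have "\<nu>\<^sup>2 \<le> \<nu>" using \<nu> by (simp add: power2_eq_square mult_left_le)
      then have "\<nu>\<^sup>2 * (X / (U * L)) \<le> \<nu> * (X / (U * L))"
        using nonneg U L by (intro mult_right_mono) auto
      then show ?thesis by simp
    qed
    ultimately show ?thesis using 1 by (simp add: distrib_left)
  qed
  have rw: "\<nu> * I (\<lambda>x. w x * r x) \<le> \<sigma> * I (\<lambda>x. (w x)\<^sup>2) + \<nu>\<^sup>2 * R / (4 * \<sigma>)"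
  proof -
    have "I (\<lambda>x. w x * (\<nu> * r x)) \<le> \<sigma> * I (\<lambda>x. (w x)\<^sup>2) + I (\<lambda>x. (\<nu> * r x)\<^sup>2) / (4 * \<sigma>)"
      by (rule integral_young) (intro sqs sqint_cmult \<sigma>)+
    then show ?thesis by (simp add: R_def power_mult_distrib mult.left_commute[of _ \<nu>])
  qed
  have rv: "\<nu> * I (\<lambda>x. v x * r x) \<le> \<sigma> * I (\<lambda>x. (v x)\<^sup>2) + \<nu>\<^sup>2 * R / (4 * \<sigma>)"
  proof -
    have "I (\<lambda>x. v x * (\<nu> * r x)) \<le> \<sigma> * I (\<lambda>x. (v x)\<^sup>2) + I (\<lambda>x. (\<nu> * r x)\<^sup>2) / (4 * \<sigma>)"
      by (rule integral_young) (intro sqs sqint_cmult \<sigma>)+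
    then show ?thesis by (simp add: R_def power_mult_distrib mult.left_commute[of _ \<nu>])
  qed
  \<comment> \<open>Each of the four products with z claims an eighth of \<nu>^3 Z; together they
    leave half of it.\<close>
  have zf: "\<nu>\<^sup>2 * (s * I (\<lambda>x. z x * f x)) \<le> \<nu> ^ 3 * Z / 8 + 2 * s\<^sup>2 * (\<nu> * I (\<lambda>x. (f x)\<^sup>2))"
    if f: "sqint (Iv L) f" for f s
  proof -
    have "I (\<lambda>x. z x * (s * f x)) \<le> \<nu> / 8 * Z + I (\<lambda>x. (s * f x)\<^sup>2) / (4 * (\<nu> / 8))"
      unfolding Z_def by (rule integral_young) (use f \<nu> in \<open>auto intro!: sqs sqint_cmult\<close>)
    then have "\<nu>\<^sup>2 * (s * I (\<lambda>x. z x * f x)) \<le> \<nu>\<^sup>2 * (\<nu> / 8 * Z + s\<^sup>2 * I (\<lambda>x. (f x)\<^sup>2) / (4 * (\<nu> / 8)))"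
      by (intro mult_left_mono) (auto simp: power_mult_distrib mult.left_commute[of _ s])
    also have "\<dots> = \<nu> ^ 3 * Z / 8 + 2 * s\<^sup>2 * (\<nu> * I (\<lambda>x. (f x)\<^sup>2))"
      using \<nu> by (simp add: field_simps power2_eq_square power3_eq_cube)
    finally show ?thesis .
  qed
  have zr: "\<nu>\<^sup>2 * (- \<nu> * I (\<lambda>x. z x * r x)) \<le> \<nu> ^ 3 * Z / 8 + 2 * (\<nu>\<^sup>2 * R)"
  proof -
    have "2 * (\<nu> * (\<nu>\<^sup>2 * R)) \<le> 2 * (1 * (\<nu>\<^sup>2 * R))"
      using \<nu> nonneg by (intro mult_left_mono mult_right_mono) auto
    then show ?thesis using zf[OF sq(3), of "- \<nu>"] by (simp add: R_def mult_ac)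
  qed
  have zE: "\<nu>\<^sup>2 * (b * I (\<lambda>x. z x * E x)) \<le> \<nu> ^ 3 * Z / 8 + \<nu>\<^sup>2 * b\<^sup>2 / m"
  proof -
    have "I (\<lambda>x. (E x)\<^sup>2) \<le> I (\<lambda>x. (exl x)\<^sup>2)"
    proof (rule integral_mono_AE)
      show "AE x in Iv L. (E x)\<^sup>2 \<le> (exl x)\<^sup>2"
        using AE_Iv_in by eventually_elim (use layer_bounds[OF L m \<nu>(1)] in \<open>auto intro!: power_mono\<close>)
    qed (intro sqint_integrable_sq sqs sqint_exp_layer[OF L m \<nu>(1)])+
    also have "\<dots> \<le> \<nu> / (2 * m)" by (rule integral_exp_sq_le[OF \<nu>(1) m less_imp_le[OF L]])
    finally have "2 * b\<^sup>2 * (\<nu> * I (\<lambda>x. (E x)\<^sup>2)) \<le> 2 * b\<^sup>2 * (\<nu> * (\<nu> / (2 * m)))"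
      using \<nu> by (intro mult_left_mono) auto
    also have "\<dots> = \<nu>\<^sup>2 * b\<^sup>2 / m" by (simp add: power2_eq_square)
    finally show ?thesis using zf[OF sqE(1), of b] by simp
  qed
  have zw: "\<nu>\<^sup>2 * (U * I (\<lambda>x. z x * w1 x)) \<le> \<nu> ^ 3 * Z / 8 + 2 * U\<^sup>2 * (\<nu> * X)"
    using zf[OF sqs(6), of U] by (simp add: X_def)
  have zp: "\<nu>\<^sup>2 * (c * I (\<lambda>x. z x * p1 x)) \<le> \<nu> ^ 3 * Z / 8 + 2 * c\<^sup>2 * (\<nu> * Y)"
    using zf[OF sqs(8), of c] by (simp add: Y_def)
  \<comment> \<open>The outflow terms p(L)^2 have the right sign and are dropped.\<close>
  define P2 where "P2 = (I p1)\<^sup>2"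
  have P2: "0 \<le> U / 2 * P2" "0 \<le> K * (U / 2 * P2)" using U K_pos by (auto simp: P2_def)
  have sqX: "I (\<lambda>x. w1 x * w1 x) = X" "I (\<lambda>x. p1 x * p1 x) = Y" "I (\<lambda>x. z x * z x) = Z"
    by (auto simp: X_def Y_def Z_def power2_eq_square)
  let ?b = "\<nu>\<^sup>2 * b\<^sup>2"
  have T1: "K * (I (\<lambda>x. w x * wt x) + I (\<lambda>x. p x * pt x))
    \<le> K * (- \<nu> * X / 2 + (\<sigma> * I (\<lambda>x. (w x)\<^sup>2) + \<nu>\<^sup>2 * R / (4 * \<sigma>)) + ?b / (4 * m ^ 3)
      + c / U * (\<theta> * (\<nu> * Y) + ?b / (8 * \<theta> * m ^ 3)))"
  proof (rule mult_left_mono)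
    have "c / U * (b * I (\<lambda>x. p x * E x)) \<le> c / U * (\<theta> * (\<nu> * Y) + ?b / (8 * \<theta> * m ^ 3))"
      using bp U c by (intro mult_left_mono) auto
    then show "I (\<lambda>x. w x * wt x) + I (\<lambda>x. p x * pt x)
      \<le> - \<nu> * X / 2 + (\<sigma> * I (\<lambda>x. (w x)\<^sup>2) + \<nu>\<^sup>2 * R / (4 * \<sigma>)) + ?b / (4 * m ^ 3)
      + c / U * (\<theta> * (\<nu> * Y) + ?b / (8 * \<theta> * m ^ 3))"
      unfolding energy1(1) sqX using bw rw P2(1) by (simp add: P2_def)
  qed (use K_pos in simp)
  have T3: "I (\<lambda>x. v x * vt x) + I (\<lambda>x. p x * pt x)
    \<le> (\<nu>\<^sup>2 / U * (b\<^sup>2 / U\<^sup>2) + (1 / (U * L) * (\<nu> * X) + 4 / (\<eta> * U\<^sup>2) * (\<nu> * X) + \<eta> / 4 * (\<nu> ^ 3 * Z)))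
      - \<nu> * Y + (\<sigma> * I (\<lambda>x. (v x)\<^sup>2) + \<nu>\<^sup>2 * R / (4 * \<sigma>))
      + (g * (\<nu> * X) + g * ?b / (8 * m ^ 3) + \<nu> * Y / 8 + g\<^sup>2 / (c\<^sup>2 * m) * ?b)
      + c / U * (\<theta> * (\<nu> * Y) + ?b / (8 * \<theta> * m ^ 3))"
  proof -
    have "c / U * (b * I (\<lambda>x. p x * E x)) \<le> c / U * (\<theta> * (\<nu> * Y) + ?b / (8 * \<theta> * m ^ 3))"
      using bp U c by (intro mult_left_mono) auto
    moreover have "U / 2 * (\<nu> / c * e)\<^sup>2 \<le> \<nu>\<^sup>2 / U * (b\<^sup>2 / U\<^sup>2)
        + (1 / (U * L) * (\<nu> * X) + 4 / (\<eta> * U\<^sup>2) * (\<nu> * X) + \<eta> / 4 * (\<nu> ^ 3 * Z))"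
      using e2 d2 unfolding distrib_left by linarith
    ultimately show ?thesis
      using energy3 bv rv P2(1) unfolding sqX P2_def mult.assoc[of "c / U" b] by linarith
  qed
  have T2: "\<eta> * \<nu>\<^sup>2 * I (\<lambda>x. w1 x * w1t x)
    \<le> \<eta> * (- (\<nu> ^ 3 * Z) / 2 + 2 * U\<^sup>2 * (\<nu> * X) + 2 * c\<^sup>2 * (\<nu> * Y) + 2 * (\<nu>\<^sup>2 * R) + ?b / m)"
  proof -
    have "\<nu>\<^sup>2 * I (\<lambda>x. w1 x * w1t x) = - (\<nu> ^ 3 * Z) + \<nu>\<^sup>2 * (U * I (\<lambda>x. z x * w1 x))
      + \<nu>\<^sup>2 * (c * I (\<lambda>x. z x * p1 x)) + \<nu>\<^sup>2 * (- \<nu> * I (\<lambda>x. z x * r x)) + \<nu>\<^sup>2 * (b * I (\<lambda>x. z x * E x))"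
      unfolding energy2 sqX by (simp add: algebra_simps power2_eq_square power3_eq_cube)
    also have "\<dots> \<le> - (\<nu> ^ 3 * Z) / 2 + 2 * U\<^sup>2 * (\<nu> * X) + 2 * c\<^sup>2 * (\<nu> * Y) + 2 * (\<nu>\<^sup>2 * R) + ?b / m"
      using zw zp zr zE by linarith
    finally show ?thesis
      using mult_left_mono[of _ _ \<eta>] \<eta>_pos by (simp add: mult.assoc)
  qed
  have YY: "(K + 1) * (c / U) * \<theta> = 1 / 8" "\<eta> * (2 * c\<^sup>2) = 1 / 8"
    using K_pos U c by (simp_all add: \<theta> \<eta>)
  \<comment> \<open>Coefficients are collected: that of \<nu> X is 0 by the choice of K, that of
    \<nu> Y is three times 1/8 minus 1, and a quarter of \<eta> \<nu>^3 Z is left over.\<close>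
  have sum: "K * (- \<nu> * X / 2 + (\<sigma> * I (\<lambda>x. (w x)\<^sup>2) + \<nu>\<^sup>2 * R / (4 * \<sigma>)) + ?b / (4 * m ^ 3)
      + c / U * (\<theta> * (\<nu> * Y) + ?b / (8 * \<theta> * m ^ 3)))
    + ((\<nu>\<^sup>2 / U * (b\<^sup>2 / U\<^sup>2) + (1 / (U * L) * (\<nu> * X) + 4 / (\<eta> * U\<^sup>2) * (\<nu> * X) + \<eta> / 4 * (\<nu> ^ 3 * Z)))
      - \<nu> * Y + (\<sigma> * I (\<lambda>x. (v x)\<^sup>2) + \<nu>\<^sup>2 * R / (4 * \<sigma>))
      + (g * (\<nu> * X) + g * ?b / (8 * m ^ 3) + \<nu> * Y / 8 + g\<^sup>2 / (c\<^sup>2 * m) * ?b)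
      + c / U * (\<theta> * (\<nu> * Y) + ?b / (8 * \<theta> * m ^ 3)))
    + \<eta> * (- (\<nu> ^ 3 * Z) / 2 + 2 * U\<^sup>2 * (\<nu> * X) + 2 * c\<^sup>2 * (\<nu> * Y) + 2 * (\<nu>\<^sup>2 * R) + ?b / m)
    = (K / (4 * m ^ 3) + (K + 1) * (c / U) / (8 * \<theta> * m ^ 3) + g / (8 * m ^ 3) + g\<^sup>2 / (c\<^sup>2 * m) + 1 / U ^ 3 + \<eta> / m) * ?b
      + ((K + 1) / (4 * \<sigma>) + 2 * \<eta>) * (\<nu>\<^sup>2 * R)
      + \<sigma> * (K * I (\<lambda>x. (w x)\<^sup>2) + I (\<lambda>x. (v x)\<^sup>2))
      + (g + 1 / (U * L) + 4 / (\<eta> * U\<^sup>2) + 2 * U\<^sup>2 * \<eta> - K / 2) * (\<nu> * X)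
      + ((K + 1) * (c / U) * \<theta> + \<eta> * (2 * c\<^sup>2) + 1 / 8 - 1) * (\<nu> * Y)
      - \<eta> / 4 * (\<nu> ^ 3 * Z)"
  proof -
    have 1: "\<nu>\<^sup>2 / U * (b\<^sup>2 / U\<^sup>2) = 1 / U ^ 3 * ?b"
      by (simp add: power2_eq_square power3_eq_cube)
    show ?thesis unfolding 1 by (simp add: algebra_simps add_divide_distrib)
  qed
  have "(g + 1 / (U * L) + 4 / (\<eta> * U\<^sup>2) + 2 * U\<^sup>2 * \<eta> - K / 2) * (\<nu> * X) = 0"
    by (simp add: K)
  moreover have "((K + 1) * (c / U) * \<theta> + \<eta> * (2 * c\<^sup>2) + 1 / 8 - 1) * (\<nu> * Y) \<le> 0"
    unfolding YY using \<nu> nonneg by simp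
  moreover have "0 \<le> \<eta> / 4 * (\<nu> ^ 3 * Z)" using \<eta>_pos \<nu> nonneg by simp
  ultimately show ?thesis
    using T1 T2 T3 sum unfolding R_def by linarith
qed

end

section \<open>Steklov averages\<close>

lemma integrable_indicator_Iv [simp]:
  "A \<in> sets borel \<Longrightarrow> integrable (Iv a) (indicator A :: real \<Rightarrow> real)"
  by (rule Iv.sqint_integrable, rule Iv.sqint_bounded[of _ _ 1]) (auto simp: indicator_def)

text \<open>The translate is continued by 0 to times before h; because 0 \<le> h and t \<le> T the
  window (0, T) cuts off nothing else.\<close>

lemma prim_shift:
  assumes [measurable]: "f \<in> borel_measurable borel" and h: "0 \<le> h" and t: "t \<le> T"
  shows "prim (Iv T) (\<lambda>s. indicator {0<..<T} (s - h) * f (s - h)) t = prim (Iv T) f (t - h)"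
proof -
  have "prim (Iv T) (\<lambda>s. indicator {0<..<T} (s - h) * f (s - h)) t
     = (\<integral>s. indicator {0<..<T} s * (indicator {..<t} s * (indicator {0<..<T} (s - h) * f (s - h))) \<partial>lborel)"
    unfolding prim_def by (subst integral_Iv) (auto simp: set_lebesgue_integral_def)
  also have "\<dots> = (\<integral>s. indicator {0<..<T} (h + s) * (indicator {..<t} (h + s) * (indicator {0<..<T} s * f s)) \<partial>lborel)"
    by (subst lborel_integral_real_affine[of 1 _ h]) auto
  also have "\<dots> = (\<integral>s. indicator {0<..<T} s * (indicator {..<t - h} s * f s) \<partial>lborel)"
    using h t by (intro Bochner_Integration.integral_cong) (auto simp: indicator_def)
  also have "\<dots> = prim (Iv T) f (t - h)"
    unfolding prim_def by (subst integral_Iv) (auto simp: set_lebesgue_integral_def)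
  finally show ?thesis .
qed

lemma AE_Iv_shift:
  assumes "AE t in Iv T. P t" and h: "0 \<le> h"
  shows "AE t in Iv T. 0 < t - h \<longrightarrow> P (t - h)"
proof -
  obtain N where N: "{t. \<not> (t \<in> {0<..<T} \<longrightarrow> P t)} \<subseteq> N" "emeasure lborel N = 0" "N \<in> sets borel"
    using assms(1) unfolding AE_Iv by (auto elim: AE_E)
  have "AE t in lborel. t \<notin> N"
    using N by (auto intro!: AE_I[of _ _ N])
  then have "AE t in lborel. - h + 1 * t \<notin> N"
    using N(3) by (intro AE_borel_affine) auto
  then show ?thesis
    unfolding AE_Iv
  proof eventually_elim
    case (elim t)
    have "t - h \<notin> N" using elim by simp
    then have "t - h \<in> {0<..<T} \<longrightarrow> P (t - h)" using N(1) by blast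
    then show ?case using h by simp
  qed
qed

text \<open>The mean of q over (t - h, t), with q continued by 0 to negative times. Looking backward
  suits the remainder, which starts from 0: the continuation creates no jump at t = 0.\<close>

definition stek :: "real \<Rightarrow> real \<Rightarrow> (real \<Rightarrow> real) \<Rightarrow> real \<Rightarrow> real" where
  "stek T h q t = (prim (Iv T) q t - prim (Iv T) q (t - h)) / h"

definition diffq :: "real \<Rightarrow> real \<Rightarrow> (real \<Rightarrow> real) \<Rightarrow> real \<Rightarrow> real" where
  "diffq T h q t = (indicator {0<..<T} t * q t - indicator {0<..<T} (t - h) * q (t - h)) / h"

lemma integrable_shift:
  fixes f :: "real \<Rightarrow> real"
  assumes f: "integrable (Iv T) f"
  shows "integrable (Iv T) (\<lambda>s. indicator {0<..<T} (s - h) * f (s - h))"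
proof -
  have [measurable]: "f \<in> borel_measurable borel" using borel_measurable_integrable[OF f] by simp
  have "integrable lborel (\<lambda>s. indicator {0<..<T} s * f s)"
    using f by (simp add: integrable_Iv set_integrable_def)
  then have "integrable lborel (\<lambda>s. indicator {0<..<T} (- h + 1 * s) * f (- h + 1 * s))"
    by (rule lborel_integrable_real_affine) simp
  then have "integrable lborel (\<lambda>s. indicator {0<..<T} s *\<^sub>R (indicator {0<..<T} (s - h) * f (s - h)))"
    by (intro integrable_mult_indicator) auto
  then show ?thesis by (subst integrable_Iv) (auto simp: set_integrable_def)
qed

lemma prim_in_cong:
  assumes [measurable]: "f \<in> borel_measurable borel"
  shows "prim (Iv T) (\<lambda>s. indicator {0<..<T} s * f s) t = prim (Iv T) f t"
proof (rule prim_cong_AE)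
  show "AE s in Iv T. indicator {0<..<T} s * f s = f s"
    using AE_Iv_in by eventually_elim auto
qed measurable

text \<open>For q merely integrable the average is absolutely continuous in t with derivative
  \<open>diffq\<close>; this is the purpose of averaging.\<close>

lemma stek_eq_prim:
  assumes q: "integrable (Iv T) q" and h: "0 < h" and t: "t \<le> T"
  shows "stek T h q t = prim (Iv T) (diffq T h q) t"
proof -
  have [measurable]: "q \<in> borel_measurable borel" using borel_measurable_integrable[OF q] by simp
  have "prim (Iv T) (diffq T h q) t
    = 1 / h * (prim (Iv T) q t - prim (Iv T) (\<lambda>s. indicator {0<..<T} (s - h) * q (s - h)) t)"
    unfolding diffq_def divide_inverse mult.commute[of _ "inverse h"] prim_cmult
    by (subst prim_diff[OF _ integrable_shift[OF q]]) (simp_all add: prim_in_cong q)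
  then show ?thesis
    using h t by (simp add: prim_shift stek_def)
qed

lemma stek_linear:
  assumes "integrable (Iv T) f" "integrable (Iv T) g"
  shows "stek T h (\<lambda>s. f s + g s) t = stek T h f t + stek T h g t"
    "stek T h (\<lambda>s. f s - g s) t = stek T h f t - stek T h g t"
  using assms by (simp_all add: stek_def prim_add prim_diff add_divide_distrib diff_divide_distrib)

lemma stek_cmult: "stek T h (\<lambda>s. k * f s) t = k * stek T h f t"
  by (simp add: stek_def prim_cmult right_diff_distrib)

text \<open>Jensen on each window, then integration over the windows: with S the primitive of q^2,
  the square of the average is at most (S(t) - S(t - h)) / h. The time integral of this telescopes
  to the integral of S over the last window, divided by h, and S is nowhere larger than its final
  value.\<close>

lemma stek_contraction:
  assumes q: "sqint (Iv T) q" and h: "0 < h" and T: "0 < T"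
  shows "(\<integral>t. (stek T h q t)\<^sup>2 \<partial>Iv T) \<le> (\<integral>t. (q t)\<^sup>2 \<partial>Iv T)"
    and "sqint (Iv T) (stek T h q)"
proof -
  have [measurable]: "q \<in> borel_measurable borel" using sqint_measurable[OF q] by simp
  note iq = sqint_Iv_integrable[OF q]
  have stek_eq: "stek T h q = (\<lambda>t. (prim (Iv T) q t - prim (Iv T) q (t - h)) / h)"
    by (auto simp: stek_def)
  show "sqint (Iv T) (stek T h q)"
  proof (rule Iv.sqint_bounded)
    show "stek T h q \<in> borel_measurable (Iv T)" unfolding stek_eq by measurable
    show "\<bar>stek T h q t\<bar> \<le> 2 * (\<integral>y. \<bar>q y\<bar> \<partial>Iv T) / h" for t
    proof -
      have "\<bar>prim (Iv T) q t - prim (Iv T) q (t - h)\<bar> \<le> 2 * (\<integral>y. \<bar>q y\<bar> \<partial>Iv T)"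
        using abs_prim_le[OF iq, of t] abs_prim_le[OF iq, of "t - h"] by linarith
      then show ?thesis using h by (simp add: stek_def divide_right_mono)
    qed
  qed
  then have sq_stek: "integrable (Iv T) (\<lambda>t. (stek T h q t)\<^sup>2)" by (rule sqint_integrable_sq)
  define S where "S = prim (Iv T) (\<lambda>s. (q s)\<^sup>2)"
  have iq2: "integrable (Iv T) (\<lambda>s. (q s)\<^sup>2)" by (rule sqint_integrable_sq[OF q])
  have S: "integrable (Iv T) S" unfolding S_def by (rule sqint_Iv_integrable[OF sqint_prim[OF iq2]])
  have [measurable]: "S \<in> borel_measurable borel" using borel_measurable_integrable[OF S] by simp
  have S_le: "S t \<le> (\<integral>t. (q t)\<^sup>2 \<partial>Iv T)" "0 \<le> S t" for t
  proof -
    show "S t \<le> (\<integral>t. (q t)\<^sup>2 \<partial>Iv T)" using abs_prim_le[OF iq2, of t] by (simp add: S_def)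
    show "0 \<le> S t" by (simp add: S_def prim_def)
  qed
  define H where "H s = indicator {0<..<T} (s - h) * S (s - h)" for s
  have H: "integrable (Iv T) H" unfolding H_def by (rule integrable_shift[OF S])
  have le: "(stek T h q t)\<^sup>2 \<le> (S t - S (t - h)) / h" if "t < T" for t
  proof -
    let ?J = "{t - h..<t}"
    have J: "prim (Iv T) f t - prim (Iv T) f (t - h) = (\<integral>s. indicator ?J s * f s \<partial>Iv T)"
      if "integrable (Iv T) f" for f
    proof -
      have "integrable (Iv T) (\<lambda>s. indicator {..<t} s * f s)" "integrable (Iv T) (\<lambda>s. indicator {..<t - h} s * f s)"
        by (rule integrable_indicator_mult[OF that], simp)+
      from Bochner_Integration.integral_diff[OF this] show ?thesis
        unfolding prim_def
        using h by (auto simp: indicator_def intro!: Bochner_Integration.integral_cong elim!: trans[OF sym])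
    qed
    define a where "a = stek T h q t"
    have a: "a * h = (\<integral>s. indicator ?J s * q s \<partial>Iv T)"
      using h J[OF iq] by (simp add: a_def stek_def)
    have iJ: "integrable (Iv T) (\<lambda>s. indicator ?J s * (q s)\<^sup>2)" "integrable (Iv T) (\<lambda>s. indicator ?J s * q s)"
      using iq2 iq by auto
    \<comment> \<open>For t < h the window reaches below 0, where \<open>Iv T\<close> has no mass,
      so only an inequality holds.\<close>
    have mJ: "measure (Iv T) ?J \<le> h"
    proof -
      have "emeasure (Iv T) ?J \<le> emeasure lborel ?J"
        by (simp add: emeasure_Iv) (rule emeasure_mono, auto)
      also have "\<dots> = ennreal h" using h by simp
      finally show ?thesis using h by (simp add: Iv.emeasure_eq_measure)
    qed
    \<comment> \<open>Jensen, from the nonnegative square deviation of q from a.\<close>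
    have "0 \<le> (\<integral>s. indicator ?J s * (q s - a)\<^sup>2 \<partial>Iv T)"
      by (intro Bochner_Integration.integral_nonneg) (auto simp: indicator_def)
    also have "\<dots> = (\<integral>s. indicator ?J s * (q s)\<^sup>2 - 2 * a * (indicator ?J s * q s) + indicator ?J s * a\<^sup>2 \<partial>Iv T)"
      by (intro Bochner_Integration.integral_cong) (auto simp: indicator_def power2_diff)
    also have "\<dots> = (\<integral>s. indicator ?J s * (q s)\<^sup>2 \<partial>Iv T) - 2 * a * (a * h) + measure (Iv T) ?J * a\<^sup>2"
      using iJ by (simp add: a)
    also have "\<dots> \<le> (\<integral>s. indicator ?J s * (q s)\<^sup>2 \<partial>Iv T) - 2 * a * (a * h) + h * a\<^sup>2"
      using mJ by (simp add: mult_right_mono)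
    finally have "h * a\<^sup>2 \<le> S t - S (t - h)"
      using J[OF iq2] by (simp add: S_def power2_eq_square mult_ac)
    then show ?thesis using h by (simp add: a_def pos_le_divide_eq mult.commute)
  qed
  have "(\<integral>t. (stek T h q t)\<^sup>2 \<partial>Iv T) \<le> (\<integral>t. (S t - H t) / h \<partial>Iv T)"
  proof (rule integral_mono_AE[OF sq_stek])
    show "integrable (Iv T) (\<lambda>t. (S t - H t) / h)" using S H by simp
    show "AE t in Iv T. (stek T h q t)\<^sup>2 \<le> (S t - H t) / h"
      using AE_Iv_in
    proof eventually_elim
      case (elim t)
      then have "H t = S (t - h)"
        using h by (cases "0 < t - h") (auto simp: H_def S_def prim_nonpos)
      then show ?case using le[of t] elim by simp
    qed
  qed
  also have "\<dots> = ((\<integral>t. S t \<partial>Iv T) - (\<integral>t. H t \<partial>Iv T)) / h"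
    using S H by simp
  \<comment> \<open>H is S delayed by h, so its integral over (0, T) is that of S over (0, T -
    h).\<close>
  also have "(\<integral>t. H t \<partial>Iv T) = prim (Iv T) S (T - h)"
    using prim_shift[of S h T T] h prim_total[of T T H] borel_measurable_integrable[OF H]
    by (simp add: H_def[abs_def])
  also have "(\<integral>t. S t \<partial>Iv T) - prim (Iv T) S (T - h) = (\<integral>t. S t - indicator {..<T - h} t * S t \<partial>Iv T)"
    using S by (simp add: prim_def)
  also have "\<dots> \<le> (\<integral>t. indicator {T - h..<T} t * (\<integral>t. (q t)\<^sup>2 \<partial>Iv T) \<partial>Iv T)"
  proof (rule integral_mono_AE)
    show "AE t in Iv T. S t - indicator {..<T - h} t * S t \<le> indicator {T - h..<T} t * (\<integral>t. (q t)\<^sup>2 \<partial>Iv T)"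
      using AE_Iv_in by eventually_elim (use S_le in \<open>auto simp: indicator_def\<close>)
  qed (use S in auto)
  also have "\<dots> = measure (Iv T) {T - h..<T} * (\<integral>t. (q t)\<^sup>2 \<partial>Iv T)"
    by simp
  also have "\<dots> \<le> h * (\<integral>t. (q t)\<^sup>2 \<partial>Iv T)"
  proof (rule mult_right_mono)
    have "emeasure (Iv T) {T - h..<T} \<le> emeasure lborel {T - h..<T}"
      by (simp add: emeasure_Iv) (rule emeasure_mono, auto)
    also have "\<dots> = ennreal h" using h by simp
    finally show "measure (Iv T) {T - h..<T} \<le> h" using h by (simp add: Iv.emeasure_eq_measure)
  qed simp
  finally show "(\<integral>t. (stek T h q t)\<^sup>2 \<partial>Iv T) \<le> (\<integral>t. (q t)\<^sup>2 \<partial>Iv T)"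
    using h by (simp add: divide_right_mono)
qed

text \<open>Averages over shrinking windows converge to the continuous representative G at every t,
  so a bound that is uniform in h passes to G. The window is taken shorter than t to stay inside (0,
  T).\<close>

lemma stek_tendsto_bound:
  assumes q: "AE t in Iv T. q t = G t" "integrable (Iv T) q"
    and G: "continuous_on UNIV G" and t: "0 < t" "t < T"
    and bound: "\<And>h. 0 < h \<Longrightarrow> \<bar>stek T h q t\<bar> \<le> B"
  shows "\<bar>G t\<bar> \<le> B"
proof (rule field_le_epsilon)
  fix e :: real assume e: "0 < e"
  have [measurable]: "G \<in> borel_measurable borel" "q \<in> borel_measurable borel"
    using G borel_measurable_integrable[OF q(2)] by (auto intro: borel_measurable_continuous_onI)
  have "isCont G t" using G by (simp add: continuous_on_eq_continuous_at)
  then obtain \<delta> where \<delta>: "\<delta> > 0" "\<And>s. \<bar>s - t\<bar> < \<delta> \<Longrightarrow> \<bar>G s - G t\<bar> < e"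
    using e unfolding continuous_at_eps_delta dist_real_def by blast
  define h where "h = min (\<delta> / 2) (t / 2)"
  have h: "0 < h" "h < \<delta>" "h < t" using \<delta>(1) t by (auto simp: h_def)
  let ?J = "{t - h..<t}"
  have mJ: "measure (Iv T) ?J = h"
  proof -
    have "?J \<inter> {0<..<T} = ?J" using h t by auto
    then have "emeasure (Iv T) ?J = emeasure lborel ?J" by (simp add: emeasure_Iv)
    also have "\<dots> = ennreal h" using h by simp
    finally show ?thesis using h by (simp add: Iv.emeasure_eq_measure)
  qed
  define g where "g s = indicator ?J s * G s" for s
  have g: "\<bar>g s\<bar> \<le> \<bar>G t\<bar> + e" for s
    using \<delta>(2)[of s] h e by (auto simp: g_def indicator_def)
  have ig: "integrable (Iv T) g"
    by (rule Iv.sqint_integrable, rule Iv.sqint_bounded[OF _ g]) (simp add: g_def)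
  define k where "k s = indicator ?J s * q s" for s
  have J: "h * stek T h q t = (\<integral>s. k s \<partial>Iv T)"
    unfolding prim_def stek_def k_def using q(2) h
    by (simp flip: Bochner_Integration.integral_diff)
       (auto intro!: Bochner_Integration.integral_cong simp: indicator_def)
  also have "\<dots> = (\<integral>s. g s \<partial>Iv T)"
    using q by (intro integral_cong_AE) (auto simp: k_def g_def elim!: eventually_mono)
  finally have J: "h * stek T h q t = (\<integral>s. g s \<partial>Iv T)" .
  have "\<bar>(\<integral>s. g s - indicator ?J s * G t \<partial>Iv T)\<bar> \<le> (\<integral>s. \<bar>g s - indicator ?J s * G t\<bar> \<partial>Iv T)"
    by (rule integral_abs_bound)
  also have "\<dots> \<le> (\<integral>s. indicator ?J s * e \<partial>Iv T)"
  proof (rule integral_mono)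
    show "\<bar>g s - indicator ?J s * G t\<bar> \<le> indicator ?J s * e" for s
      using \<delta>(2)[of s] h by (auto simp: g_def indicator_def)
  qed (use ig in \<open>auto intro!: integrable_abs\<close>)
  also have "\<dots> = h * e" by (simp add: mJ)
  also have "(\<integral>s. g s - indicator ?J s * G t \<partial>Iv T) = h * (stek T h q t - G t)"
    using ig by (simp add: mJ J[symmetric] right_diff_distrib)
  finally have "\<bar>stek T h q t - G t\<bar> \<le> e"
    using h by (simp add: abs_mult)
  with bound[OF h(1)] show "\<bar>G t\<bar> \<le> B + e" by linarith
qed

section \<open>Fubini and square-integrable functions on the space-time rectangle\<close>

lemma measurable_pair_Iv [simp]:
  "f \<in> borel_measurable (Iv a \<Otimes>\<^sub>M Iv b) \<longleftrightarrow> f \<in> borel_measurable (borel \<Otimes>\<^sub>M borel)"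
  by (intro iffI; simp cong: measurable_cong_sets sets_pair_measure_cong)

lemma sqint_pair_measurable [measurable_dest]:
  "sqint (Iv a \<Otimes>\<^sub>M Iv b) q \<Longrightarrow> q \<in> borel_measurable (borel \<Otimes>\<^sub>M borel)"
  using sqint_measurable by fastforce

lemma integrable_slice_integral:
  fixes q :: "real \<times> real \<Rightarrow> real"
  assumes "integrable (Iv a \<Otimes>\<^sub>M Iv b) q"
  shows "integrable (Iv b) (\<lambda>t. \<integral>x. q (x, t) \<partial>Iv a)" "integrable (Iv a) (\<lambda>x. \<integral>t. q (x, t) \<partial>Iv b)"
    "(\<integral>t. \<integral>x. q (x, t) \<partial>Iv a \<partial>Iv b) = (\<integral>x. \<integral>t. q (x, t) \<partial>Iv b \<partial>Iv a)"
    "(\<integral>x. \<integral>t. q (x, t) \<partial>Iv b \<partial>Iv a) = integral\<^sup>L (Iv a \<Otimes>\<^sub>M Iv b) q"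
  using Iv2.integrable_snd[of a b "\<lambda>x t. q (x, t)"] Iv2.integrable_fst[of a b "\<lambda>x t. q (x, t)"]
    Iv2.Fubini_integral[of a b "\<lambda>x t. q (x, t)"] Iv2.integral_fst'[OF assms] assms
  by (simp_all add: split_beta')

lemma AE_integrable_slices:
  fixes q :: "real \<times> real \<Rightarrow> real"
  assumes "integrable (Iv a \<Otimes>\<^sub>M Iv b) q"
  shows "AE t in Iv b. integrable (Iv a) (\<lambda>x. q (x, t))" "AE x in Iv a. integrable (Iv b) (\<lambda>t. q (x, t))"
  using Iv2.AE_integrable_snd[of a b "\<lambda>x t. q (x, t)"] Iv2.AE_integrable_fst[of a b "\<lambda>x t. q (x, t)"] assms
  by (simp_all add: split_beta')

lemma AE_sqint_slices:
  assumes q: "sqint (Iv a \<Otimes>\<^sub>M Iv b) q"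
  shows "AE t in Iv b. sqint (Iv a) (\<lambda>x. q (x, t))" "AE x in Iv a. sqint (Iv b) (\<lambda>t. q (x, t))"
proof -
  have [measurable]: "q \<in> borel_measurable (borel \<Otimes>\<^sub>M borel)" using sqint_pair_measurable[OF q] .
  note i = AE_integrable_slices[OF sqint_integrable_sq[OF q]]
  show "AE t in Iv b. sqint (Iv a) (\<lambda>x. q (x, t))"
    using i(1) by eventually_elim (simp add: sqint_def)
  show "AE x in Iv a. sqint (Iv b) (\<lambda>t. q (x, t))"
    using i(2) by eventually_elim (simp add: sqint_def)
qed

lemma sqint_pair_fst:
  assumes k: "sqint (Iv a) k"
  shows "sqint (Iv a \<Otimes>\<^sub>M Iv b) (\<lambda>p. k (fst p))"
proof -
  have [measurable]: "k \<in> borel_measurable borel" using sqint_measurable[OF k] by simp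
  have "integrable (Iv a \<Otimes>\<^sub>M Iv b) (\<lambda>p. (k (fst p))\<^sup>2 * 1)"
    using integrable_pair_mult[OF sqint_integrable_sq[OF k], of b "\<lambda>_. 1"] by simp
  then show ?thesis by (simp add: sqint_def)
qed

lemma sqint_pair_snd:
  assumes k: "sqint (Iv b) k"
  shows "sqint (Iv a \<Otimes>\<^sub>M Iv b) (\<lambda>p. k (snd p))"
proof -
  have [measurable]: "k \<in> borel_measurable borel" using sqint_measurable[OF k] by simp
  have "integrable (Iv a \<Otimes>\<^sub>M Iv b) (\<lambda>p. 1 * (k (snd p))\<^sup>2)"
    using integrable_pair_mult[OF _ sqint_integrable_sq[OF k], of a "\<lambda>_. 1"] by simp
  then show ?thesis by (simp add: sqint_def)
qed

lemma prim_square_le: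
  assumes f: "sqint (Iv a) f" and a: "0 < a"
  shows "(prim (Iv a) f x)\<^sup>2 \<le> a * (\<integral>y. (f y)\<^sup>2 \<partial>Iv a)"
proof -
  have "sqint (Iv a) (\<lambda>y. indicator {..<x} y * f y)"
    by (rule sqint_mult_bounded[OF f, where k=1]) (auto simp: indicator_def)
  from Iv.square_integral_le[OF this]
  have "(prim (Iv a) f x)\<^sup>2 \<le> a * (\<integral>y. (indicator {..<x} y * f y)\<^sup>2 \<partial>Iv a)"
    using a by (simp add: prim_def measure_Iv)
  also have "(\<integral>y. (indicator {..<x} y * f y)\<^sup>2 \<partial>Iv a) = prim (Iv a) (\<lambda>y. (f y)\<^sup>2) x"
    unfolding prim_def by (intro Bochner_Integration.integral_cong) (auto simp: indicator_def)
  also have "\<dots> \<le> (\<integral>y. (f y)\<^sup>2 \<partial>Iv a)"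
    using abs_prim_le[OF sqint_integrable_sq[OF f], of x] by simp
  finally show ?thesis using a by simp
qed

lemma sqint_pair_bound:
  assumes g: "g \<in> borel_measurable (borel \<Otimes>\<^sub>M borel)" and N: "integrable (Iv a \<Otimes>\<^sub>M Iv b) N"
    and AE: "AE x in Iv a. AE t in Iv b. (g (x, t))\<^sup>2 \<le> N (x, t)"
  shows "sqint (Iv a \<Otimes>\<^sub>M Iv b) g"
  unfolding sqint_def
proof
  have [measurable]: "N \<in> borel_measurable (borel \<Otimes>\<^sub>M borel)" using borel_measurable_integrable[OF N] by simp
  note [measurable] = g
  show "g \<in> borel_measurable (Iv a \<Otimes>\<^sub>M Iv b)" using g by simp
  show "integrable (Iv a \<Otimes>\<^sub>M Iv b) (\<lambda>x. (g x)\<^sup>2)"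
  proof (rule Bochner_Integration.integrable_bound[OF N])
    show "AE p in Iv a \<Otimes>\<^sub>M Iv b. norm ((g p)\<^sup>2) \<le> norm (N p)"
    proof (rule Iv2.AE_pair_measure)
      show "AE x in Iv a. AE y in Iv b. norm ((g (x, y))\<^sup>2) \<le> norm (N (x, y))"
        using AE by eventually_elim (auto elim!: eventually_mono)
    qed measurable
  qed simp
qed

lemma sqint_pair_prim1:
  assumes q: "sqint (Iv a \<Otimes>\<^sub>M Iv b) q" and a: "0 < a"
  shows "sqint (Iv a \<Otimes>\<^sub>M Iv b) (\<lambda>p. prim (Iv a) (\<lambda>y. q (y, snd p)) (fst p))"
proof (rule sqint_pair_bound)
  have [measurable]: "q \<in> borel_measurable (borel \<Otimes>\<^sub>M borel)" using sqint_pair_measurable[OF q] .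
  show "(\<lambda>p. prim (Iv a) (\<lambda>y. q (y, snd p)) (fst p)) \<in> borel_measurable (borel \<Otimes>\<^sub>M borel)"
    by measurable
  have "integrable (Iv b) (\<lambda>t. \<integral>y. (q (y, t))\<^sup>2 \<partial>Iv a)"
    by (rule integrable_slice_integral(1)[OF sqint_integrable_sq[OF q]])
  then show "integrable (Iv a \<Otimes>\<^sub>M Iv b) (\<lambda>p. a * (\<integral>y. (q (y, snd p))\<^sup>2 \<partial>Iv a))"
    using integrable_pair_mult[of a "\<lambda>_. a"] by auto
  show "AE x in Iv a. AE t in Iv b. (prim (Iv a) (\<lambda>y. q (y, snd (x, t))) (fst (x, t)))\<^sup>2
      \<le> a * (\<integral>y. (q (y, snd (x, t)))\<^sup>2 \<partial>Iv a)"
    by (rule AE_I2) (use AE_sqint_slices(1)[OF q] in eventually_elim, auto intro: prim_square_le a)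
qed

lemma sqint_pair_prim2:
  assumes q: "sqint (Iv a \<Otimes>\<^sub>M Iv b) q" and b: "0 < b" and [measurable]: "h \<in> borel_measurable borel"
  shows "sqint (Iv a \<Otimes>\<^sub>M Iv b) (\<lambda>p. prim (Iv b) (\<lambda>s. q (fst p, s)) (h (snd p)))"
proof (rule sqint_pair_bound)
  have [measurable]: "q \<in> borel_measurable (borel \<Otimes>\<^sub>M borel)" using sqint_pair_measurable[OF q] .
  show "(\<lambda>p. prim (Iv b) (\<lambda>s. q (fst p, s)) (h (snd p))) \<in> borel_measurable (borel \<Otimes>\<^sub>M borel)"
    by measurable
  have "integrable (Iv a) (\<lambda>x. \<integral>s. (q (x, s))\<^sup>2 \<partial>Iv b)"
    by (rule integrable_slice_integral(2)[OF sqint_integrable_sq[OF q]])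
  then show "integrable (Iv a \<Otimes>\<^sub>M Iv b) (\<lambda>p. (\<integral>s. (q (fst p, s))\<^sup>2 \<partial>Iv b) * b)"
    using integrable_pair_mult[of a _ b "\<lambda>_. b"] by auto
  show "AE x in Iv a. AE t in Iv b. (prim (Iv b) (\<lambda>s. q (fst (x, t), s)) (h (snd (x, t))))\<^sup>2
      \<le> (\<integral>s. (q (fst (x, t), s))\<^sup>2 \<partial>Iv b) * b"
    using AE_sqint_slices(2)[OF q]
    by eventually_elim (auto simp: mult.commute[of _ b] intro!: AE_I2 prim_square_le b)
qed

lemma sqint_prim_slice:
  assumes q: "sqint (Iv a \<Otimes>\<^sub>M Iv b) q" and b: "0 < b"
  shows "sqint (Iv a) (\<lambda>x. prim (Iv b) (\<lambda>s. q (x, s)) t)"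
proof -
  have [measurable]: "q \<in> borel_measurable (borel \<Otimes>\<^sub>M borel)" using sqint_pair_measurable[OF q] .
  have "integrable (Iv a) (\<lambda>x. b * (\<integral>s. (q (x, s))\<^sup>2 \<partial>Iv b))"
    using integrable_slice_integral(2)[OF sqint_integrable_sq[OF q]] by simp
  then have "integrable (Iv a) (\<lambda>x. (prim (Iv b) (\<lambda>s. q (x, s)) t)\<^sup>2)"
  proof (rule Bochner_Integration.integrable_bound)
    show "AE x in Iv a. norm ((prim (Iv b) (\<lambda>s. q (x, s)) t)\<^sup>2) \<le> norm (b * (\<integral>s. (q (x, s))\<^sup>2 \<partial>Iv b))"
      using AE_sqint_slices(2)[OF q] by eventually_elim (use prim_square_le[OF _ b] b in auto)
  qed measurable
  then show ?thesis by (simp add: sqint_def)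
qed

lemma indicator_pair_integrable:
  fixes q :: "real \<times> real \<Rightarrow> real"
  assumes q: "integrable (Iv a \<Otimes>\<^sub>M Iv b) q"
  shows "integrable (Iv a \<Otimes>\<^sub>M Iv b) (\<lambda>p. indicator {..<x} (fst p) * q p)"
    "integrable (Iv a \<Otimes>\<^sub>M Iv b) (\<lambda>p. indicator {..<t} (snd p) * q p)"
  by (rule integrable_mult_bounded(2)[OF q, where k=1]; measurable; auto simp: indicator_def)+

lemma integral_prim_swap:
  fixes q :: "real \<times> real \<Rightarrow> real"
  assumes q: "integrable (Iv a \<Otimes>\<^sub>M Iv b) q"
  shows "(\<integral>x. prim (Iv b) (\<lambda>s. q (x, s)) t \<partial>Iv a) = prim (Iv b) (\<lambda>s. \<integral>x. q (x, s) \<partial>Iv a) t"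
  unfolding prim_def
  using integrable_slice_integral(3)[OF indicator_pair_integrable(2)[OF q, of t]] by simp

lemma prim_prim_swap:
  fixes q :: "real \<times> real \<Rightarrow> real"
  assumes q: "integrable (Iv a \<Otimes>\<^sub>M Iv b) q"
  shows "prim (Iv b) (\<lambda>s. prim (Iv a) (\<lambda>y. q (y, s)) x) t = prim (Iv a) (\<lambda>y. prim (Iv b) (\<lambda>s. q (y, s)) t) x"
proof -
  have "prim (Iv b) (\<lambda>s. indicator {..<x} y * q (y, s)) t = indicator {..<x} y * prim (Iv b) (\<lambda>s. q (y, s)) t" for y
    by (rule prim_cmult)
  then show ?thesis
    using integral_prim_swap[OF indicator_pair_integrable(1)[OF q, of x], of t]
    unfolding prim_def[of "Iv a"] by simp
qed

text \<open>Fubini for averages: thanks to it the averages of w1, w, p1, p satisfy the same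
  relations in x as the functions themselves.\<close>

lemma stek_prim_swap:
  assumes q: "sqint (Iv a \<Otimes>\<^sub>M Iv b) q" and b: "0 < b"
  shows "stek b h (\<lambda>s. prim (Iv a) (\<lambda>y. q (y, s)) x) t = prim (Iv a) (\<lambda>y. stek b h (\<lambda>s. q (y, s)) t) x"
proof -
  note i = sqint_Iv_integrable[OF sqint_prim_slice[OF q b]]
  show ?thesis
    unfolding stek_def prim_prim_swap[OF Iv2f.sqint_integrable[OF q]] divide_inverse mult.commute[of _ "inverse h"]
    by (simp add: prim_cmult prim_diff i)
qed

lemma integral_stek:
  assumes q: "sqint (Iv a \<Otimes>\<^sub>M Iv b) q" and b: "0 < b"
  shows "(\<integral>x. stek b h (\<lambda>s. q (x, s)) t \<partial>Iv a) = stek b h (\<lambda>s. \<integral>x. q (x, s) \<partial>Iv a) t"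
  using sqint_Iv_integrable[OF sqint_prim_slice[OF q b]]
  by (simp add: stek_def integral_prim_swap[OF Iv2f.sqint_integrable[OF q]])

lemma sqint_stek:
  assumes q: "sqint (Iv a \<Otimes>\<^sub>M Iv b) q" and b: "0 < b"
  shows "sqint (Iv a \<Otimes>\<^sub>M Iv b) (\<lambda>p. stek b h (\<lambda>s. q (fst p, s)) (snd p))"
    "sqint (Iv a) (\<lambda>x. stek b h (\<lambda>s. q (x, s)) t)"
  unfolding stek_def
  using sqint_pair_prim2[OF q b, of "\<lambda>t. t"] sqint_pair_prim2[OF q b, of "\<lambda>t. t - h"]
  by (auto intro!: sqint_divide sqint_diff sqint_prim_slice[OF q b])

lemma sqint_shift_pair:
  assumes q: "sqint (Iv a \<Otimes>\<^sub>M Iv b) q" and h: "0 \<le> h"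
  shows "sqint (Iv a \<Otimes>\<^sub>M Iv b) (\<lambda>p. indicator {0<..<b} (snd p - h) * q (fst p, snd p - h))"
proof -
  have [measurable]: "q \<in> borel_measurable (borel \<Otimes>\<^sub>M borel)" using sqint_pair_measurable[OF q] .
  note q2 = sqint_integrable_sq[OF q]
  let ?g = "\<lambda>p. indicator {0<..<b} (snd p - h) * (q (fst p, snd p - h))\<^sup>2"
  have "integrable (Iv a \<Otimes>\<^sub>M Iv b) ?g"
  proof (rule Iv2.Fubini_integrable)
    have eq: "(\<integral>t. norm (?g (x, t)) \<partial>Iv b) = prim (Iv b) (\<lambda>s. (q (x, s))\<^sup>2) (b - h)" for x
    proof -
      have "(\<integral>t. norm (?g (x, t)) \<partial>Iv b) = prim (Iv b) (\<lambda>t. indicator {0<..<b} (t - h) * (q (x, t - h))\<^sup>2) b"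
        by (subst prim_total) (auto intro!: Bochner_Integration.integral_cong)
      also have "\<dots> = prim (Iv b) (\<lambda>s. (q (x, s))\<^sup>2) (b - h)"
        by (rule prim_shift[OF _ h]) auto
      finally show ?thesis .
    qed
    have "integrable (Iv a) (\<lambda>x. \<integral>s. indicator {..<b - h} (snd (x, s)) * (q (x, s))\<^sup>2 \<partial>Iv b)"
      using integrable_slice_integral(2)[OF indicator_pair_integrable(2)[OF q2, of "b - h"]] by simp
    then show "integrable (Iv a) (\<lambda>x. \<integral>t. norm (?g (x, t)) \<partial>Iv b)"
      unfolding eq prim_def by simp
    show "AE x in Iv a. integrable (Iv b) (\<lambda>t. ?g (x, t))"
      using AE_integrable_slices(2)[OF q2]
    proof eventually_elim
      case (elim x)
      show ?case using integrable_shift[OF elim, of h] by simp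
    qed
  qed measurable
  moreover have "(indicator {0<..<b} u * v)\<^sup>2 = indicator {0<..<b} u * v\<^sup>2" for u v :: real
    by (auto simp: indicator_def)
  ultimately show ?thesis
    unfolding sqint_def by simp
qed

lemma sqint_diffq_pair:
  assumes q: "sqint (Iv a \<Otimes>\<^sub>M Iv b) q" and h: "0 \<le> h"
  shows "sqint (Iv a \<Otimes>\<^sub>M Iv b) (\<lambda>p. diffq b h (\<lambda>s. q (fst p, s)) (snd p))"
proof -
  have "sqint (Iv a \<Otimes>\<^sub>M Iv b) (\<lambda>p. indicator {0<..<b} (snd p) * q p)"
    by (rule sqint_mult_bounded[OF q, where k=1]) (auto simp: indicator_def)
  from sqint_divide[OF sqint_diff[OF this sqint_shift_pair[OF q h]], of h] show ?thesis
    by (simp add: diffq_def)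
qed

text \<open>For almost every x the function t \<mapsto> Q(x, t) is a primitive of k that starts from
  0, so its square is the primitive of 2 Q k; integrating over x and exchanging the integrals gives
  the energy.\<close>

lemma energy_identity:
  assumes k: "sqint (Iv a \<Otimes>\<^sub>M Iv b) k" and b: "0 < b"
    and Q: "AE x in Iv a. \<forall>t\<le>b. Q (x, t) = prim (Iv b) (\<lambda>s. k (x, s)) t"
    and Qm [measurable]: "Q \<in> borel_measurable (borel \<Otimes>\<^sub>M borel)" and t: "t \<le> b"
  shows "(\<integral>x. (Q (x, t))\<^sup>2 \<partial>Iv a) = 2 * prim (Iv b) (\<lambda>s. \<integral>x. Q (x, s) * k (x, s) \<partial>Iv a) t"
    and "integrable (Iv b) (\<lambda>s. \<integral>x. Q (x, s) * k (x, s) \<partial>Iv a)"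
proof -
  have [measurable]: "k \<in> borel_measurable (borel \<Otimes>\<^sub>M borel)" using sqint_pair_measurable[OF k] .
  have sQ: "sqint (Iv a \<Otimes>\<^sub>M Iv b) Q"
  proof (rule sqint_cong_AE[OF sqint_pair_prim2[OF k b, of "\<lambda>t. t"]])
    show "AE p in Iv a \<Otimes>\<^sub>M Iv b. Q p = prim (Iv b) (\<lambda>s. k (fst p, s)) (snd p)"
    proof (rule Iv2.AE_pair_measure)
      show "AE x in Iv a. AE t in Iv b. Q (x, t) = prim (Iv b) (\<lambda>s. k (fst (x, t), s)) (snd (x, t))"
        using Q by eventually_elim (use AE_Iv_in in eventually_elim, auto)
    qed measurable
  qed auto
  have i: "integrable (Iv a \<Otimes>\<^sub>M Iv b) (\<lambda>p. Q p * k p)"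
    by (rule sqint_integrable_mult[OF sQ k])
  from integrable_slice_integral(1)[OF i]
  show "integrable (Iv b) (\<lambda>s. \<integral>x. Q (x, s) * k (x, s) \<partial>Iv a)" .
  have "(\<integral>x. (Q (x, t))\<^sup>2 \<partial>Iv a) = (\<integral>x. 2 * prim (Iv b) (\<lambda>s. Q (x, s) * k (x, s)) t \<partial>Iv a)"
  proof (rule integral_cong_AE)
    show "AE x in Iv a. (Q (x, t))\<^sup>2 = 2 * prim (Iv b) (\<lambda>s. Q (x, s) * k (x, s)) t"
      using Q AE_sqint_slices(2)[OF k]
    proof eventually_elim
      case (elim x)
      have "prim (Iv b) (\<lambda>s. Q (x, s) * k (x, s)) t = prim (Iv b) (\<lambda>s. k (x, s) * (0 + prim (Iv b) (\<lambda>s. k (x, s)) s)) t"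
        by (rule prim_cong_AE) (use AE_Iv_in in eventually_elim, use elim in auto)
      then show ?case using square_prim[OF elim(2), of 0 t] elim(1) t by simp
    qed
  qed measurable
  then show "(\<integral>x. (Q (x, t))\<^sup>2 \<partial>Iv a) = 2 * prim (Iv b) (\<lambda>s. \<integral>x. Q (x, s) * k (x, s) \<partial>Iv a) t"
    using integral_prim_swap[OF i, of t] by simp
qed

text \<open>Exchanging almost-everywhere quantifiers rests on a measurable set of pairs, which
  equations between Borel functions provide.\<close>

lemma AE_swap_eq:
  fixes f g :: "real \<times> real \<Rightarrow> real"
  assumes [measurable]: "f \<in> borel_measurable (borel \<Otimes>\<^sub>M borel)" "g \<in> borel_measurable (borel \<Otimes>\<^sub>M borel)"
  shows "(AE x in Iv a. AE t in Iv b. f (x, t) = g (x, t)) \<longleftrightarrow> (AE t in Iv b. AE x in Iv a. f (x, t) = g (x, t))"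
    "(AE p in Iv a \<Otimes>\<^sub>M Iv b. f p = g p) \<longleftrightarrow> (AE x in Iv a. AE t in Iv b. f (x, t) = g (x, t))"
proof -
  have 1: "{p \<in> space (Iv a \<Otimes>\<^sub>M Iv b). f p = g p} \<in> sets (Iv a \<Otimes>\<^sub>M Iv b)" by measurable
  have 2: "{p \<in> space (Iv a \<Otimes>\<^sub>M Iv b). f (fst p, snd p) = g (fst p, snd p)} \<in> sets (Iv a \<Otimes>\<^sub>M Iv b)"
    using 1 by simp
  show "(AE x in Iv a. AE t in Iv b. f (x, t) = g (x, t)) \<longleftrightarrow> (AE t in Iv b. AE x in Iv a. f (x, t) = g (x, t))"
    by (rule Iv2.AE_commute[OF 2])
  show "(AE p in Iv a \<Otimes>\<^sub>M Iv b. f p = g p) \<longleftrightarrow> (AE x in Iv a. AE t in Iv b. f (x, t) = g (x, t))"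
    using Iv2.AE_pair_iff[OF 2] by simp
qed

lemma stek_mult_right: "stek T h (\<lambda>s. f s * k) t = stek T h f t * k"
  using stek_cmult[of T h k f t] by (simp add: mult.commute)

section \<open>The evolution of the remainder\<close>

text \<open>The quantifiers carry the point: K, \<eta> and C are fixed before \<nu> and the slice,
  so the estimate is uniform in the viscosity.\<close>

definition slice_bound :: "real \<Rightarrow> real \<Rightarrow> real \<Rightarrow> real \<Rightarrow> real \<Rightarrow> real \<Rightarrow> real \<Rightarrow> real \<Rightarrow> bool" where
  "slice_bound L U c m \<sigma> K \<eta> C \<longleftrightarrow> (\<forall>\<nu> b d e z y r w1t p1t w1 w p1 p wt pt.
      remainder_slice L U c m \<nu> b d e z y r w1t p1t w1 w p1 p wt pt \<longrightarrow>
      K * ((\<integral>x. w x * wt x \<partial>Iv L) + (\<integral>x. p x * pt x \<partial>Iv L))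
      + ((\<integral>x. (w x + \<nu> / c * p1 x) * (wt x + \<nu> / c * p1t x) \<partial>Iv L) + (\<integral>x. p x * pt x \<partial>Iv L))
      + \<eta> * \<nu>\<^sup>2 * (\<integral>x. w1 x * w1t x \<partial>Iv L)
      \<le> C * \<nu>\<^sup>2 * (b\<^sup>2 + (\<integral>x. (r x)\<^sup>2 \<partial>Iv L))
        + \<sigma> * (K * (\<integral>x. (w x)\<^sup>2 \<partial>Iv L) + (\<integral>x. (w x + \<nu> / c * p1 x)\<^sup>2 \<partial>Iv L)))"

lemma slice_bound_exists:
  fixes L U c m \<sigma> :: real
  assumes pos: "0 < L" "0 < U" "0 < c" "0 < m" "0 < \<sigma>"
  shows "\<exists>K \<eta> C. 0 < K \<and> 0 < \<eta> \<and> 0 \<le> C \<and> slice_bound L U c m \<sigma> K \<eta> C"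
proof -
  define g where "g = 1 + m / (U * (1 - exp (- m * L)))"
  define \<eta> where "\<eta> = 1 / (16 * c\<^sup>2)"
  define K where "K = 2 * (g + 1 / (U * L) + 4 / (\<eta> * U\<^sup>2) + 2 * U\<^sup>2 * \<eta>)"
  define \<theta> where "\<theta> = 1 / (8 * ((K + 1) * (c / U)))"
  define C1 where "C1 = K / (4 * m ^ 3) + (K + 1) * (c / U) / (8 * \<theta> * m ^ 3) + g / (8 * m ^ 3)
    + g\<^sup>2 / (c\<^sup>2 * m) + 1 / U ^ 3 + \<eta> / m"
  define C2 where "C2 = (K + 1) / (4 * \<sigma>) + 2 * \<eta>"
  have g: "0 < g" using layer_denom_pos[OF pos(1,4), of 1] pos by (simp add: g_def add_pos_pos)
  have \<eta>: "0 < \<eta>" using pos by (simp add: \<eta>_def)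
  have K: "0 < K" using g \<eta> pos by (simp add: K_def add_pos_pos)
  have \<theta>: "0 < \<theta>" using K pos by (simp add: \<theta>_def)
  have C1: "0 \<le> C1" using g \<eta> K \<theta> pos by (simp add: C1_def)
  have C2: "0 \<le> C2" using \<eta> K pos by (simp add: C2_def)
  have "K * ((\<integral>x. w x * wt x \<partial>Iv L) + (\<integral>x. p x * pt x \<partial>Iv L))
      + ((\<integral>x. (w x + \<nu> / c * p1 x) * (wt x + \<nu> / c * p1t x) \<partial>Iv L) + (\<integral>x. p x * pt x \<partial>Iv L))
      + \<eta> * \<nu>\<^sup>2 * (\<integral>x. w1 x * w1t x \<partial>Iv L)
      \<le> (C1 + C2) * \<nu>\<^sup>2 * (b\<^sup>2 + (\<integral>x. (r x)\<^sup>2 \<partial>Iv L))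
        + \<sigma> * (K * (\<integral>x. (w x)\<^sup>2 \<partial>Iv L) + (\<integral>x. (w x + \<nu> / c * p1 x)\<^sup>2 \<partial>Iv L))"
    if "remainder_slice L U c m \<nu> b d e z y r w1t p1t w1 w p1 p wt pt"
    for \<nu> b d e z y r w1t p1t w1 w p1 p wt pt
  proof -
    interpret remainder_slice L U c m \<nu> b d e z y r w1t p1t w1 w p1 p wt pt by fact
    have "C1 * (\<nu>\<^sup>2 * b\<^sup>2) + C2 * (\<nu>\<^sup>2 * (\<integral>x. (r x)\<^sup>2 \<partial>Iv L))
      \<le> (C1 + C2) * \<nu>\<^sup>2 * (b\<^sup>2 + (\<integral>x. (r x)\<^sup>2 \<partial>Iv L))"
    proof -
      have "0 \<le> C1 * (\<nu>\<^sup>2 * (\<integral>x. (r x)\<^sup>2 \<partial>Iv L)) + C2 * (\<nu>\<^sup>2 * b\<^sup>2)"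
        using C1 C2 by simp
      then show ?thesis by (simp add: algebra_simps)
    qed
    then show ?thesis
      using slice_estimate[OF pos(5) g_def \<eta>_def K_def \<theta>_def]
      unfolding v_def vt_def C1_def[symmetric] C2_def[symmetric] by linarith
  qed
  then show ?thesis
    unfolding slice_bound_def using K \<eta> C1 C2 by (intro exI[of _ K] exI[of _ \<eta>] exI[of _ "C1 + C2"]) auto
qed

text \<open>The equations are integrated in time: w and p equal time primitives of the right-hand
  sides, which asks for no time derivative and contains the zero initial values. The relations in x
  hold at every point and not only almost everywhere, because w and p are built from z, y, d,
  e.\<close>

locale remainder_evolution =
  fixes L T U c m \<nu> :: real and z y r :: "real \<times> real \<Rightarrow> real" and d e b :: "real \<Rightarrow> real"
    and w1 w p1 p :: "real \<times> real \<Rightarrow> real"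
  assumes L: "0 < L" and T: "0 < T" and U: "0 < U" and c: "0 < c" and m: "0 < m" and \<nu>: "0 < \<nu>" "\<nu> \<le> 1"
    and sq: "sqint (Iv L \<Otimes>\<^sub>M Iv T) z" "sqint (Iv L \<Otimes>\<^sub>M Iv T) y" "sqint (Iv L \<Otimes>\<^sub>M Iv T) r"
      "sqint (Iv T) d" "sqint (Iv T) e" "sqint (Iv T) b"
    and w1: "\<And>x t. w1 (x, t) = d t + prim (Iv L) (\<lambda>x. z (x, t)) x"
    and w: "\<And>x t. w (x, t) = prim (Iv L) (\<lambda>x. w1 (x, t)) x"
    and p1: "\<And>x t. p1 (x, t) = e t + prim (Iv L) (\<lambda>x. y (x, t)) x"
    and p: "\<And>x t. p (x, t) = prim (Iv L) (\<lambda>x. p1 (x, t)) x"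
    and w_L: "AE t in Iv T. (\<integral>x. w1 (x, t) \<partial>Iv L) = 0"
    and PDE1: "AE x in Iv L. AE t in Iv T. w (x, t) = prim (Iv T)
      (\<lambda>s. \<nu> * z (x, s) - U * w1 (x, s) - c * p1 (x, s) + \<nu> * r (x, s) - b s * layer L m \<nu> x) t"
    and PDE2: "AE x in Iv L. AE t in Iv T. p (x, t) = prim (Iv T)
      (\<lambda>s. - U * p1 (x, s) - c * w1 (x, s) + c / U * b s * layer L m \<nu> x) t"
begin

abbreviation \<Omega> where "\<Omega> \<equiv> Iv L \<Otimes>\<^sub>M Iv T"

lemma sq': "sqint \<Omega> w1" "sqint \<Omega> w" "sqint \<Omega> p1" "sqint \<Omega> p"
proof -
  have eq: "w1 = (\<lambda>q. d (snd q) + prim (Iv L) (\<lambda>y. z (y, snd q)) (fst q))"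
    "w = (\<lambda>q. prim (Iv L) (\<lambda>y. w1 (y, snd q)) (fst q))"
    "p1 = (\<lambda>q. e (snd q) + prim (Iv L) (\<lambda>x. y (x, snd q)) (fst q))"
    "p = (\<lambda>q. prim (Iv L) (\<lambda>y. p1 (y, snd q)) (fst q))"
    by (auto simp: w w1 p p1)
  show 1: "sqint \<Omega> w1" unfolding eq(1) by (intro sqint_add sqint_pair_snd sqint_pair_prim1 sq L)
  show 2: "sqint \<Omega> p1" unfolding eq(3) by (intro sqint_add sqint_pair_snd sqint_pair_prim1 sq L)
  show "sqint \<Omega> w" unfolding eq(2) by (rule sqint_pair_prim1[OF 1 L])
  show "sqint \<Omega> p" unfolding eq(4) by (rule sqint_pair_prim1[OF 2 L])
qed

lemmas pair_meas [measurable] = sq(1-3)[THEN sqint_pair_measurable] sq'[THEN sqint_pair_measurable]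

lemma d_meas [measurable]: "d \<in> borel_measurable borel" "e \<in> borel_measurable borel" "b \<in> borel_measurable borel"
  using sq(4-6)[THEN sqint_measurable] by auto

end

locale remainder_steklov = remainder_evolution +
  fixes h :: real
  assumes h: "0 < h"
begin

definition S :: "(real \<times> real \<Rightarrow> real) \<Rightarrow> real \<times> real \<Rightarrow> real" where
  "S q = (\<lambda>p. stek T h (\<lambda>s. q (fst p, s)) (snd p))"

text \<open>The time derivative of \<open>S q\<close>. In particular \<open>D w1\<close> supplies
  the derivative w_xt that the energy of w_x calls for.\<close>

definition D :: "(real \<times> real \<Rightarrow> real) \<Rightarrow> real \<times> real \<Rightarrow> real" where
  "D q = (\<lambda>p. diffq T h (\<lambda>s. q (fst p, s)) (snd p))"

lemma S_app: "S q (x, t) = stek T h (\<lambda>s. q (x, s)) t"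
  by (simp add: S_def)

lemma D_app: "D q (x, t) = diffq T h (\<lambda>s. q (x, s)) t"
  by (simp add: D_def)

lemma sqint_S: "sqint \<Omega> q \<Longrightarrow> sqint \<Omega> (S q)" "sqint \<Omega> q \<Longrightarrow> sqint (Iv L) (\<lambda>x. S q (x, t))"
  using sqint_stek[OF _ T, of L q h] by (auto simp: S_def)

lemma sqint_D: "sqint \<Omega> q \<Longrightarrow> sqint \<Omega> (D q)"
  using sqint_diffq_pair[of L T q h] h by (simp add: D_def)

lemma S_w1: "S w1 (x, t) = stek T h d t + prim (Iv L) (\<lambda>x. S z (x, t)) x"
proof -
  have "integrable (Iv T) (\<lambda>s. prim (Iv L) (\<lambda>y. z (y, s)) x)"
    using integrable_slice_integral(1)[OF indicator_pair_integrable(1)[OF Iv2f.sqint_integrable[OF sq(1)], of x]]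
    by (simp add: prim_def)
  from stek_linear(1)[OF sqint_Iv_integrable[OF sq(4)] this, of h t]
  show ?thesis by (simp add: S_app w1 stek_prim_swap[OF sq(1) T])
qed

lemma S_p1: "S p1 (x, t) = stek T h e t + prim (Iv L) (\<lambda>x. S y (x, t)) x"
proof -
  have "integrable (Iv T) (\<lambda>s. prim (Iv L) (\<lambda>x. y (x, s)) x)"
    using integrable_slice_integral(1)[OF indicator_pair_integrable(1)[OF Iv2f.sqint_integrable[OF sq(2)], of x]]
    by (simp add: prim_def)
  from stek_linear(1)[OF sqint_Iv_integrable[OF sq(5)] this, of h t]
  show ?thesis by (simp add: S_app p1 stek_prim_swap[OF sq(2) T])
qed

lemma S_w: "S w (x, t) = prim (Iv L) (\<lambda>x. S w1 (x, t)) x"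
  by (simp add: S_app w stek_prim_swap[OF sq'(1) T])

lemma S_p: "S p (x, t) = prim (Iv L) (\<lambda>x. S p1 (x, t)) x"
  by (simp add: S_app p stek_prim_swap[OF sq'(3) T])

lemma AE_diffq_prim:
  assumes q: "sqint \<Omega> q" and Q: "\<And>x t. Q (x, t) = prim (Iv L) (\<lambda>x. q (x, t)) x"
  shows "AE t in Iv T. \<forall>x. D Q (x, t) = prim (Iv L) (\<lambda>x. D q (x, t)) x"
  using AE_integrable_slices(1)[OF Iv2f.sqint_integrable[OF q]]
    AE_Iv_shift[OF AE_integrable_slices(1)[OF Iv2f.sqint_integrable[OF q]] less_imp_le[OF h]] AE_Iv_in
proof eventually_elim
  case (elim t)
  have "integrable (Iv L) (\<lambda>x. indicator {0<..<T} (t - h) * q (x, t - h))"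
    using elim by (cases "0 < t - h") auto
  then show ?case
    unfolding D_app diffq_def divide_inverse mult.commute[of _ "inverse h"] Q prim_cmult
    using elim by (auto simp: prim_diff prim_cmult)
qed

lemma AE_diffq_integral_0: "AE t in Iv T. (\<integral>x. D w1 (x, t) \<partial>Iv L) = 0"
  using AE_integrable_slices(1)[OF Iv2f.sqint_integrable[OF sq'(1)]] w_L
    AE_Iv_shift[OF AE_integrable_slices(1)[OF Iv2f.sqint_integrable[OF sq'(1)]] less_imp_le[OF h]]
    AE_Iv_shift[OF w_L less_imp_le[OF h]] AE_Iv_in
proof eventually_elim
  case (elim t)
  have "integrable (Iv L) (\<lambda>x. indicator {0<..<T} (t - h) * w1 (x, t - h))"
    using elim by (cases "0 < t - h") auto
  moreover have "indicator {0<..<T} (t - h) * (\<integral>x. w1 (x, t - h) \<partial>Iv L) = (0 :: real)"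
    using elim by (cases "0 < t - h") auto
  ultimately show ?case
    unfolding D_app diffq_def using elim by simp
qed

text \<open>The difference quotient of a time primitive Q of q and the average of q are the same
  increment divided by h. For t \<le> h this uses that the zero continuation of Q and the primitive
  both vanish at nonpositive times.\<close>

lemma AE_diffq_stek:
  assumes Q: "AE x in Iv L. AE t in Iv T. Q (x, t) = prim (Iv T) (\<lambda>s. q (x, s)) t"
  shows "AE x in Iv L. AE t in Iv T. D Q (x, t) = S q (x, t)"
  using Q
proof eventually_elim
  case (elim x)
  show ?case using elim AE_Iv_shift[OF elim less_imp_le[OF h]] AE_Iv_in
  proof eventually_elim
    case (elim t)
    then show ?case
      using h by (cases "0 < t - h") (auto simp: D_app S_app diffq_def stek_def prim_nonpos)
  qed
qed

lemmas SD_meas [measurable] =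
  sqint_S(1)[THEN sqint_pair_measurable, OF sq(1)] sqint_S(1)[THEN sqint_pair_measurable, OF sq(3)]
  sqint_S(1)[THEN sqint_pair_measurable, OF sq'(1)] sqint_S(1)[THEN sqint_pair_measurable, OF sq'(3)]
  sqint_D[THEN sqint_pair_measurable, OF sq'(2)] sqint_D[THEN sqint_pair_measurable, OF sq'(4)]

lemma stek_b_meas [measurable]: "stek T h b \<in> borel_measurable borel"
  using sqint_measurable[OF stek_contraction(2)[OF sq(6) h T]] by simp

text \<open>The coefficients do not depend on t, so averaging passes through the equation; on the
  left it produces the time derivative of the average of w.\<close>

lemma S_PDE1: "AE t in Iv T. AE x in Iv L. D w (x, t) = \<nu> * S z (x, t) - U * S w1 (x, t) - c * S p1 (x, t)
    + \<nu> * S r (x, t) - stek T h b t * layer L m \<nu> x"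
proof -
  define g where "g = (\<lambda>q. \<nu> * z q - U * w1 q - c * p1 q + \<nu> * r q - b (snd q) * layer L m \<nu> (fst q))"
  have "AE x in Iv L. AE t in Iv T. D w (x, t) = S g (x, t)"
    by (rule AE_diffq_stek) (use PDE1 in \<open>simp add: g_def\<close>)
  moreover have "AE x in Iv L. \<forall>t. S g (x, t) = \<nu> * S z (x, t) - U * S w1 (x, t) - c * S p1 (x, t)
    + \<nu> * S r (x, t) - stek T h b t * layer L m \<nu> x"
    using AE_sqint_slices(2)[OF sq(1)] AE_sqint_slices(2)[OF sq(3)]
      AE_sqint_slices(2)[OF sq'(1)] AE_sqint_slices(2)[OF sq'(3)]
  proof eventually_elim
    case (elim x)
    note i = elim[THEN sqint_Iv_integrable] sqint_Iv_integrable[OF sq(6)]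
    show ?case
      unfolding g_def S_app fst_conv snd_conv
      by (subst stek_linear, simp add: i, simp add: i)+ (simp only: stek_cmult stek_mult_right simp_thms)
  qed
  ultimately have "AE x in Iv L. AE t in Iv T. D w (x, t) = (\<lambda>q. \<nu> * S z q - U * S w1 q - c * S p1 q
    + \<nu> * S r q - stek T h b (snd q) * layer L m \<nu> (fst q)) (x, t)"
    by eventually_elim auto
  then have "AE t in Iv T. AE x in Iv L. D w (x, t) = (\<lambda>q. \<nu> * S z q - U * S w1 q - c * S p1 q
    + \<nu> * S r q - stek T h b (snd q) * layer L m \<nu> (fst q)) (x, t)"
    by (subst (asm) AE_swap_eq) measurable
  then show ?thesis by simp
qed

lemma S_PDE2: "AE t in Iv T. AE x in Iv L. D p (x, t) = - U * S p1 (x, t) - c * S w1 (x, t)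
    + c / U * stek T h b t * layer L m \<nu> x"
proof -
  define g where "g = (\<lambda>q. - U * p1 q - c * w1 q + c / U * b (snd q) * layer L m \<nu> (fst q))"
  have "AE x in Iv L. AE t in Iv T. D p (x, t) = S g (x, t)"
    by (rule AE_diffq_stek) (use PDE2 in \<open>simp add: g_def\<close>)
  moreover have "AE x in Iv L. \<forall>t. S g (x, t) = - U * S p1 (x, t) - c * S w1 (x, t)
    + c / U * stek T h b t * layer L m \<nu> x"
    using AE_sqint_slices(2)[OF sq'(1)] AE_sqint_slices(2)[OF sq'(3)]
  proof eventually_elim
    case (elim x)
    note i = elim[THEN sqint_Iv_integrable] sqint_Iv_integrable[OF sq(6)]
    have "stek T h (\<lambda>s. - U * p1 (x, s)) t = - U * S p1 (x, t)" for t
      unfolding S_app by (rule stek_cmult)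
    then show ?case
      unfolding g_def S_app fst_conv snd_conv
      by (subst stek_linear, simp add: i, simp add: i)+ (simp only: stek_cmult stek_mult_right simp_thms)
  qed
  ultimately have "AE x in Iv L. AE t in Iv T. D p (x, t) = (\<lambda>q. - U * S p1 q - c * S w1 q
    + c / U * stek T h b (snd q) * layer L m \<nu> (fst q)) (x, t)"
    by eventually_elim auto
  then have "AE t in Iv T. AE x in Iv L. D p (x, t) = (\<lambda>q. - U * S p1 q - c * S w1 q
    + c / U * stek T h b (snd q) * layer L m \<nu> (fst q)) (x, t)"
    by (subst (asm) AE_swap_eq) measurable
  then show ?thesis by simp
qed

lemma S_w_L: "(\<integral>x. S w1 (x, t) \<partial>Iv L) = 0"
proof -
  have "prim (Iv T) (\<lambda>s. \<integral>x. w1 (x, s) \<partial>Iv L) t = prim (Iv T) (\<lambda>s. 0) t" for t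
    by (rule prim_cong_AE[OF w_L])
       (use integrable_slice_integral(1)[OF Iv2f.sqint_integrable[OF sq'(1)]] in auto)
  then show ?thesis
    unfolding S_app integral_stek[OF sq'(1) T] by (simp add: stek_def prim_def)
qed

lemma AE_remainder_slice:
  "AE t in Iv T. remainder_slice L U c m \<nu> (stek T h b t) (stek T h d t) (stek T h e t)
    (\<lambda>x. S z (x, t)) (\<lambda>x. S y (x, t)) (\<lambda>x. S r (x, t)) (\<lambda>x. D w1 (x, t)) (\<lambda>x. D p1 (x, t))
    (\<lambda>x. S w1 (x, t)) (\<lambda>x. S w (x, t)) (\<lambda>x. S p1 (x, t)) (\<lambda>x. S p (x, t)) (\<lambda>x. D w (x, t)) (\<lambda>x. D p (x, t))"
  using AE_sqint_slices(1)[OF sqint_D[OF sq'(1)]] AE_sqint_slices(1)[OF sqint_D[OF sq'(3)]]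
    AE_diffq_prim[OF sq'(1) w] AE_diffq_prim[OF sq'(3) p] AE_diffq_integral_0 S_PDE1 S_PDE2
proof eventually_elim
  case (elim t)
  show ?case
  proof unfold_locales
    show "S w1 (x, t) = stek T h d t + prim (Iv L) (\<lambda>x. S z (x, t)) x" for x by (rule S_w1)
    show "S p1 (x, t) = stek T h e t + prim (Iv L) (\<lambda>x. S y (x, t)) x" for x by (rule S_p1)
    show "S w (x, t) = prim (Iv L) (\<lambda>x. S w1 (x, t)) x" for x by (rule S_w)
    show "S p (x, t) = prim (Iv L) (\<lambda>x. S p1 (x, t)) x" for x by (rule S_p)
  qed (use elim L U c m \<nu> sq S_w_L in \<open>auto intro: sqint_S\<close>)
qed

lemma S_eq_prim_D:
  assumes q: "sqint \<Omega> q"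
  shows "AE x in Iv L. \<forall>t\<le>T. S q (x, t) = prim (Iv T) (\<lambda>s. D q (x, s)) t"
  using AE_sqint_slices(2)[OF q]
proof eventually_elim
  case (elim x)
  show ?case
    using stek_eq_prim[OF sqint_Iv_integrable[OF elim] h]
    by (auto simp: S_app D_app cong: prim_def)
qed

definition En :: "(real \<times> real \<Rightarrow> real) \<Rightarrow> real \<Rightarrow> real" where
  "En q t = (\<integral>x. (q (x, t))\<^sup>2 \<partial>Iv L)"

definition V :: "real \<times> real \<Rightarrow> real" where
  "V q = S w q + \<nu> / c * S p1 q"

definition DV :: "real \<times> real \<Rightarrow> real" where
  "DV q = D w q + \<nu> / c * D p1 q"

lemma En_nonneg: "0 \<le> En q t"
  by (simp add: En_def)

lemma En_integrable: "sqint \<Omega> q \<Longrightarrow> integrable (Iv T) (En q)"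
  using integrable_slice_integral(1)[OF sqint_integrable_sq] by (simp add: En_def[abs_def])

lemma sqint_V: "sqint \<Omega> V" "sqint \<Omega> DV"
  unfolding V_def[abs_def] DV_def[abs_def] by (intro sqint_add sqint_cmult sqint_S sqint_D sq')+

lemma V_eq_prim: "AE x in Iv L. \<forall>t\<le>T. V (x, t) = prim (Iv T) (\<lambda>s. DV (x, s)) t"
  using S_eq_prim_D[OF sq'(2)] S_eq_prim_D[OF sq'(3)]
    AE_sqint_slices(2)[OF sqint_D[OF sq'(2)]] AE_sqint_slices(2)[OF sqint_D[OF sq'(3)]]
proof eventually_elim
  case (elim x)
  note i = elim(3,4)[THEN sqint_Iv_integrable]
  have "prim (Iv T) (\<lambda>s. DV (x, s)) t = prim (Iv T) (\<lambda>s. D w (x, s)) t + \<nu> / c * prim (Iv T) (\<lambda>s. D p1 (x, s)) t" for t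
    unfolding DV_def by (subst prim_add[OF i(1)], simp add: i, subst prim_cmult, simp)
  then show ?case using elim by (simp add: V_def)
qed

lemma energy_S:
  assumes q: "sqint \<Omega> q" and t: "t \<le> T"
  shows "En (S q) t = 2 * prim (Iv T) (\<lambda>s. \<integral>x. S q (x, s) * D q (x, s) \<partial>Iv L) t"
    "integrable (Iv T) (\<lambda>s. \<integral>x. S q (x, s) * D q (x, s) \<partial>Iv L)"
  using energy_identity[OF sqint_D[OF q] T S_eq_prim_D[OF q] _ t] sqint_pair_measurable[OF sqint_S(1)[OF q]]
  by (simp_all add: En_def)

lemma energy_V:
  assumes t: "t \<le> T"
  shows "En V t = 2 * prim (Iv T) (\<lambda>s. \<integral>x. V (x, s) * DV (x, s) \<partial>Iv L) t"
    "integrable (Iv T) (\<lambda>s. \<integral>x. V (x, s) * DV (x, s) \<partial>Iv L)"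
  using energy_identity[OF sqint_V(2) T V_eq_prim _ t] sqint_pair_measurable[OF sqint_V(1)]
  by (simp_all add: En_def)

lemma En_S_r: "(\<integral>t. En (S r) t \<partial>Iv T) \<le> integral\<^sup>L \<Omega> (\<lambda>q. (r q)\<^sup>2)"
proof -
  have "(\<integral>t. En (S r) t \<partial>Iv T) = (\<integral>x. \<integral>t. (S r (x, t))\<^sup>2 \<partial>Iv T \<partial>Iv L)"
    unfolding En_def by (rule integrable_slice_integral(3)[OF sqint_integrable_sq[OF sqint_S(1)[OF sq(3)]]])
  also have "\<dots> \<le> (\<integral>x. \<integral>t. (r (x, t))\<^sup>2 \<partial>Iv T \<partial>Iv L)"
  proof (rule integral_mono_AE)
    show "AE x in Iv L. (\<integral>t. (S r (x, t))\<^sup>2 \<partial>Iv T) \<le> (\<integral>t. (r (x, t))\<^sup>2 \<partial>Iv T)"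
      using AE_sqint_slices(2)[OF sq(3)]
      by eventually_elim (simp add: S_app stek_contraction(1)[OF _ h T])
  qed (rule integrable_slice_integral(2)[OF sqint_integrable_sq], intro sqint_S sq)+
  also have "\<dots> = integral\<^sup>L \<Omega> (\<lambda>q. (r q)\<^sup>2)"
    by (rule integrable_slice_integral(4)[OF sqint_integrable_sq[OF sq(3)]])
  finally show ?thesis .
qed

definition datum :: real where
  "datum = (\<integral>t. (b t)\<^sup>2 \<partial>Iv T) + integral\<^sup>L \<Omega> (\<lambda>q. (r q)\<^sup>2)"

text \<open>The choice \<sigma> = 1 / (4 T) replaces Gronwall's inequality: with N the total energy
  and M the time integral of its part Q, one has N \<le> 2 (a + M / (4 T)) at all times. Integrating
  gives M \<le> 2 T a + M / 2, hence M / (4 T) \<le> a and N \<le> 4 a.\<close>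

lemma total_energy:
  assumes K: "0 < K" and \<eta>: "0 < \<eta>" and C: "0 \<le> C" and sb: "slice_bound L U c m (1 / (4 * T)) K \<eta> C"
    and t: "0 < t" "t < T"
  shows "K * (En (S w) t + En (S p) t) + (En V t + En (S p) t) + \<eta> * \<nu>\<^sup>2 * En (S w1) t \<le> 4 * (C * \<nu>\<^sup>2 * datum)"
proof -
  define a where "a = C * \<nu>\<^sup>2 * datum"
  define N where "N t = K * (En (S w) t + En (S p) t) + (En V t + En (S p) t) + \<eta> * \<nu>\<^sup>2 * En (S w1) t" for t
  define F where "F q k s = (\<integral>x. q (x, s) * k (x, s) \<partial>Iv L)" for q k :: "real \<times> real \<Rightarrow> real" and s
  define R where "R s = K * (F (S w) (D w) s + F (S p) (D p) s) + (F V DV s + F (S p) (D p) s)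
      + \<eta> * \<nu>\<^sup>2 * F (S w1) (D w1) s" for s
  define Q where "Q s = K * En (S w) s + En V s" for s
  define est where "est s = C * \<nu>\<^sup>2 * ((stek T h b s)\<^sup>2 + En (S r) s) + 1 / (4 * T) * Q s" for s
  have iF: "integrable (Iv T) (F (S w) (D w))" "integrable (Iv T) (F (S p) (D p))"
    "integrable (Iv T) (F V DV)" "integrable (Iv T) (F (S w1) (D w1))"
    using energy_S(2)[OF sq'(2) order_refl] energy_S(2)[OF sq'(4) order_refl] energy_V(2)[OF order_refl]
      energy_S(2)[OF sq'(1) order_refl] by (simp_all add: F_def[abs_def])
  have iR: "integrable (Iv T) R" unfolding R_def using iF by simp
  have NR: "N t = 2 * prim (Iv T) R t" if "t \<le> T" for t
  proof -
    have "prim (Iv T) R t = K * (prim (Iv T) (F (S w) (D w)) t + prim (Iv T) (F (S p) (D p)) t)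
      + (prim (Iv T) (F V DV) t + prim (Iv T) (F (S p) (D p)) t) + \<eta> * \<nu>\<^sup>2 * prim (Iv T) (F (S w1) (D w1)) t"
      unfolding R_def using iF by (simp add: prim_add prim_cmult)
    then show ?thesis
      unfolding N_def energy_S(1)[OF sq'(1) that] energy_S(1)[OF sq'(2) that] energy_S(1)[OF sq'(4) that]
        energy_V(1)[OF that]
      by (simp add: F_def[abs_def] algebra_simps)
  qed
  note sb' = sb[unfolded slice_bound_def, rule_format]
  have R_le: "AE s in Iv T. R s \<le> est s"
    using AE_remainder_slice
  proof eventually_elim
    case (elim s)
    from sb'[OF elim] show ?case
      by (simp add: R_def F_def est_def Q_def En_def V_def DV_def)
  qed
  have ib: "integrable (Iv T) (\<lambda>s. (stek T h b s)\<^sup>2)"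
    by (rule sqint_integrable_sq[OF stek_contraction(2)[OF sq(6) h T]])
  have iE: "integrable (Iv T) (En (S r))" "integrable (Iv T) (En (S w))" "integrable (Iv T) (En V)"
    by (intro En_integrable sqint_S sqint_V sq sq')+
  have iQ: "integrable (Iv T) Q" unfolding Q_def using iE by simp
  have iest: "integrable (Iv T) est" unfolding est_def using ib iE iQ by simp
  have Q_nonneg: "0 \<le> Q s" for s using K by (simp add: Q_def En_nonneg)
  have est_nonneg: "0 \<le> est s" for s
    using C T by (simp add: est_def En_nonneg Q_nonneg)
  define M where "M = (\<integral>s. Q s \<partial>Iv T)"
  have "(\<integral>s. est s \<partial>Iv T) = C * \<nu>\<^sup>2 * ((\<integral>s. (stek T h b s)\<^sup>2 \<partial>Iv T) + (\<integral>s. En (S r) s \<partial>Iv T)) + 1 / (4 * T) * M"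
    unfolding est_def M_def using ib iE iQ by simp
  also have "\<dots> \<le> a + 1 / (4 * T) * M"
    unfolding a_def datum_def
    using C stek_contraction(1)[OF sq(6) h T] En_S_r by (intro add_right_mono mult_left_mono add_mono) auto
  finally have est_le: "(\<integral>s. est s \<partial>Iv T) \<le> a + M / (4 * T)" by simp
  have N_le: "N t \<le> 2 * (a + M / (4 * T))" if "t \<le> T" for t
  proof -
    have "prim (Iv T) R t \<le> prim (Iv T) est t"
      unfolding prim_def
      using R_le by (intro integral_mono_AE integrable_indicator_mult iR iest)
        (auto elim!: eventually_mono simp: indicator_def)
    also have "\<dots> \<le> (\<integral>s. est s \<partial>Iv T)"
      using abs_prim_le[OF iest, of t] est_nonneg by simp
    finally show ?thesis using NR[OF that] est_le by simp
  qed
  have Q_le_N: "Q t \<le> N t" for t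
  proof -
    have "0 \<le> K * En (S p) t" "0 \<le> \<eta> * \<nu>\<^sup>2 * En (S w1) t"
      using K \<eta> by (simp_all add: En_nonneg)
    then show ?thesis using En_nonneg[of "S p" t] by (simp add: Q_def N_def distrib_left)
  qed
  have "(\<integral>s. Q s \<partial>Iv T) \<le> (\<integral>s. 2 * (a + M / (4 * T)) \<partial>Iv T)"
  proof (rule integral_mono_AE[OF iQ])
    show "AE s in Iv T. Q s \<le> 2 * (a + M / (4 * T))"
      using AE_Iv_in
    proof eventually_elim
      case (elim s)
      then show ?case using Q_le_N[of s] N_le[of s] by linarith
    qed
  qed simp
  then have "M \<le> (\<integral>s. 2 * (a + M / (4 * T)) \<partial>Iv T)" by (simp only: M_def)
  then have "M \<le> 2 * T * a + M / 2" using T by (simp add: measure_Iv field_simps)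
  then have "M / (4 * T) \<le> a" using T by (simp add: field_simps)
  then show ?thesis using N_le[of t] t by (simp add: N_def a_def)
qed

text \<open>The interpolation inequality for a function vanishing at x = 0, with Young weights \<nu>
  and 1 / \<nu>: these balance a squared norm of order \<nu>^2 against a squared derivative norm of
  order 1.\<close>

lemma square_prim_le:
  assumes q: "sqint (Iv L) q"
  shows "(prim (Iv L) q x)\<^sup>2 \<le> (\<integral>x. (prim (Iv L) q x)\<^sup>2 \<partial>Iv L) / \<nu> + \<nu> * (\<integral>x. (q x)\<^sup>2 \<partial>Iv L)"
proof -
  note P = sqint_prim[OF sqint_Iv_integrable[OF q]]
  have i: "integrable (Iv L) (\<lambda>y. q y * prim (Iv L) q y)" by (rule sqint_integrable_mult[OF q P])
  have "(prim (Iv L) q x)\<^sup>2 = 2 * prim (Iv L) (\<lambda>y. q y * prim (Iv L) q y) x"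
    using square_prim[OF q, of 0 x] by simp
  also have "\<dots> \<le> 2 * (\<integral>y. \<bar>q y * prim (Iv L) q y\<bar> \<partial>Iv L)"
    using abs_prim_le[OF i, of x] by simp
  also have "(\<integral>y. \<bar>q y * prim (Iv L) q y\<bar> \<partial>Iv L) = (\<integral>y. \<bar>q y\<bar> * \<bar>prim (Iv L) q y\<bar> \<partial>Iv L)"
    by (simp add: abs_mult)
  also have "\<dots> \<le> \<nu> / 2 * (\<integral>y. \<bar>q y\<bar>\<^sup>2 \<partial>Iv L) + (\<integral>y. \<bar>prim (Iv L) q y\<bar>\<^sup>2 \<partial>Iv L) / (4 * (\<nu> / 2))"
    by (rule integral_young) (use q P \<nu> in \<open>auto intro: sqint_abs\<close>)
  finally show ?thesis by simp
qed

text \<open>The total energy bounds the squared norms of w, p, v by order \<nu>^2 and that of w_x by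
  order 1. It does not contain p_x, but p_x = (c / \<nu>) (v - w) recovers a bound of order
  1.\<close>

lemma S_bound:
  assumes K: "0 < K" and \<eta>: "0 < \<eta>" and C: "0 \<le> C" and sb: "slice_bound L U c m (1 / (4 * T)) K \<eta> C"
    and t: "0 < t" "t < T"
  shows "(S w (x, t))\<^sup>2 \<le> 4 * C * (1 / K + 1 / \<eta> + 4 * c\<^sup>2 * (1 + 1 / K)) * \<nu> * datum"
    and "(S p (x, t))\<^sup>2 \<le> 4 * C * (1 / K + 1 / \<eta> + 4 * c\<^sup>2 * (1 + 1 / K)) * \<nu> * datum"
proof -
  define a where "a = 4 * (C * datum)"
  have datum: "0 \<le> datum" by (simp add: datum_def)
  have a: "0 \<le> a" using C datum by (simp add: a_def)
  have "4 * (C * \<nu>\<^sup>2 * datum) = a * \<nu>\<^sup>2" by (simp add: a_def)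
  note tot = total_energy[OF K \<eta> C sb t, unfolded this]
  have nn: "0 \<le> K * En (S w) t" "0 \<le> K * En (S p) t" "0 \<le> En V t" "0 \<le> En (S p) t" "0 \<le> \<eta> * \<nu>\<^sup>2 * En (S w1) t"
    using K \<eta> by (simp_all add: En_nonneg)
  have "K * En (S w) t \<le> a * \<nu>\<^sup>2" "K * En (S p) t \<le> a * \<nu>\<^sup>2" "En V t \<le> a * \<nu>\<^sup>2" "\<eta> * \<nu>\<^sup>2 * En (S w1) t \<le> a * \<nu>\<^sup>2"
    using tot nn unfolding distrib_left by linarith+
  then have W: "En (S w) t \<le> a * \<nu>\<^sup>2 / K" and P: "En (S p) t \<le> a * \<nu>\<^sup>2 / K" and Vb: "En V t \<le> a * \<nu>\<^sup>2"
    and X: "En (S w1) t \<le> a / \<eta>"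
    using K \<eta> \<nu> by (simp_all add: field_simps)
  have "En (S p1) t \<le> c\<^sup>2 / \<nu>\<^sup>2 * (2 * En V t + 2 * En (S w) t)"
  proof -
    have "En (S p1) t \<le> (\<integral>x. c\<^sup>2 / \<nu>\<^sup>2 * (2 * (V (x, t))\<^sup>2 + 2 * (S w (x, t))\<^sup>2) \<partial>Iv L)"
      unfolding En_def
    proof (rule integral_mono)
      have sV: "sqint (Iv L) (\<lambda>x. V (x, t))"
        unfolding V_def by (intro sqint_add sqint_cmult sqint_S sq')
      show "integrable (Iv L) (\<lambda>x. (S p1 (x, t))\<^sup>2)"
        by (rule sqint_integrable_sq[OF sqint_S(2)[OF sq'(3)]])
      show "integrable (Iv L) (\<lambda>x. c\<^sup>2 / \<nu>\<^sup>2 * (2 * (V (x, t))\<^sup>2 + 2 * (S w (x, t))\<^sup>2))"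
        using sqint_integrable_sq[OF sqint_S(2)[OF sq'(2)]] sqint_integrable_sq[OF sV] by simp
      show "(S p1 (x, t))\<^sup>2 \<le> c\<^sup>2 / \<nu>\<^sup>2 * (2 * (V (x, t))\<^sup>2 + 2 * (S w (x, t))\<^sup>2)" for x
      proof -
        have "S p1 (x, t) = c / \<nu> * (V (x, t) - S w (x, t))"
          using c \<nu> by (simp add: V_def)
        then have "(S p1 (x, t))\<^sup>2 = c\<^sup>2 / \<nu>\<^sup>2 * (V (x, t) - S w (x, t))\<^sup>2"
          by (simp only: power_mult_distrib power_divide)
        also have "(V (x, t) - S w (x, t))\<^sup>2 \<le> 2 * (V (x, t))\<^sup>2 + 2 * (S w (x, t))\<^sup>2"
          using zero_le_power2[of "V (x, t) + S w (x, t)"] by (simp add: power2_sum power2_diff)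
        finally show ?thesis by (simp add: mult_left_mono divide_right_mono)
      qed
    qed
    also have "\<dots> = c\<^sup>2 / \<nu>\<^sup>2 * (2 * En V t + 2 * En (S w) t)"
    proof -
      have "sqint (Iv L) (\<lambda>x. V (x, t))"
        unfolding V_def by (intro sqint_add sqint_cmult sqint_S sq')
      from sqint_integrable_sq[OF this] sqint_integrable_sq[OF sqint_S(2)[OF sq'(2)]]
      show ?thesis by (simp add: En_def)
    qed
    finally show ?thesis .
  qed
  also have "\<dots> \<le> c\<^sup>2 / \<nu>\<^sup>2 * (2 * (a * \<nu>\<^sup>2) + 2 * (a * \<nu>\<^sup>2 / K))"
    using W Vb by (intro mult_left_mono add_mono) auto
  also have "\<dots> = 2 * c\<^sup>2 * (1 + 1 / K) * a"
    using \<nu> by (simp add: field_simps)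
  finally have Y: "En (S p1) t \<le> 2 * c\<^sup>2 * (1 + 1 / K) * a" .
  \<comment> \<open>One constant is made to serve both w and p: the bound of each is part of this
    sum of nonnegative terms.\<close>
  have goal: "4 * C * (1 / K + 1 / \<eta> + 4 * c\<^sup>2 * (1 + 1 / K)) * \<nu> * datum
      = a * \<nu> * (1 / K) + a * \<nu> * (1 / \<eta>) + 2 * (a * \<nu> * (2 * c\<^sup>2 * (1 + 1 / K)))"
    by (simp add: a_def algebra_simps)
  have pos: "0 \<le> a * \<nu> * (1 / K)" "0 \<le> a * \<nu> * (1 / \<eta>)" "0 \<le> a * \<nu> * (2 * c\<^sup>2 * (1 + 1 / K))"
    using a \<nu> K \<eta> by simp_all
  have aux: "i \<le> j + l \<Longrightarrow> 0 \<le> k \<Longrightarrow> 0 \<le> l \<Longrightarrow> i \<le> j + k + 2 * l" for i j k l :: real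
    by simp
  have div: "e / \<nu> \<le> a * \<nu> * (1 / K)" if "e \<le> a * \<nu>\<^sup>2 / K" for e
    using divide_right_mono[OF that, of \<nu>] \<nu> by (simp add: power2_eq_square)
  have "(S w (x, t))\<^sup>2 \<le> En (S w) t / \<nu> + \<nu> * En (S w1) t"
    using square_prim_le[OF sqint_S(2)[OF sq'(1)], of t x] by (simp add: En_def flip: S_w)
  also have "\<dots> \<le> a * \<nu> * (1 / K) + a * \<nu> * (1 / \<eta>)"
    using div[OF W] mult_left_mono[OF X, of \<nu>] \<nu> by (simp add: mult_ac)
  finally show "(S w (x, t))\<^sup>2 \<le> 4 * C * (1 / K + 1 / \<eta> + 4 * c\<^sup>2 * (1 + 1 / K)) * \<nu> * datum"
    unfolding goal using pos by linarith
  have "(S p (x, t))\<^sup>2 \<le> En (S p) t / \<nu> + \<nu> * En (S p1) t"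
    using square_prim_le[OF sqint_S(2)[OF sq'(3)], of t x] by (simp add: En_def flip: S_p)
  also have "\<dots> \<le> a * \<nu> * (1 / K) + a * \<nu> * (2 * c\<^sup>2 * (1 + 1 / K))"
  proof (rule add_mono[OF div[OF P]])
    show "\<nu> * En (S p1) t \<le> a * \<nu> * (2 * c\<^sup>2 * (1 + 1 / K))"
      using mult_left_mono[OF Y, of \<nu>] \<nu> by (simp add: mult_ac)
  qed
  finally show "(S p (x, t))\<^sup>2 \<le> 4 * C * (1 / K + 1 / \<eta> + 4 * c\<^sup>2 * (1 + 1 / K)) * \<nu> * datum"
    unfolding goal using pos aux by blast
qed

end

text \<open>The limit h \<rightarrow> 0 for fixed x: the time primitive is the continuous
  representative of Q(x, .), so a bound on all averages holds for it.\<close>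

lemma (in remainder_evolution) stek_bound_imp_bound:
  assumes q: "sqint \<Omega> q" and Q: "sqint \<Omega> Q" and AE: "AE x in Iv L. AE t in Iv T. Q (x, t) = prim (Iv T) (\<lambda>s. q (x, s)) t"
    and B: "\<And>h x t. 0 < h \<Longrightarrow> 0 < t \<Longrightarrow> t < T \<Longrightarrow> (stek T h (\<lambda>s. Q (x, s)) t)\<^sup>2 \<le> B"
  shows "AE x in Iv L. AE t in Iv T. \<bar>Q (x, t)\<bar> \<le> sqrt B"
  using AE AE_sqint_slices(2)[OF q] AE_sqint_slices(2)[OF Q]
proof eventually_elim
  case (elim x)
  have cont: "continuous_on UNIV (prim (Iv T) (\<lambda>s. q (x, s)))"
    using isCont_prim[OF sqint_Iv_integrable[OF elim(2)]] by (simp add: continuous_at_imp_continuous_on)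
  show ?case using elim(1) AE_Iv_in
  proof eventually_elim
    case (elim t)
    have "\<bar>prim (Iv T) (\<lambda>s. q (x, s)) t\<bar> \<le> sqrt B"
    proof (rule stek_tendsto_bound[OF _ _ cont])
      show "AE t in Iv T. Q (x, t) = prim (Iv T) (\<lambda>s. q (x, s)) t" by fact
      show "integrable (Iv T) (\<lambda>t. Q (x, t))" by (rule sqint_Iv_integrable) fact
      show "\<bar>stek T h (\<lambda>t. Q (x, t)) t\<bar> \<le> sqrt B" if "0 < h" for h
        using real_sqrt_le_mono[OF B[OF that, of t x]] elim by simp
    qed (use elim in auto)
    then show ?case using elim by simp
  qed
qed

text \<open>K, \<eta> and the constant of the slice estimate are chosen before the remainder, so C
  depends on L, T, U, c, m only and the rate in \<nu> is explicit.\<close>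

theorem remainder_bound:
  fixes L T U c m :: real
  assumes pos: "0 < L" "0 < T" "0 < U" "0 < c" "0 < m"
  obtains C where "0 \<le> C"
    "\<And>\<nu> z y r d e b w1 w p1 p. remainder_evolution L T U c m \<nu> z y r d e b w1 w p1 p \<Longrightarrow>
      (AE x in Iv L. AE t in Iv T.
        \<bar>w (x, t)\<bar> \<le> sqrt (C * \<nu> * ((\<integral>t. (b t)\<^sup>2 \<partial>Iv T) + integral\<^sup>L (Iv L \<Otimes>\<^sub>M Iv T) (\<lambda>q. (r q)\<^sup>2)))) \<and>
      (AE x in Iv L. AE t in Iv T.
        \<bar>p (x, t)\<bar> \<le> sqrt (C * \<nu> * ((\<integral>t. (b t)\<^sup>2 \<partial>Iv T) + integral\<^sup>L (Iv L \<Otimes>\<^sub>M Iv T) (\<lambda>q. (r q)\<^sup>2))))"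
proof -
  have "0 < 1 / (4 * T)" using pos by simp
  from slice_bound_exists[OF pos(1,3-5) this] obtain K \<eta> C where
    K: "0 < K" and \<eta>: "0 < \<eta>" and C: "0 \<le> C" and sb: "slice_bound L U c m (1 / (4 * T)) K \<eta> C" by blast
  define C' where "C' = 4 * C * (1 / K + 1 / \<eta> + 4 * c\<^sup>2 * (1 + 1 / K))"
  have "0 \<le> C'" using K \<eta> C by (simp add: C'_def)
  moreover have "(AE x in Iv L. AE t in Iv T.
        \<bar>w (x, t)\<bar> \<le> sqrt (C' * \<nu> * ((\<integral>t. (b t)\<^sup>2 \<partial>Iv T) + integral\<^sup>L (Iv L \<Otimes>\<^sub>M Iv T) (\<lambda>q. (r q)\<^sup>2)))) \<and>
      (AE x in Iv L. AE t in Iv T.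
        \<bar>p (x, t)\<bar> \<le> sqrt (C' * \<nu> * ((\<integral>t. (b t)\<^sup>2 \<partial>Iv T) + integral\<^sup>L (Iv L \<Otimes>\<^sub>M Iv T) (\<lambda>q. (r q)\<^sup>2))))"
    if "remainder_evolution L T U c m \<nu> z y r d e b w1 w p1 p" for \<nu> z y r d e b w1 w p1 p
  proof -
    interpret remainder_evolution L T U c m \<nu> z y r d e b w1 w p1 p by fact
    let ?B = "C' * \<nu> * ((\<integral>t. (b t)\<^sup>2 \<partial>Iv T) + integral\<^sup>L \<Omega> (\<lambda>q. (r q)\<^sup>2))"
    have B: "(stek T h (\<lambda>s. w (x, s)) t)\<^sup>2 \<le> ?B" "(stek T h (\<lambda>s. p (x, s)) t)\<^sup>2 \<le> ?B"
      if "0 < h" "0 < t" "t < T" for h x t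
    proof -
      interpret remainder_steklov L T U c m \<nu> z y r d e b w1 w p1 p h
        by unfold_locales fact
      from S_bound[OF K \<eta> C sb that(2,3), of x]
      show "(stek T h (\<lambda>s. w (x, s)) t)\<^sup>2 \<le> ?B" "(stek T h (\<lambda>s. p (x, s)) t)\<^sup>2 \<le> ?B"
        by (simp_all add: S_app C'_def datum_def)
    qed
    define g1 where "g1 = (\<lambda>q. \<nu> * z q - U * w1 q - c * p1 q + \<nu> * r q - b (snd q) * layer L m \<nu> (fst q))"
    define g2 where "g2 = (\<lambda>q. - U * p1 q - c * w1 q + c / U * b (snd q) * layer L m \<nu> (fst q))"
    have bl: "sqint \<Omega> (\<lambda>q. k * b (snd q) * layer L m \<nu> (fst q))" for k
    proof -
      have "integrable \<Omega> (\<lambda>q. (layer L m \<nu> (fst q))\<^sup>2 * (b (snd q))\<^sup>2)"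
        by (rule integrable_pair_mult; rule sqint_integrable_sq; (rule sqint_layer[OF L m \<nu>(1)] sq))
      then have "sqint \<Omega> (\<lambda>q. layer L m \<nu> (fst q) * b (snd q))"
        by (simp add: sqint_def power_mult_distrib)
      from sqint_cmult[OF this, of k] show ?thesis by (simp add: mult_ac)
    qed
    have g1: "sqint \<Omega> g1"
      unfolding g1_def using bl[of 1] by (intro sqint_diff sqint_add sqint_cmult sq sq') auto
    have g2: "sqint \<Omega> g2"
      unfolding g2_def using bl[of "c / U"] by (intro sqint_diff sqint_add sqint_cmult sq sq') auto
    show ?thesis
      using stek_bound_imp_bound[OF g1 sq'(2) _ B(1)] stek_bound_imp_bound[OF g2 sq'(4) _ B(2)] PDE1 PDE2
      by (simp add: g1_def g2_def)
  qed
  ultimately show ?thesis by (rule that)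
qed

section \<open>Weak derivatives and traces\<close>

lemma Ck_SucI:
  assumes "\<And>x. (f has_derivative D x) (at x)" "\<And>b. b \<in> Basis \<Longrightarrow> Ck n (\<lambda>x. D x b)"
  shows "Ck (Suc n) f"
proof -
  have "frechet_derivative f (at x) = D x" for x
    using frechet_derivative_at[OF assms(1)[of x]] by simp
  then show ?thesis using assms by (auto simp: differentiable_def)
qed

lemma Ck_SucD:
  assumes "Ck (Suc n) f"
  shows "(f has_derivative frechet_derivative f (at x)) (at x)"
    "b \<in> Basis \<Longrightarrow> Ck n (\<lambda>x. frechet_derivative f (at x) b)"
  using assms by (auto simp: frechet_derivative_works)

lemma Ck_Suc_imp_Ck: "Ck (Suc n) f \<Longrightarrow> Ck n f"
proof (induction n arbitrary: f)
  case 0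
  then have "f differentiable at x" for x by simp
  then show ?case
    unfolding Ck.simps(1) by (intro continuous_at_imp_continuous_on ballI differentiable_imp_continuous_within)
next
  case (Suc n)
  from Suc.prems have diff: "\<forall>x. f differentiable at x"
    and D: "\<And>b. b \<in> Basis \<Longrightarrow> Ck (Suc n) (\<lambda>x. frechet_derivative f (at x) b)"
    unfolding Ck.simps(2)[of "Suc n" f] by blast+
  show ?case
    unfolding Ck.simps(2)[of n f] using diff Suc.IH[OF D] by blast
qed

lemma Ck_imp_continuous: "Ck n f \<Longrightarrow> continuous_on UNIV f"
proof (induction n)
  case (Suc n)
  from Ck_Suc_imp_Ck[OF Suc.prems] show ?case by (rule Suc.IH)
qed simp

lemma Ck_const: "Ck n (\<lambda>x::'a::euclidean_space. k)"
proof (induction n arbitrary: k)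
  case (Suc n)
  show ?case by (rule Ck_SucI[OF has_derivative_const]) (rule Suc.IH)
qed simp

lemma Ck_add: "Ck n f \<Longrightarrow> Ck n g \<Longrightarrow> Ck n (\<lambda>x. f x + g x)"
proof (induction n arbitrary: f g)
  case (Suc n)
  show ?case
    by (rule Ck_SucI[OF has_derivative_add[OF Ck_SucD(1)[OF Suc.prems(1)] Ck_SucD(1)[OF Suc.prems(2)]]])
       (intro Suc.IH Ck_SucD(2) Suc.prems)
qed (simp add: continuous_on_add)

lemma Ck_mult: "Ck n f \<Longrightarrow> Ck n g \<Longrightarrow> Ck n (\<lambda>x. f x * g x)"
proof (induction n arbitrary: f g)
  case (Suc n)
  show ?case
    by (rule Ck_SucI[OF has_derivative_mult[OF Ck_SucD(1)[OF Suc.prems(1)] Ck_SucD(1)[OF Suc.prems(2)]]])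
       (intro Ck_add Suc.IH Ck_SucD(2) Suc.prems Suc.prems[THEN Ck_Suc_imp_Ck])
qed (simp add: continuous_on_mult)

lemma has_derivative_real_1:
  fixes f :: "real \<Rightarrow> real"
  assumes "(f has_derivative D) (at x)"
  shows "(f has_real_derivative D 1) (at x)"
proof -
  interpret bounded_linear D by (rule has_derivative_bounded_linear[OF assms])
  have "D = (*) (D 1)"
  proof
    fix h
    show "D h = D 1 * h" using scaleR[of h 1] by (simp add: mult.commute)
  qed
  then show ?thesis using assms by (simp add: has_field_derivative_def)
qed

lemma Ck_compose_affine:
  fixes \<phi> :: "real \<Rightarrow> real" and l :: "'a::euclidean_space \<Rightarrow> real"
  assumes l: "bounded_linear l" and "Ck n \<phi>"
  shows "Ck n (\<lambda>x. \<phi> (l x + k))"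
  using assms(2)
proof (induction n arbitrary: \<phi>)
  case 0
  have "continuous_on UNIV (\<lambda>x. l x + k)"
    by (intro continuous_intros bounded_linear.continuous_on[OF l])
  with 0 show ?case by (auto intro: continuous_on_compose2)
next
  case (Suc n)
  let ?\<phi>' = "\<lambda>y. frechet_derivative \<phi> (at y) 1"
  have der: "((\<lambda>x. \<phi> (l x + k)) has_derivative (\<lambda>h. ?\<phi>' (l x + k) * l h)) (at x)" for x
  proof -
    have "((\<lambda>x. l x + k) has_derivative l) (at x)"
      using l by (auto intro!: derivative_eq_intros bounded_linear_imp_has_derivative)
    moreover have "(\<phi> has_derivative (*) (?\<phi>' (l x + k))) (at (l x + k))"
      using has_derivative_real_1[OF Ck_SucD(1)[OF Suc.prems]] by (simp add: has_field_derivative_def)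
    ultimately show ?thesis by (rule has_derivative_compose)
  qed
  show ?case
    by (rule Ck_SucI[OF der]) (intro Ck_mult Ck_const Suc.IH Ck_SucD(2)[OF Suc.prems], simp)
qed

lemma Ck_SucI_real:
  fixes f :: "real \<Rightarrow> real"
  assumes "\<And>x. (f has_real_derivative f' x) (at x)" "Ck n f'"
  shows "Ck (Suc n) f"
  by (rule Ck_SucI[of _ "\<lambda>x. (*) (f' x)"]) (use assms in \<open>auto simp: has_field_derivative_def\<close>)

section \<open>Smooth bumps and test functions on an interval\<close>

definition flat :: "nat \<Rightarrow> real \<Rightarrow> real" where
  "flat k x = (if 0 < x then exp (- 1 / x) / x ^ k else 0)"

text \<open>The power x^k is built into the family to make it closed under differentiation;
  smoothness then follows by induction on the order for all k at once. At 0 the difference quotient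
  from the right is (1/h)^(k+1) / exp (1/h), and the exponential wins.\<close>

lemma has_derivative_flat: "(flat k has_real_derivative flat (k + 2) x - real k * flat (k + 1) x) (at x)"
proof -
  consider "0 < x" | "x < 0" | "x = 0" by linarith
  then show ?thesis
  proof cases
    case 1
    have "((\<lambda>x. exp (- 1 / x) / x ^ k) has_real_derivative flat (k + 2) x - real k * flat (k + 1) x) (at x)"
    proof -
      have k: "real k * x ^ (k - Suc 0) * x = real k * x ^ k"
        by (cases k) auto
      have "((\<lambda>x. exp (- 1 / x) / x ^ k) has_real_derivative
          (exp (- 1 / x) * (1 / x\<^sup>2) * x ^ k - exp (- 1 / x) * (real k * x ^ (k - Suc 0))) / (x ^ k * x ^ k)) (at x)"
        using 1 by (auto intro!: derivative_eq_intros simp: power2_eq_square)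
      also have "(exp (- 1 / x) * (1 / x\<^sup>2) * x ^ k - exp (- 1 / x) * (real k * x ^ (k - Suc 0))) / (x ^ k * x ^ k)
        = (exp (- 1 / x) * (1 / x\<^sup>2) * x ^ k * x\<^sup>2 - exp (- 1 / x) * (real k * x ^ (k - Suc 0) * x) * x) / (x ^ k * x ^ k * x\<^sup>2)"
        using 1 by (simp add: power2_eq_square field_simps)
      also have "\<dots> = flat (k + 2) x - real k * flat (k + 1) x"
        unfolding k using 1 by (simp add: flat_def power2_eq_square field_simps)
      finally show ?thesis .
    qed
    then show ?thesis
      by (rule has_field_derivative_transform_within_open[of _ _ _ "{0<..}"]) (use 1 in \<open>auto simp: flat_def\<close>)
  next
    case 2
    have "((\<lambda>_. 0) has_real_derivative flat (k + 2) x - real k * flat (k + 1) x) (at x)"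
      using 2 by (simp add: flat_def)
    then show ?thesis
      by (rule has_field_derivative_transform_within_open[of _ _ _ "{..<0}"]) (use 2 in \<open>auto simp: flat_def\<close>)
  next
    case 3
    have "((\<lambda>h. flat k h / h) \<longlongrightarrow> 0) (at 0)"
    proof (rule filterlim_split_at_real)
      show "((\<lambda>h. flat k h / h) \<longlongrightarrow> 0) (at_left 0)"
        by (rule tendsto_eventually) (auto simp: flat_def eventually_at_filter)
      have "((\<lambda>h. (inverse h) ^ (k + 1) / exp (inverse h)) \<longlongrightarrow> 0) (at_right (0::real))"
        by (rule filterlim_compose[OF tendsto_power_div_exp_0 filterlim_inverse_at_top_right])
      then show "((\<lambda>h. flat k h / h) \<longlongrightarrow> 0) (at_right 0)"
      proof (rule Lim_transform_eventually)
        show "\<forall>\<^sub>F h in at_right 0. inverse h ^ (k + 1) / exp (inverse h) = flat k h / h"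
          unfolding eventually_at_filter
          by (auto simp: flat_def field_simps exp_minus inverse_eq_divide power_divide)
      qed
    qed
    then show ?thesis
      using 3 by (simp add: has_field_derivative_iff flat_def)
  qed
qed

lemma Ck_cmult: "Ck n f \<Longrightarrow> Ck n (\<lambda>x. k * f x)"
  by (intro Ck_mult Ck_const)

lemma Ck_flat: "Ck n (flat k)"
proof (induction n arbitrary: k)
  case 0
  show ?case
    unfolding Ck.simps using DERIV_isCont[OF has_derivative_flat]
    by (intro continuous_at_imp_continuous_on ballI)
next
  case (Suc n)
  have "Ck n (\<lambda>x. flat (k + 2) x + (- real k) * flat (k + 1) x)"
    by (intro Ck_add Ck_cmult Suc.IH)
  then show ?case
    by (intro Ck_SucI_real[OF has_derivative_flat]) simp
qed

lemma flat_0_bounds: "0 \<le> flat 0 x" "flat 0 x \<le> 1"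
  by (auto simp: flat_def)

text \<open>The shift by 1 pushes the support to distance 1 / (n + 1) inside (a, b), which makes it
  compact in the open interval; the steepening factor drives the bumps towards the indicator of (a,
  b).\<close>

definition bump :: "real \<Rightarrow> real \<Rightarrow> nat \<Rightarrow> real \<Rightarrow> real" where
  "bump a b n x = flat 0 (real (Suc n) * (x - a) - 1) * flat 0 (real (Suc n) * (b - x) - 1)"

text \<open>Test functions of one variable on (0, a), with the compact support recorded by a closed
  interval. Products of two of them are all the test functions that the proof tests with.\<close>

definition tst :: "real \<Rightarrow> (real \<Rightarrow> real) \<Rightarrow> bool" where
  "tst a \<phi> \<longleftrightarrow> (\<forall>n. Ck n \<phi>) \<and> (\<exists>k l. 0 < k \<and> l < a \<and> (\<forall>x. x \<notin> {k..l} \<longrightarrow> \<phi> x = 0))"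

lemma Ck_bump: "Ck n (bump a b N)"
proof -
  have "Ck n (\<lambda>x. flat 0 ((real (Suc N)) * x + (- real (Suc N) * a - 1)) * flat 0 ((- real (Suc N)) * x + (real (Suc N) * b - 1)))"
    by (intro Ck_mult Ck_compose_affine Ck_flat bounded_linear_mult_right)
  moreover have "bump a b N = (\<lambda>x. flat 0 ((real (Suc N)) * x + (- real (Suc N) * a - 1)) * flat 0 ((- real (Suc N)) * x + (real (Suc N) * b - 1)))"
    by (auto simp: bump_def fun_eq_iff right_diff_distrib diff_diff_eq2 algebra_simps)
  ultimately show ?thesis by simp
qed

lemma bump_bounds: "0 \<le> bump a b n x" "bump a b n x \<le> 1"
  using flat_0_bounds by (auto simp: bump_def mult_le_one)

lemma bump_eq_0: "x \<notin> {a + 1 / real (Suc n)..b - 1 / real (Suc n)} \<Longrightarrow> bump a b n x = 0"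
  by (auto simp: bump_def flat_def field_simps)

lemma bump_eq_0': "x \<notin> {a..b} \<Longrightarrow> bump a b n x = 0"
proof (rule bump_eq_0)
  assume x: "x \<notin> {a..b}"
  have "0 < 1 / real (Suc n)" by simp
  then show "x \<notin> {a + 1 / real (Suc n)..b - 1 / real (Suc n)}"
    using x unfolding atLeastAtMost_iff by linarith
qed

lemma tst_bump: "0 \<le> a \<Longrightarrow> b \<le> L \<Longrightarrow> tst L (bump a b n)"
  unfolding tst_def
proof (intro conjI allI Ck_bump exI impI)
  have p: "0 < 1 / real (Suc n)" by simp
  assume "0 \<le> a" "b \<le> L"
  with p show "0 < a + 1 / real (Suc n)" "b - 1 / real (Suc n) < L" by linarith+
qed (rule bump_eq_0)

lemma flat_0_tendsto: "filterlim g at_top sequentially \<Longrightarrow> (\<lambda>n. flat 0 (g n)) \<longlonglongrightarrow> 1"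
proof -
  assume g: "filterlim g at_top sequentially"
  have "(\<lambda>n. inverse (g n)) \<longlonglongrightarrow> 0"
    by (rule filterlim_compose[OF tendsto_inverse_0_at_top[OF filterlim_ident] g])
  then have "(\<lambda>n. exp (- inverse (g n))) \<longlonglongrightarrow> exp (- 0)"
    by (intro tendsto_exp tendsto_minus)
  then have "(\<lambda>n. exp (- inverse (g n))) \<longlonglongrightarrow> 1" by simp
  then show ?thesis
  proof (rule Lim_transform_eventually)
    have "eventually (\<lambda>n. 0 < g n) sequentially"
      using g by (auto simp: filterlim_at_top_dense)
    then show "\<forall>\<^sub>F n in sequentially. exp (- inverse (g n)) = flat 0 (g n)"
      by eventually_elim (simp add: flat_def inverse_eq_divide)
  qed
qed

lemma bump_tendsto: "(\<lambda>n. bump a b n x) \<longlonglongrightarrow> indicator {a<..<b} x"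
proof (cases "x \<in> {a<..<b}")
  case True
  have lim: "filterlim (\<lambda>n. real (Suc n) * d - 1) at_top sequentially" if "0 < d" for d :: real
  proof -
    have "filterlim (\<lambda>n. real (Suc n) * d) at_top sequentially"
      by (rule filterlim_at_top_mult_tendsto_pos[OF tendsto_const that])
         (rule filterlim_compose[OF filterlim_real_sequentially filterlim_Suc])
    then have "filterlim (\<lambda>n. - 1 + real (Suc n) * d) at_top sequentially"
      by (rule filterlim_tendsto_add_at_top[OF tendsto_const])
    then show ?thesis by simp
  qed
  have "(\<lambda>n. bump a b n x) \<longlonglongrightarrow> 1 * 1"
    unfolding bump_def using True by (intro tendsto_mult flat_0_tendsto lim) auto
  then show ?thesis using True by simp
next
  case False
  have "bump a b n x = 0" for n
  proof (rule bump_eq_0)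
    have "0 < 1 / real (Suc n)" by simp
    then show "x \<notin> {a + 1 / real (Suc n)..b - 1 / real (Suc n)}"
      using False unfolding greaterThanLessThan_iff atLeastAtMost_iff by linarith
  qed
  then show ?thesis using False by simp
qed

definition D1 :: "(real \<Rightarrow> real) \<Rightarrow> real \<Rightarrow> real" where
  "D1 \<phi> x = frechet_derivative \<phi> (at x) 1"

lemma tst_has_derivative: "tst a \<phi> \<Longrightarrow> (\<phi> has_real_derivative D1 \<phi> x) (at x)"
  unfolding tst_def D1_def by (intro has_derivative_real_1 Ck_SucD(1)[of 0]) blast

lemma D1_eqI:
  assumes "\<And>x. (\<phi> has_real_derivative \<phi>' x) (at x)"
  shows "D1 \<phi> = \<phi>'"
proof
  fix x
  show "D1 \<phi> x = \<phi>' x"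
    using fun_cong[OF frechet_derivative_at[OF assms[of x, unfolded has_field_derivative_def]], of 1]
    by (simp add: D1_def)
qed

lemma tst_continuous: "tst a \<phi> \<Longrightarrow> continuous_on S \<phi>"
  unfolding tst_def using Ck_imp_continuous[of 0 \<phi>] continuous_on_subset by blast

lemma tst_measurable [measurable_dest]: "tst a \<phi> \<Longrightarrow> \<phi> \<in> borel_measurable borel"
  by (intro borel_measurable_continuous_onI tst_continuous)

lemma tst_D1: "tst a \<phi> \<Longrightarrow> tst a (D1 \<phi>)"
proof -
  assume \<phi>: "tst a \<phi>"
  then obtain k l where kl: "0 < k" "l < a" "\<And>x. x \<notin> {k..l} \<Longrightarrow> \<phi> x = 0" and Ck: "\<And>n. Ck n \<phi>"
    unfolding tst_def by blast
  have "Ck n (D1 \<phi>)" for n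
    using Ck_SucD(2)[OF Ck[of "Suc n"], of 1] by (simp add: D1_def[abs_def])
  moreover have "D1 \<phi> x = 0" if "x \<notin> {k..l}" for x
  proof -
    have "((\<lambda>_. 0) has_real_derivative D1 \<phi> x) (at x)"
      by (rule has_field_derivative_transform_within_open[OF tst_has_derivative[OF \<phi>], where S="- {k..l}"])
         (use that kl(3) in \<open>auto simp: open_Compl\<close>)
    then show ?thesis using DERIV_unique[OF _ DERIV_const] by blast
  qed
  ultimately show ?thesis using kl(1,2) unfolding tst_def by blast
qed

lemma tst_bounded: "tst a \<phi> \<Longrightarrow> \<exists>B. \<forall>x. \<bar>\<phi> x\<bar> \<le> B"
proof -
  assume \<phi>: "tst a \<phi>"
  then obtain k l where kl: "\<And>x. x \<notin> {k..l} \<Longrightarrow> \<phi> x = 0" unfolding tst_def by blast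
  have "bounded (\<phi> ` {k..l})"
    by (intro compact_imp_bounded compact_continuous_image tst_continuous[OF \<phi>]) simp
  then obtain B where "\<forall>x\<in>{k..l}. \<bar>\<phi> x\<bar> \<le> B" unfolding bounded_iff by auto
  then have "\<bar>\<phi> x\<bar> \<le> max B 0" for x
    using kl by (cases "x \<in> {k..l}") (auto simp: max.coboundedI1)
  then show ?thesis by blast
qed

lemma sqint_tst: "tst a \<phi> \<Longrightarrow> sqint (Iv b) \<phi>"
  using tst_bounded[of a \<phi>] tst_measurable[of a \<phi>] by (auto intro: Iv.sqint_bounded)

lemma tst_diff_cmult:
  assumes "tst a \<phi>" "tst a \<psi>"
  shows "tst a (\<lambda>x. \<phi> x - k * \<psi> x)"
proof -
  from assms obtain k1 l1 k2 l2 where *: "0 < k1" "l1 < a" "\<And>x. x \<notin> {k1..l1} \<Longrightarrow> \<phi> x = 0"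
    "0 < k2" "l2 < a" "\<And>x. x \<notin> {k2..l2} \<Longrightarrow> \<psi> x = 0"
    unfolding tst_def by blast
  have "Ck n (\<lambda>x. \<phi> x + (- k) * \<psi> x)" for n
    using assms unfolding tst_def by (intro Ck_add Ck_cmult) auto
  moreover have "\<phi> x - k * \<psi> x = 0" if "x \<notin> {min k1 k2..max l1 l2}" for x
  proof -
    have "x \<notin> {k1..l1}" "x \<notin> {k2..l2}" using that by auto
    then show ?thesis using *(3,6) by simp
  qed
  ultimately show ?thesis
    unfolding tst_def using * by (intro conjI exI[of _ "min k1 k2"] exI[of _ "max l1 l2"]) auto
qed

lemma tst_eq_prim:
  assumes \<phi>: "tst a \<phi>" and x: "0 \<le> x" "x \<le> a"
  shows "\<phi> x = prim (Iv a) (D1 \<phi>) x"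
proof -
  obtain k where "0 < k" "\<And>x. x < k \<Longrightarrow> \<phi> x = 0"
    using \<phi> unfolding tst_def by (metis atLeastAtMost_iff not_le)
  then have "\<phi> 0 = 0" by blast
  then show ?thesis
    using prim_FTC[OF tst_has_derivative[OF \<phi>] tst_continuous[OF tst_D1[OF \<phi>]] x] by simp
qed

text \<open>Integral 0 makes the primitive return to 0 beyond the support of \<gamma>. So the test
  functions of integral 0 are exactly derivatives of test functions.\<close>

lemma tst_prim:
  assumes \<gamma>: "tst a \<gamma>" and int: "integral\<^sup>L (Iv a) \<gamma> = 0"
  shows "tst a (prim (Iv a) \<gamma>)" "D1 (prim (Iv a) \<gamma>) = \<gamma>"
proof -
  obtain k l where kl: "0 < k" "l < a" "\<And>x. x \<notin> {k..l} \<Longrightarrow> \<gamma> x = 0" and Ck: "\<And>n. Ck n \<gamma>"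
    using \<gamma> unfolding tst_def by blast
  have low: "prim (Iv a) \<gamma> y = 0" if "y \<le> k" for y
  proof -
    have "indicator {..<y} z * \<gamma> z = 0" for z
      using kl(3)[of z] that by (cases "z < y") auto
    then show ?thesis by (simp only: prim_def Bochner_Integration.integral_zero)
  qed
  have high: "prim (Iv a) \<gamma> y = 0" if "l < y" for y
  proof -
    have "indicator {..<y} z * \<gamma> z = \<gamma> z" for z
      using kl(3)[of z] that by (cases "z < y") auto
    then show ?thesis by (simp only: prim_def int)
  qed
  have der: "(prim (Iv a) \<gamma> has_real_derivative \<gamma> x) (at x)" for x
  proof -
    consider "x < k" | "l < x" | "k \<le> x" "x \<le> l" by linarith
    then show ?thesis
    proof cases
      case 1
      then have "((\<lambda>_. 0) has_real_derivative \<gamma> x) (at x)" using kl(3)[of x] by simp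
      then show ?thesis
        by (rule has_field_derivative_transform_within_open[where S="{..<k}"]) (use 1 low in auto)
    next
      case 2
      then have "((\<lambda>_. 0) has_real_derivative \<gamma> x) (at x)" using kl(3)[of x] by simp
      then show ?thesis
        by (rule has_field_derivative_transform_within_open[where S="{l<..}"]) (use 2 high in auto)
    next
      case 3
      \<comment> \<open>An antiderivative on a larger interval has two-sided derivatives on all of
        [0, a].\<close>
      obtain G where G: "\<And>y. y \<in> {-1..a + 1} \<Longrightarrow> (G has_vector_derivative \<gamma> y) (at y within {-1..a + 1})"
        using antiderivative_continuous[OF tst_continuous[OF \<gamma>], of "-1" "a + 1"] by blast
      have G': "(G has_real_derivative \<gamma> y) (at y)" if "0 \<le> y" "y \<le> a" for y
      proof -
        have "at y within {-1..a + 1} = at y"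
          by (rule at_within_interior) (use that in auto)
        then show ?thesis using G[of y] that by (simp add: has_real_derivative_iff_has_vector_derivative)
      qed
      have "((\<lambda>y. G y - G 0) has_real_derivative \<gamma> x) (at x)"
        using DERIV_diff[OF G' DERIV_const, of x "G 0"] 3 kl by simp
      then show ?thesis
        by (rule has_field_derivative_transform_within_open[where S="{0<..<a}"])
           (use 3 kl in \<open>auto simp: prim_FTC[OF G' tst_continuous[OF \<gamma>]]\<close>)
    qed
  qed
  show "D1 (prim (Iv a) \<gamma>) = \<gamma>" by (rule D1_eqI[OF der])
  have "Ck n (prim (Iv a) \<gamma>)" for n
    by (rule Ck_Suc_imp_Ck[OF Ck_SucI_real[OF der Ck]])
  moreover have "prim (Iv a) \<gamma> x = 0" if "x \<notin> {k..l}" for x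
    using that low[of x] high[of x] by (cases "x \<le> k") auto
  ultimately show "tst a (prim (Iv a) \<gamma>)"
    unfolding tst_def using kl(1,2) by blast
qed

section \<open>Product test functions on the rectangle\<close>

lemma pair_Iv_eq: "Iv a \<Otimes>\<^sub>M Iv b = density lborel (indicator ({0<..<a} \<times> {0<..<b}))"
proof -
  have "Iv a \<Otimes>\<^sub>M Iv b = density (lborel \<Otimes>\<^sub>M lborel) (\<lambda>(x, y). indicator {0<..<a} x * indicator {0<..<b} y)"
    unfolding Iv_def
    by (rule pair_measure_density) (use finite_measure_Iv[of b] in \<open>auto simp: Iv_def finite_measure_def sigma_finite_lborel\<close>)
  also have "\<dots> = density lborel (indicator ({0<..<a} \<times> {0<..<b}))"
    unfolding lborel_prod by (rule arg_cong[where f="density lborel"]) (auto simp: indicator_def fun_eq_iff)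
  finally show ?thesis .
qed

lemma spacetime_borel [measurable]: "{0<..<a} \<times> {0<..<b} \<in> sets (borel :: (real \<times> real) measure)"
  by (intro borel_open open_Times) auto

lemma integral_pair_Iv:
  fixes f :: "real \<times> real \<Rightarrow> real"
  assumes "f \<in> borel_measurable borel"
  shows "integral\<^sup>L (Iv a \<Otimes>\<^sub>M Iv b) f = (LINT p:{0<..<a} \<times> {0<..<b}|lborel. f p)"
    "integrable (Iv a \<Otimes>\<^sub>M Iv b) f \<longleftrightarrow> set_integrable lborel ({0<..<a} \<times> {0<..<b}) f"
proof -
  have "Iv a \<Otimes>\<^sub>M Iv b = density lborel (\<lambda>p. ennreal (indicator ({0<..<a} \<times> {0<..<b}) p))"
    unfolding pair_Iv_eq by (rule arg_cong[where f="density lborel"]) (auto simp: indicator_def)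
  then show "integral\<^sup>L (Iv a \<Otimes>\<^sub>M Iv b) f = (LINT p:{0<..<a} \<times> {0<..<b}|lborel. f p)"
    "integrable (Iv a \<Otimes>\<^sub>M Iv b) f \<longleftrightarrow> set_integrable lborel ({0<..<a} \<times> {0<..<b}) f"
    using assms by (simp_all add: integral_real_density integrable_real_density set_lebesgue_integral_def set_integrable_def)
qed

lemma AE_pair_Iv: "(AE p in Iv a \<Otimes>\<^sub>M Iv b. P p) \<longleftrightarrow> (AE p in lborel. p \<in> {0<..<a} \<times> {0<..<b} \<longrightarrow> P p)"
  unfolding pair_Iv_eq by (subst AE_density) (auto simp: indicator_def)

text \<open>On each compact rectangle K n the function g is integrable, and products of bumps
  converge to the indicator of any box clipped to K n; so all box integrals of g over K n vanish.
  The K n exhaust the open rectangle.\<close>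

lemma AE_eq_0_if_tst_integrals_eq_0:
  fixes g :: "real \<times> real \<Rightarrow> real"
  assumes loc: "locally_integrable ({0<..<a} \<times> {0<..<b}) g"
    and 0: "\<And>\<phi> \<psi>. tst a \<phi> \<Longrightarrow> tst b \<psi> \<Longrightarrow> (LINT p:{0<..<a} \<times> {0<..<b}|lborel. g p * (\<phi> (fst p) * \<psi> (snd p))) = 0"
  shows "AE p in lborel. p \<in> {0<..<a} \<times> {0<..<b} \<longrightarrow> g p = 0"
proof -
  define K where "K n = {1 / real (Suc n)..a - 1 / real (Suc n)} \<times> {1 / real (Suc n)..b - 1 / real (Suc n)}" for n
  have [measurable]: "K n \<in> sets borel" for n
    unfolding K_def by (intro borel_closed closed_Times) auto
  have pos: "0 < 1 / real (Suc n)" for n by simp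
  have KS: "K n \<subseteq> {0<..<a} \<times> {0<..<b}" for n
  proof
    fix p assume "p \<in> K n"
    with pos[of n] show "p \<in> {0<..<a} \<times> {0<..<b}"
      unfolding K_def mem_Times_iff atLeastAtMost_iff greaterThanLessThan_iff by linarith
  qed
  have "AE p in lborel. indicator (K n) p * g p = 0" for n
  proof (rule AE_eq_0_if_box_integrals_eq_0)
    have "compact (K n)" unfolding K_def by (intro compact_Times) auto
    then have "set_integrable lborel (K n) g"
      using loc KS[of n] unfolding locally_integrable_def by blast
    then show int: "integrable lborel (\<lambda>p. indicator (K n) p * g p)"
      by (simp add: set_integrable_def)
    fix u v :: "real \<times> real"
    obtain u1 u2 v1 v2 where uv: "u = (u1, u2)" "v = (v1, v2)" by (cases u, cases v)
    \<comment> \<open>The box is clipped to K n, so that the bumps vanish off K n and meet g only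
      where it is integrable.\<close>
    define a1 where "a1 = max u1 (1 / real (Suc n))"
    define b1 where "b1 = min v1 (a - 1 / real (Suc n))"
    define a2 where "a2 = max u2 (1 / real (Suc n))"
    define b2 where "b2 = min v2 (b - 1 / real (Suc n))"
    have ab: "0 \<le> a1" "b1 \<le> a" "0 \<le> a2" "b2 \<le> b"
      using pos[of n] by (auto simp: a1_def b1_def a2_def b2_def intro: order_trans[OF min.cobounded2] le_max_iff_disj[THEN iffD2])
    define F where "F N p = bump a1 b1 N (fst p) * bump a2 b2 N (snd p)" for N and p :: "real \<times> real"
    have F_K: "F N p = 0" if "p \<notin> K n" for N p
    proof -
      have "fst p \<notin> {a1..b1} \<or> snd p \<notin> {a2..b2}"
        using that by (auto simp: K_def mem_Times_iff a1_def b1_def a2_def b2_def)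
      then show ?thesis using bump_eq_0' by (auto simp: F_def)
    qed
    have F0: "0 \<le> F N p" "F N p \<le> 1" for N p
      using bump_bounds by (auto simp: F_def mult_le_one)
    have [measurable]: "bump c d N \<in> borel_measurable borel" for c d N
      by (intro borel_measurable_continuous_onI Ck_imp_continuous[OF Ck_bump[of 0]])
    have Fm [measurable]: "F N \<in> borel_measurable borel" for N
    proof -
      have "F N \<in> borel_measurable (borel \<Otimes>\<^sub>M borel)" unfolding F_def by measurable
      then show ?thesis by (simp add: borel_prod)
    qed
    have zero: "(\<integral>p. F N p * (indicator (K n) p * g p) \<partial>lborel) = 0" for N
    proof -
      have "(\<integral>p. F N p * (indicator (K n) p * g p) \<partial>lborel)
        = (LINT p:{0<..<a} \<times> {0<..<b}|lborel. g p * (bump a1 b1 N (fst p) * bump a2 b2 N (snd p)))"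
        unfolding set_lebesgue_integral_def
      proof (intro Bochner_Integration.integral_cong refl)
        fix p
        show "F N p * (indicator (K n) p * g p) =
          indicator ({0<..<a} \<times> {0<..<b}) p *\<^sub>R (g p * (bump a1 b1 N (fst p) * bump a2 b2 N (snd p)))"
        proof (cases "p \<in> K n")
          case True
          then have "p \<in> {0<..<a} \<times> {0<..<b}" using KS by blast
          then show ?thesis using True by (simp add: F_def)
        next
          case False
          then have "bump a1 b1 N (fst p) * bump a2 b2 N (snd p) = 0" using F_K by (simp add: F_def)
          then show ?thesis using False by (simp only: F_def mult_zero_left mult_zero_right scaleR_zero_right)
        qed
      qed
      also have "\<dots> = 0" using ab by (intro 0 tst_bump)
      finally show ?thesis .
    qed
    have "(\<lambda>N. \<integral>p. F N p * (indicator (K n) p * g p) \<partial>lborel)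
      \<longlonglongrightarrow> (\<integral>p. indicator ({a1<..<b1} \<times> {a2<..<b2}) p * (indicator (K n) p * g p) \<partial>lborel)"
    proof (rule integral_dominated_convergence[where w="\<lambda>p. \<bar>indicator (K n) p * g p\<bar>"])
      have gm [measurable]: "(\<lambda>p. indicator (K n) p * g p) \<in> borel_measurable borel" using int by simp
      have [measurable]: "{a1<..<b1} \<times> {a2<..<b2} \<in> sets (borel :: (real \<times> real) measure)"
        by (intro borel_open open_Times) auto
      show "(\<lambda>p. indicator ({a1<..<b1} \<times> {a2<..<b2}) p * (indicator (K n) p * g p)) \<in> borel_measurable lborel"
        by measurable
      show "(\<lambda>p. F N p * (indicator (K n) p * g p)) \<in> borel_measurable lborel" for N
        using borel_measurable_times[OF Fm[of N] gm] by simp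
      show "integrable lborel (\<lambda>p. \<bar>indicator (K n) p * g p\<bar>)" using int by (rule integrable_abs)
      show "AE p in lborel. (\<lambda>N. F N p * (indicator (K n) p * g p))
          \<longlonglongrightarrow> indicator ({a1<..<b1} \<times> {a2<..<b2}) p * (indicator (K n) p * g p)"
      proof (intro AE_I2 tendsto_mult tendsto_const)
        fix p :: "real \<times> real"
        have "(\<lambda>N. F N p) \<longlonglongrightarrow> indicator {a1<..<b1} (fst p) * indicator {a2<..<b2} (snd p)"
          unfolding F_def by (intro tendsto_mult bump_tendsto)
        then show "(\<lambda>N. F N p) \<longlonglongrightarrow> indicator ({a1<..<b1} \<times> {a2<..<b2}) p"
          by (simp add: indicator_times)
      qed
      show "AE p in lborel. norm (F N p * (indicator (K n) p * g p)) \<le> \<bar>indicator (K n) p * g p\<bar>" for N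
      proof (rule AE_I2)
        fix p
        have "norm (F N p * (indicator (K n) p * g p)) = F N p * \<bar>indicator (K n) p * g p\<bar>"
          using F0 by (simp add: abs_mult)
        also have "\<dots> \<le> 1 * \<bar>indicator (K n) p * g p\<bar>" using F0 by (intro mult_right_mono) auto
        finally show "norm (F N p * (indicator (K n) p * g p)) \<le> \<bar>indicator (K n) p * g p\<bar>" by simp
      qed
    qed
    then have "(\<integral>p. indicator ({a1<..<b1} \<times> {a2<..<b2}) p * (indicator (K n) p * g p) \<partial>lborel) = 0"
      by (simp add: zero LIMSEQ_const_iff)
    moreover have "(\<integral>p. indicator ({a1<..<b1} \<times> {a2<..<b2}) p * (indicator (K n) p * g p) \<partial>lborel)
      = (\<integral>p. indicator (box u v) p * (indicator (K n) p * g p) \<partial>lborel)"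
    proof (rule integral_cong_AE)
      have gm [measurable]: "(\<lambda>p. indicator (K n) p * g p) \<in> borel_measurable borel" using int by simp
      have [measurable]: "{a1<..<b1} \<times> {a2<..<b2} \<in> sets (borel :: (real \<times> real) measure)"
        by (intro borel_open open_Times) auto
      show "(\<lambda>p. indicator ({a1<..<b1} \<times> {a2<..<b2}) p * (indicator (K n) p * g p)) \<in> borel_measurable lborel"
        "(\<lambda>p. indicator (box u v) p * (indicator (K n) p * g p)) \<in> borel_measurable lborel"
        by measurable
      \<comment> \<open>Within K n the clipped open box and the given box can differ only on the
        faces of K n, and these are null sets.\<close>
      have ne: "AE p in lborel. fst p \<noteq> k \<and> snd p \<noteq> l" for k l :: real
      proof -
        have "AE p in (lborel :: real measure) \<Otimes>\<^sub>M (lborel :: real measure). fst p \<noteq> k \<and> snd p \<noteq> l"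
        proof (rule lborel_pair.AE_pair_measure)
          show "{p \<in> space (lborel \<Otimes>\<^sub>M lborel). fst p \<noteq> k \<and> snd p \<noteq> l} \<in> sets (lborel \<Otimes>\<^sub>M lborel)"
            by measurable
          show "AE x in lborel. AE y in lborel. fst (x, y) \<noteq> k \<and> snd (x, y) \<noteq> l"
            using AE_lborel_singleton[of k] by eventually_elim (use AE_lborel_singleton[of l] in auto)
        qed
        then show ?thesis unfolding lborel_prod .
      qed
      show "AE p in lborel. indicator ({a1<..<b1} \<times> {a2<..<b2}) p * (indicator (K n) p * g p)
        = indicator (box u v) p * (indicator (K n) p * g p)"
        using ne[of "1 / real (Suc n)" "1 / real (Suc n)"] ne[of "a - 1 / real (Suc n)" "b - 1 / real (Suc n)"]
      proof eventually_elim
        case (elim p)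
        have "p \<in> {a1<..<b1} \<times> {a2<..<b2} \<longleftrightarrow> p \<in> box u v" if "p \<in> K n"
          using elim that by (cases p) (auto simp: K_def uv box_prod box_real a1_def b1_def a2_def b2_def)
        then show ?case by (cases "p \<in> K n") (auto simp: indicator_def)
      qed
    qed
    ultimately show "(\<integral>p. indicator (box u v) p * (indicator (K n) p * g p) \<partial>lborel) = 0" by simp
  qed
  then have "AE p in lborel. \<forall>n. indicator (K n) p * g p = 0"
    unfolding AE_all_countable by blast
  then show ?thesis
  proof eventually_elim
    case (elim p)
    show ?case
    proof
      assume p: "p \<in> {0<..<a} \<times> {0<..<b}"
      define d where "d = Min {fst p, a - fst p, snd p, b - snd p}"
      have "0 < d" using p by (auto simp: d_def mem_Times_iff)
      then obtain n where n: "1 / real (Suc n) < d" using nat_approx_posE by metis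
      have "d \<le> fst p" "d \<le> a - fst p" "d \<le> snd p" "d \<le> b - snd p" by (auto simp: d_def)
      then have "p \<in> K n" using n by (auto simp: K_def mem_Times_iff)
      then show "g p = 0" using elim[rule_format, of n] by simp
    qed
  qed
qed

text \<open>\<open>weak_deriv\<close> restricted to product test functions, whose derivative in the
  direction e is written out by the product rule, and expressed with a product of two
  \<open>Iv\<close> measures so that Fubini applies.\<close>

definition weak_pair :: "real \<Rightarrow> real \<Rightarrow> real \<times> real \<Rightarrow> (real \<times> real \<Rightarrow> real) \<Rightarrow> (real \<times> real \<Rightarrow> real) \<Rightarrow> bool" where
  "weak_pair a b e u v \<longleftrightarrow> (\<forall>\<phi> \<psi>. tst a \<phi> \<longrightarrow> tst b \<psi> \<longrightarrow>
    (\<integral>p. u p * (fst e * (D1 \<phi> (fst p) * \<psi> (snd p)) + snd e * (\<phi> (fst p) * D1 \<psi> (snd p))) \<partial>(Iv a \<Otimes>\<^sub>M Iv b))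
      = - (\<integral>p. v p * (\<phi> (fst p) * \<psi> (snd p)) \<partial>(Iv a \<Otimes>\<^sub>M Iv b)))"

lemma sqint_mult_pair:
  assumes "sqint (Iv a) f" "sqint (Iv b) g"
  shows "sqint (Iv a \<Otimes>\<^sub>M Iv b) (\<lambda>p. f (fst p) * g (snd p))"
proof -
  have [measurable]: "f \<in> borel_measurable borel" "g \<in> borel_measurable borel"
    using assms[THEN sqint_measurable] by auto
  have "integrable (Iv a \<Otimes>\<^sub>M Iv b) (\<lambda>p. (f (fst p))\<^sup>2 * (g (snd p))\<^sup>2)"
    by (intro integrable_pair_mult sqint_integrable_sq assms)
  then show ?thesis by (simp add: sqint_def power_mult_distrib)
qed

lemma sqint_slice_integral:
  assumes q: "sqint (Iv a \<Otimes>\<^sub>M Iv b) q" and a: "0 < a"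
  shows "sqint (Iv b) (\<lambda>t. \<integral>x. q (x, t) \<partial>Iv a)"
proof -
  have [measurable]: "q \<in> borel_measurable (borel \<Otimes>\<^sub>M borel)" using sqint_pair_measurable[OF q] .
  have m: "(\<lambda>t. \<integral>x. q (x, t) \<partial>Iv a) \<in> borel_measurable (Iv b)"
    using integrable_slice_integral(1)[OF Iv2f.sqint_integrable[OF q]] by simp
  have "integrable (Iv b) (\<lambda>t. a * (\<integral>x. (q (x, t))\<^sup>2 \<partial>Iv a))"
    using integrable_slice_integral(1)[OF sqint_integrable_sq[OF q]] by simp
  then have "integrable (Iv b) (\<lambda>t. (\<integral>x. q (x, t) \<partial>Iv a)\<^sup>2)"
  proof (rule Bochner_Integration.integrable_bound)
    show "AE t in Iv b. norm ((\<integral>x. q (x, t) \<partial>Iv a)\<^sup>2) \<le> norm (a * (\<integral>x. (q (x, t))\<^sup>2 \<partial>Iv a))"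
      using AE_sqint_slices(1)[OF q]
    proof eventually_elim
      case (elim t)
      show ?case using Iv.square_integral_le[OF elim] a by (simp add: measure_Iv)
    qed
  qed (use m in measurable)
  then show ?thesis using m by (simp add: sqint_def)
qed

lemma integral_pair_fst_snd:
  fixes f g :: "real \<Rightarrow> real"
  assumes q: "sqint (Iv a \<Otimes>\<^sub>M Iv b) q" and f: "sqint (Iv a) f" and g: "sqint (Iv b) g"
  shows "(\<integral>p. q p * (f (fst p) * g (snd p)) \<partial>(Iv a \<Otimes>\<^sub>M Iv b)) = (\<integral>t. (\<integral>x. q (x, t) * f x \<partial>Iv a) * g t \<partial>Iv b)"
proof -
  have "integrable (Iv a \<Otimes>\<^sub>M Iv b) (\<lambda>p. q p * (f (fst p) * g (snd p)))"
    by (rule sqint_integrable_mult[OF q sqint_mult_pair[OF f g]])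
  from integrable_slice_integral(3,4)[OF this]
  have "(\<integral>p. q p * (f (fst p) * g (snd p)) \<partial>(Iv a \<Otimes>\<^sub>M Iv b)) = (\<integral>t. \<integral>x. q (x, t) * (f x * g t) \<partial>Iv a \<partial>Iv b)"
    by simp
  also have "\<dots> = (\<integral>t. (\<integral>x. q (x, t) * f x \<partial>Iv a) * g t \<partial>Iv b)"
    by (simp flip: mult.assoc)
  finally show ?thesis .
qed

lemma exists_tst_integral_1:
  assumes a: "0 < a"
  obtains \<phi> where "tst a \<phi>" "integral\<^sup>L (Iv a) \<phi> = 1"
proof -
  have [measurable]: "bump 0 a n \<in> borel_measurable borel" for n
    by (intro borel_measurable_continuous_onI Ck_imp_continuous[OF Ck_bump[of 0]])
  have "(\<lambda>n. \<integral>x. bump 0 a n x \<partial>Iv a) \<longlonglongrightarrow> (\<integral>x. indicator {0<..<a} x \<partial>Iv a)"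
    by (rule integral_dominated_convergence[where w="\<lambda>_. 1"]) (auto simp: bump_tendsto abs_of_nonneg bump_bounds)
  moreover have "(\<integral>x. indicator {0<..<a} x \<partial>Iv a) = a"
    using a by (simp add: emeasure_Iv measure_def)
  ultimately have lim: "(\<lambda>n. \<integral>x. bump 0 a n x \<partial>Iv a) \<longlonglongrightarrow> a" by simp
  obtain n where n: "(\<integral>x. bump 0 a n x \<partial>Iv a) \<noteq> 0"
  proof (rule ccontr)
    assume "\<not> thesis"
    with that have "(\<integral>x. bump 0 a n x \<partial>Iv a) = 0" for n by blast
    with lim a show False by (simp add: LIMSEQ_const_iff)
  qed
  define k where "k = (\<integral>x. bump 0 a n x \<partial>Iv a)"
  have b: "tst a (bump 0 a n)" by (rule tst_bump) auto
  \<comment> \<open>This is the bump divided by its integral k, in a form covered by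
    \<open>tst_diff_cmult\<close>.\<close>
  have "tst a (\<lambda>x. bump 0 a n x - (1 - 1 / k) * bump 0 a n x)"
    by (rule tst_diff_cmult[OF b b])
  moreover have "(\<integral>x. bump 0 a n x - (1 - 1 / k) * bump 0 a n x \<partial>Iv a) = 1"
    using sqint_Iv_integrable[OF sqint_tst[OF b]] n by (simp add: k_def left_diff_distrib)
  ultimately show ?thesis by (rule that)
qed

text \<open>Du Bois-Reymond in x with t as a parameter. The difference r of u and the x-primitive of
  v is orthogonal to x-derivatives of test functions, that is, to test functions of integral 0 in x.
  Subtracting from a test function its integral times a fixed \<phi>0 of integral 1 shows that r
  equals its pairing c(t) with \<phi>0.\<close>

lemma weak_pair_x_representation:
  assumes a: "0 < a" and u: "sqint (Iv a \<Otimes>\<^sub>M Iv b) u" and v: "sqint (Iv a \<Otimes>\<^sub>M Iv b) v"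
    and weak: "weak_pair a b (1, 0) u v"
  obtains c where "sqint (Iv b) c"
    "AE x in Iv a. AE t in Iv b. u (x, t) = c t + prim (Iv a) (\<lambda>y. v (y, t)) x"
proof -
  have [measurable]: "u \<in> borel_measurable (borel \<Otimes>\<^sub>M borel)" "v \<in> borel_measurable (borel \<Otimes>\<^sub>M borel)"
    using u v sqint_pair_measurable by auto
  define P where "P p = prim (Iv a) (\<lambda>y. v (y, snd p)) (fst p)" for p
  have P: "sqint (Iv a \<Otimes>\<^sub>M Iv b) P" unfolding P_def by (rule sqint_pair_prim1[OF v a])
  define r where "r p = u p - P p" for p
  have r: "sqint (Iv a \<Otimes>\<^sub>M Iv b) r" unfolding r_def by (intro sqint_diff u P)
  have r0: "(\<integral>p. r p * (D1 \<phi> (fst p) * \<psi> (snd p)) \<partial>(Iv a \<Otimes>\<^sub>M Iv b)) = 0"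
    if \<phi>: "tst a \<phi>" and \<psi>: "tst b \<psi>" for \<phi> \<psi>
  proof -
    note s\<phi> = sqint_tst[OF \<phi>, of a] and sD = sqint_tst[OF tst_D1[OF \<phi>], of a] and s\<psi> = sqint_tst[OF \<psi>, of b]
    have total: "integral\<^sup>L (Iv a) (D1 \<phi>) = 0"
    proof -
      obtain k l where "l < a" "\<And>x. x \<notin> {k..l} \<Longrightarrow> \<phi> x = 0" using \<phi> unfolding tst_def by blast
      then have "\<phi> a = 0" by simp
      moreover have "\<phi> a = prim (Iv a) (D1 \<phi>) a" using a by (intro tst_eq_prim[OF \<phi>]) auto
      moreover have "prim (Iv a) (D1 \<phi>) a = integral\<^sup>L (Iv a) (D1 \<phi>)"
        by (rule prim_total[OF order_refl tst_measurable[OF tst_D1[OF \<phi>]]])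
      ultimately show ?thesis by simp
    qed
    have "(\<integral>p. P p * (D1 \<phi> (fst p) * \<psi> (snd p)) \<partial>(Iv a \<Otimes>\<^sub>M Iv b))
        = (\<integral>t. (\<integral>x. P (x, t) * D1 \<phi> x \<partial>Iv a) * \<psi> t \<partial>Iv b)"
      by (rule integral_pair_fst_snd[OF P sD s\<psi>])
    also have "\<dots> = (\<integral>t. - ((\<integral>x. v (x, t) * \<phi> x \<partial>Iv a) * \<psi> t) \<partial>Iv b)"
    proof (rule integral_cong_AE)
      have [measurable]: "\<phi> \<in> borel_measurable borel" "D1 \<phi> \<in> borel_measurable borel" "\<psi> \<in> borel_measurable borel"
        using \<phi> \<psi> tst_measurable tst_D1 by blast+
      have m: "(\<lambda>t. \<integral>x. P (x, t) * D1 \<phi> x \<partial>Iv a) \<in> borel_measurable (Iv b)"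
        "(\<lambda>t. \<integral>x. v (x, t) * \<phi> x \<partial>Iv a) \<in> borel_measurable (Iv b)"
        using integrable_slice_integral(1)[OF sqint_integrable_mult[OF P sqint_pair_fst[OF sD]]]
          integrable_slice_integral(1)[OF sqint_integrable_mult[OF v sqint_pair_fst[OF s\<phi>]]] by simp_all
      show "(\<lambda>t. (\<integral>x. P (x, t) * D1 \<phi> x \<partial>Iv a) * \<psi> t) \<in> borel_measurable (Iv b)"
        "(\<lambda>t. - ((\<integral>x. v (x, t) * \<phi> x \<partial>Iv a) * \<psi> t)) \<in> borel_measurable (Iv b)"
        using m by measurable
      show "AE t in Iv b. (\<integral>x. P (x, t) * D1 \<phi> x \<partial>Iv a) * \<psi> t = - ((\<integral>x. v (x, t) * \<phi> x \<partial>Iv a) * \<psi> t)"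
        using AE_sqint_slices(1)[OF v]
      proof eventually_elim
        case (elim t)
        have [measurable]: "(\<lambda>x. v (x, t)) \<in> borel_measurable borel" by measurable
        have "(\<integral>x. P (x, t) * D1 \<phi> x \<partial>Iv a) + (\<integral>x. v (x, t) * prim (Iv a) (D1 \<phi>) x \<partial>Iv a) = 0"
          using prim_integral_by_parts[OF sqint_Iv_integrable[OF elim] sqint_Iv_integrable[OF sD]]
          unfolding total P_def fst_conv snd_conv by linarith
        moreover have "(\<integral>x. v (x, t) * prim (Iv a) (D1 \<phi>) x \<partial>Iv a) = (\<integral>x. v (x, t) * \<phi> x \<partial>Iv a)"
          by (rule integral_cong_AE)
             (measurable, use AE_Iv_in in eventually_elim, simp add: tst_eq_prim[OF \<phi>] less_imp_le)
        ultimately have "(\<integral>x. P (x, t) * D1 \<phi> x \<partial>Iv a) = - (\<integral>x. v (x, t) * \<phi> x \<partial>Iv a)" by linarith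
        then show ?case by simp
      qed
    qed
    also have "\<dots> = - (\<integral>p. v p * (\<phi> (fst p) * \<psi> (snd p)) \<partial>(Iv a \<Otimes>\<^sub>M Iv b))"
      using integral_pair_fst_snd[OF v s\<phi> s\<psi>] by simp
    also have "\<dots> = (\<integral>p. u p * (D1 \<phi> (fst p) * \<psi> (snd p)) \<partial>(Iv a \<Otimes>\<^sub>M Iv b))"
      using weak \<phi> \<psi> by (simp add: weak_pair_def)
    finally show ?thesis
      using sqint_integrable_mult[OF u sqint_mult_pair[OF sD s\<psi>]] sqint_integrable_mult[OF P sqint_mult_pair[OF sD s\<psi>]]
      by (simp add: r_def left_diff_distrib)
  qed
  obtain \<phi>0 where \<phi>0: "tst a \<phi>0" and \<phi>0_int: "integral\<^sup>L (Iv a) \<phi>0 = 1"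
    using exists_tst_integral_1[OF a] .
  define c where "c t = (\<integral>x. r (x, t) * \<phi>0 x \<partial>Iv a)" for t
  have c: "sqint (Iv b) c"
  proof -
    obtain B where B: "\<And>x. \<bar>\<phi>0 x\<bar> \<le> B" using tst_bounded[OF \<phi>0] by blast
    have [measurable]: "\<phi>0 \<in> borel_measurable borel" using \<phi>0 tst_measurable by blast
    have "sqint (Iv a \<Otimes>\<^sub>M Iv b) (\<lambda>p. \<phi>0 (fst p) * r p)"
    proof (rule sqint_mult_bounded[OF r])
      show "(\<lambda>p. \<phi>0 (fst p)) \<in> borel_measurable (Iv a \<Otimes>\<^sub>M Iv b)" by measurable
      show "\<bar>\<phi>0 (fst p)\<bar> \<le> B" for p by (rule B)
    qed
    moreover have "c = (\<lambda>t. \<integral>x. \<phi>0 (fst (x, t)) * r (x, t) \<partial>Iv a)"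
      unfolding c_def fst_conv by (intro ext Bochner_Integration.integral_cong refl mult.commute)
    ultimately show ?thesis using sqint_slice_integral[OF _ a, of b "\<lambda>p. \<phi>0 (fst p) * r p"] by simp
  qed
  have rc: "sqint (Iv a \<Otimes>\<^sub>M Iv b) (\<lambda>p. r p - c (snd p))"
    by (rule sqint_diff[OF r sqint_pair_snd[OF c]])
  have [measurable]: "r \<in> borel_measurable (borel \<Otimes>\<^sub>M borel)" "c \<in> borel_measurable borel"
    using sqint_pair_measurable[OF r] sqint_measurable[OF c] by simp_all
  have "AE p in lborel. p \<in> {0<..<a} \<times> {0<..<b} \<longrightarrow> r p - c (snd p) = 0"
  proof (rule AE_eq_0_if_tst_integrals_eq_0)
    have rcm: "(\<lambda>p. r p - c (snd p)) \<in> borel_measurable borel"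
      using sqint_pair_measurable[OF rc] unfolding borel_prod .
    have "set_integrable lborel ({0<..<a} \<times> {0<..<b}) (\<lambda>p. r p - c (snd p))"
      using Iv2f.sqint_integrable[OF rc] unfolding integral_pair_Iv(2)[OF rcm] .
    from set_integrable_subset[OF this]
    show "locally_integrable ({0<..<a} \<times> {0<..<b}) (\<lambda>p. r p - c (snd p))"
      unfolding locally_integrable_def by (simp add: borel_compact)
    fix \<phi> \<psi> assume \<phi>: "tst a \<phi>" and \<psi>: "tst b \<psi>"
    define k where "k = integral\<^sup>L (Iv a) \<phi>"
    define \<gamma> where "\<gamma> x = \<phi> x - k * \<phi>0 x" for x
    have \<gamma>: "tst a \<gamma>" unfolding \<gamma>_def by (rule tst_diff_cmult[OF \<phi> \<phi>0])
    have "integral\<^sup>L (Iv a) \<gamma> = 0"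
      using sqint_Iv_integrable[OF sqint_tst[OF \<phi>, of a]] sqint_Iv_integrable[OF sqint_tst[OF \<phi>0, of a]]
      unfolding \<gamma>_def[abs_def] k_def by (simp add: \<phi>0_int)
    note \<Gamma> = tst_prim[OF \<gamma> this]
    have "0 = (\<integral>p. r p * (\<gamma> (fst p) * \<psi> (snd p)) \<partial>(Iv a \<Otimes>\<^sub>M Iv b))"
      using r0[OF \<Gamma>(1) \<psi>] by (simp add: \<Gamma>(2))
    also have "\<dots> = (\<integral>p. r p * (\<phi> (fst p) * \<psi> (snd p)) - k * (r p * (\<phi>0 (fst p) * \<psi> (snd p))) \<partial>(Iv a \<Otimes>\<^sub>M Iv b))"
      by (intro Bochner_Integration.integral_cong) (auto simp: \<gamma>_def algebra_simps)
    also have "\<dots> = (\<integral>p. r p * (\<phi> (fst p) * \<psi> (snd p)) \<partial>(Iv a \<Otimes>\<^sub>M Iv b))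
        - k * (\<integral>p. r p * (\<phi>0 (fst p) * \<psi> (snd p)) \<partial>(Iv a \<Otimes>\<^sub>M Iv b))"
      using sqint_integrable_mult[OF r sqint_mult_pair[OF sqint_tst[OF \<phi>] sqint_tst[OF \<psi>]]]
        sqint_integrable_mult[OF r sqint_mult_pair[OF sqint_tst[OF \<phi>0] sqint_tst[OF \<psi>]]] by simp
    also have "(\<integral>p. r p * (\<phi>0 (fst p) * \<psi> (snd p)) \<partial>(Iv a \<Otimes>\<^sub>M Iv b)) = (\<integral>t. c t * \<psi> t \<partial>Iv b)"
      using integral_pair_fst_snd[OF r sqint_tst[OF \<phi>0] sqint_tst[OF \<psi>]] by (simp add: c_def)
    also have "k * (\<integral>t. c t * \<psi> t \<partial>Iv b) = (\<integral>p. c (snd p) * (\<phi> (fst p) * \<psi> (snd p)) \<partial>(Iv a \<Otimes>\<^sub>M Iv b))"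
    proof -
      have "(\<integral>p. c (snd p) * (\<phi> (fst p) * \<psi> (snd p)) \<partial>(Iv a \<Otimes>\<^sub>M Iv b))
          = (\<integral>t. (\<integral>x. c t * \<phi> x \<partial>Iv a) * \<psi> t \<partial>Iv b)"
        using integral_pair_fst_snd[OF sqint_pair_snd[OF c] sqint_tst[OF \<phi>] sqint_tst[OF \<psi>]] by simp
      also have "\<dots> = (\<integral>t. k * (c t * \<psi> t) \<partial>Iv b)"
        by (intro Bochner_Integration.integral_cong) (auto simp: k_def)
      finally show ?thesis by simp
    qed
    finally have "(\<integral>p. (r p - c (snd p)) * (\<phi> (fst p) * \<psi> (snd p)) \<partial>(Iv a \<Otimes>\<^sub>M Iv b)) = 0"
      using sqint_integrable_mult[OF r sqint_mult_pair[OF sqint_tst[OF \<phi>] sqint_tst[OF \<psi>]]]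
        sqint_integrable_mult[OF sqint_pair_snd[OF c] sqint_mult_pair[OF sqint_tst[OF \<phi>] sqint_tst[OF \<psi>]], of a]
      by (simp add: left_diff_distrib)
    moreover have "(\<lambda>p. (r p - c (snd p)) * (\<phi> (fst p) * \<psi> (snd p))) \<in> borel_measurable borel"
    proof -
      have [measurable]: "\<phi> \<in> borel_measurable borel" "\<psi> \<in> borel_measurable borel" using \<phi> \<psi> tst_measurable by blast+
      have "(\<lambda>p. (r p - c (snd p)) * (\<phi> (fst p) * \<psi> (snd p))) \<in> borel_measurable (borel \<Otimes>\<^sub>M borel)" by measurable
      then show ?thesis by (simp add: borel_prod)
    qed
    ultimately show "(LINT p:{0<..<a} \<times> {0<..<b}|lborel. (r p - c (snd p)) * (\<phi> (fst p) * \<psi> (snd p))) = 0"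
      by (simp add: integral_pair_Iv(1))
  qed
  then have "AE p in Iv a \<Otimes>\<^sub>M Iv b. u p = c (snd p) + P p"
    unfolding AE_pair_Iv
  proof eventually_elim
    case (elim p)
    then show ?case unfolding r_def by linarith
  qed
  then have "AE x in Iv a. AE t in Iv b. u (x, t) = c (snd (x, t)) + P (x, t)"
    by (rule Iv2.AE_pair)
  then have "AE x in Iv a. AE t in Iv b. u (x, t) = c t + prim (Iv a) (\<lambda>y. v (y, t)) x"
    by (simp add: P_def)
  with c show ?thesis by (rule that)
qed

lemma sqint_swap:
  assumes "sqint (Iv a \<Otimes>\<^sub>M Iv b) u"
  shows "sqint (Iv b \<Otimes>\<^sub>M Iv a) (\<lambda>p. u (snd p, fst p))"
proof -
  have [measurable]: "u \<in> borel_measurable (borel \<Otimes>\<^sub>M borel)" using sqint_pair_measurable[OF assms] .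
  show ?thesis
    using Iv2.integrable_product_swap[OF sqint_integrable_sq[OF assms]] by (simp add: sqint_def split_beta')
qed

lemma integral_pair_swap:
  fixes f :: "real \<times> real \<Rightarrow> real"
  assumes "f \<in> borel_measurable (borel \<Otimes>\<^sub>M borel)"
  shows "(\<integral>p. f (snd p, fst p) \<partial>(Iv b \<Otimes>\<^sub>M Iv a)) = integral\<^sup>L (Iv a \<Otimes>\<^sub>M Iv b) f"
  using Iv2.integral_product_swap[of f a b] assms by (simp add: split_beta')

text \<open>The representation in x, applied after exchanging the variables.\<close>

lemma weak_pair_t_representation:
  assumes b: "0 < b" and u: "sqint (Iv a \<Otimes>\<^sub>M Iv b) u" and v: "sqint (Iv a \<Otimes>\<^sub>M Iv b) v"
    and weak: "weak_pair a b (0, 1) u v"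
  obtains c where "sqint (Iv a) c"
    "AE x in Iv a. AE t in Iv b. u (x, t) = c x + prim (Iv b) (\<lambda>s. v (x, s)) t"
proof -
  have [measurable]: "u \<in> borel_measurable (borel \<Otimes>\<^sub>M borel)" "v \<in> borel_measurable (borel \<Otimes>\<^sub>M borel)"
    using u v sqint_pair_measurable by auto
  have "weak_pair b a (1, 0) (\<lambda>p. u (snd p, fst p)) (\<lambda>p. v (snd p, fst p))"
    unfolding weak_pair_def
  proof (intro allI impI)
    fix \<phi> \<psi> assume \<phi>: "tst b \<phi>" and \<psi>: "tst a \<psi>"
    have [measurable]: "\<phi> \<in> borel_measurable borel" "D1 \<phi> \<in> borel_measurable borel" "\<psi> \<in> borel_measurable borel"
      using \<phi> \<psi> tst_measurable tst_D1 by blast+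
    have "(\<integral>p. u (snd p, fst p) * (fst (1, 0) * (D1 \<phi> (fst p) * \<psi> (snd p)) + snd (1, 0) * (\<phi> (fst p) * D1 \<psi> (snd p))) \<partial>(Iv b \<Otimes>\<^sub>M Iv a))
      = (\<integral>p. u p * (\<psi> (fst p) * D1 \<phi> (snd p)) \<partial>(Iv a \<Otimes>\<^sub>M Iv b))"
      using integral_pair_swap[of "\<lambda>p. u p * (\<psi> (fst p) * D1 \<phi> (snd p))" b a] by (simp add: mult.commute)
    also have "\<dots> = - (\<integral>p. v p * (\<psi> (fst p) * \<phi> (snd p)) \<partial>(Iv a \<Otimes>\<^sub>M Iv b))"
      using weak \<phi> \<psi> by (simp add: weak_pair_def)
    also have "\<dots> = - (\<integral>p. v (snd p, fst p) * (\<phi> (fst p) * \<psi> (snd p)) \<partial>(Iv b \<Otimes>\<^sub>M Iv a))"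
      using integral_pair_swap[of "\<lambda>p. v p * (\<psi> (fst p) * \<phi> (snd p))" b a] by (simp add: mult.commute)
    finally show "(\<integral>p. u (snd p, fst p) * (fst (1, 0) * (D1 \<phi> (fst p) * \<psi> (snd p)) + snd (1, 0) * (\<phi> (fst p) * D1 \<psi> (snd p))) \<partial>(Iv b \<Otimes>\<^sub>M Iv a))
      = - (\<integral>p. v (snd p, fst p) * (\<phi> (fst p) * \<psi> (snd p)) \<partial>(Iv b \<Otimes>\<^sub>M Iv a))" .
  qed
  from weak_pair_x_representation[OF b sqint_swap[OF u] sqint_swap[OF v] this]
  obtain c where c: "sqint (Iv a) c"
    and AE: "AE t in Iv b. AE x in Iv a. u (x, t) = c x + prim (Iv b) (\<lambda>s. v (x, s)) t" by auto
  have [measurable]: "c \<in> borel_measurable borel" using sqint_measurable[OF c] by simp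
  have "(AE x in Iv a. AE t in Iv b. u (x, t) = (\<lambda>p. c (fst p) + prim (Iv b) (\<lambda>s. v (fst p, s)) (snd p)) (x, t))"
    by (subst AE_swap_eq(1)) (measurable, use AE in simp)
  with c show ?thesis by (intro that) auto
qed

lemma tst_pair_has_derivative:
  assumes "tst a \<phi>" "tst b \<psi>"
  shows "((\<lambda>p. \<phi> (fst p) * \<psi> (snd p)) has_derivative
    (\<lambda>e. fst e * (D1 \<phi> (fst p) * \<psi> (snd p)) + snd e * (\<phi> (fst p) * D1 \<psi> (snd p)))) (at p)"
proof -
  have 1: "((\<lambda>p. \<phi> (fst p)) has_derivative (\<lambda>e. D1 \<phi> (fst p) * fst e)) (at p)"
    by (rule has_derivative_compose[OF has_derivative_fst[OF has_derivative_ident]])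
       (use tst_has_derivative[OF assms(1)] in \<open>simp add: has_field_derivative_def\<close>)
  have 2: "((\<lambda>p. \<psi> (snd p)) has_derivative (\<lambda>e. D1 \<psi> (snd p) * snd e)) (at p)"
    by (rule has_derivative_compose[OF has_derivative_snd[OF has_derivative_ident]])
       (use tst_has_derivative[OF assms(2)] in \<open>simp add: has_field_derivative_def\<close>)
  show ?thesis
    by (rule has_derivative_eq_rhs[OF has_derivative_mult[OF 1 2]]) (auto simp: algebra_simps)
qed

lemma frechet_derivative_tst_pair:
  assumes "tst a \<phi>" "tst b \<psi>"
  shows "frechet_derivative (\<lambda>p. \<phi> (fst p) * \<psi> (snd p)) (at p) e
    = fst e * (D1 \<phi> (fst p) * \<psi> (snd p)) + snd e * (\<phi> (fst p) * D1 \<psi> (snd p))"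
  using fun_cong[OF frechet_derivative_at[OF tst_pair_has_derivative[OF assms, of p]], of e] by simp

lemma tst_pair_support:
  assumes "tst a \<phi>" "tst b \<psi>"
  obtains K where "compact K" "K \<subseteq> {0<..<a} \<times> {0<..<b}" "\<And>p. p \<notin> K \<Longrightarrow> \<phi> (fst p) * \<psi> (snd p) = 0"
proof -
  from assms obtain k1 l1 k2 l2 where *: "0 < k1" "l1 < a" "\<And>x. x \<notin> {k1..l1} \<Longrightarrow> \<phi> x = 0"
    "0 < k2" "l2 < b" "\<And>x. x \<notin> {k2..l2} \<Longrightarrow> \<psi> x = 0"
    unfolding tst_def by blast
  show ?thesis
  proof (rule that[of "{k1..l1} \<times> {k2..l2}"])
    show "compact ({k1..l1} \<times> {k2..l2})" by (intro compact_Times) auto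
    show "{k1..l1} \<times> {k2..l2} \<subseteq> {0<..<a} \<times> {0<..<b}" using * by auto
    show "\<phi> (fst p) * \<psi> (snd p) = 0" if "p \<notin> {k1..l1} \<times> {k2..l2}" for p
      using that *(3)[of "fst p"] *(6)[of "snd p"] by (auto simp: mem_Times_iff)
  qed
qed

lemma test_function_tst_pair:
  assumes "tst a \<phi>" "tst b \<psi>"
  shows "test_function ({0<..<a} \<times> {0<..<b}) (\<lambda>p. \<phi> (fst p) * \<psi> (snd p))"
proof -
  have "Ck n (\<lambda>p. \<phi> (fst p + 0) * \<psi> (snd p + 0))" for n
    using assms unfolding tst_def
    by (intro Ck_mult Ck_compose_affine bounded_linear_fst bounded_linear_snd) auto
  then have Ck: "\<forall>n. Ck n (\<lambda>p. \<phi> (fst p) * \<psi> (snd p))" by simp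
  obtain K where "compact K" "K \<subseteq> {0<..<a} \<times> {0<..<b}" "\<And>p. p \<notin> K \<Longrightarrow> \<phi> (fst p) * \<psi> (snd p) = 0"
    using tst_pair_support[OF assms] by blast
  then show ?thesis using Ck unfolding test_function_def by blast
qed

lemma set_integrable_mult_tst:
  fixes v :: "real \<times> real \<Rightarrow> real"
  assumes v: "locally_integrable ({0<..<a} \<times> {0<..<b}) v" and \<phi>: "tst a \<phi>" and \<psi>: "tst b \<psi>"
  shows "set_integrable lborel ({0<..<a} \<times> {0<..<b}) (\<lambda>p. v p * (\<phi> (fst p) * \<psi> (snd p)))"
proof -
  obtain K where K: "compact K" "K \<subseteq> {0<..<a} \<times> {0<..<b}" "\<And>p. p \<notin> K \<Longrightarrow> \<phi> (fst p) * \<psi> (snd p) = 0"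
    using tst_pair_support[OF \<phi> \<psi>] by blast
  have "set_integrable lborel K v" using v K unfolding locally_integrable_def by blast
  then have int: "integrable lborel (\<lambda>p. indicator K p * v p)" by (simp add: set_integrable_def)
  obtain B1 B2 where B: "\<And>x. \<bar>\<phi> x\<bar> \<le> B1" "\<And>x. \<bar>\<psi> x\<bar> \<le> B2"
    using tst_bounded[OF \<phi>] tst_bounded[OF \<psi>] by blast
  have [measurable]: "\<phi> \<in> borel_measurable borel" "\<psi> \<in> borel_measurable borel" using \<phi> \<psi> tst_measurable by blast+
  have "integrable lborel (\<lambda>p. (indicator K p * v p) * (\<phi> (fst p) * \<psi> (snd p)))"
  proof (rule integrable_mult_bounded(1)[OF int, where k="B1 * B2"])
    have "(\<lambda>p. \<phi> (fst p) * \<psi> (snd p)) \<in> borel_measurable (borel \<Otimes>\<^sub>M borel)" by measurable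
    then show "(\<lambda>p. \<phi> (fst p) * \<psi> (snd p)) \<in> borel_measurable lborel" by (simp add: borel_prod)
    have "0 \<le> B1" using B(1)[of 0] by linarith
    then show "\<bar>\<phi> (fst p) * \<psi> (snd p)\<bar> \<le> B1 * B2" for p
      using B by (auto simp: abs_mult intro!: mult_mono)
  qed
  moreover have "(indicator K p * v p) * (\<phi> (fst p) * \<psi> (snd p))
      = indicator ({0<..<a} \<times> {0<..<b}) p *\<^sub>R (v p * (\<phi> (fst p) * \<psi> (snd p)))" for p
  proof (cases "p \<in> K")
    case True
    then have "p \<in> {0<..<a} \<times> {0<..<b}" using K by blast
    then show ?thesis using True by simp
  next
    case False
    then show ?thesis using K(3)[OF False] by (simp only: mult_zero_right scaleR_zero_right)
  qed
  ultimately show ?thesis unfolding set_integrable_def by simp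
qed

lemma weak_deriv_tst:
  assumes w: "weak_deriv ({0<..<a} \<times> {0<..<b}) e u v" and \<phi>: "tst a \<phi>" and \<psi>: "tst b \<psi>"
  shows "(LINT p:{0<..<a} \<times> {0<..<b}|lborel. u p * (fst e * (D1 \<phi> (fst p) * \<psi> (snd p)) + snd e * (\<phi> (fst p) * D1 \<psi> (snd p))))
      = - (LINT p:{0<..<a} \<times> {0<..<b}|lborel. v p * (\<phi> (fst p) * \<psi> (snd p)))"
    and "set_integrable lborel ({0<..<a} \<times> {0<..<b})
      (\<lambda>p. u p * (fst e * (D1 \<phi> (fst p) * \<psi> (snd p)) + snd e * (\<phi> (fst p) * D1 \<psi> (snd p))))"
    and "set_integrable lborel ({0<..<a} \<times> {0<..<b}) (\<lambda>p. v p * (\<phi> (fst p) * \<psi> (snd p)))"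
proof -
  have u: "locally_integrable ({0<..<a} \<times> {0<..<b}) u" and v: "locally_integrable ({0<..<a} \<times> {0<..<b}) v"
    using w by (auto simp: weak_deriv_def)
  show "(LINT p:{0<..<a} \<times> {0<..<b}|lborel. u p * (fst e * (D1 \<phi> (fst p) * \<psi> (snd p)) + snd e * (\<phi> (fst p) * D1 \<psi> (snd p))))
      = - (LINT p:{0<..<a} \<times> {0<..<b}|lborel. v p * (\<phi> (fst p) * \<psi> (snd p)))"
    using w test_function_tst_pair[OF \<phi> \<psi>] unfolding weak_deriv_def
    by (auto simp: frechet_derivative_tst_pair[OF \<phi> \<psi>])
  have "set_integrable lborel ({0<..<a} \<times> {0<..<b})
      (\<lambda>p. fst e * (u p * (D1 \<phi> (fst p) * \<psi> (snd p))) + snd e * (u p * (\<phi> (fst p) * D1 \<psi> (snd p))))"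
    by (intro set_integral_add set_integrable_mult_right set_integrable_mult_tst u \<phi> \<psi> tst_D1)
  then show "set_integrable lborel ({0<..<a} \<times> {0<..<b})
      (\<lambda>p. u p * (fst e * (D1 \<phi> (fst p) * \<psi> (snd p)) + snd e * (\<phi> (fst p) * D1 \<psi> (snd p))))"
    by (simp add: algebra_simps)
  show "set_integrable lborel ({0<..<a} \<times> {0<..<b}) (\<lambda>p. v p * (\<phi> (fst p) * \<psi> (snd p)))"
    by (rule set_integrable_mult_tst[OF v \<phi> \<psi>])
qed

text \<open>The function spaces and the two problems each come with their own witnesses for the weak
  derivatives; this is what identifies them.\<close>

lemma weak_deriv_unique:
  fixes a b :: real
  assumes w1: "weak_deriv ({0<..<a} \<times> {0<..<b}) e u1 v1" and w2: "weak_deriv ({0<..<a} \<times> {0<..<b}) e u2 v2"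
    and eq: "AE p in lborel. p \<in> {0<..<a} \<times> {0<..<b} \<longrightarrow> u1 p = u2 p"
  shows "AE p in lborel. p \<in> {0<..<a} \<times> {0<..<b} \<longrightarrow> v1 p = v2 p"
proof -
  have "AE p in lborel. p \<in> {0<..<a} \<times> {0<..<b} \<longrightarrow> v1 p - v2 p = 0"
  proof (rule AE_eq_0_if_tst_integrals_eq_0)
    show "locally_integrable ({0<..<a} \<times> {0<..<b}) (\<lambda>p. v1 p - v2 p)"
      using w1 w2 unfolding weak_deriv_def locally_integrable_def by (auto intro: set_integral_diff)
    fix \<phi> \<psi> assume \<phi>: "tst a \<phi>" and \<psi>: "tst b \<psi>"
    note W1 = weak_deriv_tst[OF w1 \<phi> \<psi>] and W2 = weak_deriv_tst[OF w2 \<phi> \<psi>]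
    have "(LINT p:{0<..<a} \<times> {0<..<b}|lborel. u1 p * (fst e * (D1 \<phi> (fst p) * \<psi> (snd p)) + snd e * (\<phi> (fst p) * D1 \<psi> (snd p))))
      = (LINT p:{0<..<a} \<times> {0<..<b}|lborel. u2 p * (fst e * (D1 \<phi> (fst p) * \<psi> (snd p)) + snd e * (\<phi> (fst p) * D1 \<psi> (snd p))))"
      unfolding set_lebesgue_integral_def
      by (rule integral_cong_AE)
         (use W1(2) W2(2) in \<open>simp_all add: set_integrable_def del: real_scaleR_def\<close>,
          use eq in eventually_elim, auto simp: indicator_def)
    then show "(LINT p:{0<..<a} \<times> {0<..<b}|lborel. (v1 p - v2 p) * (\<phi> (fst p) * \<psi> (snd p))) = 0"
      using W1(1,3) W2(1,3) by (simp add: left_diff_distrib set_integral_diff)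
  qed
  then show ?thesis by eventually_elim auto
qed

lemma weak_deriv_imp_weak_pair:
  assumes w: "weak_deriv ({0<..<a} \<times> {0<..<b}) e u v"
    and u': "sqint (Iv a \<Otimes>\<^sub>M Iv b) u'" "AE p in lborel. p \<in> {0<..<a} \<times> {0<..<b} \<longrightarrow> u' p = u p"
    and v': "sqint (Iv a \<Otimes>\<^sub>M Iv b) v'" "AE p in lborel. p \<in> {0<..<a} \<times> {0<..<b} \<longrightarrow> v' p = v p"
  shows "weak_pair a b e u' v'"
  unfolding weak_pair_def
proof (intro allI impI)
  fix \<phi> \<psi> assume \<phi>: "tst a \<phi>" and \<psi>: "tst b \<psi>"
  note W = weak_deriv_tst[OF w \<phi> \<psi>]
  have [measurable]: "\<phi> \<in> borel_measurable borel" "\<psi> \<in> borel_measurable borel"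
    "D1 \<phi> \<in> borel_measurable borel" "D1 \<psi> \<in> borel_measurable borel"
    using \<phi> \<psi> tst_measurable tst_D1 by blast+
  have [measurable]: "u' \<in> borel_measurable (borel \<Otimes>\<^sub>M borel)" "v' \<in> borel_measurable (borel \<Otimes>\<^sub>M borel)"
    using u' v' sqint_pair_measurable by auto
  let ?F = "\<lambda>p. fst e * (D1 \<phi> (fst p) * \<psi> (snd p)) + snd e * (\<phi> (fst p) * D1 \<psi> (snd p))"
  let ?G = "\<lambda>p. \<phi> (fst p) * \<psi> (snd p)"
  have m: "(\<lambda>p. u' p * ?F p) \<in> borel_measurable borel" "(\<lambda>p. v' p * ?G p) \<in> borel_measurable borel"
    unfolding borel_prod[symmetric] by measurable
  have S: "{0<..<a} \<times> {0<..<b} \<in> sets lborel" by simp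
  have "(\<integral>p. u' p * ?F p \<partial>(Iv a \<Otimes>\<^sub>M Iv b)) = (LINT p:{0<..<a} \<times> {0<..<b}|lborel. u p * ?F p)"
    unfolding integral_pair_Iv(1)[OF m(1)] set_lebesgue_integral_def
  proof (rule integral_cong_AE)
    show "(\<lambda>p. indicator ({0<..<a} \<times> {0<..<b}) p *\<^sub>R (u' p * ?F p)) \<in> borel_measurable lborel"
      using m(1) S by (intro borel_measurable_scaleR) auto
    show "(\<lambda>p. indicator ({0<..<a} \<times> {0<..<b}) p *\<^sub>R (u p * ?F p)) \<in> borel_measurable lborel"
      using W(2) unfolding set_integrable_def by (rule borel_measurable_integrable)
    show "AE p in lborel. indicator ({0<..<a} \<times> {0<..<b}) p *\<^sub>R (u' p * ?F p)
        = indicator ({0<..<a} \<times> {0<..<b}) p *\<^sub>R (u p * ?F p)"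
      using u'(2) by eventually_elim (auto simp: indicator_def)
  qed
  also have "\<dots> = - (LINT p:{0<..<a} \<times> {0<..<b}|lborel. v p * ?G p)" by (rule W(1))
  also have "(LINT p:{0<..<a} \<times> {0<..<b}|lborel. v p * ?G p) = (\<integral>p. v' p * ?G p \<partial>(Iv a \<Otimes>\<^sub>M Iv b))"
    unfolding integral_pair_Iv(1)[OF m(2)] set_lebesgue_integral_def
  proof (rule integral_cong_AE)
    show "(\<lambda>p. indicator ({0<..<a} \<times> {0<..<b}) p *\<^sub>R (v' p * ?G p)) \<in> borel_measurable lborel"
      using m(2) S by (intro borel_measurable_scaleR) auto
    show "(\<lambda>p. indicator ({0<..<a} \<times> {0<..<b}) p *\<^sub>R (v p * ?G p)) \<in> borel_measurable lborel"
      using W(3) unfolding set_integrable_def by (rule borel_measurable_integrable)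
    show "AE p in lborel. indicator ({0<..<a} \<times> {0<..<b}) p *\<^sub>R (v p * ?G p)
        = indicator ({0<..<a} \<times> {0<..<b}) p *\<^sub>R (v' p * ?G p)"
      using v'(2) by eventually_elim (auto simp: indicator_def)
  qed
  finally show "(\<integral>p. u' p * ?F p \<partial>(Iv a \<Otimes>\<^sub>M Iv b)) = - (\<integral>p. v' p * ?G p \<partial>(Iv a \<Otimes>\<^sub>M Iv b))" .
qed

section \<open>Borel representatives and continuity in time\<close>

definition cut :: "real \<Rightarrow> real \<Rightarrow> (real \<times> real \<Rightarrow> real) \<Rightarrow> real \<times> real \<Rightarrow> real" where
  "cut a b v p = indicator ({0<..<a} \<times> {0<..<b}) p * v p"

lemma cut_eq: "p \<in> {0<..<a} \<times> {0<..<b} \<Longrightarrow> cut a b v p = v p"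
  by (simp add: cut_def)

text \<open>\<open>set_borel_measurable\<close> speaks only of the function multiplied by the
  indicator of the rectangle. Passing from a solution to its \<open>cut\<close> makes it Borel on
  the plane and leaves it unchanged inside the rectangle.\<close>

lemma cut_measurable:
  assumes "set_borel_measurable lborel ({0<..<a} \<times> {0<..<b}) v"
  shows "cut a b v \<in> borel_measurable (borel \<Otimes>\<^sub>M borel)"
  using assms by (simp add: set_borel_measurable_def cut_def[abs_def] borel_prod)

lemma L2_imp_sqint:
  assumes "L2 {0<..<a} v"
  shows "sqint (Iv a) (\<lambda>x. indicator {0<..<a} x * v x)"
    "(\<integral>x. (indicator {0<..<a} x * v x)\<^sup>2 \<partial>Iv a) = (L2_norm_on {0<..<a} v)\<^sup>2"
proof -
  have m [measurable]: "(\<lambda>x. indicator {0<..<a} x * v x) \<in> borel_measurable borel"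
    using assms by (simp add: L2_def set_borel_measurable_def)
  have eq: "indicator {0<..<a} x *\<^sub>R (indicator {0<..<a} x * v x)\<^sup>2 = indicator {0<..<a} x *\<^sub>R (v x)\<^sup>2" for x
    by (simp add: indicator_def)
  have "set_integrable lborel {0<..<a} (\<lambda>x. (indicator {0<..<a} x * v x)\<^sup>2)"
    using assms unfolding L2_def set_integrable_def eq by blast
  then show "sqint (Iv a) (\<lambda>x. indicator {0<..<a} x * v x)"
    by (simp add: sqint_def integrable_Iv)
  have "0 \<le> (LINT x:{0<..<a}|lborel. (v x)\<^sup>2)"
    unfolding set_lebesgue_integral_def by (intro Bochner_Integration.integral_nonneg) auto
  then show "(\<integral>x. (indicator {0<..<a} x * v x)\<^sup>2 \<partial>Iv a) = (L2_norm_on {0<..<a} v)\<^sup>2"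
    by (subst integral_Iv) (simp_all add: L2_norm_on_def set_lebesgue_integral_def eq del: real_scaleR_def)
qed

lemma sqint_cutI:
  assumes m: "set_borel_measurable lborel ({0<..<a} \<times> {0<..<b}) v"
    and AE: "AE t in Iv b. L2 {0<..<a} (\<lambda>x. v (x, t)) \<and> L2_norm_on {0<..<a} (\<lambda>x. v (x, t)) \<le> C"
  shows "sqint (Iv a \<Otimes>\<^sub>M Iv b) (cut a b v)"
proof -
  have [measurable]: "cut a b v \<in> borel_measurable (borel \<Otimes>\<^sub>M borel)" by (rule cut_measurable[OF m])
  have m2: "(\<lambda>p. (cut a b v p)\<^sup>2) \<in> borel_measurable (Iv a \<Otimes>\<^sub>M Iv b)" by measurable
  have "(\<integral>\<^sup>+ p. ennreal ((cut a b v p)\<^sup>2) \<partial>(Iv a \<Otimes>\<^sub>M Iv b)) = (\<integral>\<^sup>+ t. \<integral>\<^sup>+ x. ennreal ((cut a b v (x, t))\<^sup>2) \<partial>Iv a \<partial>Iv b)"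
    using Iv2.nn_integral_snd[of "\<lambda>p. ennreal ((cut a b v p)\<^sup>2)" a b] m2 by simp
  also have "\<dots> \<le> (\<integral>\<^sup>+ t. ennreal (C\<^sup>2) \<partial>Iv b)"
  proof (rule nn_integral_mono_AE)
    show "AE t in Iv b. (\<integral>\<^sup>+ x. ennreal ((cut a b v (x, t))\<^sup>2) \<partial>Iv a) \<le> ennreal (C\<^sup>2)"
      using AE AE_Iv_in
    proof eventually_elim
      case (elim t)
      have eq: "cut a b v (x, t) = indicator {0<..<a} x * v (x, t)" for x
        using elim by (simp add: cut_def indicator_times)
      note L2 = L2_imp_sqint[OF conjunct1[OF elim(1)]]
      have "(\<integral>\<^sup>+ x. ennreal ((cut a b v (x, t))\<^sup>2) \<partial>Iv a) = ennreal (\<integral>x. (indicator {0<..<a} x * v (x, t))\<^sup>2 \<partial>Iv a)"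
        unfolding eq by (rule nn_integral_eq_integral[OF sqint_integrable_sq[OF L2(1)]]) simp
      also have "\<dots> \<le> ennreal (C\<^sup>2)"
      proof -
        have "0 \<le> L2_norm_on {0<..<a} (\<lambda>x. v (x, t))"
          unfolding L2_norm_on_def set_lebesgue_integral_def
          by (intro real_sqrt_ge_zero Bochner_Integration.integral_nonneg) auto
        then show ?thesis unfolding L2(2) using elim by (intro ennreal_leI power_mono) auto
      qed
      finally show ?case .
    qed
  qed
  also have "\<dots> < \<infinity>" by (simp add: ennreal_mult_less_top Iv.emeasure_eq_measure)
  finally show ?thesis
    unfolding sqint_def by (intro conjI integrableI_nonneg) (auto simp: m2)
qed

lemma sqint_cut_Linf_L2: "Linf_L2 a b v \<Longrightarrow> sqint (Iv a \<Otimes>\<^sub>M Iv b) (cut a b v)"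
  unfolding Linf_L2_def using sqint_cutI[of a b v] unfolding AE_Iv by blast

lemma C_L2_norm_sq:
  assumes C: "C_L2 L T v" and s: "s \<in> {0..T}" and t: "t \<in> {0..T}"
  shows "(\<integral>x. (indicator {0<..<L} x * (v (x, s) - v (x, t)))\<^sup>2 \<partial>Iv L) = (L2_norm_on {0<..<L} (\<lambda>x. v (x, s) - v (x, t)))\<^sup>2"
    and "sqint (Iv L) (\<lambda>x. indicator {0<..<L} x * v (x, s))"
    and "sqint (Iv L) (\<lambda>x. indicator {0<..<L} x * (v (x, s) - v (x, t)))"
proof -
  have L2s: "L2 {0<..<L} (\<lambda>x. v (x, s))" and L2t: "L2 {0<..<L} (\<lambda>x. v (x, t))"
    using C s t by (auto simp: C_L2_def)
  show "sqint (Iv L) (\<lambda>x. indicator {0<..<L} x * v (x, s))" by (rule L2_imp_sqint(1)[OF L2s])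
  have sq: "sqint (Iv L) (\<lambda>x. indicator {0<..<L} x * v (x, s) - indicator {0<..<L} x * v (x, t))"
    by (rule sqint_diff[OF L2_imp_sqint(1)[OF L2s] L2_imp_sqint(1)[OF L2t]])
  have eq: "indicator {0<..<L} x * v (x, s) - indicator {0<..<L} x * v (x, t)
      = indicator {0<..<L} x * (v (x, s) - v (x, t))" for x
    by (simp add: right_diff_distrib)
  show sq': "sqint (Iv L) (\<lambda>x. indicator {0<..<L} x * (v (x, s) - v (x, t)))"
    using sq unfolding eq .
  have m: "(\<lambda>x. indicator {0<..<L} x * (v (x, s) - v (x, t))) \<in> borel_measurable borel"
    using sqint_measurable[OF sq'] by simp
  have e2: "indicator {0<..<L} x *\<^sub>R (indicator {0<..<L} x * (v (x, s) - v (x, t)))\<^sup>2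
      = indicator {0<..<L} x *\<^sub>R (v (x, s) - v (x, t))\<^sup>2" for x
    by (simp add: indicator_def)
  have "integrable (Iv L) (\<lambda>x. (indicator {0<..<L} x * (v (x, s) - v (x, t)))\<^sup>2)"
    by (rule sqint_integrable_sq[OF sq'])
  then have "set_integrable lborel {0<..<L} (\<lambda>x. (indicator {0<..<L} x * (v (x, s) - v (x, t)))\<^sup>2)"
    by (subst (asm) integrable_Iv) (use m in measurable)
  then have "set_integrable lborel {0<..<L} (\<lambda>x. (v (x, s) - v (x, t))\<^sup>2)"
    unfolding set_integrable_def e2 .
  moreover have "set_borel_measurable lborel {0<..<L} (\<lambda>x. v (x, s) - v (x, t))"
    using m by (simp add: set_borel_measurable_def)
  ultimately have "L2 {0<..<L} (\<lambda>x. v (x, s) - v (x, t))" by (simp add: L2_def)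
  from L2_imp_sqint(2)[OF this]
  show "(\<integral>x. (indicator {0<..<L} x * (v (x, s) - v (x, t)))\<^sup>2 \<partial>Iv L) = (L2_norm_on {0<..<L} (\<lambda>x. v (x, s) - v (x, t)))\<^sup>2" .
qed

lemma C_L2_close:
  assumes C: "C_L2 L T v" and t: "t \<in> {0..T}" and e: "0 < e"
  obtains \<delta> where "0 < \<delta>"
    "\<And>s. s \<in> {0..T} \<Longrightarrow> \<bar>s - t\<bar> < \<delta> \<Longrightarrow> (\<integral>x. (indicator {0<..<L} x * (v (x, s) - v (x, t)))\<^sup>2 \<partial>Iv L) < e"
proof -
  have "((\<lambda>s. L2_norm_on {0<..<L} (\<lambda>x. v (x, s) - v (x, t))) \<longlongrightarrow> 0) (at t within {0..T})"
    using C t by (auto simp: C_L2_def)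
  then have "((\<lambda>s. (L2_norm_on {0<..<L} (\<lambda>x. v (x, s) - v (x, t)))\<^sup>2) \<longlongrightarrow> 0\<^sup>2) (at t within {0..T})"
    by (rule tendsto_power)
  then have "eventually (\<lambda>s. (L2_norm_on {0<..<L} (\<lambda>x. v (x, s) - v (x, t)))\<^sup>2 < e) (at t within {0..T})"
    by (rule order_tendstoD) (use e in simp)
  then obtain \<delta> where \<delta>: "0 < \<delta>" "\<And>s. s \<in> {0..T} \<Longrightarrow> s \<noteq> t \<Longrightarrow> dist s t < \<delta> \<Longrightarrow>
      (L2_norm_on {0<..<L} (\<lambda>x. v (x, s) - v (x, t)))\<^sup>2 < e"
    unfolding eventually_at by blast
  show ?thesis
  proof (rule that[OF \<delta>(1)])
    fix s assume s: "s \<in> {0..T}" "\<bar>s - t\<bar> < \<delta>"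
    show "(\<integral>x. (indicator {0<..<L} x * (v (x, s) - v (x, t)))\<^sup>2 \<partial>Iv L) < e"
    proof (cases "s = t")
      case True
      then show ?thesis using e by simp
    next
      case False
      then show ?thesis
        unfolding C_L2_norm_sq(1)[OF C s(1) t] using \<delta>(2)[OF s(1)] s(2) by (simp add: dist_real_def)
    qed
  qed
qed

lemma integral_square_add_le:
  assumes "sqint M f" "sqint M g"
  shows "(\<integral>x. (f x + g x)\<^sup>2 \<partial>M) \<le> 2 * (\<integral>x. (f x)\<^sup>2 \<partial>M) + 2 * (\<integral>x. (g x)\<^sup>2 \<partial>M)"
proof -
  have "(\<integral>x. (f x + g x)\<^sup>2 \<partial>M) \<le> (\<integral>x. 2 * (f x)\<^sup>2 + 2 * (g x)\<^sup>2 \<partial>M)"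
  proof (rule integral_mono)
    show "integrable M (\<lambda>x. (f x + g x)\<^sup>2)" by (rule sqint_integrable_sq[OF sqint_add[OF assms]])
    show "integrable M (\<lambda>x. 2 * (f x)\<^sup>2 + 2 * (g x)\<^sup>2)"
      using assms[THEN sqint_integrable_sq] by simp
    show "(f x + g x)\<^sup>2 \<le> 2 * (f x)\<^sup>2 + 2 * (g x)\<^sup>2" for x
      using zero_le_power2[of "f x - g x"] by (simp add: power2_sum power2_diff)
  qed
  also have "\<dots> = 2 * (\<integral>x. (f x)\<^sup>2 \<partial>M) + 2 * (\<integral>x. (g x)\<^sup>2 \<partial>M)"
    using assms[THEN sqint_integrable_sq] by simp
  finally show ?thesis .
qed

text \<open>\<open>C_L2\<close> states no bound in time. The squared norm N is locally bounded, by 2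
  N(t) + 2 near t, and times along which it grew beyond all bounds would accumulate in the compact
  interval [0, T].\<close>

lemma sqint_cut_C_L2:
  assumes C: "C_L2 L T v"
  shows "sqint (Iv L \<Otimes>\<^sub>M Iv T) (cut L T v)"
proof -
  define N where "N t = (\<integral>x. (indicator {0<..<L} x * v (x, t))\<^sup>2 \<partial>Iv L)" for t
  have near: "\<exists>\<delta>>0. \<forall>s\<in>{0..T}. \<bar>s - t\<bar> < \<delta> \<longrightarrow> N s \<le> 2 * N t + 2" if t: "t \<in> {0..T}" for t
  proof -
    obtain \<delta> where \<delta>: "0 < \<delta>"
      "\<And>s. s \<in> {0..T} \<Longrightarrow> \<bar>s - t\<bar> < \<delta> \<Longrightarrow> (\<integral>x. (indicator {0<..<L} x * (v (x, s) - v (x, t)))\<^sup>2 \<partial>Iv L) < 1"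
      using C_L2_close[OF C t, of 1] by auto
    have "N s \<le> 2 * N t + 2" if s: "s \<in> {0..T}" "\<bar>s - t\<bar> < \<delta>" for s
    proof -
      have "N s = (\<integral>x. (indicator {0<..<L} x * v (x, t) + indicator {0<..<L} x * (v (x, s) - v (x, t)))\<^sup>2 \<partial>Iv L)"
        unfolding N_def by (intro Bochner_Integration.integral_cong) (auto simp: algebra_simps)
      also have "\<dots> \<le> 2 * N t + 2 * (\<integral>x. (indicator {0<..<L} x * (v (x, s) - v (x, t)))\<^sup>2 \<partial>Iv L)"
        unfolding N_def by (rule integral_square_add_le[OF C_L2_norm_sq(2)[OF C t t] C_L2_norm_sq(3)[OF C s(1) t]])
      also have "\<dots> \<le> 2 * N t + 2" using \<delta>(2)[OF s] by simp
      finally show ?thesis .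
    qed
    then show ?thesis using \<delta>(1) by blast
  qed
  have "bounded (N ` {0..T})"
  proof (rule ccontr)
    assume nb: "\<not> bounded (N ` {0..T})"
    have N0: "0 \<le> N t" for t by (simp add: N_def)
    have "\<exists>s\<in>{0..T}. real n < N s" for n
    proof (rule ccontr)
      assume "\<not> ?thesis"
      then have "\<forall>x\<in>N ` {0..T}. norm x \<le> real n" using N0 by (auto simp: not_less)
      then show False using nb unfolding bounded_iff by blast
    qed
    then obtain s where s: "\<And>n. s n \<in> {0..T}" "\<And>n. real n < N (s n)" by metis
    obtain t r where t: "t \<in> {0..T}" "strict_mono r" "(s \<circ> r) \<longlonglongrightarrow> t"
      using compact_Icc[of 0 T] s(1) unfolding compact_def by blast
    obtain \<delta> where \<delta>: "\<delta> > 0" "\<forall>s\<in>{0..T}. \<bar>s - t\<bar> < \<delta> \<longrightarrow> N s \<le> 2 * N t + 2"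
      using near[OF t(1)] by blast
    obtain n0 where n0: "\<And>n. n \<ge> n0 \<Longrightarrow> \<bar>(s \<circ> r) n - t\<bar> < \<delta>"
      using LIMSEQ_D[OF t(3) \<delta>(1)] by auto
    obtain n1 :: nat where n1: "2 * N t + 2 < real n1" using reals_Archimedean2 by blast
    let ?n = "max n0 n1"
    have "N (s (r ?n)) \<le> 2 * N t + 2" using \<delta>(2) s(1) n0[of ?n] by simp
    moreover have "real n1 \<le> real (r ?n)" using seq_suble[OF t(2), of ?n] by simp
    ultimately show False using s(2)[of "r ?n"] n1 by linarith
  qed
  then obtain B where "\<forall>t\<in>{0..T}. \<bar>N t\<bar> \<le> B" unfolding bounded_iff by auto
  then have B: "\<And>t. t \<in> {0..T} \<Longrightarrow> N t \<le> B" using abs_le_D1 by blast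
  show ?thesis
  proof (rule sqint_cutI)
    have m: "(\<lambda>p. indicator ({0<..<L} \<times> {0..T}) p *\<^sub>R v p) \<in> borel_measurable lborel"
      using C by (simp add: C_L2_def set_borel_measurable_def)
    have "(\<lambda>p. indicator ({0<..<L} \<times> {0<..<T}) p *\<^sub>R (indicator ({0<..<L} \<times> {0..T}) p *\<^sub>R v p)) \<in> borel_measurable lborel"
      by (intro borel_measurable_scaleR borel_measurable_indicator m) simp
    moreover have "indicator ({0<..<L} \<times> {0<..<T}) p *\<^sub>R (indicator ({0<..<L} \<times> {0..T}) p *\<^sub>R v p)
        = indicator ({0<..<L} \<times> {0<..<T}) p *\<^sub>R v p" for p
      by (auto simp: indicator_def)
    ultimately show "set_borel_measurable lborel ({0<..<L} \<times> {0<..<T}) v"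
      unfolding set_borel_measurable_def by (simp only:)
    show "AE t in Iv T. L2 {0<..<L} (\<lambda>x. v (x, t)) \<and> L2_norm_on {0<..<L} (\<lambda>x. v (x, t)) \<le> sqrt B"
      using AE_Iv_in
    proof eventually_elim
      case (elim t)
      then have t: "t \<in> {0..T}" by simp
      then have L2: "L2 {0<..<L} (\<lambda>x. v (x, t))" using C by (auto simp: C_L2_def)
      have "(L2_norm_on {0<..<L} (\<lambda>x. v (x, t)))\<^sup>2 \<le> B"
        using B[OF t] L2_imp_sqint(2)[OF L2] by (simp add: N_def)
      then show ?case using L2 by (simp add: real_le_rsqrt)
    qed
  qed
qed

section \<open>Traces and initial values\<close>

lemma AE_Iv_ex:
  assumes AE: "AE x in Iv a. P x" and a: "0 < a" and \<eta>: "0 < \<eta>"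
  obtains x where "0 < x" "x < a" "x < \<eta>" "P x"
proof -
  define l where "l = min a \<eta>"
  have l: "0 < l" using a \<eta> by (simp add: l_def)
  have "\<exists>x. x \<in> {0<..<l} \<and> P x"
  proof (rule ccontr)
    assume "\<nexists>x. x \<in> {0<..<l} \<and> P x"
    moreover have "AE x in lborel. x \<in> {0<..<a} \<longrightarrow> P x" using AE by (simp add: AE_Iv)
    ultimately have "AE x in lborel. x \<notin> {0<..<l}"
      by (auto elim!: eventually_mono simp: l_def)
    then have "emeasure lborel {0<..<l} = 0"
      by (subst (asm) AE_iff_measurable[where N="{0<..<l}"]) auto
    then show False using l by simp
  qed
  then show ?thesis using that by (auto simp: l_def)
qed

text \<open>A boundary value is that of some continuous representative; the primitive is another
  one, and the two agree up to the end points.\<close>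

lemma boundary_value_eq:
  assumes bv: "boundary_value L v x0 k" and AE: "AE x in Iv L. v x = c + prim (Iv L) g x"
    and g: "integrable (Iv L) g" and L: "0 < L" and x0: "x0 \<in> {0..L}"
  shows "k = c + prim (Iv L) g x0"
proof -
  obtain w where w: "continuous_on {0..L} w" "AE x in lborel. x \<in> {0<..<L} \<longrightarrow> v x = w x" "w x0 = k"
    using bv by (auto simp: boundary_value_def)
  have "continuous_on {0..L} (\<lambda>x. w x - (c + prim (Iv L) g x))"
    using isCont_prim[OF g]
    by (intro continuous_on_diff continuous_on_add continuous_on_const w(1) continuous_at_imp_continuous_on ballI)
  moreover have "AE x in Iv L. w x - (c + prim (Iv L) g x) = 0"
    using AE w(2)[folded AE_Iv] by eventually_elim simp
  ultimately have "w x0 - (c + prim (Iv L) g x0) = 0"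
    using x0 L by (rule continuous_AE_eq_const)
  then show ?thesis using w(3) by simp
qed

text \<open>For almost every x, \<beta>(t) is the x-primitive of qx at x minus q(x, t), and both are
  time primitives up to the constant \<open>prim (Iv L) \<rho> x\<close>. Comparing two values of x
  shows this constant to be the same for almost all x; being continuous in x and 0 at x = 0, it is
  0. So \<beta> itself is a time primitive, starting from 0.\<close>

lemma trace_is_primitive:
  assumes L: "0 < L" and T: "0 < T"
    and q: "sqint (Iv L \<Otimes>\<^sub>M Iv T) q" and qx: "sqint (Iv L \<Otimes>\<^sub>M Iv T) qx" and qt: "sqint (Iv L \<Otimes>\<^sub>M Iv T) qt"
    and qxt: "sqint (Iv L \<Otimes>\<^sub>M Iv T) qxt" and \<rho>: "sqint (Iv L) \<rho>"
    and rx: "AE x in Iv L. AE t in Iv T. q (x, t) = - \<beta> t + prim (Iv L) (\<lambda>y. qx (y, t)) x"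
    and rt: "AE x in Iv L. AE t in Iv T. q (x, t) = prim (Iv T) (\<lambda>s. qt (x, s)) t"
    and rxt: "AE x in Iv L. AE t in Iv T. qx (x, t) = \<rho> x + prim (Iv T) (\<lambda>s. qxt (x, s)) t"
  obtains b where "sqint (Iv T) b" "AE t in Iv T. \<beta> t = prim (Iv T) b t"
proof -
  have [measurable]: "qx \<in> borel_measurable (borel \<Otimes>\<^sub>M borel)" "qxt \<in> borel_measurable (borel \<Otimes>\<^sub>M borel)"
    "\<rho> \<in> borel_measurable borel"
    using sqint_pair_measurable[OF qx] sqint_pair_measurable[OF qxt] sqint_measurable[OF \<rho>] by simp_all
  define g where "g p = prim (Iv L) (\<lambda>y. qxt (y, snd p)) (fst p) - qt p" for p
  have g: "sqint (Iv L \<Otimes>\<^sub>M Iv T) g"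
    unfolding g_def by (rule sqint_diff[OF sqint_pair_prim1[OF qxt L] qt])
  have "AE x in Iv L. AE t in Iv T. qx (x, t) = (\<lambda>p. \<rho> (fst p) + prim (Iv T) (\<lambda>s. qxt (fst p, s)) (snd p)) (x, t)"
    using rxt by simp
  then have "AE t in Iv T. AE x in Iv L. qx (x, t) = (\<lambda>p. \<rho> (fst p) + prim (Iv T) (\<lambda>s. qxt (fst p, s)) (snd p)) (x, t)"
    by (subst (asm) AE_swap_eq(1)) measurable
  then have px: "AE t in Iv T. \<forall>x. prim (Iv L) (\<lambda>y. qx (y, t)) x
      = prim (Iv L) \<rho> x + prim (Iv T) (\<lambda>s. prim (Iv L) (\<lambda>y. qxt (y, s)) x) t"
  proof eventually_elim
    case (elim t)
    have i: "integrable (Iv L) (\<lambda>y. prim (Iv T) (\<lambda>s. qxt (y, s)) t)"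
      by (rule sqint_Iv_integrable[OF sqint_prim_slice[OF qxt T]])
    have "prim (Iv L) (\<lambda>y. qx (y, t)) x = prim (Iv L) (\<lambda>y. \<rho> y + prim (Iv T) (\<lambda>s. qxt (y, s)) t) x" for x
      by (rule prim_cong_AE) (use elim in \<open>simp, measurable\<close>)
    then show ?case
      by (simp add: prim_add[OF sqint_Iv_integrable[OF \<rho>] i] prim_prim_swap[OF Iv2f.sqint_integrable[OF qxt]])
  qed
  have key: "AE x in Iv L. AE t in Iv T. \<beta> t = prim (Iv L) \<rho> x + prim (Iv T) (\<lambda>s. g (x, s)) t"
    using rx rt AE_sqint_slices(2)[OF qt] AE_sqint_slices(2)[OF sqint_pair_prim1[OF qxt L]]
  proof eventually_elim
    case (elim x)
    have pg: "prim (Iv T) (\<lambda>s. g (x, s)) t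
        = prim (Iv T) (\<lambda>s. prim (Iv L) (\<lambda>y. qxt (y, s)) x) t - prim (Iv T) (\<lambda>s. qt (x, s)) t" for t
      unfolding g_def fst_conv snd_conv using elim(3,4)[THEN sqint_Iv_integrable] by (simp add: prim_diff)
    show ?case using elim(1,2) px
      by eventually_elim (simp add: pg)
  qed
  then obtain x0 where x0: "AE t in Iv T. \<beta> t = prim (Iv L) \<rho> x0 + prim (Iv T) (\<lambda>s. g (x0, s)) t"
    "sqint (Iv T) (\<lambda>s. g (x0, s))"
    using AE_Iv_ex[OF AE_conjI[OF key AE_sqint_slices(2)[OF g]] L L] by blast
  have const: "AE x in Iv L. prim (Iv L) \<rho> x = prim (Iv L) \<rho> x0"
    using key AE_sqint_slices(2)[OF g]
  proof eventually_elim
    case (elim x)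
    have "AE t in Iv T. prim (Iv T) (\<lambda>s. g (x, s)) t = (prim (Iv L) \<rho> x0 - prim (Iv L) \<rho> x) + prim (Iv T) (\<lambda>s. g (x0, s)) t"
      using elim(1) x0(1) by eventually_elim simp
    from AE_eq_if_prim_eq(1)[OF T sqint_Iv_integrable[OF elim(2)] sqint_Iv_integrable[OF x0(2)] this]
    show ?case by simp
  qed
  have "continuous_on {0..L} (prim (Iv L) \<rho>)"
    using isCont_prim[OF sqint_Iv_integrable[OF \<rho>]] by (auto intro: continuous_at_imp_continuous_on)
  from continuous_AE_eq_const[OF this const, of 0] L have "prim (Iv L) \<rho> x0 = 0"
    by (simp add: prim_nonpos)
  with x0 show ?thesis by (intro that[of "\<lambda>s. g (x0, s)"]) auto
qed

text \<open>With Q the time primitive of qt, the constant of integration is c = q(., s) - Q(., s)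
  for almost every s. Its squared norm is at most twice the sum of those of q(., s) and Q(., s),
  which tend to 0 with s.\<close>

lemma zero_initial_value:
  assumes L: "0 < L" and T: "0 < T"
    and q: "sqint (Iv L \<Otimes>\<^sub>M Iv T) q" and qt: "sqint (Iv L \<Otimes>\<^sub>M Iv T) qt" and c: "sqint (Iv L) c"
    and rt: "AE x in Iv L. AE t in Iv T. q (x, t) = c x + prim (Iv T) (\<lambda>s. qt (x, s)) t"
    and init: "\<And>e. 0 < e \<Longrightarrow> \<exists>\<eta>>0. \<forall>s. 0 < s \<longrightarrow> s < \<eta> \<longrightarrow> s < T \<longrightarrow> (\<integral>x. (q (x, s))\<^sup>2 \<partial>Iv L) \<le> e"
  shows "AE x in Iv L. AE t in Iv T. q (x, t) = prim (Iv T) (\<lambda>s. qt (x, s)) t"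
proof -
  have [measurable]: "q \<in> borel_measurable (borel \<Otimes>\<^sub>M borel)" "qt \<in> borel_measurable (borel \<Otimes>\<^sub>M borel)"
    "c \<in> borel_measurable borel"
    using sqint_pair_measurable[OF q] sqint_pair_measurable[OF qt] sqint_measurable[OF c] by simp_all
  define Q where "Q p = prim (Iv T) (\<lambda>s. qt (fst p, s)) (snd p)" for p
  have Qm [measurable]: "Q \<in> borel_measurable (borel \<Otimes>\<^sub>M borel)" unfolding Q_def by measurable
  have Qs: "sqint (Iv L) (\<lambda>x. Q (x, t))" for t
    unfolding Q_def fst_conv snd_conv by (rule sqint_prim_slice[OF qt T])
  have Qe: "AE x in Iv L. \<forall>t\<le>T. Q (x, t) = prim (Iv T) (\<lambda>s. qt (x, s)) t" by (simp add: Q_def)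
  \<comment> \<open>By the energy identity this is the squared norm of Q, in a form whose continuity
    at 0 is that of a primitive.\<close>
  define E where "E t = 2 * prim (Iv T) (\<lambda>s. \<integral>x. Q (x, s) * qt (x, s) \<partial>Iv L) t" for t
  have EQ: "(\<integral>x. (Q (x, t))\<^sup>2 \<partial>Iv L) = E t" if "t \<le> T" for t
    unfolding E_def by (rule energy_identity(1)[OF qt T Qe Qm that])
  have contE: "isCont E 0"
    unfolding E_def
    by (rule continuous_mult[OF continuous_const isCont_prim[OF energy_identity(2)[OF qt T Qe Qm order_refl]]])
  have E0: "E 0 = 0" by (simp add: E_def prim_nonpos)
  have swap: "AE t in Iv T. AE x in Iv L. q (x, t) = c x + Q (x, t)"
  proof -
    have "AE x in Iv L. AE t in Iv T. q (x, t) = (\<lambda>p. c (fst p) + Q p) (x, t)"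
      using rt by (simp add: Q_def)
    then have "AE t in Iv T. AE x in Iv L. q (x, t) = (\<lambda>p. c (fst p) + Q p) (x, t)"
      by (subst (asm) AE_swap_eq(1)) measurable
    then show ?thesis by simp
  qed
  have le: "(\<integral>x. (c x)\<^sup>2 \<partial>Iv L) \<le> 4 * e" if e: "0 < e" for e
  proof -
    obtain \<eta>1 where \<eta>1: "0 < \<eta>1" "\<And>s. 0 < s \<Longrightarrow> s < \<eta>1 \<Longrightarrow> s < T \<Longrightarrow> (\<integral>x. (q (x, s))\<^sup>2 \<partial>Iv L) \<le> e"
      using init[OF e] by blast
    obtain \<eta>2 where "0 < \<eta>2" "\<forall>s. \<bar>s - 0\<bar> < \<eta>2 \<longrightarrow> \<bar>E s - E 0\<bar> < e"
      using contE e unfolding continuous_at_eps_delta dist_real_def by blast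
    then have \<eta>2: "0 < \<eta>2" "\<And>s. \<bar>s\<bar> < \<eta>2 \<Longrightarrow> \<bar>E s\<bar> < e"
      by (simp_all add: E0)
    obtain s where s: "0 < s" "s < T" "s < min \<eta>1 \<eta>2" "AE x in Iv L. q (x, s) = c x + Q (x, s)" "sqint (Iv L) (\<lambda>x. q (x, s))"
    proof -
      have "0 < min \<eta>1 \<eta>2" using \<eta>1 \<eta>2 by simp
      from AE_Iv_ex[OF AE_conjI[OF swap AE_sqint_slices(1)[OF q]] T this] that show ?thesis by blast
    qed
    have "(\<integral>x. (c x)\<^sup>2 \<partial>Iv L) = (\<integral>x. (q (x, s) + (- Q (x, s)))\<^sup>2 \<partial>Iv L)"
    proof (rule integral_cong_AE)
      show "AE x in Iv L. (c x)\<^sup>2 = (q (x, s) + (- Q (x, s)))\<^sup>2"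
        using s(4) by eventually_elim simp
    qed measurable
    also have "\<dots> \<le> 2 * (\<integral>x. (q (x, s))\<^sup>2 \<partial>Iv L) + 2 * (\<integral>x. (- Q (x, s))\<^sup>2 \<partial>Iv L)"
      by (rule integral_square_add_le[OF s(5) sqint_uminus[OF Qs]])
    also have "\<dots> \<le> 2 * e + 2 * e"
      using \<eta>1(2)[of s] \<eta>2(2)[of s] EQ[of s] s by simp
    finally show ?thesis by simp
  qed
  have "(\<integral>x. (c x)\<^sup>2 \<partial>Iv L) \<le> 0"
  proof (rule field_le_epsilon)
    fix e :: real assume "0 < e"
    then show "(\<integral>x. (c x)\<^sup>2 \<partial>Iv L) \<le> 0 + e" using le[of "e / 4"] by simp
  qed
  moreover have "0 \<le> (\<integral>x. (c x)\<^sup>2 \<partial>Iv L)" by simp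
  ultimately have "(\<integral>x. (c x)\<^sup>2 \<partial>Iv L) = 0" by linarith
  then have "AE x in Iv L. (c x)\<^sup>2 = 0"
    by (subst (asm) integral_nonneg_eq_0_iff_AE[OF sqint_integrable_sq[OF c]]) auto
  then show ?thesis
    using rt by eventually_elim simp
qed

section \<open>The layer expansion\<close>

text \<open>The viscous solution \<open>(u, \<psi>)\<close>, the limit solution \<open>(u0, \<psi>0)\<close> with boundary values \<open>\<alpha>\<close>, \<open>\<beta>\<close> at
  \<open>x = 0\<close>, and the time derivative \<open>b\<close> of \<open>\<beta>\<close>; \<open>d\<close>, \<open>e\<close> are boundary values of \<open>x\<close>-derivatives.\<close>

locale layer_setting =
  fixes L T lam U \<epsilon> :: real
    and u ux uxx ut \<psi> \<psi>x \<psi>xx \<psi>t u0 u0x u0xx u0t \<psi>0 \<psi>0x \<psi>0xx \<psi>0t :: "real \<times> real \<Rightarrow> real"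
    and d e d0 e0 \<alpha> \<beta> b :: "real \<Rightarrow> real"
  assumes pos: "0 < L" "0 < T" "0 < lam" "0 < U" "U < 1 / lam" "0 < \<epsilon>" "2 * \<epsilon> \<le> 1"
    and sq: "sqint (Iv L \<Otimes>\<^sub>M Iv T) ux" "sqint (Iv L \<Otimes>\<^sub>M Iv T) uxx" "sqint (Iv L \<Otimes>\<^sub>M Iv T) ut"
      "sqint (Iv L \<Otimes>\<^sub>M Iv T) \<psi>x" "sqint (Iv L \<Otimes>\<^sub>M Iv T) \<psi>xx" "sqint (Iv L \<Otimes>\<^sub>M Iv T) \<psi>t"
      "sqint (Iv L \<Otimes>\<^sub>M Iv T) u0x" "sqint (Iv L \<Otimes>\<^sub>M Iv T) u0xx" "sqint (Iv L \<Otimes>\<^sub>M Iv T) u0t"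
      "sqint (Iv L \<Otimes>\<^sub>M Iv T) \<psi>0x" "sqint (Iv L \<Otimes>\<^sub>M Iv T) \<psi>0xx" "sqint (Iv L \<Otimes>\<^sub>M Iv T) \<psi>0t"
      "sqint (Iv T) d" "sqint (Iv T) e" "sqint (Iv T) d0" "sqint (Iv T) e0" "sqint (Iv T) b"
    and rep: "AE x in Iv L. AE t in Iv T. u (x, t) = prim (Iv L) (\<lambda>y. ux (y, t)) x"
      "AE t in Iv T. AE x in Iv L. ux (x, t) = d t + prim (Iv L) (\<lambda>y. uxx (y, t)) x"
      "AE x in Iv L. AE t in Iv T. \<psi> (x, t) = prim (Iv L) (\<lambda>y. \<psi>x (y, t)) x"
      "AE t in Iv T. AE x in Iv L. \<psi>x (x, t) = e t + prim (Iv L) (\<lambda>y. \<psi>xx (y, t)) x"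
      "AE x in Iv L. AE t in Iv T. u0 (x, t) = \<alpha> t + prim (Iv L) (\<lambda>y. u0x (y, t)) x"
      "AE t in Iv T. AE x in Iv L. u0x (x, t) = d0 t + prim (Iv L) (\<lambda>y. u0xx (y, t)) x"
      "AE x in Iv L. AE t in Iv T. \<psi>0 (x, t) = \<beta> t + prim (Iv L) (\<lambda>y. \<psi>0x (y, t)) x"
      "AE t in Iv T. AE x in Iv L. \<psi>0x (x, t) = e0 t + prim (Iv L) (\<lambda>y. \<psi>0xx (y, t)) x"
    and bc: "AE t in Iv T. (\<integral>x. ux (x, t) \<partial>Iv L) = 0"
      "AE t in Iv T. \<alpha> t + (\<integral>x. u0x (x, t) \<partial>Iv L) = 0"
      "AE t in Iv T. \<alpha> t + U * lam\<^sup>2 * \<beta> t = 0"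
      "AE t in Iv T. \<beta> t = prim (Iv T) b t"
    and time: "AE x in Iv L. AE t in Iv T. u (x, t) - u0 (x, t) = prim (Iv T) (\<lambda>s. ut (x, s) - u0t (x, s)) t"
      "AE x in Iv L. AE t in Iv T. \<psi> (x, t) - \<psi>0 (x, t) = prim (Iv T) (\<lambda>s. \<psi>t (x, s) - \<psi>0t (x, s)) t"
    and PDE: "AE x in Iv L. AE t in Iv T. ut (x, t) - u0t (x, t)
        = - U * (ux (x, t) - u0x (x, t)) - (\<psi>x (x, t) - \<psi>0x (x, t)) + 2 * \<epsilon> * uxx (x, t)"
      "AE x in Iv L. AE t in Iv T. \<psi>t (x, t) - \<psi>0t (x, t)
        = - U * (\<psi>x (x, t) - \<psi>0x (x, t)) - (ux (x, t) - u0x (x, t)) / lam\<^sup>2"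
begin

definition c :: real where "c = 1 / lam"
definition m :: real where "m = c\<^sup>2 / U - U"
definition \<nu> :: real where "\<nu> = 2 * \<epsilon>"
text \<open>Its primitive \<open>a\<close> equals U lam^2 \<beta> = - \<alpha> almost everywhere:
  the amplitude of the layer, which starts from 0.\<close>

definition bb :: "real \<Rightarrow> real" where "bb t = U * lam\<^sup>2 * b t"
definition a :: "real \<Rightarrow> real" where "a = prim (Iv T) bb"

abbreviation E :: "real \<Rightarrow> real" where "E \<equiv> layer L m \<nu>"
abbreviation E1 :: "real \<Rightarrow> real" where "E1 \<equiv> layer' L m \<nu>"

text \<open>The remainder is built from the inside out: \<open>zr\<close>, \<open>yr\<close> are the
  second x-derivatives and \<open>dr\<close>, \<open>er\<close> the first x-derivatives at x = 0 of
  u - u0 - a E and lam (\<psi> - \<psi>0) + (c / U) a E, where \<open>- (m / \<nu>) * E1\<close> is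
  E''. Recovering \<open>w\<close> and \<open>p\<close> by primitives makes the relations in x hold
  everywhere.\<close>

definition zr :: "real \<times> real \<Rightarrow> real" where
  "zr p = uxx p - u0xx p - a (snd p) * (- (m / \<nu>) * E1 (fst p))"
definition dr :: "real \<Rightarrow> real" where
  "dr t = d t - d0 t - a t * E1 0"
definition yr :: "real \<times> real \<Rightarrow> real" where
  "yr p = lam * (\<psi>xx p - \<psi>0xx p) + c / U * a (snd p) * (- (m / \<nu>) * E1 (fst p))"
definition er :: "real \<Rightarrow> real" where
  "er t = lam * (e t - e0 t) + c / U * a t * E1 0"
definition w1 :: "real \<times> real \<Rightarrow> real" where
  "w1 p = dr (snd p) + prim (Iv L) (\<lambda>x. zr (x, snd p)) (fst p)"
definition w :: "real \<times> real \<Rightarrow> real" where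
  "w p = prim (Iv L) (\<lambda>x. w1 (x, snd p)) (fst p)"
definition p1 :: "real \<times> real \<Rightarrow> real" where
  "p1 p = er (snd p) + prim (Iv L) (\<lambda>x. yr (x, snd p)) (fst p)"
definition p :: "real \<times> real \<Rightarrow> real" where
  "p q = prim (Iv L) (\<lambda>x. p1 (x, snd q)) (fst q)"

lemma c_pos: "0 < c" and lam_c: "lam * c = 1" "lam = 1 / c"
  using pos by (auto simp: c_def)

lemma m_pos: "0 < m"
proof -
  have "U * U < c * c" using pos by (intro mult_strict_mono) (auto simp: c_def)
  then show ?thesis using pos by (simp add: m_def power2_eq_square less_divide_eq)
qed

lemma \<nu>_pos: "0 < \<nu>" "\<nu> \<le> 1"
  using pos by (auto simp: \<nu>_def)

lemma sq_bb: "sqint (Iv T) bb"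
  unfolding bb_def by (rule sqint_cmult[OF sq(17)])

lemma sq_a: "sqint (Iv T) a"
  unfolding a_def by (rule sqint_prim[OF sqint_Iv_integrable[OF sq_bb]])

lemma sqE: "sqint (Iv L) E" "sqint (Iv L) E1" "sqint (Iv L) (\<lambda>x. - (m / \<nu>) * E1 x)"
  using sqint_layer[OF pos(1) m_pos \<nu>_pos(1)] by (blast intro: sqint_cmult)+

lemma sq_zr: "sqint (Iv L \<Otimes>\<^sub>M Iv T) zr"
proof -
  have "sqint (Iv L \<Otimes>\<^sub>M Iv T) (\<lambda>p. (- (m / \<nu>) * E1 (fst p)) * a (snd p))"
    by (rule sqint_mult_pair[OF sqE(3) sq_a])
  then have "sqint (Iv L \<Otimes>\<^sub>M Iv T) (\<lambda>p. a (snd p) * (- (m / \<nu>) * E1 (fst p)))"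
    by (simp only: mult.commute)
  from sqint_diff[OF sqint_diff[OF sq(2) sq(8)] this] show ?thesis unfolding zr_def[abs_def] .
qed

lemma sq_yr: "sqint (Iv L \<Otimes>\<^sub>M Iv T) yr"
proof -
  have "sqint (Iv L \<Otimes>\<^sub>M Iv T) (\<lambda>p. (- (m / \<nu>) * E1 (fst p)) * (c / U * a (snd p)))"
    by (rule sqint_mult_pair[OF sqE(3) sqint_cmult[OF sq_a]])
  then have "sqint (Iv L \<Otimes>\<^sub>M Iv T) (\<lambda>p. (c / U * a (snd p)) * (- (m / \<nu>) * E1 (fst p)))"
    by (subst mult.commute)
  from sqint_add[OF sqint_cmult[OF sqint_diff[OF sq(5) sq(11)], of lam] this] show ?thesis
    unfolding yr_def[abs_def] .
qed

lemma sq_dr: "sqint (Iv T) dr" "sqint (Iv T) er"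
  unfolding dr_def[abs_def] er_def[abs_def]
  by (intro sqint_diff sqint_add sqint_cmult sqint_mult_right sq sq_a)+

lemma AE_space: "AE t in Iv T. (\<forall>x. w (x, t) = prim (Iv L) (\<lambda>y. ux (y, t) - u0x (y, t) - a t * E1 y) x)
    \<and> (AE x in Iv L. w1 (x, t) = ux (x, t) - u0x (x, t) - a t * E1 x)
    \<and> (\<forall>x. p (x, t) = prim (Iv L) (\<lambda>y. lam * (\<psi>x (y, t) - \<psi>0x (y, t)) + c / U * a t * E1 y) x)
    \<and> (AE x in Iv L. p1 (x, t) = lam * (\<psi>x (x, t) - \<psi>0x (x, t)) + c / U * a t * E1 x)"
  using rep(2,4,6,8) AE_sqint_slices(1)[OF sq(2)] AE_sqint_slices(1)[OF sq(8)]
    AE_sqint_slices(1)[OF sq(5)] AE_sqint_slices(1)[OF sq(11)]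
    AE_sqint_slices(1)[OF sq(1)] AE_sqint_slices(1)[OF sq(7)]
    AE_sqint_slices(1)[OF sq(4)] AE_sqint_slices(1)[OF sq(10)]
    AE_sqint_slices(1)[OF sq_zr] AE_sqint_slices(1)[OF sq_yr]
proof eventually_elim
  case (elim t)
  note i = elim(5-)[THEN sqint_Iv_integrable]
  note iE = sqint_Iv_integrable[OF sqE(3)]
  have meas: "ux' \<in> borel_measurable borel" if "sqint (Iv L) ux'" for ux'
    using sqint_measurable[OF that] by simp
  have pz: "prim (Iv L) (\<lambda>x. zr (x, t)) x = prim (Iv L) (\<lambda>y. uxx (y, t)) x - prim (Iv L) (\<lambda>y. u0xx (y, t)) x
      - a t * prim (Iv L) (\<lambda>x. - (m / \<nu>) * E1 x) x" for x
    unfolding zr_def fst_conv snd_conv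
    by (subst prim_diff prim_diff, intro Bochner_Integration.integrable_diff i, rule integrable_mult_right[OF iE],
        subst prim_diff, rule i, rule i, simp only: prim_cmult)
  have py: "prim (Iv L) (\<lambda>x. yr (x, t)) x = lam * (prim (Iv L) (\<lambda>y. \<psi>xx (y, t)) x - prim (Iv L) (\<lambda>y. \<psi>0xx (y, t)) x)
      + c / U * a t * prim (Iv L) (\<lambda>x. - (m / \<nu>) * E1 x) x" for x
    unfolding yr_def fst_conv snd_conv
    by (subst prim_add, intro integrable_mult_right Bochner_Integration.integrable_diff i, rule integrable_mult_right[OF iE],
        subst prim_cmult, subst prim_diff, rule i, rule i, simp only: prim_cmult)
  have w1: "AE x in Iv L. w1 (x, t) = ux (x, t) - u0x (x, t) - a t * E1 x"
    using elim(1,3) AE_Iv_in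
  proof eventually_elim
    case (elim x)
    have "E1 x = E1 0 + prim (Iv L) (\<lambda>x. - (m / \<nu>) * E1 x) x"
      using elim by (intro layer_eq_prim(2)[OF pos(1) m_pos \<nu>_pos(1)]) auto
    then show ?case unfolding w1_def fst_conv snd_conv dr_def pz elim
      by (simp only:) (simp only: algebra_simps)
  qed
  have p1: "AE x in Iv L. p1 (x, t) = lam * (\<psi>x (x, t) - \<psi>0x (x, t)) + c / U * a t * E1 x"
    using elim(2,4) AE_Iv_in
  proof eventually_elim
    case (elim x)
    have "E1 x = E1 0 + prim (Iv L) (\<lambda>x. - (m / \<nu>) * E1 x) x"
      using elim by (intro layer_eq_prim(2)[OF pos(1) m_pos \<nu>_pos(1)]) auto
    then show ?case unfolding p1_def fst_conv snd_conv er_def py elim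
      by (simp only:) (simp only: algebra_simps)
  qed
  have mz: "(\<lambda>x. w1 (x, t)) \<in> borel_measurable borel" "(\<lambda>x. p1 (x, t)) \<in> borel_measurable borel"
    unfolding w1_def p1_def fst_conv snd_conv
    using meas[OF elim(13)] meas[OF elim(14)] by measurable
  have mx: "(\<lambda>x. ux (x, t) - u0x (x, t) - a t * E1 x) \<in> borel_measurable borel"
    "(\<lambda>x. lam * (\<psi>x (x, t) - \<psi>0x (x, t)) + c / U * a t * E1 x) \<in> borel_measurable borel"
    by (rule meas, intro sqint_diff sqint_add sqint_cmult elim sqE)+
  have "w (x, t) = prim (Iv L) (\<lambda>y. ux (y, t) - u0x (y, t) - a t * E1 y) x" for x
    unfolding w_def fst_conv snd_conv by (rule prim_cong_AE[OF w1 mz(1) mx(1)])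
  moreover have "p (x, t) = prim (Iv L) (\<lambda>y. lam * (\<psi>x (y, t) - \<psi>0x (y, t)) + c / U * a t * E1 y) x" for x
    unfolding p_def fst_conv snd_conv by (rule prim_cong_AE[OF p1 mz(2) mx(2)])
  ultimately show ?case using w1 p1 by blast
qed

lemma sq_w1: "sqint (Iv L \<Otimes>\<^sub>M Iv T) w1" "sqint (Iv L \<Otimes>\<^sub>M Iv T) p1"
  unfolding w1_def[abs_def] p1_def[abs_def]
  by (intro sqint_add sqint_pair_snd sq_dr sqint_pair_prim1 sq_zr sq_yr pos)+

lemma E_total: "integral\<^sup>L (Iv L) E1 = - 1"
proof -
  have "E L = 1 + prim (Iv L) E1 L" by (rule layer_eq_prim(1)[OF pos(1) m_pos \<nu>_pos(1)]) (use pos in auto)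
  then show ?thesis
    using prim_total[of L L E1] by (simp add: layer_L[OF pos(1) m_pos \<nu>_pos(1)])
qed

lemma AE_alpha: "AE t in Iv T. \<alpha> t = - a t \<and> \<beta> t = a t / (U * lam\<^sup>2)"
  using bc(3,4)
proof eventually_elim
  case (elim t)
  have "a t = U * lam\<^sup>2 * prim (Iv T) b t"
    unfolding a_def bb_def by (rule prim_cmult)
  then show ?case using elim pos by simp
qed

text \<open>The three integrals are 0, a and - 1: u vanishes at both ends, u0 goes from \<alpha> = -
  a to 0, and the profile drops from 1 to 0.\<close>

lemma w_L: "AE t in Iv T. (\<integral>x. w1 (x, t) \<partial>Iv L) = 0"
  using AE_space bc(1,2) AE_alpha AE_sqint_slices(1)[OF sq(1)] AE_sqint_slices(1)[OF sq(7)] AE_sqint_slices(1)[OF sq_w1(1)]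
proof eventually_elim
  case (elim t)
  note i = elim(5,6)[THEN sqint_Iv_integrable] sqint_Iv_integrable[OF sqE(2)]
  have "(\<integral>x. w1 (x, t) \<partial>Iv L) = (\<integral>x. ux (x, t) - u0x (x, t) - a t * E1 x \<partial>Iv L)"
    by (rule integral_cong_AE)
       (use elim(1) sqint_measurable[OF elim(7)] borel_measurable_integrable[OF i(1)] borel_measurable_integrable[OF i(2)]
          borel_measurable_integrable[OF i(3)] in auto)
  also have "\<dots> = 0" using i elim(2-4) by (simp add: E_total)
  finally show ?case .
qed

lemma E_eq: "0 < x \<Longrightarrow> x < L \<Longrightarrow> prim (Iv L) E1 x = E x - 1"
  using layer_eq_prim(1)[OF pos(1) m_pos \<nu>_pos(1), of x] by simp

text \<open>Primitives start from 0, so the profile enters as E - 1. The constants a and (c / U) a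
  left over in this way cancel against the traces \<alpha> and lam \<beta> of the limit
  solution.\<close>

lemma AE_w: "AE x in Iv L. AE t in Iv T. w (x, t) = u (x, t) - u0 (x, t) - a t * E x
    \<and> p (x, t) = lam * (\<psi> (x, t) - \<psi>0 (x, t)) + c / U * a t * E x"
  using rep(1,3,5,7) AE_Iv_in
proof eventually_elim
  case (elim x)
  have "AE t in Iv T. w (x, t) = prim (Iv L) (\<lambda>y. ux (y, t)) x - prim (Iv L) (\<lambda>y. u0x (y, t)) x - a t * (E x - 1)
    \<and> p (x, t) = lam * (prim (Iv L) (\<lambda>y. \<psi>x (y, t)) x - prim (Iv L) (\<lambda>y. \<psi>0x (y, t)) x) + c / U * a t * (E x - 1)"
    using AE_space AE_sqint_slices(1)[OF sq(1)] AE_sqint_slices(1)[OF sq(7)]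
      AE_sqint_slices(1)[OF sq(4)] AE_sqint_slices(1)[OF sq(10)]
  proof eventually_elim
    case t: (elim t)
    note i = t(2-)[THEN sqint_Iv_integrable] and iE = sqint_Iv_integrable[OF sqE(2)]
    have "prim (Iv L) (\<lambda>y. ux (y, t) - u0x (y, t) - a t * E1 y) x
      = prim (Iv L) (\<lambda>y. ux (y, t)) x - prim (Iv L) (\<lambda>y. u0x (y, t)) x - a t * prim (Iv L) E1 x"
      by (subst prim_diff, intro Bochner_Integration.integrable_diff i, rule integrable_mult_right[OF iE],
          subst prim_diff, rule i, rule i, simp only: prim_cmult)
    moreover have "prim (Iv L) (\<lambda>y. lam * (\<psi>x (y, t) - \<psi>0x (y, t)) + c / U * a t * E1 y) x
      = lam * (prim (Iv L) (\<lambda>y. \<psi>x (y, t)) x - prim (Iv L) (\<lambda>y. \<psi>0x (y, t)) x) + c / U * a t * prim (Iv L) E1 x"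
      by (subst prim_add, intro integrable_mult_right Bochner_Integration.integrable_diff i, rule integrable_mult_right[OF iE],
          subst prim_cmult, subst prim_diff, rule i, rule i, simp only: prim_cmult)
    ultimately show ?case using t(1) elim E_eq[of x] by simp
  qed
  then show ?case using elim(1-4) AE_alpha
  proof eventually_elim
    case t: (elim t)
    have "c / U * a t = lam * \<beta> t"
      using t(6) pos by (simp add: c_def power2_eq_square)
    then have "c / U * a t * (E x - 1) = c / U * a t * E x - lam * \<beta> t"
      by (simp only: right_diff_distrib mult_1_right)
    moreover have "prim (Iv L) (\<lambda>y. \<psi>0x (y, t)) x = \<psi>0 (x, t) - \<beta> t" using t(5) by simp
    ultimately have "p (x, t) = lam * (\<psi> (x, t) - (\<psi>0 (x, t) - \<beta> t)) + (c / U * a t * E x - lam * \<beta> t)"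
      using t(1,3) by (simp only:)
    moreover have "\<dots> = lam * (\<psi> (x, t) - \<psi>0 (x, t)) + c / U * a t * E x"
      unfolding right_diff_distrib by linarith
    moreover have "w (x, t) = u (x, t) - u0 (x, t) - a t * E x"
      using t(1,2,4,6) by (simp add: right_diff_distrib)
    ultimately show ?case by linarith
  qed
qed

lemma AE_w1: "AE x in Iv L. AE t in Iv T. w1 (x, t) = ux (x, t) - u0x (x, t) - a t * E1 x
    \<and> p1 (x, t) = lam * (\<psi>x (x, t) - \<psi>0x (x, t)) + c / U * a t * E1 x"
proof -
  have [measurable]: "ux \<in> borel_measurable (borel \<Otimes>\<^sub>M borel)" "u0x \<in> borel_measurable (borel \<Otimes>\<^sub>M borel)"
    "\<psi>x \<in> borel_measurable (borel \<Otimes>\<^sub>M borel)" "\<psi>0x \<in> borel_measurable (borel \<Otimes>\<^sub>M borel)"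
    "w1 \<in> borel_measurable (borel \<Otimes>\<^sub>M borel)" "p1 \<in> borel_measurable (borel \<Otimes>\<^sub>M borel)"
    "a \<in> borel_measurable borel"
    using sqint_pair_measurable[OF sq(1)] sqint_pair_measurable[OF sq(7)] sqint_pair_measurable[OF sq(4)]
      sqint_pair_measurable[OF sq(10)] sqint_pair_measurable[OF sq_w1(1)] sqint_pair_measurable[OF sq_w1(2)]
      sqint_measurable[OF sq_a] by simp_all
  have "AE t in Iv T. AE x in Iv L. w1 (x, t) = (\<lambda>q. ux q - u0x q - a (snd q) * E1 (fst q)) (x, t)"
    using AE_space by eventually_elim simp
  then have 1: "AE x in Iv L. AE t in Iv T. w1 (x, t) = (\<lambda>q. ux q - u0x q - a (snd q) * E1 (fst q)) (x, t)"
    by (subst AE_swap_eq(1)) measurable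
  have "AE t in Iv T. AE x in Iv L. p1 (x, t) = (\<lambda>q. lam * (\<psi>x q - \<psi>0x q) + c / U * a (snd q) * E1 (fst q)) (x, t)"
    using AE_space by eventually_elim simp
  then have 2: "AE x in Iv L. AE t in Iv T. p1 (x, t) = (\<lambda>q. lam * (\<psi>x q - \<psi>0x q) + c / U * a (snd q) * E1 (fst q)) (x, t)"
    by (subst AE_swap_eq(1)) measurable
  show ?thesis using 1 2
  proof eventually_elim
    case (elim x)
    then show ?case by eventually_elim simp
  qed
qed

text \<open>The layer part solves the steady equations: its viscous term contributes m a E1, and m +
  U - c^2 / U = 0 cancels this against transport and coupling. What remains of it is
  \<open>bb\<close> E, from the time derivative of a; the limit solution, having no viscous term,
  leaves \<nu> times \<open>u0xx\<close>.\<close>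

lemma evolution: "remainder_evolution L T U c m \<nu> zr yr u0xx dr er bb w1 w p1 p"
proof unfold_locales
  show "w1 (x, t) = dr t + prim (Iv L) (\<lambda>x. zr (x, t)) x" for x t by (simp add: w1_def)
  show "w (x, t) = prim (Iv L) (\<lambda>x. w1 (x, t)) x" for x t by (simp add: w_def)
  show "p1 (x, t) = er t + prim (Iv L) (\<lambda>x. yr (x, t)) x" for x t by (simp add: p1_def)
  show "p (x, t) = prim (Iv L) (\<lambda>x. p1 (x, t)) x" for x t by (simp add: p_def)
  show "AE x in Iv L. AE t in Iv T. w (x, t) = prim (Iv T)
      (\<lambda>s. \<nu> * zr (x, s) - U * w1 (x, s) - c * p1 (x, s) + \<nu> * u0xx (x, s) - bb s * E x) t"
    using AE_w AE_w1 time(1) PDE(1) AE_sqint_slices(2)[OF sq(3)] AE_sqint_slices(2)[OF sq(9)]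
      AE_sqint_slices(2)[OF sq_zr] AE_sqint_slices(2)[OF sq_w1(1)] AE_sqint_slices(2)[OF sq_w1(2)]
      AE_sqint_slices(2)[OF sq(8)]
  proof eventually_elim
    case (elim x)
    note i = elim(5,6)[THEN sqint_Iv_integrable] and ib = sqint_Iv_integrable[OF sq_bb]
    have eq: "AE s in Iv T. ut (x, s) - u0t (x, s) - E x * bb s
        = \<nu> * zr (x, s) - U * w1 (x, s) - c * p1 (x, s) + \<nu> * u0xx (x, s) - bb s * E x"
      using elim(2,4)
    proof eventually_elim
      case (elim s)
      have "c * (lam * (\<psi>x (x, s) - \<psi>0x (x, s))) = \<psi>x (x, s) - \<psi>0x (x, s)"
        using lam_c by (simp flip: mult.assoc add: mult.commute)
      moreover have "\<nu> * (a s * (- (m / \<nu>) * E1 x)) = - (a s * (m * E1 x))"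
        using \<nu>_pos by simp
      moreover have "c * (c / U * a s * E1 x) - U * (a s * E1 x) = a s * (m * E1 x)"
        by (simp add: m_def power2_eq_square algebra_simps)
      ultimately show ?case
        using elim by (simp add: zr_def right_diff_distrib distrib_left \<nu>_def[symmetric])
    qed
    have "prim (Iv T) (\<lambda>s. ut (x, s) - u0t (x, s) - E x * bb s) t
      = prim (Iv T) (\<lambda>s. ut (x, s) - u0t (x, s)) t - E x * a t" for t
      unfolding a_def
      by (subst prim_diff, intro Bochner_Integration.integrable_diff i, rule integrable_mult_right[OF ib],
          simp only: prim_cmult)
    moreover have "prim (Iv T) (\<lambda>s. ut (x, s) - u0t (x, s) - E x * bb s) t
      = prim (Iv T) (\<lambda>s. \<nu> * zr (x, s) - U * w1 (x, s) - c * p1 (x, s) + \<nu> * u0xx (x, s) - bb s * E x) t" for t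
    proof (rule prim_cong_AE[OF eq])
      have "sqint (Iv T) (\<lambda>s. ut (x, s) - u0t (x, s) - E x * bb s)"
        by (intro sqint_diff sqint_cmult elim sq_bb)
      from sqint_measurable[OF this] show "(\<lambda>s. ut (x, s) - u0t (x, s) - E x * bb s) \<in> borel_measurable borel" by simp
      have "sqint (Iv T) (\<lambda>s. \<nu> * zr (x, s) - U * w1 (x, s) - c * p1 (x, s) + \<nu> * u0xx (x, s) - bb s * E x)"
        by (intro sqint_diff sqint_add sqint_cmult sqint_mult_right elim sq_bb)
      from sqint_measurable[OF this]
      show "(\<lambda>s. \<nu> * zr (x, s) - U * w1 (x, s) - c * p1 (x, s) + \<nu> * u0xx (x, s) - bb s * E x) \<in> borel_measurable borel"
        by simp
    qed
    ultimately have eqt: "prim (Iv T) (\<lambda>s. \<nu> * zr (x, s) - U * w1 (x, s) - c * p1 (x, s) + \<nu> * u0xx (x, s) - bb s * E x) t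
      = prim (Iv T) (\<lambda>s. ut (x, s) - u0t (x, s)) t - E x * a t" for t by metis
    show ?case using elim(1,3) unfolding eqt by eventually_elim simp
  qed
  show "AE x in Iv L. AE t in Iv T. p (x, t) = prim (Iv T)
      (\<lambda>s. - U * p1 (x, s) - c * w1 (x, s) + c / U * bb s * E x) t"
    using AE_w AE_w1 time(2) PDE(2) AE_sqint_slices(2)[OF sq(6)] AE_sqint_slices(2)[OF sq(12)]
      AE_sqint_slices(2)[OF sq_w1(1)] AE_sqint_slices(2)[OF sq_w1(2)]
  proof eventually_elim
    case (elim x)
    note i = elim(5,6)[THEN sqint_Iv_integrable] and ib = sqint_Iv_integrable[OF sq_bb]
    have eq: "AE s in Iv T. lam * (\<psi>t (x, s) - \<psi>0t (x, s)) + c / U * E x * bb s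
        = - U * p1 (x, s) - c * w1 (x, s) + c / U * bb s * E x"
      using elim(2,4)
    proof eventually_elim
      case (elim s)
      have "lam * ((ux (x, s) - u0x (x, s)) / lam\<^sup>2) = c * (ux (x, s) - u0x (x, s))"
        using pos by (simp add: c_def power2_eq_square)
      moreover have "U * (c / U * a s * E1 x) = c * (a s * E1 x)" using pos by simp
      ultimately show ?case
        using elim by (simp add: right_diff_distrib distrib_left mult_ac)
    qed
    have "prim (Iv T) (\<lambda>s. lam * (\<psi>t (x, s) - \<psi>0t (x, s)) + c / U * E x * bb s) t
      = lam * prim (Iv T) (\<lambda>s. \<psi>t (x, s) - \<psi>0t (x, s)) t + c / U * E x * a t" for t
      unfolding a_def
      by (subst prim_add, intro integrable_mult_right Bochner_Integration.integrable_diff i, rule integrable_mult_right[OF ib],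
          simp only: prim_cmult)
    moreover have "prim (Iv T) (\<lambda>s. lam * (\<psi>t (x, s) - \<psi>0t (x, s)) + c / U * E x * bb s) t
      = prim (Iv T) (\<lambda>s. - U * p1 (x, s) - c * w1 (x, s) + c / U * bb s * E x) t" for t
    proof (rule prim_cong_AE[OF eq])
      have "sqint (Iv T) (\<lambda>s. lam * (\<psi>t (x, s) - \<psi>0t (x, s)) + c / U * E x * bb s)"
        by (intro sqint_add sqint_diff sqint_cmult elim sq_bb)
      from sqint_measurable[OF this]
      show "(\<lambda>s. lam * (\<psi>t (x, s) - \<psi>0t (x, s)) + c / U * E x * bb s) \<in> borel_measurable borel" by simp
      have "sqint (Iv T) (\<lambda>s. - U * p1 (x, s) - c * w1 (x, s) + c / U * bb s * E x)"
        by (intro sqint_diff sqint_add sqint_cmult sqint_mult_right elim sq_bb)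
      from sqint_measurable[OF this]
      show "(\<lambda>s. - U * p1 (x, s) - c * w1 (x, s) + c / U * bb s * E x) \<in> borel_measurable borel" by simp
    qed
    ultimately have eqt: "prim (Iv T) (\<lambda>s. - U * p1 (x, s) - c * w1 (x, s) + c / U * bb s * E x) t
      = lam * prim (Iv T) (\<lambda>s. \<psi>t (x, s) - \<psi>0t (x, s)) t + c / U * E x * a t" for t by metis
    show ?case using elim(1,3) unfolding eqt by eventually_elim (simp add: mult_ac)
  qed
qed (rule pos m_pos \<nu>_pos c_pos sq_zr sq_yr sq sq_dr sq_bb w_L)+

end

section \<open>From the function spaces to the setting of the expansion\<close>

definition regular where
  "regular L T u ux uxx ut \<psi> \<psi>x \<psi>xx \<psi>xt \<psi>t \<longleftrightarrow>
    (\<forall>q\<in>{u, ux, uxx, ut, \<psi>, \<psi>x, \<psi>xx, \<psi>xt, \<psi>t}. sqint (Iv L \<Otimes>\<^sub>M Iv T) q) \<and>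
    weak_pair L T (1, 0) u ux \<and> weak_pair L T (1, 0) ux uxx \<and> weak_pair L T (0, 1) u ut \<and>
    weak_pair L T (1, 0) \<psi> \<psi>x \<and> weak_pair L T (1, 0) \<psi>x \<psi>xx \<and> weak_pair L T (0, 1) \<psi>x \<psi>xt \<and>
    weak_pair L T (0, 1) \<psi> \<psi>t"

lemma AE_cut: "AE p in lborel. p \<in> {0<..<L} \<times> {0<..<T} \<longrightarrow> cut L T v p = v p"
  by (simp add: cut_def)

text \<open>The spaces bound an x-derivative in one place and differentiate it again in another,
  each time with a witness of its own; uniqueness almost everywhere merges \<open>ux\<close> with
  \<open>ux'\<close> and \<open>\<psi>x\<close> with \<open>\<psi>x'\<close>.\<close>

lemma regular_cut:
  assumes w: "weak_dx L T u ux" "weak_dx L T u ux'" "weak_dx L T ux' uxx" "weak_dt L T u ut"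
    "weak_dx L T \<psi> \<psi>x" "weak_dx L T \<psi> \<psi>x'" "weak_dx L T \<psi>x' \<psi>xx" "weak_dt L T \<psi>x' \<psi>xt" "weak_dt L T \<psi> \<psi>t"
    and B: "Linf_L2 L T u" "Linf_L2 L T ux" "Linf_L2 L T uxx" "C_L2 L T ut"
    "Linf_L2 L T \<psi>" "Linf_L2 L T \<psi>x" "Linf_L2 L T \<psi>xx" "Linf_L2 L T \<psi>xt" "C_L2 L T \<psi>t"
  shows "regular L T (cut L T u) (cut L T ux) (cut L T uxx) (cut L T ut)
    (cut L T \<psi>) (cut L T \<psi>x) (cut L T \<psi>xx) (cut L T \<psi>xt) (cut L T \<psi>t)"
proof -
  note s = B(1-3,5-8)[THEN sqint_cut_Linf_L2] B(4,9)[THEN sqint_cut_C_L2]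
  have 1: "AE p in lborel. p \<in> {0<..<L} \<times> {0<..<T} \<longrightarrow> cut L T ux p = ux' p"
    using weak_deriv_unique[OF w(1,2)] by (auto simp: cut_def)
  have 2: "AE p in lborel. p \<in> {0<..<L} \<times> {0<..<T} \<longrightarrow> cut L T \<psi>x p = \<psi>x' p"
    using weak_deriv_unique[OF w(5,6)] by (auto simp: cut_def)
  show ?thesis
    unfolding regular_def
  proof (intro conjI)
    show "\<forall>q\<in>{cut L T u, cut L T ux, cut L T uxx, cut L T ut, cut L T \<psi>, cut L T \<psi>x, cut L T \<psi>xx, cut L T \<psi>xt,
        cut L T \<psi>t}. sqint (Iv L \<Otimes>\<^sub>M Iv T) q"
      using s by blast
    show "weak_pair L T (1, 0) (cut L T u) (cut L T ux)"
      by (rule weak_deriv_imp_weak_pair[OF w(1) s(1) AE_cut s(2) AE_cut])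
    show "weak_pair L T (1, 0) (cut L T ux) (cut L T uxx)"
      by (rule weak_deriv_imp_weak_pair[OF w(3) s(2) 1 s(3) AE_cut])
    show "weak_pair L T (0, 1) (cut L T u) (cut L T ut)"
      by (rule weak_deriv_imp_weak_pair[OF w(4) s(1) AE_cut s(8) AE_cut])
    show "weak_pair L T (1, 0) (cut L T \<psi>) (cut L T \<psi>x)"
      by (rule weak_deriv_imp_weak_pair[OF w(5) s(4) AE_cut s(5) AE_cut])
    show "weak_pair L T (1, 0) (cut L T \<psi>x) (cut L T \<psi>xx)"
      by (rule weak_deriv_imp_weak_pair[OF w(7) s(5) 2 s(6) AE_cut])
    show "weak_pair L T (0, 1) (cut L T \<psi>x) (cut L T \<psi>xt)"
      by (rule weak_deriv_imp_weak_pair[OF w(8) s(5) 2 s(7) AE_cut])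
    show "weak_pair L T (0, 1) (cut L T \<psi>) (cut L T \<psi>t)"
      by (rule weak_deriv_imp_weak_pair[OF w(9) s(4) AE_cut s(9) AE_cut])
  qed
qed

lemma viscous_regular:
  assumes K: "(u, \<psi>) \<in> space_K L T" and sol: "viscous_solution lam U L T \<epsilon> f g ui \<psi>i u \<psi>"
  obtains ux uxx ut \<psi>x \<psi>xx \<psi>xt \<psi>t where
    "regular L T (cut L T u) ux uxx ut (cut L T \<psi>) \<psi>x \<psi>xx \<psi>xt \<psi>t"
    "AE p in lborel. p \<in> {0<..<L} \<times> {0<..<T} \<longrightarrow>
       ut p + U * ux p + \<psi>x p - 2 * \<epsilon> * uxx p = f p \<and> \<psi>t p + U * \<psi>x p + ux p / lam\<^sup>2 = g p"
proof -
  obtain ux \<psi>x uxx where F: "weak_dx L T u ux" "weak_dx L T \<psi> \<psi>x" "weak_dx L T ux uxx"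
    "Linf_L2 L T ux" "Linf_L2 L T \<psi>x" "Linf_L2 L T uxx" "Linf_L2 L T u" "Linf_L2 L T \<psi>"
    using K unfolding space_K_def space_F_def Linf_dom_A_def by blast
  obtain \<psi>x' \<psi>xt \<psi>xx where K1: "weak_dx L T \<psi> \<psi>x'" "weak_dt L T \<psi>x' \<psi>xt" "weak_dx L T \<psi>x' \<psi>xx"
    "Linf_L2 L T \<psi>xt" "Linf_L2 L T \<psi>xx"
    using K unfolding space_K_def by blast
  obtain ut \<psi>t where K2: "weak_dt L T u ut" "weak_dt L T \<psi> \<psi>t" "C_L2 L T ut" "C_L2 L T \<psi>t"
    using K unfolding space_K_def by blast
  have reg: "regular L T (cut L T u) (cut L T ux) (cut L T uxx) (cut L T ut)
      (cut L T \<psi>) (cut L T \<psi>x) (cut L T \<psi>xx) (cut L T \<psi>xt) (cut L T \<psi>t)"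
    by (rule regular_cut[OF F(1,1,3) K2(1) F(2) K1(1,3,2) K2(2) F(7,4,6) K2(3) F(8,5) K1(5,4) K2(4)])
  obtain ut' ux' uxx' \<psi>t' \<psi>x'' where S: "weak_dt L T u ut'" "weak_dx L T u ux'" "weak_dx L T ux' uxx'"
    "weak_dt L T \<psi> \<psi>t'" "weak_dx L T \<psi> \<psi>x''"
    and PDE: "AE p in lborel. p \<in> spacetime L T \<longrightarrow>
       ut' p + U * ux' p + \<psi>x'' p - 2 * \<epsilon> * uxx' p = f p \<and> \<psi>t' p + U * \<psi>x'' p + ux' p / lam\<^sup>2 = g p"
    using sol unfolding viscous_solution_def by blast
  have refl: "AE p in lborel. p \<in> spacetime L T \<longrightarrow> h p = h p" for h :: "real \<times> real \<Rightarrow> real" by simp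
  note ux = weak_deriv_unique[OF F(1) S(2) refl]
  note uniq = ux weak_deriv_unique[OF F(3) S(3) ux] weak_deriv_unique[OF K2(1) S(1) refl]
    weak_deriv_unique[OF F(2) S(5) refl] weak_deriv_unique[OF K2(2) S(4) refl]
  have "AE p in lborel. p \<in> {0<..<L} \<times> {0<..<T} \<longrightarrow>
       cut L T ut p + U * cut L T ux p + cut L T \<psi>x p - 2 * \<epsilon> * cut L T uxx p = f p \<and>
       cut L T \<psi>t p + U * cut L T \<psi>x p + cut L T ux p / lam\<^sup>2 = g p"
    using PDE uniq
  proof eventually_elim
    case (elim p)
    show ?case
    proof
      assume p: "p \<in> {0<..<L} \<times> {0<..<T}"
      show "cut L T ut p + U * cut L T ux p + cut L T \<psi>x p - 2 * \<epsilon> * cut L T uxx p = f p \<and>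
       cut L T \<psi>t p + U * cut L T \<psi>x p + cut L T ux p / lam\<^sup>2 = g p"
        using elim p unfolding cut_eq[OF p] by simp
    qed
  qed
  with reg show ?thesis by (rule that)
qed

lemma limit_regular:
  assumes K: "(u, \<psi>) \<in> space_K0 lam U L T" and sol: "limit_solution lam U L T f g ui \<psi>i u \<psi>"
  obtains ux uxx ut \<psi>x \<psi>xx \<psi>xt \<psi>t where
    "regular L T (cut L T u) ux uxx ut (cut L T \<psi>) \<psi>x \<psi>xx \<psi>xt \<psi>t"
    "AE p in lborel. p \<in> {0<..<L} \<times> {0<..<T} \<longrightarrow>
       ut p + U * ux p + \<psi>x p = f p \<and> \<psi>t p + U * \<psi>x p + ux p / lam\<^sup>2 = g p"
    "Linf_L2 L T ux" "Linf_L2 L T \<psi>x"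
proof -
  obtain ux \<psi>x where F: "weak_dx L T u ux" "weak_dx L T \<psi> \<psi>x"
    "Linf_L2 L T ux" "Linf_L2 L T \<psi>x" "Linf_L2 L T u" "Linf_L2 L T \<psi>"
    using K unfolding space_K0_def space_F0_def Linf_dom_A0_def by blast
  obtain ux0 uxx \<psi>x' \<psi>xt \<psi>xx where K1: "weak_dx L T u ux0" "weak_dx L T ux0 uxx"
    "weak_dx L T \<psi> \<psi>x'" "weak_dt L T \<psi>x' \<psi>xt" "weak_dx L T \<psi>x' \<psi>xx"
    "Linf_L2 L T \<psi>xt" "Linf_L2 L T uxx" "Linf_L2 L T \<psi>xx"
    using K unfolding space_K0_def by blast
  obtain ut \<psi>t where K2: "weak_dt L T u ut" "weak_dt L T \<psi> \<psi>t" "C_L2 L T ut" "C_L2 L T \<psi>t"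
    using K unfolding space_K0_def by blast
  have reg: "regular L T (cut L T u) (cut L T ux) (cut L T uxx) (cut L T ut)
      (cut L T \<psi>) (cut L T \<psi>x) (cut L T \<psi>xx) (cut L T \<psi>xt) (cut L T \<psi>t)"
    by (rule regular_cut[OF F(1) K1(1,2) K2(1) F(2) K1(3,5,4) K2(2) F(5,3) K1(7) K2(3) F(6,4) K1(8,6) K2(4)])
  obtain ut' ux' \<psi>t' \<psi>x'' where S: "weak_dt L T u ut'" "weak_dx L T u ux'"
    "weak_dt L T \<psi> \<psi>t'" "weak_dx L T \<psi> \<psi>x''"
    and PDE: "AE p in lborel. p \<in> spacetime L T \<longrightarrow>
       ut' p + U * ux' p + \<psi>x'' p = f p \<and> \<psi>t' p + U * \<psi>x'' p + ux' p / lam\<^sup>2 = g p"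
    using sol unfolding limit_solution_def by blast
  have refl: "AE p in lborel. p \<in> spacetime L T \<longrightarrow> h p = h p" for h :: "real \<times> real \<Rightarrow> real" by simp
  note uniq = weak_deriv_unique[OF F(1) S(2) refl] weak_deriv_unique[OF K2(1) S(1) refl]
    weak_deriv_unique[OF F(2) S(4) refl] weak_deriv_unique[OF K2(2) S(3) refl]
  have PDE': "AE p in lborel. p \<in> {0<..<L} \<times> {0<..<T} \<longrightarrow>
       cut L T ut p + U * cut L T ux p + cut L T \<psi>x p = f p \<and>
       cut L T \<psi>t p + U * cut L T \<psi>x p + cut L T ux p / lam\<^sup>2 = g p"
    using PDE uniq
  proof eventually_elim
    case (elim p)
    show ?case
    proof
      assume p: "p \<in> {0<..<L} \<times> {0<..<T}"
      show "cut L T ut p + U * cut L T ux p + cut L T \<psi>x p = f p \<and>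
       cut L T \<psi>t p + U * cut L T \<psi>x p + cut L T ux p / lam\<^sup>2 = g p"
        using elim p unfolding cut_eq[OF p] by simp
    qed
  qed
  have Linf_cut: "Linf_L2 L T (cut L T v)" if "Linf_L2 L T v" for v
  proof -
    have "set_borel_measurable lborel (spacetime L T) (cut L T v)"
    proof -
      have "(\<lambda>p. indicator (spacetime L T) p *\<^sub>R cut L T v p) = (\<lambda>p. indicator (spacetime L T) p *\<^sub>R v p)"
        by (auto simp: cut_def indicator_def)
      then show ?thesis using that unfolding Linf_L2_def set_borel_measurable_def by simp
    qed
    moreover have "L2 {0<..<L} (\<lambda>x. cut L T v (x, t)) \<longleftrightarrow> L2 {0<..<L} (\<lambda>x. v (x, t))"
      "L2_norm_on {0<..<L} (\<lambda>x. cut L T v (x, t)) = L2_norm_on {0<..<L} (\<lambda>x. v (x, t))" if "t \<in> {0<..<T}" for t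
    proof -
      have "indicator {0<..<L} x *\<^sub>R cut L T v (x, t) = indicator {0<..<L} x *\<^sub>R v (x, t)"
        "indicator {0<..<L} x *\<^sub>R (cut L T v (x, t))\<^sup>2 = indicator {0<..<L} x *\<^sub>R (v (x, t))\<^sup>2" for x
        using that by (auto simp: cut_def indicator_def)
      then show "L2 {0<..<L} (\<lambda>x. cut L T v (x, t)) \<longleftrightarrow> L2 {0<..<L} (\<lambda>x. v (x, t))"
        "L2_norm_on {0<..<L} (\<lambda>x. cut L T v (x, t)) = L2_norm_on {0<..<L} (\<lambda>x. v (x, t))"
        unfolding L2_def L2_norm_on_def set_borel_measurable_def set_integrable_def set_lebesgue_integral_def
        by (simp_all only:)
    qed
    ultimately show ?thesis using that unfolding Linf_L2_def by (auto elim!: eventually_mono)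
  qed
  show ?thesis by (rule that[OF reg PDE' Linf_cut[OF F(3)] Linf_cut[OF F(4)]])
qed

lemma AE_pair_Iv_slices:
  assumes "AE p in lborel. p \<in> {0<..<a} \<times> {0<..<b} \<longrightarrow> P p"
  shows "AE x in Iv a. AE t in Iv b. P (x, t)"
  using Iv2.AE_pair[of P a b] assms by (simp add: AE_pair_Iv)

text \<open>At time 0 the two functions agree, so their difference at time s comes from two
  increments since time 0, each small by continuity.\<close>

lemma small_initial_difference:
  assumes C1: "C_L2 L T u1" and C2: "C_L2 L T u2" and T: "0 < T"
    and eq: "AE x in lborel. x \<in> {0<..<L} \<longrightarrow> u1 (x, 0) = u2 (x, 0)" and e: "0 < (e::real)"
  shows "\<exists>\<eta>>0. \<forall>s. 0 < s \<longrightarrow> s < \<eta> \<longrightarrow> s < T \<longrightarrow> (\<integral>x. (cut L T u1 (x, s) - cut L T u2 (x, s))\<^sup>2 \<partial>Iv L) \<le> e"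
proof -
  have 0: "0 \<in> {0..T}" using T by simp
  have e4: "0 < e / 4" using e by simp
  obtain \<eta>1 where \<eta>1: "0 < \<eta>1" "\<And>s. s \<in> {0..T} \<Longrightarrow> \<bar>s - 0\<bar> < \<eta>1 \<Longrightarrow>
      (\<integral>x. (indicator {0<..<L} x * (u1 (x, s) - u1 (x, 0)))\<^sup>2 \<partial>Iv L) < e / 4"
    using C_L2_close[OF C1 0 e4] by blast
  obtain \<eta>2 where \<eta>2: "0 < \<eta>2" "\<And>s. s \<in> {0..T} \<Longrightarrow> \<bar>s - 0\<bar> < \<eta>2 \<Longrightarrow>
      (\<integral>x. (indicator {0<..<L} x * (u2 (x, s) - u2 (x, 0)))\<^sup>2 \<partial>Iv L) < e / 4"
    using C_L2_close[OF C2 0 e4] by blast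
  have "(\<integral>x. (cut L T u1 (x, s) - cut L T u2 (x, s))\<^sup>2 \<partial>Iv L) \<le> e" if s: "0 < s" "s < min \<eta>1 \<eta>2" "s < T" for s
  proof -
    have sT: "s \<in> {0..T}" using s by simp
    let ?f = "\<lambda>x. indicator {0<..<L} x * (u1 (x, s) - u1 (x, 0))"
    let ?g = "\<lambda>x. - (indicator {0<..<L} x * (u2 (x, s) - u2 (x, 0)))"
    note f = C_L2_norm_sq(3)[OF C1 sT 0] and g = sqint_uminus[OF C_L2_norm_sq(3)[OF C2 sT 0]]
    note m = C_L2_norm_sq(2)[OF C1 sT 0, THEN sqint_measurable] C_L2_norm_sq(2)[OF C2 sT 0, THEN sqint_measurable]
    have "(\<integral>x. (cut L T u1 (x, s) - cut L T u2 (x, s))\<^sup>2 \<partial>Iv L)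
        = (\<integral>x. (indicator {0<..<L} x * u1 (x, s) - indicator {0<..<L} x * u2 (x, s))\<^sup>2 \<partial>Iv L)"
      using s by (intro Bochner_Integration.integral_cong) (auto simp: cut_def indicator_def)
    also have "\<dots> = (\<integral>x. (?f x + ?g x)\<^sup>2 \<partial>Iv L)"
    proof (rule integral_cong_AE)
      show "(\<lambda>x. (indicator {0<..<L} x * u1 (x, s) - indicator {0<..<L} x * u2 (x, s))\<^sup>2) \<in> borel_measurable (Iv L)"
        using m by (intro borel_measurable_power borel_measurable_diff)
      show "(\<lambda>x. (?f x + ?g x)\<^sup>2) \<in> borel_measurable (Iv L)"
        using sqint_measurable[OF f] sqint_measurable[OF g] by (intro borel_measurable_power borel_measurable_add)
      show "AE x in Iv L. (indicator {0<..<L} x * u1 (x, s) - indicator {0<..<L} x * u2 (x, s))\<^sup>2 = (?f x + ?g x)\<^sup>2"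
        using eq[folded AE_Iv]
      proof eventually_elim
        case (elim x)
        then show ?case by (simp add: right_diff_distrib)
      qed
    qed
    also have "\<dots> \<le> 2 * (\<integral>x. (?f x)\<^sup>2 \<partial>Iv L) + 2 * (\<integral>x. (?g x)\<^sup>2 \<partial>Iv L)"
      by (rule integral_square_add_le[OF f g])
    also have "\<dots> \<le> e"
      using \<eta>1(2)[OF sT] \<eta>2(2)[OF sT] s by simp
    finally show ?thesis .
  qed
  then show ?thesis using \<eta>1(1) \<eta>2(1) by (intro exI[of _ "min \<eta>1 \<eta>2"]) auto
qed

lemma regularD:
  assumes "regular L T u ux uxx ut \<psi> \<psi>x \<psi>xx \<psi>xt \<psi>t"
  shows "sqint (Iv L \<Otimes>\<^sub>M Iv T) u" "sqint (Iv L \<Otimes>\<^sub>M Iv T) ux" "sqint (Iv L \<Otimes>\<^sub>M Iv T) uxx"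
    "sqint (Iv L \<Otimes>\<^sub>M Iv T) ut" "sqint (Iv L \<Otimes>\<^sub>M Iv T) \<psi>" "sqint (Iv L \<Otimes>\<^sub>M Iv T) \<psi>x"
    "sqint (Iv L \<Otimes>\<^sub>M Iv T) \<psi>xx" "sqint (Iv L \<Otimes>\<^sub>M Iv T) \<psi>xt" "sqint (Iv L \<Otimes>\<^sub>M Iv T) \<psi>t"
    "weak_pair L T (1, 0) u ux" "weak_pair L T (1, 0) ux uxx" "weak_pair L T (0, 1) u ut"
    "weak_pair L T (1, 0) \<psi> \<psi>x" "weak_pair L T (1, 0) \<psi>x \<psi>xx" "weak_pair L T (0, 1) \<psi>x \<psi>xt"
    "weak_pair L T (0, 1) \<psi> \<psi>t"
  using assms unfolding regular_def by blast+

lemma AE_swap_representation: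
  assumes q: "sqint (Iv a \<Otimes>\<^sub>M Iv b) q" and qx: "sqint (Iv a \<Otimes>\<^sub>M Iv b) qx" and c: "sqint (Iv b) c"
    and AE: "AE x in Iv a. AE t in Iv b. q (x, t) = c t + prim (Iv a) (\<lambda>y. qx (y, t)) x"
  shows "AE t in Iv b. AE x in Iv a. q (x, t) = c t + prim (Iv a) (\<lambda>y. qx (y, t)) x"
proof -
  have [measurable]: "q \<in> borel_measurable (borel \<Otimes>\<^sub>M borel)" "qx \<in> borel_measurable (borel \<Otimes>\<^sub>M borel)"
    "c \<in> borel_measurable borel"
    using sqint_pair_measurable[OF q] sqint_pair_measurable[OF qx] sqint_measurable[OF c] by simp_all
  have "AE x in Iv a. AE t in Iv b. q (x, t) = (\<lambda>p. c (snd p) + prim (Iv a) (\<lambda>y. qx (y, snd p)) (fst p)) (x, t)"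
    using AE by simp
  then have "AE t in Iv b. AE x in Iv a. q (x, t) = (\<lambda>p. c (snd p) + prim (Iv a) (\<lambda>y. qx (y, snd p)) (fst p)) (x, t)"
    by (subst (asm) AE_swap_eq(1)) measurable
  then show ?thesis by simp
qed

lemma boundary_value_cut:
  assumes t: "0 < t" "t < T" and AE: "AE x in Iv L. cut L T v (x, t) = c + prim (Iv L) g x"
    and bv: "boundary_value L (\<lambda>x. v (x, t)) x0 k"
    and g: "integrable (Iv L) g" and L: "0 < L" and x0: "x0 \<in> {0..L}"
  shows "k = c + prim (Iv L) g x0"
proof (rule boundary_value_eq[OF bv _ g L x0])
  show "AE x in Iv L. v (x, t) = c + prim (Iv L) g x"
    using AE AE_Iv_in by eventually_elim (use t in \<open>simp add: cut_def\<close>)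
qed

text \<open>The problems only assert that certain boundary values occur; this pins them to the
  coefficient functions of the representation in x.\<close>

lemma boundary_value_at_0_unique:
  assumes L: "0 < L" and u: "sqint (Iv L \<Otimes>\<^sub>M Iv T) (cut L T u)" and ux: "sqint (Iv L \<Otimes>\<^sub>M Iv T) ux" and c: "sqint (Iv T) c"
    and rep: "AE x in Iv L. AE t in Iv T. cut L T u (x, t) = c t + prim (Iv L) (\<lambda>y. ux (y, t)) x"
  shows "AE t in Iv T. \<forall>k. (boundary_value L (\<lambda>x. u (x, t)) 0 k \<longrightarrow> k = c t)
    \<and> (boundary_value L (\<lambda>x. u (x, t)) L k \<longrightarrow> k = c t + (\<integral>x. ux (x, t) \<partial>Iv L))"
  using AE_swap_representation[OF u ux c rep] AE_sqint_slices(1)[OF ux] AE_Iv_in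
proof eventually_elim
  case (elim t)
  note i = sqint_Iv_integrable[OF elim(2)]
  have m: "(\<lambda>x. ux (x, t)) \<in> borel_measurable borel" using sqint_measurable[OF elim(2)] by simp
  show ?case
  proof (intro allI conjI impI)
    fix k assume "boundary_value L (\<lambda>x. u (x, t)) 0 k"
    from boundary_value_cut[OF _ _ elim(1) this i L] elim(3) L show "k = c t" by (simp add: prim_nonpos)
  next
    fix k assume "boundary_value L (\<lambda>x. u (x, t)) L k"
    from boundary_value_cut[OF _ _ elim(1) this i L] elim(3) L
    show "k = c t + (\<integral>x. ux (x, t) \<partial>Iv L)" by (simp add: prim_total[OF order_refl m])
  qed
qed

text \<open>Everything fixed here belongs to the limit problem, traces included, so constants drawn
  from it cannot depend on \<epsilon>.\<close>

locale limit_layer =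
  fixes L T lam U :: real and f g :: "real \<times> real \<Rightarrow> real" and ui \<psi>i :: "real \<Rightarrow> real"
    and u0 \<psi>0 u0x u0xx u0t \<psi>0x \<psi>0xx \<psi>0xt \<psi>0t :: "real \<times> real \<Rightarrow> real" and \<alpha> \<beta> d0 e0 :: "real \<Rightarrow> real"
  assumes pos: "0 < L" "0 < T" "0 < lam" "0 < U" "U < 1 / lam"
    and K0: "(u0, \<psi>0) \<in> space_K0 lam U L T" and sol0: "limit_solution lam U L T f g ui \<psi>i u0 \<psi>0"
    and reg0: "regular L T (cut L T u0) u0x u0xx u0t (cut L T \<psi>0) \<psi>0x \<psi>0xx \<psi>0xt \<psi>0t"
    and PDE0: "AE p in lborel. p \<in> {0<..<L} \<times> {0<..<T} \<longrightarrow>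
       u0t p + U * u0x p + \<psi>0x p = f p \<and> \<psi>0t p + U * \<psi>0x p + u0x p / lam\<^sup>2 = g p"
    and sq0: "sqint (Iv T) \<alpha>" "sqint (Iv T) \<beta>" "sqint (Iv T) d0" "sqint (Iv T) e0"
    and rep0: "AE x in Iv L. AE t in Iv T. cut L T u0 (x, t) = \<alpha> t + prim (Iv L) (\<lambda>y. u0x (y, t)) x"
      "AE x in Iv L. AE t in Iv T. u0x (x, t) = d0 t + prim (Iv L) (\<lambda>y. u0xx (y, t)) x"
      "AE x in Iv L. AE t in Iv T. cut L T \<psi>0 (x, t) = \<beta> t + prim (Iv L) (\<lambda>y. \<psi>0x (y, t)) x"
      "AE x in Iv L. AE t in Iv T. \<psi>0x (x, t) = e0 t + prim (Iv L) (\<lambda>y. \<psi>0xx (y, t)) x"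
begin

lemma traces0: "AE t in Iv T. \<alpha> t + (\<integral>x. u0x (x, t) \<partial>Iv L) = 0" "AE t in Iv T. \<alpha> t + U * lam\<^sup>2 * \<beta> t = 0"
proof -
  note r = regularD[OF reg0]
  have bc: "AE t in Iv T. (\<exists>a b. boundary_value L (\<lambda>x. u0 (x, t)) 0 a \<and> boundary_value L (\<lambda>x. \<psi>0 (x, t)) 0 b \<and>
           a + U * lam\<^sup>2 * b = 0) \<and> boundary_value L (\<lambda>x. u0 (x, t)) L 0"
    using sol0 unfolding limit_solution_def AE_Iv by blast
  note b = boundary_value_at_0_unique[OF pos(1) r(1,2) sq0(1) rep0(1)]
    boundary_value_at_0_unique[OF pos(1) r(5,6) sq0(2) rep0(3)]
  show "AE t in Iv T. \<alpha> t + (\<integral>x. u0x (x, t) \<partial>Iv L) = 0"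
    using bc b(1)
  proof eventually_elim
    case (elim t)
    then have "0 = \<alpha> t + (\<integral>x. u0x (x, t) \<partial>Iv L)" by blast
    then show ?case by simp
  qed
  show "AE t in Iv T. \<alpha> t + U * lam\<^sup>2 * \<beta> t = 0"
    using bc b
  proof eventually_elim
    case (elim t)
    then obtain k l where "boundary_value L (\<lambda>x. u0 (x, t)) 0 k" "boundary_value L (\<lambda>x. \<psi>0 (x, t)) 0 l"
      "k + U * lam\<^sup>2 * l = 0" by blast
    moreover have "k = \<alpha> t" "l = \<beta> t" using calculation elim by blast+
    ultimately show ?case by simp
  qed
qed

text \<open>A derivative of \<beta> is found through the viscous solution and so might change with
  \<epsilon>. The setting is therefore offered for every b' with primitive \<beta>, so that one
  choice can serve all \<epsilon>.\<close>

lemma viscous_layer_setting: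
  assumes \<epsilon>: "0 < \<epsilon>" "2 * \<epsilon> \<le> 1" and K: "(u, \<psi>) \<in> space_K L T"
    and sol: "viscous_solution lam U L T \<epsilon> f g ui \<psi>i u \<psi>"
  obtains ux uxx ut \<psi>x \<psi>xx \<psi>t d e b where "sqint (Iv T) b" "AE t in Iv T. \<beta> t = prim (Iv T) b t"
    "\<And>b'. sqint (Iv T) b' \<Longrightarrow> AE t in Iv T. \<beta> t = prim (Iv T) b' t \<Longrightarrow>
      layer_setting L T lam U \<epsilon> (cut L T u) ux uxx ut (cut L T \<psi>) \<psi>x \<psi>xx \<psi>t
        (cut L T u0) u0x u0xx u0t (cut L T \<psi>0) \<psi>0x \<psi>0xx \<psi>0t d e d0 e0 \<alpha> \<beta> b'"
proof -
  obtain ux uxx ut \<psi>x \<psi>xx \<psi>xt \<psi>t where reg: "regular L T (cut L T u) ux uxx ut (cut L T \<psi>) \<psi>x \<psi>xx \<psi>xt \<psi>t"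
    and PDE: "AE p in lborel. p \<in> {0<..<L} \<times> {0<..<T} \<longrightarrow>
       ut p + U * ux p + \<psi>x p - 2 * \<epsilon> * uxx p = f p \<and> \<psi>t p + U * \<psi>x p + ux p / lam\<^sup>2 = g p"
    by (rule viscous_regular[OF K sol])
  note r = regularD[OF reg] and r0 = regularD[OF reg0]
  note L = pos(1) and T = pos(2)
  obtain a1 where a1: "sqint (Iv T) a1"
    "AE x in Iv L. AE t in Iv T. cut L T u (x, t) = a1 t + prim (Iv L) (\<lambda>y. ux (y, t)) x"
    by (rule weak_pair_x_representation[OF L r(1,2,10)])
  obtain a2 where a2: "sqint (Iv T) a2"
    "AE x in Iv L. AE t in Iv T. cut L T \<psi> (x, t) = a2 t + prim (Iv L) (\<lambda>y. \<psi>x (y, t)) x"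
    by (rule weak_pair_x_representation[OF L r(5,6,13)])
  obtain d where d: "sqint (Iv T) d"
    "AE x in Iv L. AE t in Iv T. ux (x, t) = d t + prim (Iv L) (\<lambda>y. uxx (y, t)) x"
    by (rule weak_pair_x_representation[OF L r(2,3,11)])
  obtain e where e: "sqint (Iv T) e"
    "AE x in Iv L. AE t in Iv T. \<psi>x (x, t) = e t + prim (Iv L) (\<lambda>y. \<psi>xx (y, t)) x"
    by (rule weak_pair_x_representation[OF L r(6,7,14)])
  have bc: "AE t in Iv T. boundary_value L (\<lambda>x. u (x, t)) 0 0 \<and> boundary_value L (\<lambda>x. u (x, t)) L 0 \<and>
        boundary_value L (\<lambda>x. \<psi> (x, t)) 0 0"
    using sol unfolding viscous_solution_def AE_Iv by blast
  have zero: "AE t in Iv T. a1 t = 0 \<and> (\<integral>x. ux (x, t) \<partial>Iv L) = 0 \<and> a2 t = 0"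
    using bc boundary_value_at_0_unique[OF L r(1,2) a1] boundary_value_at_0_unique[OF L r(5,6) a2]
  proof eventually_elim
    case (elim t)
    have "0 = a1 t" "0 = a1 t + (\<integral>x. ux (x, t) \<partial>Iv L)" "0 = a2 t"
      using elim by blast+
    then show ?case by simp
  qed
  have repu: "AE x in Iv L. AE t in Iv T. cut L T u (x, t) = prim (Iv L) (\<lambda>y. ux (y, t)) x"
    using a1(2)
  proof eventually_elim
    case (elim x)
    then show ?case using zero by eventually_elim simp
  qed
  have rep\<psi>: "AE x in Iv L. AE t in Iv T. cut L T \<psi> (x, t) = prim (Iv L) (\<lambda>y. \<psi>x (y, t)) x"
    using a2(2)
  proof eventually_elim
    case (elim x)
    then show ?case using zero by eventually_elim simp
  qed
  have C: "C_L2 L T u" "C_L2 L T \<psi>" "C_L2 L T u0" "C_L2 L T \<psi>0"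
    using K K0 unfolding space_K_def space_K0_def space_F_def space_F0_def by blast+
  have init: "AE x in lborel. x \<in> {0<..<L} \<longrightarrow> u (x, 0) = u0 (x, 0)" "AE x in lborel. x \<in> {0<..<L} \<longrightarrow> \<psi> (x, 0) = \<psi>0 (x, 0)"
  proof -
    have "AE x in lborel. x \<in> {0<..<L} \<longrightarrow> u (x, 0) = ui x \<and> \<psi> (x, 0) = \<psi>i x"
      "AE x in lborel. x \<in> {0<..<L} \<longrightarrow> u0 (x, 0) = ui x \<and> \<psi>0 (x, 0) = \<psi>i x"
      using sol sol0 unfolding viscous_solution_def limit_solution_def by blast+
    then show "AE x in lborel. x \<in> {0<..<L} \<longrightarrow> u (x, 0) = u0 (x, 0)" "AE x in lborel. x \<in> {0<..<L} \<longrightarrow> \<psi> (x, 0) = \<psi>0 (x, 0)"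
      by (eventually_elim, simp)+
  qed
  \<comment> \<open>Each solution has its own constant of integration in time; the common initial
    data make these cancel in the difference.\<close>
  have time: "AE x in Iv L. AE t in Iv T. cut L T v (x, t) - cut L T v0 (x, t) = prim (Iv T) (\<lambda>s. vt (x, s) - v0t (x, s)) t"
    if v: "sqint (Iv L \<Otimes>\<^sub>M Iv T) (cut L T v)" "sqint (Iv L \<Otimes>\<^sub>M Iv T) vt" "weak_pair L T (0, 1) (cut L T v) vt"
      and v0: "sqint (Iv L \<Otimes>\<^sub>M Iv T) (cut L T v0)" "sqint (Iv L \<Otimes>\<^sub>M Iv T) v0t" "weak_pair L T (0, 1) (cut L T v0) v0t"
      and C: "C_L2 L T v" "C_L2 L T v0" and i: "AE x in lborel. x \<in> {0<..<L} \<longrightarrow> v (x, 0) = v0 (x, 0)"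
    for v vt v0 v0t
  proof -
    obtain k where k: "sqint (Iv L) k" "AE x in Iv L. AE t in Iv T. cut L T v (x, t) = k x + prim (Iv T) (\<lambda>s. vt (x, s)) t"
      by (rule weak_pair_t_representation[OF T v])
    obtain k0 where k0: "sqint (Iv L) k0" "AE x in Iv L. AE t in Iv T. cut L T v0 (x, t) = k0 x + prim (Iv T) (\<lambda>s. v0t (x, s)) t"
      by (rule weak_pair_t_representation[OF T v0])
    have "AE x in Iv L. AE t in Iv T. (\<lambda>p. cut L T v p - cut L T v0 p) (x, t)
        = (k x - k0 x) + prim (Iv T) (\<lambda>s. (\<lambda>p. vt p - v0t p) (x, s)) t"
      using k(2) k0(2) AE_sqint_slices(2)[OF v(2)] AE_sqint_slices(2)[OF v0(2)]
    proof eventually_elim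
      case (elim x)
      show ?case using elim(1,2)
        by eventually_elim (simp add: prim_diff[OF elim(3,4)[THEN sqint_Iv_integrable]])
    qed
    from zero_initial_value[OF L T sqint_diff[OF v(1) v0(1)] sqint_diff[OF v(2) v0(2)] sqint_diff[OF k(1) k0(1)] this
        small_initial_difference[OF C T i]]
    show ?thesis by simp
  qed
  note time_u = time[OF r(1,4,12) r0(1,4,12) C(1,3) init(1)]
  note time_\<psi> = time[OF r(5,9,16) r0(5,9,16) C(2,4) init(2)]
  obtain \<rho> where \<rho>: "sqint (Iv L) \<rho>" "AE x in Iv L. AE t in Iv T. \<psi>x (x, t) = \<rho> x + prim (Iv T) (\<lambda>s. \<psi>xt (x, s)) t"
    by (rule weak_pair_t_representation[OF T r(6,8,15)])
  obtain \<rho>0 where \<rho>0: "sqint (Iv L) \<rho>0" "AE x in Iv L. AE t in Iv T. \<psi>0x (x, t) = \<rho>0 x + prim (Iv T) (\<lambda>s. \<psi>0xt (x, s)) t"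
    by (rule weak_pair_t_representation[OF T r0(6,8,15)])
  \<comment> \<open>Applied to \<psi> - \<psi>0, whose trace at x = 0 is - \<beta> because \<psi>
    vanishes there.\<close>
  obtain b where b: "sqint (Iv T) b" "AE t in Iv T. \<beta> t = prim (Iv T) b t"
  proof (rule trace_is_primitive[OF L T sqint_diff[OF r(5) r0(5)] sqint_diff[OF r(6) r0(6)] sqint_diff[OF r(9) r0(9)]
        sqint_diff[OF r(8) r0(8)] sqint_diff[OF \<rho>(1) \<rho>0(1)]])
    have px: "AE t in Iv T. \<forall>x. prim (Iv L) (\<lambda>y. \<psi>x (y, t) - \<psi>0x (y, t)) x
        = prim (Iv L) (\<lambda>y. \<psi>x (y, t)) x - prim (Iv L) (\<lambda>y. \<psi>0x (y, t)) x"
      using AE_sqint_slices(1)[OF r(6)] AE_sqint_slices(1)[OF r0(6)]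
    proof eventually_elim
      case (elim t)
      show ?case using prim_diff[OF elim[THEN sqint_Iv_integrable]] by blast
    qed
    show "AE x in Iv L. AE t in Iv T. cut L T \<psi> (x, t) - cut L T \<psi>0 (x, t) = - \<beta> t + prim (Iv L) (\<lambda>y. \<psi>x (y, t) - \<psi>0x (y, t)) x"
      using rep\<psi> rep0(3)
    proof eventually_elim
      case (elim x)
      show ?case using elim px by eventually_elim simp
    qed
    show "AE x in Iv L. AE t in Iv T. cut L T \<psi> (x, t) - cut L T \<psi>0 (x, t) = prim (Iv T) (\<lambda>s. \<psi>t (x, s) - \<psi>0t (x, s)) t"
      by (rule time_\<psi>)
    show "AE x in Iv L. AE t in Iv T. \<psi>x (x, t) - \<psi>0x (x, t) = \<rho> x - \<rho>0 x + prim (Iv T) (\<lambda>s. \<psi>xt (x, s) - \<psi>0xt (x, s)) t"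
      using \<rho>(2) \<rho>0(2) AE_sqint_slices(2)[OF r(8)] AE_sqint_slices(2)[OF r0(8)]
    proof eventually_elim
      case (elim x)
      show ?case using elim(1,2)
        by eventually_elim (simp add: prim_diff[OF elim(3,4)[THEN sqint_Iv_integrable]])
    qed
  qed
  have dPDE: "AE x in Iv L. AE t in Iv T. (ut (x, t) + U * ux (x, t) + \<psi>x (x, t) - 2 * \<epsilon> * uxx (x, t)
      = u0t (x, t) + U * u0x (x, t) + \<psi>0x (x, t)) \<and>
      (\<psi>t (x, t) + U * \<psi>x (x, t) + ux (x, t) / lam\<^sup>2 = \<psi>0t (x, t) + U * \<psi>0x (x, t) + u0x (x, t) / lam\<^sup>2)"
    by (rule AE_pair_Iv_slices) (use PDE PDE0 in eventually_elim, simp)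
  show ?thesis
  proof (rule that[OF b])
    fix b' assume b': "sqint (Iv T) b'" "AE t in Iv T. \<beta> t = prim (Iv T) b' t"
    show "layer_setting L T lam U \<epsilon> (cut L T u) ux uxx ut (cut L T \<psi>) \<psi>x \<psi>xx \<psi>t
        (cut L T u0) u0x u0xx u0t (cut L T \<psi>0) \<psi>0x \<psi>0xx \<psi>0t d e d0 e0 \<alpha> \<beta> b'"
    proof unfold_locales
      show "AE t in Iv T. (\<integral>x. ux (x, t) \<partial>Iv L) = 0" using zero by eventually_elim simp
      show "AE x in Iv L. AE t in Iv T. ut (x, t) - u0t (x, t)
        = - U * (ux (x, t) - u0x (x, t)) - (\<psi>x (x, t) - \<psi>0x (x, t)) + 2 * \<epsilon> * uxx (x, t)"
        using dPDE
      proof eventually_elim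
        case (elim x)
        then show ?case by eventually_elim (simp add: algebra_simps)
      qed
      show "AE x in Iv L. AE t in Iv T. \<psi>t (x, t) - \<psi>0t (x, t)
        = - U * (\<psi>x (x, t) - \<psi>0x (x, t)) - (ux (x, t) - u0x (x, t)) / lam\<^sup>2"
        using dPDE
      proof eventually_elim
        case (elim x)
        then show ?case by eventually_elim (simp add: algebra_simps diff_divide_distrib)
      qed
      show "AE t in Iv T. AE x in Iv L. ux (x, t) = d t + prim (Iv L) (\<lambda>y. uxx (y, t)) x"
        by (rule AE_swap_representation[OF r(2,3) d])
      show "AE t in Iv T. AE x in Iv L. \<psi>x (x, t) = e t + prim (Iv L) (\<lambda>y. \<psi>xx (y, t)) x"
        by (rule AE_swap_representation[OF r(6,7) e])
      show "AE t in Iv T. AE x in Iv L. u0x (x, t) = d0 t + prim (Iv L) (\<lambda>y. u0xx (y, t)) x"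
        by (rule AE_swap_representation[OF r0(2,3) sq0(3) rep0(2)])
      show "AE t in Iv T. AE x in Iv L. \<psi>0x (x, t) = e0 t + prim (Iv L) (\<lambda>y. \<psi>0xx (y, t)) x"
        by (rule AE_swap_representation[OF r0(6,7) sq0(4) rep0(4)])
    qed (rule pos \<epsilon> r r0 d e sq0 b' repu rep\<psi> rep0 traces0 time_u time_\<psi>)+
  qed
qed

end

text \<open>The constants must precede \<epsilon>, and so must the derivative b of the trace. If
  \<beta> has no such derivative, no viscous solution exists for the \<epsilon> considered, and any
  constants do.\<close>

lemma (in limit_layer) error_bound:
  obtains A Q m where "0 \<le> A" "0 \<le> Q" "0 < m"
    "\<And>\<epsilon> u \<psi>. 0 < \<epsilon> \<Longrightarrow> 2 * \<epsilon> \<le> 1 \<Longrightarrow> (u, \<psi>) \<in> space_K L T \<Longrightarrow>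
      viscous_solution lam U L T \<epsilon> f g ui \<psi>i u \<psi> \<Longrightarrow>
      AE x in Iv L. AE t in Iv T.
        \<bar>cut L T u (x, t) - cut L T u0 (x, t)\<bar> \<le> sqrt (Q * \<epsilon>) + A * exp (- m * x / (2 * \<epsilon>)) \<and>
        \<bar>cut L T \<psi> (x, t) - cut L T \<psi>0 (x, t)\<bar> \<le> sqrt (Q * \<epsilon>) + A * exp (- m * x / (2 * \<epsilon>))"
proof (cases "\<exists>b. sqint (Iv T) b \<and> (AE t in Iv T. \<beta> t = prim (Iv T) b t)")
  case False
  have False if "0 < \<epsilon>" "2 * \<epsilon> \<le> 1" "(u, \<psi>) \<in> space_K L T" "viscous_solution lam U L T \<epsilon> f g ui \<psi>i u \<psi>" for \<epsilon> u \<psi>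
    using viscous_layer_setting[OF that] False by blast
  then show ?thesis by (intro that[of 0 0 1]) auto
next
  case True
  then obtain b where b: "sqint (Iv T) b" "AE t in Iv T. \<beta> t = prim (Iv T) b t" by blast
  define c where "c = 1 / lam"
  define m where "m = c\<^sup>2 / U - U"
  have c: "0 < c" using pos by (simp add: c_def)
  have "U * U < c * c" using pos by (intro mult_strict_mono) (auto simp: c_def)
  then have m: "0 < m" using pos by (simp add: m_def power2_eq_square less_divide_eq)
  obtain C where C: "0 \<le> C"
    "\<And>\<nu> z y r d e b w1 w p1 p. remainder_evolution L T U c m \<nu> z y r d e b w1 w p1 p \<Longrightarrow>
      (AE x in Iv L. AE t in Iv T.
        \<bar>w (x, t)\<bar> \<le> sqrt (C * \<nu> * ((\<integral>t. (b t)\<^sup>2 \<partial>Iv T) + integral\<^sup>L (Iv L \<Otimes>\<^sub>M Iv T) (\<lambda>q. (r q)\<^sup>2)))) \<and>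
      (AE x in Iv L. AE t in Iv T.
        \<bar>p (x, t)\<bar> \<le> sqrt (C * \<nu> * ((\<integral>t. (b t)\<^sup>2 \<partial>Iv T) + integral\<^sup>L (Iv L \<Otimes>\<^sub>M Iv T) (\<lambda>q. (r q)\<^sup>2))))"
    using remainder_bound[OF pos(1,2,4) c m] by metis
  define B where "B t = U * lam\<^sup>2 * b t" for t
  have sB: "sqint (Iv T) B" unfolding B_def[abs_def] by (rule sqint_cmult[OF b(1)])
  define Q0 where "Q0 = (\<integral>t. (B t)\<^sup>2 \<partial>Iv T) + integral\<^sup>L (Iv L \<Otimes>\<^sub>M Iv T) (\<lambda>q. (u0xx q)\<^sup>2)"
  have Q0: "0 \<le> Q0" by (simp add: Q0_def)
  define A0 where "A0 = (\<integral>t. \<bar>B t\<bar> \<partial>Iv T)"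
  have A0: "0 \<le> A0" by (simp add: A0_def)
  \<comment> \<open>The factor 1 + 1 / lam covers both w and p / lam, since p estimates lam times
    the error of \<psi>; the 2 comes from \<nu> = 2 \<epsilon>.\<close>
  define Q where "Q = (1 + 1 / lam)\<^sup>2 * (C * 2 * Q0)"
  define A where "A = A0 + c / U * A0 / lam"
  show ?thesis
  proof (rule that[of A Q m])
    show "0 \<le> A" using A0 c pos by (simp add: A_def)
    show "0 \<le> Q" using C Q0 by (simp add: Q_def)
    show "0 < m" by (rule m)
    fix \<epsilon> u \<psi> assume \<epsilon>: "0 < \<epsilon>" "2 * \<epsilon> \<le> 1" and K: "(u, \<psi>) \<in> space_K L T"
      and sol: "viscous_solution lam U L T \<epsilon> f g ui \<psi>i u \<psi>"
    obtain ux uxx ut \<psi>x \<psi>xx \<psi>t d e where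
      setting: "layer_setting L T lam U \<epsilon> (cut L T u) ux uxx ut (cut L T \<psi>) \<psi>x \<psi>xx \<psi>t
        (cut L T u0) u0x u0xx u0t (cut L T \<psi>0) \<psi>0x \<psi>0xx \<psi>0t d e d0 e0 \<alpha> \<beta> b"
      by (rule viscous_layer_setting[OF \<epsilon> K sol]) (use b in blast)
    interpret S: layer_setting L T lam U \<epsilon> "cut L T u" ux uxx ut "cut L T \<psi>" \<psi>x \<psi>xx \<psi>t
        "cut L T u0" u0x u0xx u0t "cut L T \<psi>0" \<psi>0x \<psi>0xx \<psi>0t d e d0 e0 \<alpha> \<beta> b
      by (rule setting)
    have cS: "S.c = c" by (simp add: S.c_def c_def)
    have mS: "S.m = m" by (simp add: S.m_def m_def cS)
    have nS: "S.\<nu> = 2 * \<epsilon>" by (simp add: S.\<nu>_def)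
    have bS: "S.bb = B" by (simp add: S.bb_def B_def fun_eq_iff)
    note bound = C(2)[OF S.evolution[unfolded cS mS nS bS]]
    define s where "s = sqrt (C * (2 * \<epsilon>) * Q0)"
    have s0: "0 \<le> s" using C Q0 \<epsilon> by (simp add: s_def)
    have sQ: "sqrt (Q * \<epsilon>) = (1 + 1 / lam) * s"
    proof -
      have "Q * \<epsilon> = (1 + 1 / lam)\<^sup>2 * (C * (2 * \<epsilon>) * Q0)" by (simp add: Q_def)
      then have "sqrt (Q * \<epsilon>) = sqrt ((1 + 1 / lam)\<^sup>2) * s"
        unfolding s_def by (simp only: real_sqrt_mult)
      also have "sqrt ((1 + 1 / lam)\<^sup>2) = 1 + 1 / lam" using pos by simp
      finally show ?thesis .
    qed
    have a_le: "\<bar>S.a t\<bar> \<le> A0" for t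
      using abs_prim_le[OF sqint_Iv_integrable[OF sB], of t] by (simp add: S.a_def bS A0_def)
    show "AE x in Iv L. AE t in Iv T.
        \<bar>cut L T u (x, t) - cut L T u0 (x, t)\<bar> \<le> sqrt (Q * \<epsilon>) + A * exp (- m * x / (2 * \<epsilon>)) \<and>
        \<bar>cut L T \<psi> (x, t) - cut L T \<psi>0 (x, t)\<bar> \<le> sqrt (Q * \<epsilon>) + A * exp (- m * x / (2 * \<epsilon>))"
      using S.AE_w conjunct1[OF bound] conjunct2[OF bound] AE_Iv_in
    proof eventually_elim
      case x: (elim x)
      define E where "E = layer L m (2 * \<epsilon>) x"
      define X where "X = exp (- m * x / (2 * \<epsilon>))"
      have E: "0 \<le> E" "E \<le> X"
        using layer_bounds[OF pos(1) m, of "2 * \<epsilon>" x] \<epsilon> x by (simp_all add: E_def X_def)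
      show ?case
        using x(1-3)
      proof eventually_elim
        case (elim t)
        have w: "\<bar>S.w (x, t)\<bar> \<le> s" "\<bar>S.p (x, t)\<bar> \<le> s"
          using elim(2,3) by (simp_all add: s_def Q0_def)
        have aE: "\<bar>S.a t * E\<bar> \<le> A0 * X"
          unfolding abs_mult using a_le[of t] E A0 by (intro mult_mono) auto
        have u: "cut L T u (x, t) - cut L T u0 (x, t) = S.w (x, t) + S.a t * E"
          and p: "lam * (cut L T \<psi> (x, t) - cut L T \<psi>0 (x, t)) = S.p (x, t) - c / U * (S.a t * E)"
          using elim(1) by (simp_all add: E_def cS mS nS)
        have "\<bar>cut L T u (x, t) - cut L T u0 (x, t)\<bar> \<le> s + A0 * X"
          unfolding u using w aE by linarith
        moreover have "s \<le> sqrt (Q * \<epsilon>)" "s / lam \<le> sqrt (Q * \<epsilon>)"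
          unfolding sQ using s0 pos by (simp_all add: distrib_right)
        moreover have "A0 * X \<le> A * X" "c / U * A0 / lam * X \<le> A * X"
        proof -
          have X: "0 \<le> X" by (simp add: X_def)
          have "0 \<le> c / U * A0 / lam" using A0 c pos by simp
          then have "A0 \<le> A" "c / U * A0 / lam \<le> A" using A0 by (simp_all add: A_def)
          then show "A0 * X \<le> A * X" "c / U * A0 / lam * X \<le> A * X"
            using mult_right_mono[OF _ X] by blast+
        qed
        moreover have "\<bar>cut L T \<psi> (x, t) - cut L T \<psi>0 (x, t)\<bar> \<le> s / lam + c / U * A0 / lam * X"
        proof -
          have "lam * \<bar>cut L T \<psi> (x, t) - cut L T \<psi>0 (x, t)\<bar> = \<bar>S.p (x, t) - c / U * (S.a t * E)\<bar>"
            using pos unfolding p[symmetric] by (simp add: abs_mult)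
          also have "\<dots> \<le> \<bar>S.p (x, t)\<bar> + \<bar>c / U * (S.a t * E)\<bar>" by (rule abs_triangle_ineq4)
          also have "\<bar>c / U * (S.a t * E)\<bar> = c / U * \<bar>S.a t * E\<bar>" using c pos by (simp add: abs_mult)
          also have "\<bar>S.p (x, t)\<bar> + c / U * \<bar>S.a t * E\<bar> \<le> s + c / U * (A0 * X)"
            using w aE c pos by (intro add_mono mult_left_mono) auto
          finally have "\<bar>cut L T \<psi> (x, t) - cut L T \<psi>0 (x, t)\<bar> \<le> (s + c / U * (A0 * X)) / lam"
            using pos by (simp add: pos_le_divide_eq mult.commute)
          then show ?thesis by (simp add: add_divide_distrib)
        qed
        ultimately show ?case unfolding X_def by linarith
      qed
    qed
  qed
qed

section \<open>Traces at individual times\<close>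

lemma AE_Iv_ex_between:
  assumes AE: "AE x in Iv a. P x" and lu: "0 \<le> l" "l < u" "u \<le> a"
  obtains x where "l < x" "x < u" "P x"
proof -
  have "\<exists>x. x \<in> {l<..<u} \<and> P x"
  proof (rule ccontr)
    assume "\<nexists>x. x \<in> {l<..<u} \<and> P x"
    moreover have "AE x in lborel. x \<in> {0<..<a} \<longrightarrow> P x" using AE by (simp add: AE_Iv)
    ultimately have "AE x in lborel. x \<notin> {l<..<u}"
      using lu by (auto elim!: eventually_mono)
    then have "emeasure lborel {l<..<u} = 0"
      by (subst (asm) AE_iff_measurable[where N="{l<..<u}"]) auto
    then show False using lu by simp
  qed
  then show ?thesis using that by auto
qed

text \<open>Young's inequality for f against the indicator of the points below x: the bound depends
  on f only through C, hence is uniform over slices whose derivatives have a common bound.\<close>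

lemma prim_small:
  assumes f: "sqint (Iv L) f" and C: "(\<integral>x. (f x)\<^sup>2 \<partial>Iv L) \<le> C" and \<theta>: "0 < \<theta>" and x: "0 \<le> x" "x \<le> \<eta>"
  shows "\<bar>prim (Iv L) f x\<bar> \<le> \<theta> * \<eta> + C / (4 * \<theta>)"
proof -
  have si: "sqint (Iv L) (indicator {..<x} :: real \<Rightarrow> real)"
    by (rule Iv.sqint_bounded[where k=1]) (auto simp: indicator_def)
  have "\<bar>prim (Iv L) f x\<bar> \<le> (\<integral>y. \<bar>indicator {..<x} y * f y\<bar> \<partial>Iv L)"
    unfolding prim_def by (rule integral_abs_bound)
  also have "\<dots> = (\<integral>y. indicator {..<x} y * \<bar>f y\<bar> \<partial>Iv L)" by (simp add: abs_mult)
  also have "\<dots> \<le> \<theta> * (\<integral>y. (indicator {..<x} y)\<^sup>2 \<partial>Iv L) + (\<integral>y. \<bar>f y\<bar>\<^sup>2 \<partial>Iv L) / (4 * \<theta>)"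
    by (rule integral_young[OF si sqint_abs[OF f] \<theta>])
  also have "(\<integral>y. (indicator {..<x} y :: real)\<^sup>2 \<partial>Iv L) = measure (Iv L) {..<x}"
  proof -
    have "(indicator {..<x} y :: real)\<^sup>2 = indicator {..<x} y" for y by (simp add: indicator_def)
    then show ?thesis by simp
  qed
  also have "\<theta> * measure (Iv L) {..<x} + (\<integral>y. \<bar>f y\<bar>\<^sup>2 \<partial>Iv L) / (4 * \<theta>) \<le> \<theta> * \<eta> + C / (4 * \<theta>)"
  proof (intro add_mono mult_left_mono divide_right_mono)
    have "emeasure (Iv L) {..<x} \<le> emeasure lborel {0<..<x}"
      by (simp add: emeasure_Iv) (rule emeasure_mono, auto)
    also have "\<dots> = ennreal x" using x by simp
    finally show "measure (Iv L) {..<x} \<le> \<eta>" using x by (simp add: Iv.emeasure_eq_measure)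
  qed (use C \<theta> in auto)
  finally show ?thesis .
qed

text \<open>The trace vanishes for almost every time, but a given t may be exceptional. If v(., t)
  had boundary value k \<noteq> 0, it would stay within |k| / 2 of k on some (0, \<eta>), while at
  nearby good times s the bound on vx keeps |v(., s)| at most |k| / 4 there. The L^2 distance of the
  slices would be bounded below, against continuity in time.\<close>

lemma zero_trace_at_all_times:
  assumes L: "0 < L" and Cv: "C_L2 L T v" and v: "sqint (Iv L \<Otimes>\<^sub>M Iv T) (cut L T v)"
    and vx: "sqint (Iv L \<Otimes>\<^sub>M Iv T) vx" "Linf_L2 L T vx" and \<alpha>: "sqint (Iv T) \<alpha>"
    and rep: "AE x in Iv L. AE t in Iv T. cut L T v (x, t) = \<alpha> t + prim (Iv L) (\<lambda>y. vx (y, t)) x"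
    and zero: "AE t in Iv T. \<alpha> t = 0"
    and t: "0 < t" "t < T" and bv: "boundary_value L (\<lambda>x. v (x, t)) 0 k"
  shows "k = 0"
proof (rule ccontr)
  assume k: "k \<noteq> 0"
  obtain C where C: "AE t in lborel. t \<in> {0<..<T} \<longrightarrow>
        L2 {0<..<L} (\<lambda>x. vx (x, t)) \<and> L2_norm_on {0<..<L} (\<lambda>x. vx (x, t)) \<le> C"
    using vx(2) unfolding Linf_L2_def by blast
  define C2 where "C2 = C\<^sup>2 + 1"
  have C2: "0 < C2" by (simp add: C2_def add_nonneg_pos)
  have vx2: "AE s in Iv T. (\<integral>x. (vx (x, s))\<^sup>2 \<partial>Iv L) \<le> C2"
    using C[folded AE_Iv] AE_sqint_slices(1)[OF vx(1)]
  proof eventually_elim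
    case (elim s)
    have [measurable]: "(\<lambda>x. vx (x, s)) \<in> borel_measurable borel"
      "(\<lambda>x. indicator {0<..<L} x * vx (x, s)) \<in> borel_measurable borel"
      using sqint_measurable[OF elim(2)] sqint_measurable[OF L2_imp_sqint(1)[OF conjunct1[OF elim(1)]]] by simp_all
    have "(\<integral>x. (vx (x, s))\<^sup>2 \<partial>Iv L) = (\<integral>x. (indicator {0<..<L} x * vx (x, s))\<^sup>2 \<partial>Iv L)"
    proof (rule integral_cong_AE)
      show "AE x in Iv L. (vx (x, s))\<^sup>2 = (indicator {0<..<L} x * vx (x, s))\<^sup>2"
        using AE_Iv_in by eventually_elim simp
    qed measurable
    also have "\<dots> = (L2_norm_on {0<..<L} (\<lambda>x. vx (x, s)))\<^sup>2"
      by (rule L2_imp_sqint(2)[OF conjunct1[OF elim(1)]])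
    also have "\<dots> \<le> C\<^sup>2"
    proof (rule power_mono)
      show "0 \<le> L2_norm_on {0<..<L} (\<lambda>x. vx (x, s))"
        unfolding L2_norm_on_def set_lebesgue_integral_def
        by (intro real_sqrt_ge_zero Bochner_Integration.integral_nonneg) auto
    qed (use elim in simp)
    finally show ?case by (simp add: C2_def)
  qed
  \<comment> \<open>Chosen to make C2 / (4 \<theta>) equal to |k| / 8; the choice of \<eta> makes
    the other term of \<open>prim_small\<close> at most |k| / 8 too.\<close>
  define \<theta> where "\<theta> = 2 * C2 / \<bar>k\<bar>"
  have \<theta>: "0 < \<theta>" using k C2 by (simp add: \<theta>_def)
  obtain W where W: "continuous_on {0..L} W" "AE x in Iv L. v (x, t) = W x" "W 0 = k"
    using bv unfolding boundary_value_def AE_Iv by blast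
  have "\<exists>\<eta>>0. \<forall>x\<in>{0..L}. dist x 0 < \<eta> \<longrightarrow> dist (W x) (W 0) < \<bar>k\<bar> / 2"
  proof -
    have "0 \<in> {0..L}" "0 < \<bar>k\<bar> / 2" using L k by auto
    then show ?thesis using W(1) unfolding continuous_on_iff by blast
  qed
  then obtain \<eta>1 where \<eta>1: "0 < \<eta>1" "\<And>x. x \<in> {0..L} \<Longrightarrow> x < \<eta>1 \<Longrightarrow> \<bar>W x - k\<bar> < \<bar>k\<bar> / 2"
    using W(3) by (auto simp: dist_real_def)
  define \<eta> where "\<eta> = min (min \<eta>1 L) (\<bar>k\<bar> / 8 / \<theta>)"
  have \<eta>: "0 < \<eta>" "\<eta> \<le> \<eta>1" "\<eta> \<le> L" "\<theta> * \<eta> \<le> \<bar>k\<bar> / 8"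
  proof -
    have "0 < \<bar>k\<bar> / 8 / \<theta>" using k \<theta> by simp
    then show "0 < \<eta>" "\<eta> \<le> \<eta>1" "\<eta> \<le> L" using \<eta>1 L by (simp_all add: \<eta>_def)
    have "\<theta> * \<eta> \<le> \<theta> * (\<bar>k\<bar> / 8 / \<theta>)" using \<theta> by (intro mult_left_mono) (auto simp: \<eta>_def)
    then show "\<theta> * \<eta> \<le> \<bar>k\<bar> / 8" using \<theta> by simp
  qed
  have small: "\<theta> * \<eta> + C2 / (4 * \<theta>) \<le> \<bar>k\<bar> / 4"
  proof -
    have "C2 / (4 * \<theta>) = \<bar>k\<bar> / 8" using C2 k by (simp add: \<theta>_def)
    then show ?thesis using \<eta>(4) by simp
  qed
  \<comment> \<open>The squared L^2 distance forced by a gap of |k| / 4 on (0, \<eta>).\<close>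
  define e where "e = \<eta> * (k / 4)\<^sup>2"
  have e: "0 < e" using \<eta> k by (simp add: e_def)
  have tT: "t \<in> {0..T}" using t by simp
  obtain \<delta> where \<delta>: "0 < \<delta>" "\<And>s. s \<in> {0..T} \<Longrightarrow> \<bar>s - t\<bar> < \<delta> \<Longrightarrow>
      (\<integral>x. (indicator {0<..<L} x * (v (x, s) - v (x, t)))\<^sup>2 \<partial>Iv L) < e"
    using C_L2_close[OF Cv tT e] by blast
  have "AE s in Iv T. (AE x in Iv L. cut L T v (x, s) = \<alpha> s + prim (Iv L) (\<lambda>y. vx (y, s)) x)
      \<and> \<alpha> s = 0 \<and> (\<integral>x. (vx (x, s))\<^sup>2 \<partial>Iv L) \<le> C2 \<and> sqint (Iv L) (\<lambda>x. vx (x, s))"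
    using AE_swap_representation[OF v vx(1) \<alpha> rep] zero vx2 AE_sqint_slices(1)[OF vx(1)] by eventually_elim blast
  then obtain s where s: "t < s" "s < min T (t + \<delta>)"
    "AE x in Iv L. cut L T v (x, s) = \<alpha> s + prim (Iv L) (\<lambda>y. vx (y, s)) x"
    "\<alpha> s = 0" "(\<integral>x. (vx (x, s))\<^sup>2 \<partial>Iv L) \<le> C2" "sqint (Iv L) (\<lambda>x. vx (x, s))"
    by (rule AE_Iv_ex_between[of _ _ t "min T (t + \<delta>)"]) (use t \<delta>(1) in auto)
  have sT: "s \<in> {0..T}" using s t by simp
  have "e = (\<integral>x. indicator {..<\<eta>} x * (k / 4)\<^sup>2 \<partial>Iv L)"
  proof -
    have "{..<\<eta>} \<inter> {0<..<L} = {0<..<\<eta>}" using \<eta> by auto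
    then have "emeasure (Iv L) {..<\<eta>} = ennreal \<eta>" using \<eta> by (simp add: emeasure_Iv)
    then have "measure (Iv L) {..<\<eta>} = \<eta>" using \<eta> by (simp add: measure_def)
    then show ?thesis by (simp add: e_def)
  qed
  also have "\<dots> \<le> (\<integral>x. (indicator {0<..<L} x * (v (x, s) - v (x, t)))\<^sup>2 \<partial>Iv L)"
  proof (rule integral_mono_AE)
    show "integrable (Iv L) (\<lambda>x. (indicator {0<..<L} x * (v (x, s) - v (x, t)))\<^sup>2)"
      by (rule sqint_integrable_sq[OF C_L2_norm_sq(3)[OF Cv sT tT]])
    show "AE x in Iv L. indicator {..<\<eta>} x * (k / 4)\<^sup>2 \<le> (indicator {0<..<L} x * (v (x, s) - v (x, t)))\<^sup>2"
      using s(3) W(2) AE_Iv_in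
    proof eventually_elim
      case (elim x)
      show ?case
      proof (cases "x < \<eta>")
        case True
        have vs: "v (x, s) = prim (Iv L) (\<lambda>y. vx (y, s)) x"
          using elim s t by (simp add: cut_def)
        have "\<bar>prim (Iv L) (\<lambda>y. vx (y, s)) x\<bar> \<le> \<theta> * \<eta> + C2 / (4 * \<theta>)"
          using elim True by (intro prim_small[OF s(6,5) \<theta>]) auto
        then have "\<bar>v (x, s)\<bar> \<le> \<bar>k\<bar> / 4" using vs small by simp
        moreover have "\<bar>v (x, t) - k\<bar> < \<bar>k\<bar> / 2" using \<eta>1(2)[of x] elim True \<eta> by simp
        ultimately have "\<bar>k / 4\<bar> \<le> \<bar>v (x, s) - v (x, t)\<bar>" by linarith
        then have "(k / 4)\<^sup>2 \<le> (v (x, s) - v (x, t))\<^sup>2" by (simp only: abs_le_square_iff)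
        then show ?thesis using True elim by simp
      qed simp
    qed
  qed simp
  also have "\<dots> < e" using \<delta>(2)[OF sT] s by simp
  finally show False by simp
qed

section \<open>Thickness of the boundary layer\<close>

lemma AE_restrict_lborel:
  "(AE x in restrict_space lborel {a<..<b}. P x) \<longleftrightarrow> (AE x in lborel. x \<in> {a<..<b} \<longrightarrow> P (x::real))"
  by (subst AE_restrict_space_iff) auto

text \<open>Bounding an essential supremum by \<open>esssup_I\<close> requires measurability; for
  the outer one this concerns the inner supremum as a function of t.\<close>

lemma Linf_Linf_le:
  assumes m: "cut L T v \<in> borel_measurable (borel \<Otimes>\<^sub>M borel)" and \<delta>: "0 \<le> \<delta>"
    and bound: "AE x in Iv L. AE t in Iv T. \<delta> < x \<longrightarrow> \<bar>cut L T v (x, t)\<bar> \<le> B"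
  shows "Linf_Linf T \<delta> L v \<le> ennreal B"
proof -
  note [measurable] = m
  let ?N = "restrict_space lborel {\<delta><..<L}" and ?M = "restrict_space lborel {0<..<T}"
  have slice: "(\<lambda>x. ennreal \<bar>v (x, t)\<bar>) \<in> borel_measurable ?N" if t: "t \<in> {0<..<T}" for t
  proof -
    have "(\<lambda>x. ennreal \<bar>cut L T v (x, t)\<bar>) \<in> borel_measurable borel" by measurable
    then have "(\<lambda>x. ennreal \<bar>cut L T v (x, t)\<bar>) \<in> borel_measurable ?N"
      by (intro measurable_restrict_space1) simp
    then show ?thesis
      by (rule measurable_cong[THEN iffD1, rotated]) (use t \<delta> in \<open>auto simp: space_restrict_space cut_def\<close>)
  qed
  have le_iff: "esssup ?N (\<lambda>x. ennreal \<bar>v (x, t)\<bar>) \<le> y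
      \<longleftrightarrow> (AE x in lborel. x \<in> {\<delta><..<L} \<longrightarrow> ennreal \<bar>cut L T v (x, t)\<bar> \<le> y)" if t: "t \<in> {0<..<T}" for t y
  proof -
    have "esssup ?N (\<lambda>x. ennreal \<bar>v (x, t)\<bar>) \<le> y \<longleftrightarrow> (AE x in ?N. ennreal \<bar>v (x, t)\<bar> \<le> y)"
    proof
      assume "esssup ?N (\<lambda>x. ennreal \<bar>v (x, t)\<bar>) \<le> y"
      then show "AE x in ?N. ennreal \<bar>v (x, t)\<bar> \<le> y"
        using esssup_AE[where M="?N" and f="\<lambda>x. ennreal \<bar>v (x, t)\<bar>"] by (auto elim!: eventually_mono)
    qed (rule esssup_I[OF slice[OF t]])
    also have "\<dots> \<longleftrightarrow> (AE x in lborel. x \<in> {\<delta><..<L} \<longrightarrow> ennreal \<bar>cut L T v (x, t)\<bar> \<le> y)"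
      unfolding AE_restrict_lborel
      by (intro eventually_subst AE_I2) (use t \<delta> in \<open>auto simp: cut_def\<close>)
    finally show ?thesis .
  qed
  \<comment> \<open>The inner supremum is at most y exactly when the section at t of the set where y
    is exceeded is null, and the measure of sections is a measurable function of t.\<close>
  have meas: "(\<lambda>t. esssup ?N (\<lambda>x. ennreal \<bar>v (x, t)\<bar>)) \<in> borel_measurable ?M"
  proof (rule borel_measurableI_le)
    fix y
    define A where "A = {p \<in> space (borel \<Otimes>\<^sub>M borel). fst p \<in> {\<delta><..<L} \<and> y < ennreal \<bar>cut L T v p\<bar>}"
    have A: "A \<in> sets (borel \<Otimes>\<^sub>M borel)" unfolding A_def by measurable
    then have A': "A \<in> sets (lborel \<Otimes>\<^sub>M lborel)" by (simp cong: sets_pair_measure_cong)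
    have "(\<lambda>t. emeasure lborel ((\<lambda>x. (x, t)) -` A)) \<in> borel_measurable lborel"
      by (rule lborel_pair.measurable_emeasure_Pair2[OF A'])
    then have z: "{t \<in> space lborel. emeasure lborel ((\<lambda>x. (x, t)) -` A) = 0} \<in> sets lborel"
      by measurable
    have "{t \<in> space ?M. esssup ?N (\<lambda>x. ennreal \<bar>v (x, t)\<bar>) \<le> y}
        = {0<..<T} \<inter> {t \<in> space lborel. emeasure lborel ((\<lambda>x. (x, t)) -` A) = 0}"
    proof -
      have "esssup ?N (\<lambda>x. ennreal \<bar>v (x, t)\<bar>) \<le> y \<longleftrightarrow> emeasure lborel ((\<lambda>x. (x, t)) -` A) = 0"
        if t: "t \<in> {0<..<T}" for t
      proof -
        have "(\<lambda>x. (x, t)) -` A \<in> sets lborel"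
          using measurable_sets[OF measurable_Pair2'[of t borel borel] A] by (simp add: space_pair_measure)
        moreover have "{x \<in> space lborel. \<not> (x \<in> {\<delta><..<L} \<longrightarrow> ennreal \<bar>cut L T v (x, t)\<bar> \<le> y)} = (\<lambda>x. (x, t)) -` A"
          by (auto simp: A_def space_pair_measure not_le)
        ultimately show ?thesis
          unfolding le_iff[OF t] by (subst AE_iff_measurable) auto
      qed
      then show ?thesis by (auto simp: space_restrict_space)
    qed
    then show "{t \<in> space ?M. esssup ?N (\<lambda>x. ennreal \<bar>v (x, t)\<bar>) \<le> y} \<in> sets ?M"
      using z by (auto simp: sets_restrict_space_iff)
  qed
  have swap: "AE t in Iv T. AE x in Iv L. \<delta> < x \<longrightarrow> \<bar>cut L T v (x, t)\<bar> \<le> B"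
  proof -
    have "{p \<in> space (Iv L \<Otimes>\<^sub>M Iv T). \<delta> < fst p \<longrightarrow> \<bar>cut L T v (fst p, snd p)\<bar> \<le> B} \<in> sets (Iv L \<Otimes>\<^sub>M Iv T)"
      by measurable
    from Iv2.AE_commute[of L T "\<lambda>x t. \<delta> < x \<longrightarrow> \<bar>cut L T v (x, t)\<bar> \<le> B", OF this] bound show ?thesis by blast
  qed
  show ?thesis
    unfolding Linf_Linf_def
  proof (rule esssup_I[OF meas])
    show "AE t in ?M. esssup ?N (\<lambda>x. ennreal \<bar>v (x, t)\<bar>) \<le> ennreal B"
      unfolding AE_restrict_lborel AE_Iv[symmetric]
      using swap AE_Iv_in
    proof eventually_elim
      case (elim t)
      have t: "t \<in> {0<..<T}" using elim by simp
      show ?case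
        unfolding le_iff[OF t] using elim(1)[unfolded AE_Iv]
        by eventually_elim (use \<delta> in \<open>auto intro!: ennreal_leI\<close>)
    qed
  qed
qed

lemma Linf_Linf_less_imp_AE:
  assumes less: "Linf_Linf T 0 \<delta> v < ennreal \<kappa>"
  shows "AE t in Iv T. AE x in lborel. x \<in> {0<..<\<delta>} \<longrightarrow> \<bar>v (x, t)\<bar> \<le> \<kappa>"
proof -
  let ?N = "restrict_space lborel {0<..<\<delta>}" and ?M = "restrict_space lborel {0<..<T}"
  have "AE t in ?M. esssup ?N (\<lambda>x. ennreal \<bar>v (x, t)\<bar>) \<le> Linf_Linf T 0 \<delta> v"
    unfolding Linf_Linf_def by (rule esssup_AE)
  then show ?thesis
    unfolding AE_restrict_lborel AE_Iv[symmetric]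
  proof eventually_elim
    case (elim t)
    have "AE x in ?N. ennreal \<bar>v (x, t)\<bar> \<le> esssup ?N (\<lambda>x. ennreal \<bar>v (x, t)\<bar>)" by (rule esssup_AE)
    then show ?case
      unfolding AE_restrict_lborel AE_Iv
    proof eventually_elim
      case (elim x)
      show ?case
      proof
        assume "x \<in> {0<..<\<delta>}"
        then have "ennreal \<bar>v (x, t)\<bar> < ennreal \<kappa>"
          using elim[rule_format] \<open>esssup ?N (\<lambda>x. ennreal \<bar>v (x, t)\<bar>) \<le> Linf_Linf T 0 \<delta> v\<close> less by (meson le_less_trans)
        then show "\<bar>v (x, t)\<bar> \<le> \<kappa>" by (simp add: ennreal_less_iff)
      qed
    qed
  qed
qed

lemma trace_le_sup:
  assumes g: "integrable (Iv L) g" and L: "0 < L" and \<delta>: "0 < \<delta>"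
    and AE: "AE x in Iv L. x < \<delta> \<longrightarrow> \<bar>k + prim (Iv L) g x\<bar> \<le> \<kappa>"
  shows "\<bar>k\<bar> \<le> \<kappa>"
proof (rule field_le_epsilon)
  fix e :: real assume e: "0 < e"
  obtain \<eta> where \<eta>: "0 < \<eta>" "\<forall>x. \<bar>x - 0\<bar> < \<eta> \<longrightarrow> \<bar>prim (Iv L) g x - prim (Iv L) g 0\<bar> < e"
    using isCont_prim[OF g, of 0] e unfolding continuous_at_eps_delta dist_real_def by blast
  have "0 < min \<eta> \<delta>" using \<eta> \<delta> by simp
  then obtain x where x: "0 < x" "x < L" "x < min \<eta> \<delta>" "x < \<delta> \<longrightarrow> \<bar>k + prim (Iv L) g x\<bar> \<le> \<kappa>"
    by (rule AE_Iv_ex[OF AE L])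
  have "\<bar>prim (Iv L) g x\<bar> < e" using \<eta>(2) x by (simp add: prim_nonpos)
  then show "\<bar>k\<bar> \<le> \<kappa> + e" using x by auto
qed

text \<open>At x = 0 the first function vanishes and the second has trace \<alpha>; a bound on the
  difference over (0, \<delta>) passes to the limit x \<rightarrow> 0, however small \<delta>
  is.\<close>

lemma trace_difference_le:
  assumes L: "0 < L" and \<delta>: "0 < \<delta>"
    and v: "sqint (Iv L \<Otimes>\<^sub>M Iv T) (cut L T v)" "sqint (Iv L \<Otimes>\<^sub>M Iv T) vx"
    and v0: "sqint (Iv L \<Otimes>\<^sub>M Iv T) (cut L T v0)" "sqint (Iv L \<Otimes>\<^sub>M Iv T) v0x" "sqint (Iv T) \<alpha>"
    and rep: "AE x in Iv L. AE t in Iv T. cut L T v (x, t) = prim (Iv L) (\<lambda>y. vx (y, t)) x"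
    and rep0: "AE x in Iv L. AE t in Iv T. cut L T v0 (x, t) = \<alpha> t + prim (Iv L) (\<lambda>y. v0x (y, t)) x"
    and less: "Linf_Linf T 0 \<delta> (\<lambda>p. v p - v0 p) < ennreal \<kappa>"
  shows "AE t in Iv T. \<bar>\<alpha> t\<bar> \<le> \<kappa>"
proof -
  have "AE x in Iv L. AE t in Iv T. cut L T v (x, t) = (\<lambda>_. 0) t + prim (Iv L) (\<lambda>y. vx (y, t)) x"
    using rep by simp
  from AE_swap_representation[OF v Iv.sqint_const this] AE_swap_representation[OF v0 rep0]
    AE_sqint_slices(1)[OF v(2)] AE_sqint_slices(1)[OF v0(2)] Linf_Linf_less_imp_AE[OF less] AE_Iv_in
  show ?thesis
  proof eventually_elim
    case (elim t)
    note i = elim(3,4)[THEN sqint_Iv_integrable]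
    have "\<bar>- \<alpha> t\<bar> \<le> \<kappa>"
    proof (rule trace_le_sup[OF _ L \<delta>])
      show "integrable (Iv L) (\<lambda>y. vx (y, t) - v0x (y, t))" using i by simp
      have "AE x in Iv L. x \<in> {0<..<\<delta>} \<longrightarrow> \<bar>v (x, t) - v0 (x, t)\<bar> \<le> \<kappa>"
        unfolding AE_Iv using elim(5) by eventually_elim simp
      then show "AE x in Iv L. x < \<delta> \<longrightarrow> \<bar>- \<alpha> t + prim (Iv L) (\<lambda>y. vx (y, t) - v0x (y, t)) x\<bar> \<le> \<kappa>"
        using elim(1,2) AE_Iv_in
      proof eventually_elim
        case x: (elim x)
        have "v (x, t) = prim (Iv L) (\<lambda>y. vx (y, t)) x" "v0 (x, t) = \<alpha> t + prim (Iv L) (\<lambda>y. v0x (y, t)) x"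
          using x elim(6) by (simp_all add: cut_def)
        then have "v (x, t) - v0 (x, t) = - \<alpha> t + prim (Iv L) (\<lambda>y. vx (y, t) - v0x (y, t)) x"
          by (simp add: prim_diff[OF i])
        then show ?case using x by simp
      qed
    qed
    then show ?case by simp
  qed
qed

text \<open>Were both traces below every \<kappa> almost everywhere, they would vanish almost
  everywhere, hence at every time, also at the one where the boundary values are not both 0.\<close>

lemma (in limit_layer) traces_not_small:
  assumes t: "t \<in> {0<..<T}" and bv: "boundary_value L (\<lambda>x. u0 (x, t)) 0 k" "boundary_value L (\<lambda>x. \<psi>0 (x, t)) 0 l"
    and kl: "(k, l) \<noteq> (0, 0)" and B: "Linf_L2 L T u0x" "Linf_L2 L T \<psi>0x"
  obtains \<kappa> where "0 < \<kappa>" "\<not> (AE t in Iv T. \<bar>\<alpha> t\<bar> \<le> \<kappa> \<and> \<bar>\<beta> t\<bar> \<le> \<kappa>)"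
proof (rule ccontr)
  assume "\<not> thesis"
  with that have all: "AE t in Iv T. \<bar>\<alpha> t\<bar> \<le> \<kappa> \<and> \<bar>\<beta> t\<bar> \<le> \<kappa>" if "0 < \<kappa>" for \<kappa> using that by blast
  have "AE t in Iv T. \<forall>n. \<bar>\<alpha> t\<bar> \<le> 1 / real (Suc n) \<and> \<bar>\<beta> t\<bar> \<le> 1 / real (Suc n)"
    unfolding AE_all_countable by (intro allI all) simp
  then have zero: "AE t in Iv T. \<alpha> t = 0 \<and> \<beta> t = 0"
  proof eventually_elim
    case (elim t)
    have "x = 0" if "\<And>n. \<bar>x\<bar> \<le> 1 / real (Suc n)" for x :: real
    proof (rule ccontr)
      assume "x \<noteq> 0"
      then obtain n where "1 / real (Suc n) < \<bar>x\<bar>" using nat_approx_posE[of "\<bar>x\<bar>"] by auto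
      then show False using that[of n] by simp
    qed
    then show ?case using elim by blast
  qed
  have z: "AE t in Iv T. \<alpha> t = 0" "AE t in Iv T. \<beta> t = 0"
    using zero by (eventually_elim, simp)+
  have C: "C_L2 L T u0" "C_L2 L T \<psi>0"
    using K0 unfolding space_K0_def space_F0_def by blast+
  note r0 = regularD[OF reg0]
  have "k = 0"
    by (rule zero_trace_at_all_times[OF pos(1) C(1) r0(1,2) B(1) sq0(1) rep0(1) z(1) _ _ bv(1)]) (use t in auto)
  moreover have "l = 0"
    by (rule zero_trace_at_all_times[OF pos(1) C(2) r0(5,6) B(2) sq0(2) rep0(3) z(2) _ _ bv(2)]) (use t in auto)
  ultimately show False using kl by simp
qed

text \<open>The number \<kappa> is tied to the traces of the limit solution alone, so the lower
  bound is uniform in \<epsilon> and in the width \<delta>.\<close>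

lemma (in limit_layer) error_ge:
  assumes \<epsilon>: "0 < \<epsilon>" "2 * \<epsilon> \<le> 1" and K: "(u, \<psi>) \<in> space_K L T"
    and sol: "viscous_solution lam U L T \<epsilon> f g ui \<psi>i u \<psi>" and \<delta>: "0 < \<delta>"
    and \<kappa>: "\<not> (AE t in Iv T. \<bar>\<alpha> t\<bar> \<le> \<kappa> \<and> \<bar>\<beta> t\<bar> \<le> \<kappa>)"
  shows "ennreal \<kappa> \<le> Linf_Linf_pair T 0 \<delta> (\<lambda>p. u p - u0 p) (\<lambda>p. \<psi> p - \<psi>0 p)"
proof (rule ccontr)
  assume "\<not> ?thesis"
  then have less: "Linf_Linf T 0 \<delta> (\<lambda>p. u p - u0 p) + Linf_Linf T 0 \<delta> (\<lambda>p. \<psi> p - \<psi>0 p) < ennreal \<kappa>"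
    by (simp add: Linf_Linf_pair_def not_le)
  have "Linf_Linf T 0 \<delta> (\<lambda>p. u p - u0 p) \<le> Linf_Linf T 0 \<delta> (\<lambda>p. u p - u0 p) + Linf_Linf T 0 \<delta> (\<lambda>p. \<psi> p - \<psi>0 p)"
    "Linf_Linf T 0 \<delta> (\<lambda>p. \<psi> p - \<psi>0 p) \<le> Linf_Linf T 0 \<delta> (\<lambda>p. u p - u0 p) + Linf_Linf T 0 \<delta> (\<lambda>p. \<psi> p - \<psi>0 p)"
    by simp_all
  with less have l: "Linf_Linf T 0 \<delta> (\<lambda>p. u p - u0 p) < ennreal \<kappa>" "Linf_Linf T 0 \<delta> (\<lambda>p. \<psi> p - \<psi>0 p) < ennreal \<kappa>"
    by (blast intro: le_less_trans)+
  obtain ux uxx ut \<psi>x \<psi>xx \<psi>t d e b where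
    "layer_setting L T lam U \<epsilon> (cut L T u) ux uxx ut (cut L T \<psi>) \<psi>x \<psi>xx \<psi>t
        (cut L T u0) u0x u0xx u0t (cut L T \<psi>0) \<psi>0x \<psi>0xx \<psi>0t d e d0 e0 \<alpha> \<beta> b"
    by (rule viscous_layer_setting[OF \<epsilon> K sol]) blast
  then interpret S: layer_setting L T lam U \<epsilon> "cut L T u" ux uxx ut "cut L T \<psi>" \<psi>x \<psi>xx \<psi>t
        "cut L T u0" u0x u0xx u0t "cut L T \<psi>0" \<psi>0x \<psi>0xx \<psi>0t d e d0 e0 \<alpha> \<beta> b .
  note r0 = regularD[OF reg0]
  have F: "Linf_L2 L T u" "Linf_L2 L T \<psi>"
    using K unfolding space_K_def space_F_def Linf_dom_A_def by blast+
  have "AE t in Iv T. \<bar>\<alpha> t\<bar> \<le> \<kappa>"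
    by (rule trace_difference_le[OF pos(1) \<delta> sqint_cut_Linf_L2[OF F(1)] S.sq(1) r0(1,2) sq0(1) S.rep(1) rep0(1) l(1)])
  moreover have "AE t in Iv T. \<bar>\<beta> t\<bar> \<le> \<kappa>"
    by (rule trace_difference_le[OF pos(1) \<delta> sqint_cut_Linf_L2[OF F(2)] S.sq(4) r0(5,6) sq0(2) S.rep(3) rep0(3) l(2)])
  ultimately have "AE t in Iv T. \<bar>\<alpha> t\<bar> \<le> \<kappa> \<and> \<bar>\<beta> t\<bar> \<le> \<kappa>" by eventually_elim blast
  then show False using \<kappa> by blast
qed

theorem corollary1p1:
  fixes L T lam U0 :: real
    and f g :: "real \<times> real \<Rightarrow> real"
    and u_init \<psi>_init :: "real \<Rightarrow> real"
    and u\<epsilon> \<psi>\<epsilon> :: "real \<Rightarrow> real \<times> real \<Rightarrow> real"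
    and u0 \<psi>0 :: "real \<times> real \<Rightarrow> real"
  assumes "L > 0" and "T > 0" and "lam > 0" and "U0 > 0" and "U0 < 1 / lam"
    and "\<forall>\<^sub>F \<epsilon> in at_right 0. (u\<epsilon> \<epsilon>, \<psi>\<epsilon> \<epsilon>) \<in> space_K L T \<and>
           viscous_solution lam U0 L T \<epsilon> f g u_init \<psi>_init (u\<epsilon> \<epsilon>) (\<psi>\<epsilon> \<epsilon>)"
    and "(u0, \<psi>0) \<in> space_K0 lam U0 L T"
    and "limit_solution lam U0 L T f g u_init \<psi>_init u0 \<psi>0"
  shows "(\<forall>\<delta>::real \<Rightarrow> real.
            (\<forall>\<epsilon>>0. 0 \<le> \<delta> \<epsilon>) \<and> (\<delta> \<longlongrightarrow> 0) (at_right 0) \<and>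
            filterlim (\<lambda>\<epsilon>. \<delta> \<epsilon> / \<epsilon>) at_top (at_right 0) \<longrightarrow>
            ((\<lambda>\<epsilon>. Linf_Linf_pair T (\<delta> \<epsilon>) L (\<lambda>p. u\<epsilon> \<epsilon> p - u0 p) (\<lambda>p. \<psi>\<epsilon> \<epsilon> p - \<psi>0 p)) \<longlongrightarrow> 0)
              (at_right 0)) \<and>
         (\<forall>(\<delta>::real \<Rightarrow> real) c.
            (\<forall>\<epsilon>>0. 0 \<le> \<delta> \<epsilon>) \<and> (\<delta> \<longlongrightarrow> 0) (at_right 0) \<and>
            0 \<le> c \<and> ((\<lambda>\<epsilon>. \<delta> \<epsilon> / \<epsilon>) \<longlongrightarrow> c) (at_right 0) \<and>
            (\<exists>t\<in>{0<..<T}. \<exists>a b. boundary_value L (\<lambda>x. u0 (x, t)) 0 a \<and>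
               boundary_value L (\<lambda>x. \<psi>0 (x, t)) 0 b \<and> (a, b) \<noteq> (0, 0)) \<longrightarrow>
            Liminf (at 0 within {\<epsilon>. 0 < \<epsilon> \<and> 0 < \<delta> \<epsilon>})
              (\<lambda>\<epsilon>. Linf_Linf_pair T 0 (\<delta> \<epsilon>) (\<lambda>p. u\<epsilon> \<epsilon> p - u0 p) (\<lambda>p. \<psi>\<epsilon> \<epsilon> p - \<psi>0 p)) > 0)"
proof -
  let ?W = "\<lambda>\<epsilon>. (\<lambda>p. u\<epsilon> \<epsilon> p - u0 p)" and ?P = "\<lambda>\<epsilon>. (\<lambda>p. \<psi>\<epsilon> \<epsilon> p - \<psi>0 p)"
  note L = assms(1) and T = assms(2)
  obtain u0x u0xx u0t \<psi>0x \<psi>0xx \<psi>0xt \<psi>0t where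
    reg0: "regular L T (cut L T u0) u0x u0xx u0t (cut L T \<psi>0) \<psi>0x \<psi>0xx \<psi>0xt \<psi>0t"
    and PDE0: "AE p in lborel. p \<in> {0<..<L} \<times> {0<..<T} \<longrightarrow>
       u0t p + U0 * u0x p + \<psi>0x p = f p \<and> \<psi>0t p + U0 * \<psi>0x p + u0x p / lam\<^sup>2 = g p"
    and B0: "Linf_L2 L T u0x" "Linf_L2 L T \<psi>0x"
    by (rule limit_regular[OF assms(7,8)])
  note r0 = regularD[OF reg0]
  obtain \<alpha> where \<alpha>: "sqint (Iv T) \<alpha>"
    "AE x in Iv L. AE t in Iv T. cut L T u0 (x, t) = \<alpha> t + prim (Iv L) (\<lambda>y. u0x (y, t)) x"
    by (rule weak_pair_x_representation[OF L r0(1,2,10)])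
  obtain d0 where d0: "sqint (Iv T) d0"
    "AE x in Iv L. AE t in Iv T. u0x (x, t) = d0 t + prim (Iv L) (\<lambda>y. u0xx (y, t)) x"
    by (rule weak_pair_x_representation[OF L r0(2,3,11)])
  obtain \<beta> where \<beta>: "sqint (Iv T) \<beta>"
    "AE x in Iv L. AE t in Iv T. cut L T \<psi>0 (x, t) = \<beta> t + prim (Iv L) (\<lambda>y. \<psi>0x (y, t)) x"
    by (rule weak_pair_x_representation[OF L r0(5,6,13)])
  obtain e0 where e0: "sqint (Iv T) e0"
    "AE x in Iv L. AE t in Iv T. \<psi>0x (x, t) = e0 t + prim (Iv L) (\<lambda>y. \<psi>0xx (y, t)) x"
    by (rule weak_pair_x_representation[OF L r0(6,7,14)])
  interpret limit_layer L T lam U0 f g u_init \<psi>_init u0 \<psi>0 u0x u0xx u0t \<psi>0x \<psi>0xx \<psi>0xt \<psi>0t \<alpha> \<beta> d0 e0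
    by unfold_locales (rule assms reg0 PDE0 \<alpha> \<beta> d0 e0)+
  have ev: "\<forall>\<^sub>F \<epsilon> in at_right 0. 0 < \<epsilon> \<and> 2 * \<epsilon> \<le> 1 \<and> (u\<epsilon> \<epsilon>, \<psi>\<epsilon> \<epsilon>) \<in> space_K L T \<and>
      viscous_solution lam U0 L T \<epsilon> f g u_init \<psi>_init (u\<epsilon> \<epsilon>) (\<psi>\<epsilon> \<epsilon>)"
  proof -
    have "\<forall>\<^sub>F \<epsilon> in at_right (0::real). \<epsilon> \<in> {0<..<1/2}"
      by (rule eventually_at_right_real) simp
    then show ?thesis using assms(6) by eventually_elim simp
  qed
  show ?thesis
  proof (intro conjI allI impI)
    fix \<delta> :: "real \<Rightarrow> real"
    assume \<delta>: "(\<forall>\<epsilon>>0. 0 \<le> \<delta> \<epsilon>) \<and> (\<delta> \<longlongrightarrow> 0) (at_right 0) \<and> filterlim (\<lambda>\<epsilon>. \<delta> \<epsilon> / \<epsilon>) at_top (at_right 0)"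
    obtain A Q m where AQm: "0 \<le> A" "0 \<le> Q" "0 < m"
      and bound: "\<And>\<epsilon> u \<psi>. 0 < \<epsilon> \<Longrightarrow> 2 * \<epsilon> \<le> 1 \<Longrightarrow> (u, \<psi>) \<in> space_K L T \<Longrightarrow>
      viscous_solution lam U0 L T \<epsilon> f g u_init \<psi>_init u \<psi> \<Longrightarrow>
      AE x in Iv L. AE t in Iv T.
        \<bar>cut L T u (x, t) - cut L T u0 (x, t)\<bar> \<le> sqrt (Q * \<epsilon>) + A * exp (- m * x / (2 * \<epsilon>)) \<and>
        \<bar>cut L T \<psi> (x, t) - cut L T \<psi>0 (x, t)\<bar> \<le> sqrt (Q * \<epsilon>) + A * exp (- m * x / (2 * \<epsilon>))"
      by (rule error_bound) blast
    \<comment> \<open>The pointwise error bound at x = \<delta>(\<epsilon>); it decreases in x and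
      so dominates on (\<delta>(\<epsilon>), L).\<close>
    define R where "R \<epsilon> = sqrt (Q * \<epsilon>) + A * exp (- (m / 2) * (\<delta> \<epsilon> / \<epsilon>))" for \<epsilon>
    have R_lim: "(R \<longlongrightarrow> 0) (at_right 0)"
    proof -
      have "((\<lambda>\<epsilon>. exp (- (m / 2) * (\<delta> \<epsilon> / \<epsilon>))) \<longlongrightarrow> 0) (at_right 0)"
      proof (rule filterlim_compose[OF exp_at_bot])
        show "filterlim (\<lambda>\<epsilon>. - (m / 2) * (\<delta> \<epsilon> / \<epsilon>)) at_bot (at_right 0)"
          using \<delta> AQm(3) by (intro filterlim_tendsto_neg_mult_at_bot[OF tendsto_const]) auto
      qed
      moreover have "((\<lambda>\<epsilon>. sqrt (Q * \<epsilon>)) \<longlongrightarrow> sqrt (Q * 0)) (at_right 0)"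
        by (intro tendsto_intros)
      ultimately have "(R \<longlongrightarrow> sqrt (Q * 0) + A * 0) (at_right 0)"
        unfolding R_def by (intro tendsto_intros)
      then show ?thesis by simp
    qed
    have "((\<lambda>\<epsilon>. ennreal (R \<epsilon>) + ennreal (R \<epsilon>)) \<longlongrightarrow> ennreal 0 + ennreal 0) (at_right 0)"
      by (intro tendsto_add tendsto_ennrealI R_lim)
    then have upper: "((\<lambda>\<epsilon>. ennreal (R \<epsilon>) + ennreal (R \<epsilon>)) \<longlongrightarrow> 0) (at_right 0)" by simp
    show "((\<lambda>\<epsilon>. Linf_Linf_pair T (\<delta> \<epsilon>) L (?W \<epsilon>) (?P \<epsilon>)) \<longlongrightarrow> 0) (at_right 0)"
    proof (rule tendsto_sandwich[OF _ _ tendsto_const upper])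
      show "\<forall>\<^sub>F \<epsilon> in at_right 0. Linf_Linf_pair T (\<delta> \<epsilon>) L (?W \<epsilon>) (?P \<epsilon>) \<le> ennreal (R \<epsilon>) + ennreal (R \<epsilon>)"
        using ev
      proof eventually_elim
        case (elim \<epsilon>)
        then have elim: "0 < \<epsilon>" "2 * \<epsilon> \<le> 1" "(u\<epsilon> \<epsilon>, \<psi>\<epsilon> \<epsilon>) \<in> space_K L T"
          "viscous_solution lam U0 L T \<epsilon> f g u_init \<psi>_init (u\<epsilon> \<epsilon>) (\<psi>\<epsilon> \<epsilon>)" by blast+
        then have \<epsilon>: "0 < \<epsilon>" and K: "(u\<epsilon> \<epsilon>, \<psi>\<epsilon> \<epsilon>) \<in> space_K L T" by auto
        have \<delta>0: "0 \<le> \<delta> \<epsilon>" using \<delta> \<epsilon> by blast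
        have F: "Linf_L2 L T (u\<epsilon> \<epsilon>)" "Linf_L2 L T (\<psi>\<epsilon> \<epsilon>)"
          using K unfolding space_K_def space_F_def Linf_dom_A_def by blast+
        have cut_diff: "cut L T (\<lambda>p. v p - w p) = (\<lambda>p. cut L T v p - cut L T w p)" for v w
          by (auto simp: cut_def right_diff_distrib)
        have m: "cut L T (?W \<epsilon>) \<in> borel_measurable (borel \<Otimes>\<^sub>M borel)" "cut L T (?P \<epsilon>) \<in> borel_measurable (borel \<Otimes>\<^sub>M borel)"
          unfolding cut_diff
          using sqint_pair_measurable[OF sqint_diff[OF sqint_cut_Linf_L2[OF F(1)] r0(1)]]
            sqint_pair_measurable[OF sqint_diff[OF sqint_cut_Linf_L2[OF F(2)] r0(5)]] by blast+
        have b: "AE x in Iv L. AE t in Iv T. \<delta> \<epsilon> < x \<longrightarrow> \<bar>cut L T (?W \<epsilon>) (x, t)\<bar> \<le> R \<epsilon> \<and> \<bar>cut L T (?P \<epsilon>) (x, t)\<bar> \<le> R \<epsilon>"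
          using bound[OF elim(1,2,3,4)]
        proof eventually_elim
          case (elim x)
          have le: "\<delta> \<epsilon> < x \<Longrightarrow> sqrt (Q * \<epsilon>) + A * exp (- m * x / (2 * \<epsilon>)) \<le> R \<epsilon>"
          proof -
            assume "\<delta> \<epsilon> < x"
            then have "m * \<delta> \<epsilon> / (2 * \<epsilon>) \<le> m * x / (2 * \<epsilon>)"
              using AQm \<epsilon> by (intro divide_right_mono mult_left_mono) auto
            then have "exp (- m * x / (2 * \<epsilon>)) \<le> exp (- (m / 2) * (\<delta> \<epsilon> / \<epsilon>))" by simp
            then show ?thesis using AQm(1) by (simp add: R_def mult_left_mono)
          qed
          show ?case using elim(1)
          proof eventually_elim
            case t: (elim t)
            show ?case using t le unfolding cut_diff by auto
          qed
        qed
        have "Linf_Linf T (\<delta> \<epsilon>) L (?W \<epsilon>) \<le> ennreal (R \<epsilon>)"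
        proof (rule Linf_Linf_le[OF m(1) \<delta>0])
          show "AE x in Iv L. AE t in Iv T. \<delta> \<epsilon> < x \<longrightarrow> \<bar>cut L T (?W \<epsilon>) (x, t)\<bar> \<le> R \<epsilon>"
            using b
          proof eventually_elim
            case (elim x)
            then show ?case by eventually_elim blast
          qed
        qed
        moreover have "Linf_Linf T (\<delta> \<epsilon>) L (?P \<epsilon>) \<le> ennreal (R \<epsilon>)"
        proof (rule Linf_Linf_le[OF m(2) \<delta>0])
          show "AE x in Iv L. AE t in Iv T. \<delta> \<epsilon> < x \<longrightarrow> \<bar>cut L T (?P \<epsilon>) (x, t)\<bar> \<le> R \<epsilon>"
            using b
          proof eventually_elim
            case (elim x)
            then show ?case by eventually_elim blast
          qed
        qed
        ultimately show ?case unfolding Linf_Linf_pair_def by (rule add_mono)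
      qed
    qed simp
  next
    fix \<delta> :: "real \<Rightarrow> real" and c :: real
    assume \<delta>: "(\<forall>\<epsilon>>0. 0 \<le> \<delta> \<epsilon>) \<and> (\<delta> \<longlongrightarrow> 0) (at_right 0) \<and> 0 \<le> c \<and> ((\<lambda>\<epsilon>. \<delta> \<epsilon> / \<epsilon>) \<longlongrightarrow> c) (at_right 0) \<and>
            (\<exists>t\<in>{0<..<T}. \<exists>a b. boundary_value L (\<lambda>x. u0 (x, t)) 0 a \<and>
               boundary_value L (\<lambda>x. \<psi>0 (x, t)) 0 b \<and> (a, b) \<noteq> (0, 0))"
    then obtain t k l where tkl: "t \<in> {0<..<T}" "boundary_value L (\<lambda>x. u0 (x, t)) 0 k"
      "boundary_value L (\<lambda>x. \<psi>0 (x, t)) 0 l" "(k, l) \<noteq> (0, 0)" by blast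
    obtain \<kappa> where \<kappa>: "0 < \<kappa>" "\<not> (AE t in Iv T. \<bar>\<alpha> t\<bar> \<le> \<kappa> \<and> \<bar>\<beta> t\<bar> \<le> \<kappa>)"
      by (rule traces_not_small[OF tkl B0])
    \<comment> \<open>Where \<delta>(\<epsilon>) = 0 the interval (0, \<delta>(\<epsilon>)) is empty
      and the norm is 0, so the lower limit runs over \<epsilon> with \<delta>(\<epsilon>) > 0; this
      filter is finer than \<open>at_right 0\<close>.\<close>
    let ?F = "at 0 within {\<epsilon>. 0 < \<epsilon> \<and> 0 < \<delta> \<epsilon>}"
    have "?F \<le> at_right 0" by (rule at_le) auto
    then have "\<forall>\<^sub>F \<epsilon> in ?F. 0 < \<epsilon> \<and> 2 * \<epsilon> \<le> 1 \<and> (u\<epsilon> \<epsilon>, \<psi>\<epsilon> \<epsilon>) \<in> space_K L T \<and>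
      viscous_solution lam U0 L T \<epsilon> f g u_init \<psi>_init (u\<epsilon> \<epsilon>) (\<psi>\<epsilon> \<epsilon>)"
      by (rule filter_leD[OF _ ev])
    moreover have "\<forall>\<^sub>F \<epsilon> in ?F. 0 < \<delta> \<epsilon>" by (simp add: eventually_at_filter)
    ultimately have "\<forall>\<^sub>F \<epsilon> in ?F. ennreal \<kappa> \<le> Linf_Linf_pair T 0 (\<delta> \<epsilon>) (?W \<epsilon>) (?P \<epsilon>)"
      by eventually_elim (rule error_ge; use \<kappa>(2) in blast)
    then have "ennreal \<kappa> \<le> Liminf ?F (\<lambda>\<epsilon>. Linf_Linf_pair T 0 (\<delta> \<epsilon>) (?W \<epsilon>) (?P \<epsilon>))"
      by (rule Liminf_bounded)
    moreover have "0 < ennreal \<kappa>" using \<kappa>(1) by simp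
    ultimately show "0 < Liminf ?F (\<lambda>\<epsilon>. Linf_Linf_pair T 0 (\<delta> \<epsilon>) (?W \<epsilon>) (?P \<epsilon>))"
      by (rule less_le_trans[rotated])
  qed
qed

end
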